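(* If either the minimum fill-in problem or the chordal completion problem has a polynomial time approximation scheme, then $\mathrm{P} = \mathrm{NP}$.
   Context: All graphs are finite, undirected and simple. A graph is chordal if it has no induced cycle of length at least four. A fill-in of a graph $G$ is a set $E_+$ of non-edges of $G$ such that $G + E_+$ (the graph with vertex set $V(G)$ and edge set $E(G)\cup E_+$) is chordal. Let $\varphi(G)$ denote the minimum size of a fill-in of $G$. Minimum fill-in problem: given $G$, find a fill-in $E_+$ of $G$, with objective to minimize $|E_+|$. An algorithm has approximation ratio $\alpha$ for it if it always outputs a fill-in $E_+$ with $|E_+| \le \alpha\,\varphi(G)$. Chordal completion problem: given $G$, find a fill-in $E_+$ of $G$, with objective to minimize the number $|E(G)| + |E_+|$ of edges of the chordal supergraph $G+E_+$. An algorithm has approximation ratio $\alpha$ for it if it always outputs a fill-in $E_+$ with $|E(G)| + |E_+| \le \alpha\,(|E(G)| + \varphi(G))$. A polynomial time approximation scheme for a minimization problem is a family of algorithms containing, for each fixed $\epsilon > 0$, an algorithm with approximation ratio $1+\epsilon$ running in time polynomial in the size of the input. *)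

theory Defs
  imports Main "HOL-Computational_Algebra.Polynomial"
begin

section \<open>Graphs and fill-ins\<close>

text \<open>A graph is given by its vertex set \<open>V\<close> and its edge set \<open>E\<close>, edges being 2-element
  subsets of \<open>V\<close>.\<close>

definition vertex_pairs :: "'a set \<Rightarrow> 'a set set" where
  "vertex_pairs V = {e. e \<subseteq> V \<and> card e = 2}"

definition simple_graph :: "'a set \<Rightarrow> 'a set set \<Rightarrow> bool" where
  "simple_graph V E \<longleftrightarrow> finite V \<and> E \<subseteq> vertex_pairs V"

definition induced_cycle :: "'a set \<Rightarrow> 'a set set \<Rightarrow> 'a list \<Rightarrow> bool" where
  "induced_cycle V E c \<longleftrightarrow>
     length c \<ge> 3 \<and> distinct c \<and> set c \<subseteq> V \<and>
     (\<forall>i < length c. \<forall>j < length c.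
        {c ! i, c ! j} \<in> E \<longleftrightarrow> j = (i + 1) mod length c \<or> i = (j + 1) mod length c)"

definition chordal :: "'a set \<Rightarrow> 'a set set \<Rightarrow> bool" where
  "chordal V E \<longleftrightarrow> \<not> (\<exists>c. induced_cycle V E c \<and> length c \<ge> 4)"

definition fill_in :: "'a set \<Rightarrow> 'a set set \<Rightarrow> 'a set set \<Rightarrow> bool" where
  "fill_in V E F \<longleftrightarrow> F \<subseteq> vertex_pairs V - E \<and> chordal V (E \<union> F)"

definition min_fill_in :: "'a set \<Rightarrow> 'a set set \<Rightarrow> nat" where
  "min_fill_in V E = (LEAST k. \<exists>F. fill_in V E F \<and> card F = k)"

lemma chordal_complete: "chordal V (vertex_pairs V)"
proof -
  have False if c: "induced_cycle V (vertex_pairs V) c" and len: "length c \<ge> 4" for c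
  proof -
    have d: "distinct c" and s: "set c \<subseteq> V"
      using c by (auto simp: induced_cycle_def)
    have "0 < length c" "2 < length c" using len by auto
    then have ne: "c ! 0 \<noteq> c ! 2" and mem: "c ! 0 \<in> V" "c ! 2 \<in> V"
      using d s by (auto simp: nth_eq_iff_index_eq)
    then have "{c ! 0, c ! 2} \<in> vertex_pairs V"
      by (simp add: vertex_pairs_def)
    then have "2 = (0 + 1) mod length c \<or> 0 = (2 + 1) mod length c"
      using c \<open>0 < length c\<close> \<open>2 < length c\<close> unfolding induced_cycle_def by blast
    then show False using len by simp
  qed
  then show ?thesis by (auto simp: chordal_def)
qed

lemma fill_in_exists: "simple_graph V E \<Longrightarrow> \<exists>F. fill_in V E F"
  by (rule exI[of _ "vertex_pairs V - E"])
     (auto simp: fill_in_def simple_graph_def Un_absorb1 chordal_complete)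


section \<open>Turing machines\<close>

text \<open>Deterministic machines with finitely many two-way infinite tapes. The states are
  \<open>{..<states M}\<close>, with initial state 0 and halting state 1. The tape symbols are
  \<open>{..<symbols M}\<close>, where 0 is the blank and 1 and 2 stand for the bits False and True.\<close>

datatype head_move = Move_Left | Stay | Move_Right

record turing_machine =
  tapes :: nat
  symbols :: nat
  states :: nat
  delta :: "nat \<Rightarrow> nat list \<Rightarrow> nat \<times> (nat \<times> head_move) list"

text \<open>Only the values of \<open>delta\<close> on the finitely many arguments considered here can
  influence a computation, so a well-formed machine is a finite object.\<close>

definition wf_tm :: "turing_machine \<Rightarrow> bool" where
  "wf_tm M \<longleftrightarrow> tapes M \<ge> 1 \<and> symbols M \<ge> 3 \<and> states M \<ge> 2 \<and>
     (\<forall>q ss. q < states M \<and> length ss = tapes M \<and> set ss \<subseteq> {..<symbols M} \<longrightarrow>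
        (case delta M q ss of (q', acts) \<Rightarrow>
           q' < states M \<and> length acts = tapes M \<and> fst ` set acts \<subseteq> {..<symbols M}))"

text \<open>A tape consists of its cell contents and its head position.\<close>

type_synonym tape = "(int \<Rightarrow> nat) \<times> int"
type_synonym config = "nat \<times> tape list"

fun read :: "tape \<Rightarrow> nat" where
  "read (f, h) = f h"

fun head_shift :: "head_move \<Rightarrow> int" where
  "head_shift Move_Left = -1"
| "head_shift Stay = 0"
| "head_shift Move_Right = 1"

fun act :: "nat \<times> head_move \<Rightarrow> tape \<Rightarrow> tape" where
  "act (s, m) (f, h) = (f(h := s), h + head_shift m)"

fun step :: "turing_machine \<Rightarrow> config \<Rightarrow> config" where
  "step M (q, ts) =
     (if q = 1 then (q, ts)
      else case delta M q (map read ts) of (q', acts) \<Rightarrow> (q', map2 act acts ts))"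

definition bit_symbol :: "bool \<Rightarrow> nat" where
  "bit_symbol b = (if b then 2 else 1)"

definition blank_tape :: tape where
  "blank_tape = (\<lambda>_. 0, 0)"

definition input_tape :: "bool list \<Rightarrow> tape" where
  "input_tape x =
     (\<lambda>i. if 0 \<le> i \<and> i < int (length x) then bit_symbol (x ! nat i) else 0, 0)"

definition initial_config :: "turing_machine \<Rightarrow> bool list \<Rightarrow> config" where
  "initial_config M x = (0, input_tape x # replicate (tapes M - 1) blank_tape)"

definition run :: "turing_machine \<Rightarrow> bool list \<Rightarrow> nat \<Rightarrow> config" where
  "run M x t = (step M ^^ t) (initial_config M x)"

definition halts_within :: "turing_machine \<Rightarrow> bool list \<Rightarrow> nat \<Rightarrow> bool" where
  "halts_within M x t \<longleftrightarrow> fst (run M x t) = 1"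

text \<open>The output is the word on the first tape that starts at cell 0 and ends before the
  first blank.\<close>

definition outputs :: "turing_machine \<Rightarrow> bool list \<Rightarrow> bool list \<Rightarrow> bool" where
  "outputs M x y \<longleftrightarrow>
     (\<exists>t. halts_within M x t \<and>
        (let f = fst (hd (snd (run M x t))) in
           (\<forall>i < length y. f (int i) = bit_symbol (y ! i)) \<and> f (int (length y)) = 0))"


section \<open>The classes P and NP\<close>

type_synonym language = "bool list set"

definition decides :: "turing_machine \<Rightarrow> language \<Rightarrow> bool" where
  "decides M L \<longleftrightarrow> (\<forall>x. outputs M x [x \<in> L])"

definition poly_time_on :: "turing_machine \<Rightarrow> bool list set \<Rightarrow> bool" where
  "poly_time_on M X \<longleftrightarrow> (\<exists>p :: nat poly. \<forall>x \<in> X. halts_within M x (poly p (length x)))"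

definition class_P :: "language set" where
  "class_P = {L. \<exists>M. wf_tm M \<and> decides M L \<and> poly_time_on M UNIV}"

text \<open>Injective pairing of words: the bits of the first word are doubled, and the block 01
  separates it from the second word.\<close>

definition pair_code :: "bool list \<Rightarrow> bool list \<Rightarrow> bool list" where
  "pair_code x u = concat (map (\<lambda>b. [b, b]) x) @ [False, True] @ u"

text \<open>NP in terms of certificates of polynomial length that are verified in polynomial time.\<close>

definition class_NP :: "language set" where
  "class_NP = {L. \<exists>R \<in> class_P. \<exists>p :: nat poly.
     L = {x. \<exists>u. length u \<le> poly p (length x) \<and> pair_code x u \<in> R}}"


section \<open>Approximation schemes\<close>

text \<open>Graphs handed to an algorithm have vertex set \<open>{..<n}\<close> for some \<open>n\<close> and are encoded by
  the rows of their adjacency matrix, of total length \<open>n\<^sup>2\<close>. Fill-ins that an algorithm returns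
  are encoded in the same way.\<close>

definition encode :: "nat \<Rightarrow> nat set set \<Rightarrow> bool list" where
  "encode n E = concat (map (\<lambda>i. map (\<lambda>j. {i, j} \<in> E) [0..<n]) [0..<n])"

definition graph_codes :: "bool list set" where
  "graph_codes = {encode n E | n E. simple_graph {..<n} E}"

definition min_fill_in_ratio :: "turing_machine \<Rightarrow> real \<Rightarrow> bool" where
  "min_fill_in_ratio M \<alpha> \<longleftrightarrow>
     (\<forall>n E. simple_graph {..<n} E \<longrightarrow>
        (\<exists>F. outputs M (encode n E) (encode n F) \<and> fill_in {..<n} E F \<and>
           real (card F) \<le> \<alpha> * real (min_fill_in {..<n} E)))"

definition chordal_completion_ratio :: "turing_machine \<Rightarrow> real \<Rightarrow> bool" where
  "chordal_completion_ratio M \<alpha> \<longleftrightarrow>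
     (\<forall>n E. simple_graph {..<n} E \<longrightarrow>
        (\<exists>F. outputs M (encode n E) (encode n F) \<and> fill_in {..<n} E F \<and>
           real (card E + card F) \<le> \<alpha> * real (card E + min_fill_in {..<n} E)))"

text \<open>The scheme is allowed to be non-uniform in \<open>\<epsilon>\<close>: both the machine and the polynomial
  bounding its running time may depend on \<open>\<epsilon>\<close>.\<close>

definition has_PTAS :: "(turing_machine \<Rightarrow> real \<Rightarrow> bool) \<Rightarrow> bool" where
  "has_PTAS ratio \<longleftrightarrow>
     (\<forall>\<epsilon> > 0. \<exists>M. wf_tm M \<and> ratio M (1 + \<epsilon>) \<and> poly_time_on M graph_codes)"

lemma length_encode: "length (encode n E) = n * n"
  by (simp add: encode_def length_concat comp_def sum_list_triv)

lemma encode_inj: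
  assumes "E \<subseteq> vertex_pairs {..<n}" "F \<subseteq> vertex_pairs {..<m}" "encode n E = encode m F"
  shows "n = m \<and> E = F"
proof -
  have "n * n = m * m" using assms(3) length_encode by metis
  then have nm: "n = m" by (metis power2_eq_square power2_eq_iff_nonneg zero_le)
  have "map (\<lambda>i. map (\<lambda>j. {i, j} \<in> E) [0..<n]) [0..<n] =
        map (\<lambda>i. map (\<lambda>j. {i, j} \<in> F) [0..<n]) [0..<n]"
    using assms(3) unfolding encode_def nm
    by (intro concat_injective) (auto simp: set_zip)
  then have eq: "{i, j} \<in> E \<longleftrightarrow> {i, j} \<in> F" if "i < n" "j < n" for i j
    using that by auto
  have "e \<in> E \<longleftrightarrow> e \<in> F" for e
  proof (cases "e \<in> vertex_pairs {..<n}")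
    case True
    then obtain i j where "e = {i, j}" "i < n" "j < n"
      unfolding vertex_pairs_def card_2_iff by auto
    then show ?thesis using eq by simp
  next
    case False
    then show ?thesis using assms nm by auto
  qed
  then show ?thesis using nm by blast
qed

end

(* A PTAS decides every promise problem whose two cases force optimal fill-ins that differ by a constant
factor, so it suffices to reduce an arbitrary NP language to such a problem. The tableau of a verifier
is a constraint satisfaction problem over bits. A round of Dinur's gap amplification (degree reduction
with an expander, powering, composition with a long-code test of constant size) doubles the fraction of
violated constraints as long as it is below a constant; logarithmically many rounds leave a constant gap.
The accepting local views and the values of the variables in them are the vertices of a conflict graph
with boundedly many colours, in which small vertex covers come from good assignments. Add a large clique
with one block for each colour and join every vertex to all blocks except that of its own colour. A
conflict edge and one vertex of each of the two missed blocks form a 4-cycle, so a fill-in completes one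
end of every conflict edge to its missed block, and the least fill-in is about the block size times the
vertex cover number. It is of the order of the number of edges, which settles both objectives. *)

theory Submission
  imports Defs "HOL-Analysis.Analysis"
begin

text \<open>Two demands shape the proof. A round of amplification is iterated, so it must return to
  the arity \<open>q\<close> it started from: the long-code test reads ten bits by one fixed
  predicate \<open>sP\<close>, whence \<open>10 <= q\<close>, and the target \<open>kap q\<close>
  depends on \<open>q\<close> alone, so that the walk length remains free to compensate all losses
  of a round. The fixed predicate serves the last reduction too: every constraint then accepts the
  same number of views, so the size of a cover that comes from a satisfying assignment is known
  exactly and can be compared with a threshold. The other demand is the concrete machine model. All
  numbers that occur are polynomially bounded and kept in unary; a class of functions closed under
  composition, bounded recursion and table lookup of constant size suffices for all reductions. The
  approximation algorithm is only a machine with guarantees on codes of graphs; it is simulated as a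
  black box between two compiled programs. Its accuracy is a constant fixed by \<open>q\<close> and
  the gap, so a scheme that is non-uniform in \<epsilon> is enough.\<close>

notation (input) iff (infixr "<->" 25)

section \<open>Structured programs and Turing machines\<close>

type_synonym tps = "nat => tape"

definition rd :: "tps => nat => nat" where
 "rd ts = (%t. read (ts t))"

text \<open>A \<open>Do\<close> acts on all tapes at once and may depend on all symbols under the
  heads, like a single step of a machine. Tapes are indexed by all natural numbers, which spares
  renumbering when programs are combined; finiteness comes back through locality.\<close>

datatype prog =
  Do "(nat => nat) => nat => nat \<times> head_move"
 | Seq prog prog (infixr ";;" 60)
 | Cond "(nat => nat) => bool" prog prog
 | Loop "(nat => nat) => bool" prog

text \<open>The counts are exact: every control transition costs one step, because the compiled
  machine spends a step on unfolding its stack of pending programs.\<close>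

inductive exec :: "prog => tps => nat => tps => bool" where
 exec_Do: "ts' = (%t. act (F (rd ts) t) (ts t)) ==> exec (Do F) ts 1 ts'"
| exec_Seq: "exec p a m b ==> exec q b n c ==> exec (p ;; q) a (Suc (m + n)) c"
| exec_CondT: "b (rd a) ==> exec p a n c ==> exec (Cond b p q) a (Suc n) c"
| exec_CondF: "~ b (rd a) ==> exec q a n c ==> exec (Cond b p q) a (Suc n) c"
| exec_LoopF: "~ b (rd a) ==> exec (Loop b p) a 1 a"
| exec_LoopT: "b (rd a) ==> exec p a m c ==> exec (Loop b p) c n d ==>
  exec (Loop b p) a (Suc (m + n)) d"

definition local_cond :: "nat => ((nat => nat) => bool) => bool" where
 "local_cond k b <-> (ALL r r'. (ALL u<k. r u = r' u) --> b r = b r')"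

text \<open>The disjunct \<open>fst (F r t) = r t\<close> admits actions that write back what they
  read, so a mere head movement is local for every alphabet bound \<open>m\<close>.\<close>

definition local_act :: "nat => nat => ((nat => nat) => nat => nat \<times> head_move) => bool" where
 "local_act k m F <-> (ALL r t. t < k --> fst (F r t) < m | fst (F r t) = r t) &
   (ALL r t. k <= t --> F r t = (r t, Stay)) &
   (ALL r r' t. (ALL u<k. r u = r' u) --> t < k --> F r t = F r' t)"

text \<open>\<open>wfpr k m p\<close>: the program only touches the first \<open>k\<close> tapes and writes symbols below \<open>m\<close>.\<close>

fun wfpr :: "nat => nat => prog => bool" where
 "wfpr k m (Do F) <-> local_act k m F"
| "wfpr k m (p ;; q) <-> wfpr k m p & wfpr k m q"
| "wfpr k m (Cond b p q) <-> local_cond k b & wfpr k m p & wfpr k m q"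
| "wfpr k m (Loop b p) <-> local_cond k b & wfpr k m p"

definition well :: "prog => bool" where
 "well p <-> (EX k m. wfpr k m p)"

lemma local_cond_mono: "local_cond k b ==> k <= k' ==> local_cond k' b" unfolding local_cond_def by (meson less_le_trans)

lemma local_act_mono:
 assumes "local_act k m F" "k <= k'" "m <= m'"
 shows "local_act k' m' F" unfolding local_act_def
proof (intro conjI allI impI)
 fix r t
 show "fst (F r t) < m' | fst (F r t) = r t"
 proof (cases "t < k")
  case True
  then have "fst (F r t) < m | fst (F r t) = r t" using assms(1) unfolding local_act_def by blast
  then show ?thesis using assms(3) by linarith
 next
  case False
  then have "F r t = (r t, Stay)" using assms(1) unfolding local_act_def by (metis not_less)
  then show ?thesis by simp
 qed
next
 fix r t assume "k' <= t"
 then show "F r t = (r t, Stay)" using assms unfolding local_act_def by simp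
next
 fix r r' :: "nat => nat" and t assume a: "ALL u<k'. r u = r' u" "t < k'"
 have "ALL u<k. r u = r' u" using a assms by simp
 then show "F r t = F r' t"
 proof (cases "t < k")
  case True
  then show ?thesis using assms(1) \<open>ALL u<k. r u = r' u\<close> unfolding local_act_def by blast
 next
  case False
  then have "F r t = (r t, Stay)" "F r' t = (r' t, Stay)" using assms(1) unfolding local_act_def by (metis not_less)+
  then show ?thesis using a by simp
 qed
qed

lemma wfpr_mono: "wfpr k m p ==> k <= k' ==> m <= m' ==> wfpr k' m' p" by (induction p) (auto elim: local_act_mono local_cond_mono)

lemma well_Seq [simp]: "well (p ;; q) <-> well p & well q"
proof
 assume "well p & well q"
 then obtain k m k' m' where a: "wfpr k m p" "wfpr k' m' q" by (auto simp: well_def)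
 have "wfpr (max k k') (max m m') (p ;; q)"
  using wfpr_mono[OF a(1), of "max k k'" "max m m'"] wfpr_mono[OF a(2), of "max k k'" "max m m'"] by simp
 then show "well (p ;; q)" unfolding well_def by blast
qed (auto simp: well_def)

lemma well_Cond:
 assumes "local_cond j b" "well p" "well q"
 shows "well (Cond b p q)"
proof -
 obtain k m where a: "wfpr k m (p ;; q)" using assms well_Seq unfolding well_def by metis
 have "wfpr (max j k) m (Cond b p q)" using wfpr_mono[OF a, of "max j k" m] local_cond_mono[OF assms(1), of "max j k"] by simp
 then show ?thesis unfolding well_def by blast
qed

lemma well_Loop:
 assumes "local_cond j b" "well p"
 shows "well (Loop b p)"
proof -
 obtain k m where a: "wfpr k m p" using assms unfolding well_def by metis
 have "wfpr (max j k) m (Loop b p)" using wfpr_mono[OF a, of "max j k" m] local_cond_mono[OF assms(1), of "max j k"] by simp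
 then show ?thesis unfolding well_def by blast
qed

definition keep :: "(nat => nat) => nat => nat \<times> head_move" where
 "keep r = (%t. (r t, Stay))"

lemma act_keep [simp]: "act (keep (rd ts) t) (ts t) = ts t" by (cases "ts t") (simp add: keep_def rd_def)

section \<open>Compilation of programs into Turing machines\<close>

fun nxt :: "prog list => (nat => nat) => prog list \<times> (nat => nat \<times> head_move)" where
 "nxt [] r = ([], keep r)"
| "nxt (Do F # K) r = (K, F r)"
| "nxt ((p ;; q) # K) r = (p # q # K, keep r)"
| "nxt (Cond b p q # K) r = ((if b r then p else q) # K, keep r)"
| "nxt (Loop b p # K) r = (if b r then p # Loop b p # K else K, keep r)"

definition sstep :: "prog list \<times> tps => prog list \<times> tps" where
 "sstep c = (fst (nxt (fst c) (rd (snd c))),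
   %t. act (snd (nxt (fst c) (rd (snd c))) t) (snd c t))"

lemma exec_sstep: "exec p ts n ts' ==> (sstep ^^ n) (p # K, ts) = (K, ts')"
proof (induction arbitrary: K rule: exec.induct)
 case (exec_Seq p a m b q n c)
 have "(sstep ^^ Suc (m + n)) ((p ;; q) # K, a) = (sstep ^^ (n + m)) (p # q # K, a)"
  by (simp only: funpow_Suc_right o_apply add.commute) (simp add: sstep_def)
 then show ?case using exec_Seq by (simp only: funpow_add o_apply)
next
 case (exec_LoopT b a p m c n d)
 have "(sstep ^^ Suc (m + n)) (Loop b p # K, a) = (sstep ^^ (n + m)) (p # Loop b p # K, a)"
  using exec_LoopT(1) by (simp only: funpow_Suc_right o_apply add.commute) (simp add: sstep_def)
 then show ?case using exec_LoopT by (simp only: funpow_add o_apply)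
next
 case (exec_CondT b a p n c q)
 have "(sstep ^^ Suc n) (Cond b p q # K, a) = (sstep ^^ n) (p # K, a)"
  using exec_CondT(1) by (simp only: funpow_Suc_right o_apply) (simp add: sstep_def)
 then show ?case using exec_CondT by simp
next
 case (exec_CondF b a q n c p)
 have "(sstep ^^ Suc n) (Cond b p q # K, a) = (sstep ^^ n) (q # K, a)"
  using exec_CondF(1) by (simp only: funpow_Suc_right o_apply) (simp add: sstep_def)
 then show ?case using exec_CondF by simp
qed (simp_all add: sstep_def)

text \<open>These are the stacks of pending programs that can occur while \<open>p\<close> runs on
  top of \<open>K\<close>. A loop puts itself back on the stack while its body runs, so the set is
  finite and its elements can serve as the states of a machine.\<close>

fun conts :: "prog => prog list => prog list set" where
 "conts (Do F) K = {Do F # K, K}"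
| "conts (p ;; q) K = insert ((p ;; q) # K) (conts p (q # K) \<union> conts q K)"
| "conts (Cond b p q) K = insert (Cond b p q # K) (conts p K \<union> conts q K)"
| "conts (Loop b p) K = insert (Loop b p # K) (insert K (conts p (Loop b p # K)))"

lemma finite_conts: "finite (conts p K)" by (induction p arbitrary: K) auto

lemma conts_self: "p # K \<in> conts p K" "K \<in> conts p K" by (induction p arbitrary: K) auto

lemma conts_closed: "L \<in> conts p K ==> L ~= K ==> fst (nxt L r) \<in> conts p K"
proof (induction p arbitrary: K)
 case (Seq p q)
 consider "L = (p ;; q) # K" | "L \<in> conts p (q # K)" "L ~= q # K" | "L \<in> conts q K" using Seq.prems(1) conts_self(1)[of q K] by auto
 then show ?case
 proof cases
  case 1
  then show ?thesis using conts_self(1)[of p "q # K"] by simp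
 next
  case 2
  then show ?thesis using Seq.IH(1)[of "q # K"] by simp
 next
  case 3
  then show ?thesis using Seq.IH(2)[of K] Seq.prems(2) by simp
 qed
next
 case (Cond b p q)
 consider "L = Cond b p q # K" | "L \<in> conts p K" | "L \<in> conts q K" using Cond.prems(1) by auto
 then show ?case
 proof cases
  case 1
  then show ?thesis using conts_self(1)[of p K] conts_self(1)[of q K] by simp
 next
  case 2
  then show ?thesis using Cond.IH(1)[of K] Cond.prems(2) by simp
 next
  case 3
  then show ?thesis using Cond.IH(2)[of K] Cond.prems(2) by simp
 qed
next
 case (Loop b p)
 consider "L = Loop b p # K" | "L \<in> conts p (Loop b p # K)" "L ~= Loop b p # K" using Loop.prems by auto
 then show ?case
 proof cases
  case 1
  then show ?thesis using conts_self(1)[of p "Loop b p # K"] by simp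
 next
  case 2
  then show ?thesis using Loop.IH[of "Loop b p # K"] by simp
 qed
qed auto

lemma conts_wf: "L \<in> conts p K ==> wfpr k m p ==> ALL q:set K. wfpr k m q ==> ALL q:set L. wfpr k m q"
proof (induction p arbitrary: K)
 case (Seq p q)
 have w: "wfpr k m p" "wfpr k m q" using Seq.prems by simp_all
 consider "L = (p ;; q) # K" | "L \<in> conts p (q # K)" | "L \<in> conts q K" using Seq.prems(1) by auto
 then show ?case
 proof cases
  case 1
  then show ?thesis using Seq.prems by simp
 next
  case 2
  then show ?thesis using Seq.IH(1)[OF 2 w(1)] w Seq.prems(3) by simp
 next
  case 3
  then show ?thesis using Seq.IH(2)[OF 3 w(2)] Seq.prems(3) by simp
 qed
next
 case (Cond b p q)
 have w: "wfpr k m p" "wfpr k m q" using Cond.prems by simp_all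
 consider "L = Cond b p q # K" | "L \<in> conts p K" | "L \<in> conts q K" using Cond.prems(1) by auto
 then show ?case
 proof cases
  case 1
  then show ?thesis using Cond.prems by simp
 next
  case 2
  then show ?thesis using Cond.IH(1)[OF 2 w(1) Cond.prems(3)] by simp
 next
  case 3
  then show ?thesis using Cond.IH(2)[OF 3 w(2) Cond.prems(3)] by simp
 qed
next
 case (Loop b p)
 consider "L = Loop b p # K" | "L = K" | "L \<in> conts p (Loop b p # K)" using Loop.prems(1) by auto
 then show ?case
 proof cases
  case 3
  then show ?thesis using Loop.IH[OF 3] Loop.prems by simp
 qed (use Loop.prems in simp_all)
next
 case (Do F)
 then consider "L = Do F # K" | "L = K" by auto
 then show ?case using Do.prems by cases simp_all
qed

text \<open>The machine model fixes 0 as the initial and 1 as the halting state; these will be the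
  whole program and the empty stack.\<close>

lemma ex_numbering:
 assumes "finite C" "a \<in> C" "b \<in> C" "a ~= b"
 shows "EX (f :: 'a => nat) N. inj_on f C & f a = 0 & f b = 1 & f ` C \<subseteq> {..<N} & 2 <= N"
proof -
 have "finite (C - {a, b})" using assms(1) by simp
 from finite_imp_inj_to_nat_seg[OF this]
 obtain g :: "'a => nat" and n where g: "g ` (C - {a, b}) = {i. i < n}" "inj_on g (C - {a, b})" by (elim exE conjE) (rule that)
 define f where "f x = (if x = a then 0 else if x = b then 1 else g x + 2)" for x
 have "inj_on f C"
 proof (rule inj_onI)
  fix x y assume xy: "x \<in> C" "y \<in> C" "f x = f y"
  show "x = y"
  proof (cases "x \<in> {a, b} | y \<in> {a, b}")
   case True
   then show ?thesis using xy(3) assms(4) by (auto simp: f_def split: if_splits)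
  next
   case False
   then show ?thesis using xy inj_onD[OF g(2), of x y] by (simp add: f_def)
  qed
 qed
 moreover have "f x < n + 2" if "x \<in> C" for x
 proof (cases "x = a | x = b")
  case False
  then have "g x \<in> {i. i < n}" using that g(1) by blast
  then show ?thesis using False by (simp add: f_def)
 qed (auto simp: f_def)
 moreover have "f a = 0" "f b = 1" using assms by (auto simp: f_def)
 ultimately show ?thesis by (intro exI[of _ f] exI[of _ "n + 2"]) auto
qed

definition start :: "bool list => tps" where
 "start x = (%t. if t = 0 then input_tape x else blank_tape)"

lemma prog_TM:
 assumes wf: "wfpr k m p" and k: "1 <= k" and m: "3 <= m"
 shows "EX M. wf_tm M & (ALL x n ts. exec p (start x) n ts -->
      (ALL n' >= n. run M x n' = (1, map ts [0..<k])))"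
proof -
 let ?C = "conts p []"
 obtain f :: "prog list => nat" and N where f: "inj_on f ?C" "f [p] = 0" "f [] = 1"
  "f ` ?C \<subseteq> {..<N}" "2 <= N"
  using ex_numbering[OF finite_conts conts_self not_Cons_self2, of p "[]"] by (elim exE conjE) (rule that, auto)
 define g where "g = the_inv_into ?C f"
 \<comment> \<open>Beyond the \<open>k\<close> tapes of the machine the program is shown blanks; by
   locality this cannot influence it.\<close>
 define R where "R = (%ss t. if t < k then ss ! t else (0::nat))"
 \<comment> \<open>\<open>wf_tm\<close> demands a transition for every state, so numbers that code
   no stack are sent to the halting state.\<close>
 define d where "d = (%q ss. if q \<in> f ` ?C then
   (f (fst (nxt (g q) (R ss))), map (snd (nxt (g q) (R ss))) [0..<k])
   else (1, map (keep (R ss)) [0..<k]))"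
 define M where "M = \<lparr>tapes = k, symbols = m, states = N, delta = d\<rparr>"
 have gf: "g (f K) = K" if "K \<in> ?C" for K using that f(1) by (simp add: g_def the_inv_into_f_f)
 have good: "fst (nxt K (R ss)) \<in> ?C" if "K \<in> ?C" for K ss using conts_closed[OF that] that by (cases "K = []") auto
 have out: "fst (snd (nxt K r) t) < m" if "K \<in> ?C" "ALL u<k. r u < m" "t < k" for K r t
 proof -
  have w: "ALL q:set K. wfpr k m q" using conts_wf[OF that(1) wf] by simp
  show ?thesis
  proof (cases "(K, r)" rule: nxt.cases)
   case (2 F K' r')
   then have "wfpr k m (Do F)" using w by auto
   then have "fst (F r t) < m | fst (F r t) = r t" using that(3) by (simp add: local_act_def)
   then show ?thesis using 2 that by auto
  qed (use that in "auto simp: keep_def")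
 qed
 have wfM: "wf_tm M" unfolding wf_tm_def
 proof (intro conjI allI impI)
  fix q ss assume a: "q < states M & length ss = tapes M & set ss \<subseteq> {..<symbols M}"
  have r: "ALL u<k. R ss u < m" using a unfolding R_def M_def by (auto simp: subset_iff)
  show "case delta M q ss of (q', acts) => q' < states M & length acts = tapes M &
   fst ` set acts \<subseteq> {..<symbols M}"
  proof (cases "q \<in> f ` ?C")
   case True
   then obtain K where K: "K \<in> ?C" "q = f K" by blast
   then show ?thesis using good[OF K(1), of ss] out[OF K(1) r] f(4) gf[OF K(1)] by (auto simp: M_def d_def)
  next
   case False
   then show ?thesis using r f(5) by (auto simp: M_def d_def keep_def)
  qed
 qed (use k m f in "auto simp: M_def")
 have sim: "step M (f K, map ts [0..<k]) = (f (fst (sstep (K, ts))), map (snd (sstep (K, ts))) [0..<k])"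
  if K: "K \<in> ?C" "K ~= []" for K ts
 proof -
  have ne: "f K ~= 1" using f(1,3) K conts_self(2)[of "[]" p] by (metis inj_onD)
  let ?r = "R (map read (map ts [0..<k]))"
  have agree: "ALL u<k. ?r u = rd ts u" by (simp add: R_def rd_def)
  have w: "ALL q:set K. wfpr k m q" using conts_wf[OF K(1) wf] by simp
  have n: "fst (nxt K ?r) = fst (nxt K (rd ts)) & (ALL t<k. snd (nxt K ?r) t = snd (nxt K (rd ts)) t)"
  proof (cases "(K, rd ts)" rule: nxt.cases)
   case (2 F K' r')
   then have "wfpr k m (Do F)" using w by auto
   then have "ALL t<k. F ?r t = F (rd ts) t" using agree unfolding wfpr.simps local_act_def by blast
   then show ?thesis using 2 by simp
  next
   case (4 b pa q K' r')
   then have "local_cond k b" using w by auto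
   then have "b ?r = b (rd ts)" using agree unfolding local_cond_def by blast
   then show ?thesis using 4 agree by (simp add: keep_def)
  next
   case (5 b pa K' r')
   then have "local_cond k b" using w by auto
   then have "b ?r = b (rd ts)" using agree unfolding local_cond_def by blast
   then show ?thesis using 5 agree by (simp add: keep_def)
  qed (use K agree in "auto simp: keep_def")
  have "delta M (f K) (map read (map ts [0..<k])) =
    (f (fst (nxt K (rd ts))), map (snd (nxt K (rd ts))) [0..<k])" using n K gf[OF K(1)] by (simp add: M_def d_def)
  then show ?thesis using ne by (auto simp: sstep_def intro!: nth_equalityI)
 qed
 have stay: "step M (1, ts) = (1, ts)" for ts by simp
 have simn: "(step M ^^ n) (f K, map ts [0..<k]) = (f L, map ts' [0..<k])"
  if "(sstep ^^ n) (K, ts) = (L, ts')" "K \<in> ?C" for n K L ts ts' using that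
 proof (induction n arbitrary: K ts)
  case (Suc n)
  show ?case
  proof (cases "K = []")
   case True
   have "sstep ([], ts) = ([], ts)" for ts by (simp add: sstep_def)
   then have "(sstep ^^ j) ([], ts) = ([], ts)" for j ts by (induction j) auto
   moreover have "(step M ^^ j) (1, us) = (1, us)" for j us by (induction j) auto
   ultimately show ?thesis using Suc.prems True f(3) by (metis Pair_inject)
  next
   case False
   obtain K' ts2 where s: "sstep (K, ts) = (K', ts2)" by fastforce
   have "K' \<in> ?C" using conts_closed[OF Suc.prems(2) False] s by (auto simp: sstep_def)
   then show ?thesis using Suc.IH[of K' ts2] Suc.prems sim[OF Suc.prems(2) False] s
    by (simp only: funpow_Suc_right o_apply fst_conv snd_conv)
  qed
 qed simp
 show ?thesis
 proof (intro exI[of _ M] conjI allI impI wfM)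
  fix x n ts n' assume e: "exec p (start x) n ts" and le: "n <= n'"
  have "initial_config M x = (f [p], map (start x) [0..<k])"
   using k f(2) by (auto simp: initial_config_def M_def start_def nth_Cons intro!: nth_equalityI split: nat.splits)
  then have 1: "run M x n = (1, map ts [0..<k])" using simn[OF exec_sstep[OF e]] conts_self(1) f(3) by (simp add: run_def)
  obtain j where j: "n' = j + n" using le by (metis add.commute le_iff_add)
  have "(step M ^^ j) (1, us) = (1, us)" for us by (induction j) auto
  then show "run M x n' = (1, map ts [0..<k])" using 1 by (simp add: run_def j funpow_add)
 qed
qed

lemma poly_bound: "EX p :: nat poly. ALL n. poly p n = (n + 2) ^ e" by (rule exI[of _ "[:2, 1:] ^ e"]) (simp add: add.commute)

lemma prog_class_P:
 assumes w: "well p"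
  and ex: "!!x. EX n ts. n <= (length x + 2) ^ e & exec p (start x) n ts &
   fst (ts 0) 0 = bit_symbol (x \<in> L) & fst (ts 0) 1 = 0"
 shows "L \<in> class_P"
proof -
 obtain k0 m where "wfpr k0 m p" using w by (auto simp: well_def)
 then obtain k where k: "1 <= k" "wfpr k (max 3 m) p" by (meson max.cobounded1 max.cobounded2 wfpr_mono)
 obtain M where M: "wf_tm M" and run: "!!x n ts n'. exec p (start x) n ts ==> n <= n' ==>
   run M x n' = (1, map ts [0..<k])" using prog_TM[OF k(2,1)] by auto
 obtain P :: "nat poly" where P: "!!n. poly P n = (n + 2) ^ e" using poly_bound by blast
 have hd: "hd (map ts [0..<k]) = ts 0" for ts :: tps using k by (simp add: hd_map hd_upt)
 have "decides M L" unfolding decides_def outputs_def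
 proof
  fix x
  obtain n ts where "exec p (start x) n ts" "fst (ts 0) 0 = bit_symbol (x \<in> L)" "fst (ts 0) 1 = 0" using ex by blast
  then show "EX t. halts_within M x t & (let f = fst (hd (snd (run M x t)))
    in (ALL i<length [x \<in> L]. f (int i) = bit_symbol ([x \<in> L] ! i)) & f (int (length [x \<in> L])) = 0)"
   using run[of x n ts n] by (intro exI[of _ n]) (simp add: halts_within_def hd)
 qed
 moreover have "poly_time_on M UNIV" unfolding poly_time_on_def
 proof (intro exI[of _ P] ballI)
  fix x
  obtain n ts where "n <= (length x + 2) ^ e" "exec p (start x) n ts" using ex by blast
  then show "halts_within M x (poly P (length x))" using run[of x n ts "poly P (length x)"] by (simp add: P halts_within_def)
 qed
 ultimately show ?thesis using M by (auto simp: class_P_def)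
qed

definition runs :: "prog => tps => nat => tps => bool" where
 "runs p a T b <-> (EX n<=T. exec p a n b)"

lemma runs_mono: "runs p a T b ==> T <= T' ==> runs p a T' b" unfolding runs_def by (meson le_trans)

lemma runs_Seq: "runs p a m b ==> runs q b n c ==> m + n + 1 <= T ==> runs (p ;; q) a T c"
 unfolding runs_def by (elim exE conjE) (rule exI, rule conjI[OF _ exec_Seq], auto)

lemma runs_CondT: "b (rd a) ==> runs p a n c ==> n + 1 <= T ==> runs (Cond b p q) a T c"
 unfolding runs_def by (elim exE conjE) (rule exI, rule conjI[OF _ exec_CondT], auto)

lemma runs_CondF: "~ b (rd a) ==> runs q a n c ==> n + 1 <= T ==> runs (Cond b p q) a T c"
 unfolding runs_def by (elim exE conjE) (rule exI, rule conjI[OF _ exec_CondF], auto)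

lemma runs_Loop:
 assumes "!!j. j < N ==> b (rd (st j)) & runs p (st j) T (st (Suc j))" and "~ b (rd (st N))"
 shows "runs (Loop b p) (st 0) (N * (T + 1) + 1) (st N)"
proof -
 have "runs (Loop b p) (st j) ((N - j) * (T + 1) + 1) (st N)" if "j <= N" for j using that
 proof (induction rule: inc_induct)
  case base
  have "exec (Loop b p) (st N) 1 (st N)" using assms(2) by (rule exec_LoopF)
  then show ?case unfolding runs_def by (intro exI[of _ 1]) simp
 next
  case (step n)
  obtain m where m: "m <= T" "exec p (st n) m (st (Suc n))" using assms(1)[OF step(2)] by (auto simp: runs_def)
  obtain l where l: "l <= (N - Suc n) * (T + 1) + 1" "exec (Loop b p) (st (Suc n)) l (st N)" using step(3) by (auto simp: runs_def)
  have "exec (Loop b p) (st n) (Suc (m + l)) (st N)" using assms(1)[OF step(2)] m l exec_LoopT by blast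
  moreover have "(N - n) = Suc (N - Suc n)" using step(2) by simp
  then have "(N - n) * (T + 1) = (T + 1) + (N - Suc n) * (T + 1)" by simp
  then have "Suc (m + l) <= (N - n) * (T + 1) + 1" using m(1) l(1) by linarith
  ultimately show ?case unfolding runs_def by blast
 qed
 from this[of 0] show ?thesis by simp
qed

section \<open>Counters and elementary programs on them\<close>

definition ctr :: "nat => tape" where
 "ctr n = (%j. if j = 0 then 1 else 0, int n)"

text \<open>Odd tapes are counters, stored as the head position on a tape whose cell 0 is marked;
 even tapes hold words.\<close>

definition mk :: "(nat => nat) => (nat => tape) => tps" where
 "mk c u = (%t. if odd t then ctr (c (t div 2)) else u (t div 2))"

definition Mv :: "nat => head_move => prog" where
 "Mv t m = Do (%r v. (r v, if v = t then m else Stay))"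

definition Wr :: "nat => nat => prog" where
 "Wr t s = Do (%r v. (if v = t then s else r v, Stay))"

lemma well_Mv [simp]: "well (Mv t m)" unfolding well_def Mv_def by (intro exI[of _ "Suc t"] exI[of _ 0]) (auto simp: local_act_def)

lemma well_Wr [simp]: "well (Wr t s)" unfolding well_def Wr_def by (intro exI[of _ "Suc t"] exI[of _ "Suc s"]) (auto simp: local_act_def)

lemma act_stay: "act (rd ts t, Stay) (ts t) = ts t" using act_keep[of ts t] by (simp add: keep_def)

lemma runs_Mv: "runs (Mv t m) ts 1 (ts(t := (fst (ts t), snd (ts t) + head_shift m)))"
proof -
 have "act (rd ts t, m) (ts t) = (fst (ts t), snd (ts t) + head_shift m)" by (cases "ts t") (simp add: rd_def)
 then have "exec (Mv t m) ts 1 (ts(t := (fst (ts t), snd (ts t) + head_shift m)))"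
  unfolding Mv_def by (intro exec_Do) (auto simp: act_stay simp del: act.simps)
 then show ?thesis by (auto simp: runs_def)
qed

lemma runs_Wr: "runs (Wr t s) ts 1 (ts(t := ((fst (ts t))(snd (ts t) := s), snd (ts t))))"
proof -
 have "act (s, Stay) (ts t) = ((fst (ts t))(snd (ts t) := s), snd (ts t))" by (cases "ts t") simp
 then have "exec (Wr t s) ts 1 (ts(t := ((fst (ts t))(snd (ts t) := s), snd (ts t))))"
  unfolding Wr_def by (intro exec_Do) (auto simp: act_stay simp del: act.simps)
 then show ?thesis by (auto simp: runs_def)
qed

lemma mk_odd: "mk c u (Suc (2 * i)) = ctr (c i)" and mk_even: "mk c u (2 * i) = u i" by (auto simp: mk_def)

lemma mk_upd_odd: "(mk c u)(Suc (2 * i) := ctr n) = mk (c(i := n)) u" by (rule ext) (auto simp: mk_def elim!: oddE)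

lemma mk_upd_even: "(mk c u)(2 * i := x) = mk c (u(i := x))" by (rule ext) (auto simp: mk_def elim!: evenE)

definition inc :: "nat => prog" where "inc i = Mv (Suc (2 * i)) Move_Right"
definition dec :: "nat => prog" where "dec i = Mv (Suc (2 * i)) Move_Left"
definition pos :: "nat => (nat => nat) => bool" where "pos i r <-> r (Suc (2 * i)) ~= 1"

lemma well_inc [simp]: "well (inc i)" "well (dec i)" by (auto simp: inc_def dec_def)

lemma local_pos: "local_cond (2 * i + 2) (pos i)" by (auto simp: local_cond_def pos_def)

lemma well_Loop_pos [simp]: "well p ==> well (Loop (pos i) p)" using well_Loop local_pos by blast

lemma well_Cond_pos [simp]: "well p ==> well q ==> well (Cond (pos i) p q)" using well_Cond local_pos by blast

lemma runs_inc: "runs (inc i) (mk c u) 1 (mk (c(i := Suc (c i))) u)" using runs_Mv[of "Suc (2 * i)" Move_Right "mk c u"]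
 by (simp add: inc_def mk_odd ctr_def flip: mk_upd_odd) (simp add: add.commute)

lemma runs_dec: "0 < c i ==> runs (dec i) (mk c u) 1 (mk (c(i := c i - 1)) u)" using runs_Mv[of "Suc (2 * i)" Move_Left "mk c u"]
 by (simp add: dec_def mk_odd ctr_def of_nat_diff flip: mk_upd_odd)

lemma pos_mk [simp]: "pos i (rd (mk c u)) <-> 0 < c i" by (simp add: pos_def rd_def mk_odd ctr_def)

definition clear :: "nat => prog" where "clear i = Loop (pos i) (dec i)"
definition mov :: "nat => nat => prog" where "mov i j = Loop (pos i) (dec i ;; inc j)"
definition mov2 :: "nat => nat => nat => prog" where
 "mov2 i j l = Loop (pos i) (dec i ;; inc j ;; inc l)"

lemma well_mov [simp]: "well (clear i)" "well (mov i j)" "well (mov2 i j l)" by (auto simp: clear_def mov_def mov2_def)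

lemma runs_clear: "2 * c i + 1 <= T ==> runs (clear i) (mk c u) T (mk (c(i := 0)) u)"
proof -
 assume T: "2 * c i + 1 <= T"
 have "runs (clear i) (mk (c(i := c i - 0)) u) (c i * (1 + 1) + 1) (mk (c(i := c i - c i)) u)" unfolding clear_def
 proof (rule runs_Loop[of "c i" "pos i" "%k. mk (c(i := c i - k)) u"])
  fix k assume "k < c i"
  then show "pos i (rd (mk (c(i := c i - k)) u)) &
   runs (dec i) (mk (c(i := c i - k)) u) 1 (mk (c(i := c i - Suc k)) u)" using runs_dec[of "c(i := c i - k)" i u] by simp
 qed simp
 then show ?thesis using T by (auto elim: runs_mono)
qed

lemma runs_mov: "i ~= j ==> 4 * c i + 1 <= T ==> runs (mov i j) (mk c u) T (mk (c(i := 0, j := c j + c i)) u)"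
proof -
 assume T: "4 * c i + 1 <= T" and ij: "i ~= j"
 let ?c = "%k. c(i := c i - k, j := c j + k)"
 have "runs (mov i j) (mk (?c 0) u) (c i * (3 + 1) + 1) (mk (?c (c i)) u)" unfolding mov_def
 proof (rule runs_Loop[of "c i" "pos i" "%k. mk (?c k) u"])
  fix k assume k: "k < c i"
  have "runs (dec i ;; inc j) (mk (?c k) u) 3 (mk (?c (Suc k)) u)"
   using runs_Seq[OF runs_dec[of "?c k" i u] runs_inc[of j "(?c k)(i := ?c k i - 1)" u], of 3] k ij by (simp add: fun_upd_twist)
  then show "pos i (rd (mk (?c k) u)) &
   runs (dec i ;; inc j) (mk (?c k) u) 3 (mk (?c (Suc k)) u)" using k ij by simp
 qed (use ij in simp)
 then show ?thesis using T by (auto elim: runs_mono)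
qed

lemma runs_mov2: "distinct [i, j, l] ==> 6 * c i + 1 <= T ==>
 runs (mov2 i j l) (mk c u) T (mk (c(i := 0, j := c j + c i, l := c l + c i)) u)"
proof -
 assume T: "6 * c i + 1 <= T" and ij: "distinct [i, j, l]"
 let ?c = "%k. c(i := c i - k, j := c j + k, l := c l + k)"
 have "runs (mov2 i j l) (mk (?c 0) u) (c i * (5 + 1) + 1) (mk (?c (c i)) u)" unfolding mov2_def
 proof (rule runs_Loop[of "c i" "pos i" "%k. mk (?c k) u"])
  fix k assume k: "k < c i"
  let ?d = "(?c k)(i := ?c k i - 1)" let ?e = "?d(j := Suc (?d j))"
  have "runs (inc j ;; inc l) (mk ?d u) 3 (mk (?e(l := Suc (?e l))) u)" by (rule runs_Seq[OF runs_inc runs_inc]) simp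
  then have "runs (dec i ;; inc j ;; inc l) (mk (?c k) u) 5 (mk (?e(l := Suc (?e l))) u)" using k ij by (intro runs_Seq[OF runs_dec]) auto
  moreover have "?e(l := Suc (?e l)) = ?c (Suc k)" using ij by (auto simp: fun_eq_iff)
  ultimately show "pos i (rd (mk (?c k) u)) &
   runs (dec i ;; inc j ;; inc l) (mk (?c k) u) 5 (mk (?c (Suc k)) u)" using k ij by simp
 qed (use ij in simp)
 then show ?thesis using T by (auto elim: runs_mono)
qed

text \<open>A counter can only be read by running it down to zero, so a copy moves the value into
  two counters and restores the original from the scratch counter \<open>l\<close>.\<close>

definition copy :: "nat => nat => nat => prog" where "copy i j l = mov2 i j l ;; mov l i"

lemma well_copy [simp]: "well (copy i j l)" by (simp add: copy_def)

lemma runs_copy: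
 assumes "distinct [i, j, l]" "c j = 0" "c l = 0" "10 * c i + 3 <= T"
 shows "runs (copy i j l) (mk c u) T (mk (c(j := c i)) u)"
proof -
 let ?c = "c(i := 0, j := c j + c i, l := c l + c i)"
 have 1: "runs (mov2 i j l) (mk c u) (6 * c i + 1) (mk ?c u)" using assms by (intro runs_mov2) auto
 have 2: "runs (mov l i) (mk ?c u) (4 * c i + 1) (mk (?c(l := 0, i := ?c i + ?c l)) u)" using assms by (intro runs_mov) auto
 have "runs (copy i j l) (mk c u) T (mk (?c(l := 0, i := ?c i + ?c l)) u)" unfolding copy_def by (rule runs_Seq[OF 1 2]) (use assms in simp)
 moreover have "?c(l := 0, i := ?c i + ?c l) = c(j := c i)" using assms by (auto simp: fun_eq_iff)
 ultimately show ?thesis by simp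
qed

text \<open>The base is at least 2, so a single exponent absorbs constants and coefficients, and the
  class is closed under sums and products without tracking degrees.\<close>

definition pb :: "('a => nat) => ('a => nat) => bool" where
 "pb z T <-> (EX e. ALL s. T s <= (z s + 2) ^ e)"

lemma pb_mono: "pb z T ==> (!!s. T' s <= T s) ==> pb z T'" unfolding pb_def by (meson le_trans)

lemma pb_const: "pb z (%s. k)"
proof -
 have "k <= (z s + 2) ^ k" for s using less_exp[of k] power_mono[of 2 "z s + 2" k] by linarith
 then show ?thesis unfolding pb_def by blast
qed

lemma pb_size: "pb z z" unfolding pb_def by (intro exI[of _ 1]) simp

lemma pb_mult: "pb z T ==> pb z S ==> pb z (%s. T s * S s)"
proof -
 assume "pb z T" "pb z S"
 then obtain e f where "!!s. T s <= (z s + 2) ^ e" "!!s. S s <= (z s + 2) ^ f" by (auto simp: pb_def)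
 then have "T s * S s <= (z s + 2) ^ (e + f)" for s by (simp only: power_add mult_le_mono)
 then show ?thesis unfolding pb_def by blast
qed

lemma pb_Suc: "pb z T ==> pb z (%s. T s + 1)"
proof -
 assume "pb z T"
 then obtain e where e: "!!s. T s <= (z s + 2) ^ e" by (auto simp: pb_def)
 have "T s + 1 <= (z s + 2) ^ Suc e" for s
 proof -
  have "1 <= (z s + 2) ^ e" by simp
  then have "T s + 1 <= 2 * (z s + 2) ^ e" using e[of s] by linarith
  also have "... <= (z s + 2) * (z s + 2) ^ e" by (intro mult_le_mono1) simp
  finally show ?thesis by simp
 qed
 then show ?thesis unfolding pb_def by blast
qed

lemma pb_add: "pb z T ==> pb z S ==> pb z (%s. T s + S s)"
 by (rule pb_mono[OF pb_mult[OF pb_Suc[of z T] pb_Suc[of z S]]]) (auto simp: algebra_simps)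

lemma pb_comp:
 assumes "pb z' T" "pb z Z" "!!s. z' (f s) <= Z s"
 shows "pb z (%s. T (f s))"
proof -
 obtain e where e: "!!s. T s <= (z' s + 2) ^ e" using assms(1) by (auto simp: pb_def)
 have "pb z (%s. Z s + 2)" using assms(2) pb_add pb_const by blast
 then obtain g where g: "!!s. Z s + 2 <= (z s + 2) ^ g" by (auto simp: pb_def)
 have "T (f s) <= (z s + 2) ^ (g * e)" for s
 proof -
  have "T (f s) <= (z' (f s) + 2) ^ e" by (rule e)
  also have "... <= ((z s + 2) ^ g) ^ e" using g[of s] assms(3)[of s] by (intro power_mono) linarith+
  finally show ?thesis by (simp add: power_mult)
 qed
 then show ?thesis unfolding pb_def by blast
qed

lemmas pb_intros = pb_const pb_size pb_mult pb_add

section \<open>Polynomial-time functions\<close>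

definition sz :: "('a => bool list) => ('a => nat) list => 'a => nat" where
 "sz W G s = length (W s) + (\<Sum>v\<leftarrow>G. v s)"

definition env :: "('a => bool list) => ('a => nat) list => nat list => nat => 'a => (nat => nat) => (nat => tape) => bool" where
 "env W G ad b s c u <-> u 0 = input_tape (W s) & map c ad = map (%v. v s) G & (ALL a:set ad. a < b) & (ALL j>=b. c j = 0)"

text \<open>\<open>U W G f\<close>: the number \<open>f s\<close> is computable in polynomial time from the word \<open>W s\<close> and the
 numbers \<open>v s\<close> in unary, for \<open>v\<close> in \<open>G\<close>. The latter sit in the counters \<open>ad\<close>; the result goes to
 counter \<open>b\<close>, and all counters from \<open>b\<close> on serve as scratch space.\<close>

definition cmpt where
 "cmpt W G f T P <-> pb (sz W G) T & (ALL s. f s <= T s) & (ALL ad b. well (P ad b)) &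
   (ALL ad b s c u. env W G ad b s c u --> runs (P ad b) (mk c u) (T s) (mk (c(b := f s)) u))"

definition U :: "('a => bool list) => ('a => nat) list => ('a => nat) => bool" where
 "U W G f <-> (EX T P. cmpt W G f T P)"

lemma UI:
 assumes "pb (sz W G) T" "!!s. f s <= T s" "!!ad b. well (P ad b)"
  "!!ad b s c u. env W G ad b s c u ==> runs (P ad b) (mk c u) (T s) (mk (c(b := f s)) u)"
 shows "U W G f" unfolding U_def cmpt_def using assms by blast

lemma cmptD:
 assumes "cmpt W G f T P"
 shows "pb (sz W G) T" "f s <= T s" "well (P ad b)"
  "env W G ad b s c u ==> runs (P ad b) (mk c u) (T s) (mk (c(b := f s)) u)" using assms by (auto simp: cmpt_def)

lemma UE:
 assumes "U W G f"
 obtains T P where "cmpt W G f T P" using assms unfolding U_def by blast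

text \<open>Results are delivered in unary, so a function in \<open>U\<close> is itself polynomially
  bounded. This supplies the value bounds that recursion asks for.\<close>

lemma U_pb: "U W G f ==> pb (sz W G) f" by (erule UE) (rule pb_mono[OF cmptD(1,2)])

lemma env_cong: "env W G ad b s c u ==> (!!a. a \<in> set ad ==> c' a = c a) ==> b <= b' ==> (!!j. j >= b' ==> c' j = 0) ==>
  env W G ad b' s c' u" unfolding env_def by (auto cong: map_cong)

definition nop :: prog where "nop = Mv 0 Stay"

lemma well_nop [simp]: "well nop" by (simp add: nop_def)

lemma runs_nop: "runs nop ts 1 ts" using runs_Mv[of 0 Stay ts] by (simp add: nop_def)

fun incs :: "nat => nat => prog" where
 "incs b 0 = nop" | "incs b (Suc k) = incs b k ;; inc b"

lemma well_incs [simp]: "well (incs b k)" by (induction k) auto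

lemma runs_incs: "runs (incs b k) (mk c u) (2 * k + 1) (mk (c(b := c b + k)) u)"
proof (induction k)
 case (Suc k)
 have "(c(b := c b + k))(b := Suc ((c(b := c b + k)) b)) = c(b := c b + Suc k)" by auto
 moreover have "runs (incs b k ;; inc b) (mk c u) (2 * Suc k + 1) (mk ((c(b := c b + k))(b := Suc ((c(b := c b + k)) b))) u)"
  by (rule runs_Seq[OF Suc runs_inc]) simp
 ultimately show ?case by (simp only: incs.simps)
qed (simp add: runs_nop[simplified])

lemma U_const: "U W G (%s. k)"
proof (rule UI[of _ _ "%s. 2 * k + 1" _ "%ad b. incs b k"])
 show "env W G ad b s c u ==> runs (incs b k) (mk c u) (2 * k + 1) (mk (c(b := k)) u)" for ad b s c u
  using runs_incs[of b k c u] by (simp add: env_def)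
qed (auto intro: pb_const)

lemma le_sz: "v \<in> set G ==> v s <= sz W G s" unfolding sz_def by (rule trans_le_add2, rule member_le_sum_list) auto

lemma U_var: "v \<in> set G ==> U W G v"
proof -
 assume v: "v \<in> set G"
 then obtain i where i: "i < length G" "G ! i = v" by (auto simp: in_set_conv_nth)
 show "U W G v"
 proof (rule UI[of _ _ "%s. 10 * v s + 3" _ "%ad b. copy (ad ! i) b (Suc b)"])
  have "pb (sz W G) v" by (rule pb_mono[OF pb_size le_sz[OF v]])
  then show "pb (sz W G) (%s. 10 * v s + 3)" by (intro pb_add pb_mult pb_const)
  fix ad b s c u assume "env W G ad b s c u"
  then have e: "map c ad = map (%v. v s) G" "ALL j>=b. c j = 0" and ad: "ALL a:set ad. a < b" by (auto simp: env_def)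
  have l: "i < length ad" using arg_cong[OF e(1), of length] i by simp
  then have "c (ad ! i) = v s" "ad ! i < b" using arg_cong[OF e(1), of "%l. l ! i"] i ad by simp_all
  then show "runs (copy (ad ! i) b (Suc b)) (mk c u) (10 * v s + 3) (mk (c(b := v s)) u)"
   using runs_copy[of "ad ! i" b "Suc b" c "10 * v s + 3" u] e by simp
 qed simp_all
qed

lemma U_Suc: "U W G f ==> U W G (%s. Suc (f s))"
proof (erule UE)
 fix T P assume C: "cmpt W G f T P"
 show "U W G (%s. Suc (f s))"
 proof (rule UI[of _ _ "%s. T s + 2" _ "%ad b. P ad b ;; inc b"])
  fix ad b s c u assume "env W G ad b s c u"
  from runs_Seq[OF cmptD(4)[OF C this] runs_inc[of b], of "T s + 2"]
  show "runs (P ad b ;; inc b) (mk c u) (T s + 2) (mk (c(b := Suc (f s))) u)" by simp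
 next
  show "pb (sz W G) (%s. T s + 2)" by (intro pb_intros cmptD(1)[OF C])
  show "Suc (f s) <= T s + 2" for s using cmptD(2)[OF C, of s] by simp
 qed (simp add: cmptD[OF C])
qed

lemma U_case0:
 assumes "U W G e" "U W G f" "U W G g"
 shows "U W G (%s. if e s = 0 then f s else g s)"
proof -
 obtain T1 P where P: "cmpt W G e T1 P" by (rule UE[OF assms(1)])
 obtain T2 Q where Q: "cmpt W G f T2 Q" by (rule UE[OF assms(2)])
 obtain T3 R where R: "cmpt W G g T3 R" by (rule UE[OF assms(3)])
 let ?T = "%s. 3 * T1 s + T2 s + T3 s + 5" and ?i = "%s. if e s = 0 then f s else g s"
 let ?p = "%ad b. Cond (pos b) (clear b ;; R ad b) (Q ad b)"
 show ?thesis
 proof (rule UI[of _ _ ?T _ "%ad b. P ad b ;; ?p ad b"])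
  show "pb (sz W G) ?T" by (intro pb_intros cmptD(1)[OF P] cmptD(1)[OF Q] cmptD(1)[OF R])
  show "?i s <= ?T s" for s using cmptD(2)[OF Q, of s] cmptD(2)[OF R, of s] by auto
  fix ad b s c u assume env: "env W G ad b s c u"
  then have cb: "c(b := 0) = c" "c b = 0" by (auto simp: env_def)
  have "runs (?p ad b) (mk (c(b := e s)) u) (2 * T1 s + T2 s + T3 s + 4) (mk (c(b := ?i s)) u)"
  proof (cases "e s = 0")
   case True
   then show ?thesis using cmptD(4)[OF Q env] cb by (intro runs_CondF) auto
  next
   case False
   have 1: "runs (clear b) (mk (c(b := e s)) u) (2 * T1 s + 1) (mk c u)"
    using runs_clear[of "c(b := e s)" b "2 * T1 s + 1" u] cmptD(2)[OF P, of s] cb by simp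
   have "runs (?p ad b) (mk (c(b := e s)) u) (2 * T1 s + T2 s + T3 s + 4) (mk (c(b := g s)) u)"
    by (rule runs_CondT[OF _ runs_Seq[OF 1 cmptD(4)[OF R env] le_refl]]) (use False in auto)
   then show ?thesis using False by simp
  qed
  from runs_Seq[OF cmptD(4)[OF P env] this, of "?T s"]
  show "runs (P ad b ;; ?p ad b) (mk c u) (?T s) (mk (c(b := ?i s)) u)" by simp
 qed (simp add: cmptD(3)[OF P] cmptD(3)[OF Q] cmptD(3)[OF R])
qed

definition fill :: "(nat => nat) => nat => nat list => nat => nat" where
 "fill c b xs = (%j. if b <= j & j < b + length xs then xs ! (j - b) else c j)"

lemma fill_Nil [simp]: "fill c b [] = c" by (auto simp: fill_def)

lemma fill_snoc: "fill c b (xs @ [x]) = (fill c b xs)(b + length xs := x)" by (auto simp: fill_def nth_append fun_eq_iff)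

text \<open>Evaluates several functions into consecutive counters from \<open>b\<close> on, which
  lays out the arguments of an outer function as its environment.\<close>

lemma U_list:
 assumes "ALL g:set gs. U W G g"
 shows "EX T P. pb (sz W G) T & (ALL s. (\<Sum>g\<leftarrow>gs. g s) <= T s) & (ALL ad b. well (P ad b)) &
   (ALL ad b s c u. env W G ad b s c u --> runs (P ad b) (mk c u) (T s) (mk (fill c b (map (%g. g s) gs)) u))" using assms
proof (induction gs rule: rev_induct)
 case Nil
 show ?case by (rule exI[of _ "%s. 1"], rule exI[of _ "%ad b. nop"]) (simp add: pb_const runs_nop[simplified])
next
 case (snoc g gs)
 have "ALL g:set gs. U W G g" "U W G g" using snoc.prems by simp_all
 from snoc.IH[OF this(1)] obtain T1 P where T1: "pb (sz W G) T1" "ALL s. (\<Sum>g\<leftarrow>gs. g s) <= T1 s" "ALL ad b. well (P ad b)"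
   "ALL ad b s c u. env W G ad b s c u --> runs (P ad b) (mk c u) (T1 s) (mk (fill c b (map (%g. g s) gs)) u)"
  by (elim exE conjE) (rule that)
 obtain T2 Q where Q: "cmpt W G g T2 Q" by (rule UE[OF \<open>U W G g\<close>])
 let ?b = "%b. b + length gs"
 show ?case
 proof (intro exI[of _ "%s. T1 s + T2 s + 1"] exI[of _ "%ad b. P ad b ;; Q ad (?b b)"] conjI allI impI)
  show "pb (sz W G) (%s. T1 s + T2 s + 1)" using T1(1) cmptD(1)[OF Q] by (intro pb_intros)
  show "(\<Sum>g\<leftarrow>gs @ [g]. g s) <= T1 s + T2 s + 1" for s using T1(2)[rule_format, of s] cmptD(2)[OF Q, of s] by simp
  fix ad b s c u assume env: "env W G ad b s c u"
  have "env W G ad (?b b) s (fill c b (map (%g. g s) gs)) u" by (rule env_cong[OF env]) (use env in "auto simp: fill_def env_def")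
  from runs_Seq[OF T1(4)[rule_format, OF env] cmptD(4)[OF Q this] le_refl]
  show "runs (P ad b ;; Q ad (?b b)) (mk c u) (T1 s + T2 s + 1) (mk (fill c b (map (%g. g s) (gs @ [g]))) u)" by (simp add: fill_snoc)
 qed (use T1(3) cmptD(3)[OF Q] in simp)
qed

fun clears :: "nat => nat => prog" where
 "clears b 0 = nop" | "clears b (Suc k) = clear (b + k) ;; clears b k"

lemma well_clears [simp]: "well (clears b k)" by (induction k) auto

text \<open>\<open>y\<close> is the result to be preserved, stored beyond the counters being
  cleared. The distance \<open>d\<close> is generalised because it grows as the block shrinks from
  its upper end.\<close>

lemma runs_clears: "length xs = k ==> (ALL j>=b. c j = 0) ==>
  runs (clears b k) (mk ((fill c b xs)(b + k + d := y)) u) (2 * sum_list xs + 2 * k + 1) (mk (c(b + k + d := y)) u)"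
proof (induction k arbitrary: xs d)
 case 0
 then show ?case by (simp add: runs_nop[simplified])
next
 case (Suc k)
 then obtain ys x where xs: "xs = ys @ [x]" "length ys = k" by (metis append_butlast_last_id length_0_conv length_butlast diff_Suc_1 nat.distinct(1))
 let ?c = "(fill c b xs)(b + Suc k + d := y)"
 have "runs (clear (b + k)) (mk ?c u) (2 * x + 1) (mk (?c(b + k := 0)) u)" by (rule runs_clear) (simp add: xs fill_snoc)
 moreover have "?c(b + k := 0) = (fill c b ys)(b + k + Suc d := y)"
  using Suc.prems xs by (auto simp: fun_eq_iff fill_snoc fill_def nth_append)
 ultimately have 1: "runs (clear (b + k)) (mk ?c u) (2 * x + 1) (mk ((fill c b ys)(b + k + Suc d := y)) u)" by simp
 have e: "b + k + Suc d = b + Suc k + d" by simp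
 show ?case unfolding clears.simps by (rule runs_Seq[OF 1[unfolded e] Suc.IH[OF xs(2) Suc.prems(2), of "Suc d", unfolded e]])
   (use xs in simp)
qed

text \<open>\<open>h\<close> maps the whole argument to another one: the numbers may change
  arbitrarily within \<open>U\<close>, while the word stays on its tape, hence the condition
  \<open>W' (h s) = W s\<close>.\<close>

lemma U_comp:
 assumes f: "U W' G' f" and g: "ALL v:set G'. U W G (%s. v (h s))" and W: "!!s. W' (h s) = W s"
 shows "U W G (%s. f (h s))"
proof -
 define gs where "gs = map (%v s. v (h s)) G'"
 have "ALL g:set gs. U W G g" using g by (auto simp: gs_def)
 from U_list[OF this] obtain T1 P where T1: "pb (sz W G) T1" "ALL s. (\<Sum>g\<leftarrow>gs. g s) <= T1 s" "ALL ad b. well (P ad b)"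
   "ALL ad b s c u. env W G ad b s c u --> runs (P ad b) (mk c u) (T1 s) (mk (fill c b (map (%g. g s) gs)) u)"
  by (elim exE conjE) (rule that)
 obtain T2 Q where Q: "cmpt W' G' f T2 Q" by (rule UE[OF f])
 let ?k = "length G'"
 have "sz W' G' (h s) <= sz W G s + T1 s" for s using T1(2)[rule_format, of s] by (simp add: sz_def W gs_def o_def)
 from pb_comp[OF cmptD(1)[OF Q] pb_add[OF pb_size T1(1)], of h, OF this]
 have T2h: "pb (sz W G) (%s. T2 (h s))" .
 let ?T = "%s. 3 * T1 s + 5 * T2 (h s) + 2 * ?k + 5"
 let ?m = "%b. if ?k = 0 then nop else mov (b + ?k) b"
 let ?p = "%ad b. P ad b ;; Q [b..<b + ?k] (b + ?k) ;; clears b ?k ;; ?m b"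
 show ?thesis
 proof (rule UI[of _ _ ?T _ ?p])
  show "pb (sz W G) ?T" using T1(1) T2h by (intro pb_intros)
  show "f (h s) <= ?T s" for s using cmptD(2)[OF Q, of "h s"] by simp
  fix ad b s c u assume env: "env W G ad b s c u"
  let ?xs = "map (%g. g s) gs" and ?c = "c(b + ?k := f (h s))"
  let ?c1 = "fill c b ?xs"
  have lx: "length ?xs = ?k" by (simp add: gs_def)
  have z: "ALL j>=b. c j = 0" using env by (simp add: env_def)
  have "env W' G' [b..<b + ?k] (b + ?k) (h s) ?c1 u" using env lx by (auto simp: env_def W gs_def fill_def intro!: nth_equalityI)
  note 2 = cmptD(4)[OF Q this]
  have 3: "runs (clears b ?k) (mk (?c1(b + ?k := f (h s))) u) (2 * sum_list ?xs + 2 * ?k + 1) (mk ?c u)"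
   using runs_clears[OF lx z, of 0 "f (h s)" u] by simp
  have 4: "runs (?m b) (mk ?c u) (4 * f (h s) + 1) (mk (c(b := f (h s))) u)"
  proof (cases "?k = 0")
   case True
   then show ?thesis using runs_mono[OF runs_nop] by simp
  next
   case False
   then have "?c(b + ?k := 0, b := ?c b + ?c (b + ?k)) = c(b := f (h s))" using z by (auto simp: fun_eq_iff)
   then show ?thesis using runs_mov[of "b + ?k" b ?c "4 * f (h s) + 1" u] False by simp
  qed
  have s1: "sum_list ?xs <= T1 s" using T1(2)[rule_format, of s] by simp
  show "runs (?p ad b) (mk c u) (?T s) (mk (c(b := f (h s))) u)"
   by (rule runs_Seq[OF T1(4)[rule_format, OF env] runs_Seq[OF 2 runs_Seq[OF 3 4 le_refl] le_refl]])
    (use s1 cmptD(2)[OF Q, of "h s"] in linarith)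
 qed (use T1(3) cmptD(3)[OF Q] in simp)
qed

text \<open>Recursion is safe only with an a-priori polynomial bound \<open>B\<close> on all
  intermediate values, since iterated polynomial growth is exponential. The counters
  \<open>b\<close>, \<open>b + 1\<close> and \<open>b + 2\<close> hold the remaining rounds, the
  index and the accumulator.\<close>

lemma U_rec:
 assumes N: "U W G N" and g: "U W G g" and B: "pb (sz W G) B"
  and h: "U (%p. W (fst p)) (map (%v p. v (fst p)) G @ [%p. fst (snd p), %p. snd (snd p)])
      (%p. h (fst p) (fst (snd p)) (snd (snd p)))"
  and bnd: "!!s i. i <= N s ==> rec_nat (g s) (h s) i <= B s"
 shows "U W G (%s. rec_nat (g s) (h s) (N s))"
proof -
 obtain T1 p where p: "cmpt W G N T1 p" by (rule UE[OF N])
 obtain T2 q where q: "cmpt W G g T2 q" by (rule UE[OF g])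
 let ?W = "%p. W (fst p)" and ?G = "map (%v p. v (fst p)) G @ [%p. fst (snd p), %p. snd (snd p)]"
 obtain T3 r where r: "cmpt ?W ?G (%p. h (fst p) (fst (snd p)) (snd (snd p))) T3 r" by (rule UE[OF h])
 obtain e where e: "!!s. T3 s <= (sz ?W ?G s + 2) ^ e" using cmptD(1)[OF r] by (auto simp: pb_def)
 define R where "R s = rec_nat (g s) (h s)" for s
 define H where "H s = ((sz W G s + N s + B s) + 2) ^ e" for s
 have pB: "pb (sz W G) B" and pN: "pb (sz W G) N" using U_pb B N by auto
 have "pb id (%x. (x + 2) ^ e)" unfolding pb_def by (intro exI[of _ e]) simp
 from pb_comp[OF this pb_add[OF pb_add[OF pb_size pN] pB], of "%s. sz W G s + N s + B s"]
 have pH: "pb (sz W G) H" unfolding H_def by simp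
 have H: "T3 (s, k, R s k) <= H s" if "k < N s" for s k
 proof -
  have "sz ?W ?G (s, k, R s k) <= sz W G s + N s + B s" using bnd[of k s] that by (simp add: sz_def R_def o_def)
  then have "(sz ?W ?G (s, k, R s k) + 2) ^ e <= H s" unfolding H_def by (intro power_mono) auto
  then show ?thesis using e le_trans by blast
 qed
 let ?I = "%s. H s + 6 * B s + 4 * H s + 10"
 let ?T = "%s. T1 s + 5 * T2 s + (N s * (?I s + 1) + 1) + 2 * N s + 4 * B s + 10"
 let ?body = "%ad b. dec b ;; r (ad @ [b + 1, b + 2]) (b + 3) ;; clear (b + 2) ;; mov (b + 3) (b + 2) ;; inc (b + 1)"
 let ?p = "%ad b. p ad b ;; q ad (b + 2) ;; Loop (pos b) (?body ad b) ;; clear (b + 1) ;; mov (b + 2) b"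
 show ?thesis
 proof (rule UI[of _ _ ?T _ ?p])
  show "pb (sz W G) ?T" using cmptD(1)[OF p] cmptD(1)[OF q] pH pB pN by (intro pb_intros)
  show "rec_nat (g s) (h s) (N s) <= ?T s" for s using bnd[of "N s" s] by simp
  fix ad b s c u assume env: "env W G ad b s c u"
  then have z: "ALL j>=b. c j = 0" and ad: "ALL a:set ad. a < b" by (simp_all add: env_def)
  then have z': "c b = 0" "c (b + 1) = 0" "c (b + 2) = 0" "c (b + 3) = 0" by auto
  have adb: "!!a. a \<in> set ad ==> a ~= b & a ~= b + 1 & a ~= b + 2" using ad by fastforce
  let ?st = "%k. c(b := N s - k, b + 1 := k, b + 2 := R s k)"
  have "env W G ad (b + 2) s (c(b := N s)) u" by (rule env_cong[OF env]) (use adb z in auto)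
  from cmptD(4)[OF q this] have 2: "runs (q ad (b + 2)) (mk (c(b := N s)) u) (T2 s) (mk (?st 0) u)"
   using z' by (simp add: R_def fun_upd_idem fun_upd_twist)
  have loop: "runs (Loop (pos b) (?body ad b)) (mk (?st 0) u) (N s * (?I s + 1) + 1) (mk (?st (N s)) u)"
  proof (rule runs_Loop[of "N s" "pos b" "%k. mk (?st k) u"])
   fix k assume k: "k < N s"
   let ?c1 = "(?st k)(b := ?st k b - 1)"
   have 1: "runs (dec b) (mk (?st k) u) 1 (mk ?c1 u)" using k by (intro runs_dec) simp
   have "env W G ad (b + 3) s ?c1 u" by (rule env_cong[OF env]) (use adb z in auto)
   then have "env ?W ?G (ad @ [b + 1, b + 2]) (b + 3) (s, k, R s k) ?c1 u" by (simp add: env_def o_def)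
   from cmptD(4)[OF r this] have 2: "runs (r (ad @ [b + 1, b + 2]) (b + 3)) (mk ?c1 u) (H s) (mk (?c1(b + 3 := R s (Suc k))) u)"
    using H[OF k] by (simp add: R_def runs_mono)
   let ?c2 = "?c1(b + 3 := R s (Suc k))"
   have RB: "R s k <= B s" using bnd[of k s] k by (simp add: R_def)
   have RH: "R s (Suc k) <= H s" using cmptD(2)[OF r, of "(s, k, R s k)"] H[OF k] by (simp add: R_def)
   have 3: "runs (clear (b + 2)) (mk ?c2 u) (2 * B s + 1) (mk (?c2(b + 2 := 0)) u)" using RB by (intro runs_clear) simp
   let ?c3 = "?c2(b + 2 := 0)"
   let ?c4 = "?c3(b + 3 := 0, b + 2 := ?c3 (b + 2) + ?c3 (b + 3))"
   have 4: "runs (mov (b + 3) (b + 2)) (mk ?c3 u) (4 * H s + 1) (mk ?c4 u)" using RH by (intro runs_mov) auto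
   have "?c4(b + 1 := Suc (?c4 (b + 1))) = ?st (Suc k)" using z' by (auto simp: fun_eq_iff)
   with runs_inc[of "b + 1" ?c4 u] have 5: "runs (inc (b + 1)) (mk ?c4 u) 1 (mk (?st (Suc k)) u)" by simp
   have "runs (?body ad b) (mk (?st k) u) (?I s) (mk (?st (Suc k)) u)"
    by (rule runs_Seq[OF 1 runs_Seq[OF 2 runs_Seq[OF 3 runs_Seq[OF 4 5 le_refl] le_refl] le_refl]]) simp
   then show "pos b (rd (mk (?st k) u)) & runs (?body ad b) (mk (?st k) u) (?I s) (mk (?st (Suc k)) u)" using k by simp
  qed simp
  let ?c5 = "?st (N s)"
  let ?c6 = "?c5(b + 1 := 0)"
  have 4: "runs (clear (b + 1)) (mk ?c5 u) (2 * N s + 1) (mk ?c6 u)" by (intro runs_clear) simp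
  have "runs (mov (b + 2) b) (mk ?c6 u) (4 * B s + 1) (mk (?c6(b + 2 := 0, b := ?c6 b + ?c6 (b + 2))) u)"
   using bnd[of "N s" s] by (intro runs_mov) (auto simp: R_def)
  moreover have "?c6(b + 2 := 0, b := ?c6 b + ?c6 (b + 2)) = c(b := rec_nat (g s) (h s) (N s))" using z' by (auto simp: fun_eq_iff R_def)
  ultimately have 5: "runs (mov (b + 2) b) (mk ?c6 u) (4 * B s + 1) (mk (c(b := rec_nat (g s) (h s) (N s))) u)" by simp
  show "runs (?p ad b) (mk c u) (?T s) (mk (c(b := rec_nat (g s) (h s) (N s))) u)"
   by (rule runs_Seq[OF cmptD(4)[OF p env] runs_Seq[OF 2 runs_Seq[OF loop runs_Seq[OF 4 5 le_refl] le_refl] le_refl]]) simp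
 qed (simp add: cmptD(3)[OF p] cmptD(3)[OF q] cmptD(3)[OF r])
qed

section \<open>Access to the input word\<close>

lemma mk_0: "mk c u 0 = u 0" using mk_even[of c u 0] by simp

lemma mk_upd_0: "(mk c u)(0 := x) = mk c (u(0 := x))" using mk_upd_even[of c u 0 x] by simp

lemma runs_Mv0: "runs (Mv 0 m) (mk c u) 1 (mk c (u(0 := (fst (u 0), snd (u 0) + head_shift m))))"
 using runs_Mv[of 0 m "mk c u"] by (simp only: mk_0 mk_upd_0)

lemma local_rd0: "local_cond 1 (%r. P (r 0))" by (auto simp: local_cond_def)

lemma rd_mk_0: "rd (mk c (u(0 := (f, h)))) 0 = f h" by (simp add: rd_def mk_0)

definition goto :: "nat => nat => prog" where
 "goto i j = Loop (pos i) (dec i ;; inc j ;; Mv 0 Move_Right)"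

definition ungo :: "nat => prog" where
 "ungo i = Loop (pos i) (dec i ;; Mv 0 Move_Left)"

lemma well_goto [simp]: "well (goto i j)" "well (ungo i)" by (auto simp: goto_def ungo_def)

lemma runs_goto: "i ~= j ==> c j = 0 ==> u 0 = (f, h) ==>
 runs (goto i j) (mk c u) (6 * c i + 1) (mk (c(i := 0, j := c i)) (u(0 := (f, h + int (c i)))))"
proof -
 assume ij: "i ~= j" and z: "c j = 0" and u: "u 0 = (f, h)"
 let ?c = "%k. c(i := c i - k, j := k)" and ?u = "%k. u(0 := (f, h + int k))"
 have "runs (goto i j) (mk (?c 0) (?u 0)) (c i * (5 + 1) + 1) (mk (?c (c i)) (?u (c i)))" unfolding goto_def
 proof (rule runs_Loop[of "c i" "pos i" "%k. mk (?c k) (?u k)"])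
  fix k assume k: "k < c i"
  let ?d = "(?c k)(i := ?c k i - 1)" let ?e = "?d(j := Suc (?d j))"
  have 3: "runs (Mv 0 Move_Right) (mk ?e (?u k)) 1 (mk ?e (?u (Suc k)))" using runs_Mv0[of Move_Right ?e "?u k"] by (simp add: ac_simps)
  have "runs (dec i ;; inc j ;; Mv 0 Move_Right) (mk (?c k) (?u k)) 5 (mk ?e (?u (Suc k)))"
   by (rule runs_Seq[OF runs_dec runs_Seq[OF runs_inc 3 le_refl]]) (use k ij in auto)
  moreover have "?e = ?c (Suc k)" using ij by (auto simp: fun_eq_iff)
  ultimately show "pos i (rd (mk (?c k) (?u k))) &
   runs (dec i ;; inc j ;; Mv 0 Move_Right) (mk (?c k) (?u k)) 5 (mk (?c (Suc k)) (?u (Suc k)))" using k ij by simp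
 qed (use ij in simp)
 moreover have "?c 0 = c" "?u 0 = u" using z u by (auto simp: fun_eq_iff)
 ultimately show ?thesis by (simp add: mult.commute)
qed

lemma runs_ungo: "u 0 = (f, h) ==>
 runs (ungo i) (mk c u) (4 * c i + 1) (mk (c(i := 0)) (u(0 := (f, h - int (c i)))))"
proof -
 assume u: "u 0 = (f, h)"
 let ?c = "%k. c(i := c i - k)" and ?u = "%k. u(0 := (f, h - int k))"
 have "runs (ungo i) (mk (?c 0) (?u 0)) (c i * (3 + 1) + 1) (mk (?c (c i)) (?u (c i)))" unfolding ungo_def
 proof (rule runs_Loop[of "c i" "pos i" "%k. mk (?c k) (?u k)"])
  fix k assume k: "k < c i"
  let ?d = "(?c k)(i := ?c k i - 1)"
  have 3: "runs (Mv 0 Move_Left) (mk ?d (?u k)) 1 (mk ?d (?u (Suc k)))" using runs_Mv0[of Move_Left ?d "?u k"] by (simp add: algebra_simps)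
  have "runs (dec i ;; Mv 0 Move_Left) (mk (?c k) (?u k)) 3 (mk ?d (?u (Suc k)))" by (rule runs_Seq[OF runs_dec 3]) (use k in auto)
  moreover have "?d = ?c (Suc k)" by (auto simp: fun_eq_iff)
  ultimately show "pos i (rd (mk (?c k) (?u k))) &
   runs (dec i ;; Mv 0 Move_Left) (mk (?c k) (?u k)) 3 (mk (?c (Suc k)) (?u (Suc k)))" using k by simp
 qed simp
 moreover have "?c 0 = c" "?u 0 = u" using u by (auto simp: fun_eq_iff)
 ultimately show ?thesis by (simp add: mult.commute)
qed

definition scan :: "nat => nat => prog" where
 "scan i j = Loop (%r. r 0 ~= 0) (inc i ;; inc j ;; Mv 0 Move_Right)"

lemma well_scan [simp]: "well (scan i j)" unfolding scan_def by (rule well_Loop[OF local_rd0]) simp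

lemma fst_input_tape: "k < length w ==> fst (input_tape w) (int k) = bit_symbol (w ! k)"
 "length w <= k ==> fst (input_tape w) (int k) = 0" by (auto simp: input_tape_def)

lemma snd_input_tape: "snd (input_tape w) = 0" by (simp add: input_tape_def)

lemma runs_scan: "i ~= j ==> c i = 0 ==> c j = 0 ==> u 0 = input_tape w ==>
 runs (scan i j) (mk c u) (6 * length w + 1)
  (mk (c(i := length w, j := length w)) (u(0 := (fst (input_tape w), int (length w)))))"
proof -
 assume ij: "i ~= j" and z: "c i = 0" "c j = 0" and u: "u 0 = input_tape w"
 let ?f = "fst (input_tape w)"
 let ?c = "%k. c(i := k, j := k)" and ?u = "%k. u(0 := (?f, int k))"
 have "runs (scan i j) (mk (?c 0) (?u 0)) (length w * (5 + 1) + 1) (mk (?c (length w)) (?u (length w)))" unfolding scan_def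
 proof (rule runs_Loop[of "length w" "%r. r 0 ~= 0" "%k. mk (?c k) (?u k)"])
  fix k assume k: "k < length w"
  let ?d = "(?c k)(i := Suc (?c k i))" let ?e = "?d(j := Suc (?d j))"
  have 3: "runs (Mv 0 Move_Right) (mk ?e (?u k)) 1 (mk ?e (?u (Suc k)))" using runs_Mv0[of Move_Right ?e "?u k"] by (simp add: ac_simps)
  have "runs (inc i ;; inc j ;; Mv 0 Move_Right) (mk (?c k) (?u k)) 5 (mk ?e (?u (Suc k)))"
   by (rule runs_Seq[OF runs_inc runs_Seq[OF runs_inc 3 le_refl]]) simp
  moreover have "?e = ?c (Suc k)" using ij by (auto simp: fun_eq_iff)
  moreover have "?f (int k) ~= 0" using k by (simp add: fst_input_tape bit_symbol_def)
  ultimately show "rd (mk (?c k) (?u k)) 0 ~= 0 &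
   runs (inc i ;; inc j ;; Mv 0 Move_Right) (mk (?c k) (?u k)) 5 (mk (?c (Suc k)) (?u (Suc k)))" by (simp add: rd_mk_0)
 next
  show "~ rd (mk (?c (length w)) (?u (length w))) 0 ~= 0" by (simp add: rd_mk_0 fst_input_tape)
 qed
 moreover have "?c 0 = c" using z by (auto simp: fun_eq_iff)
 moreover have "?u 0 = u" using u snd_input_tape[of w] by (auto simp: fun_eq_iff prod_eq_iff)
 ultimately show ?thesis by (simp add: mult.commute)
qed

lemma U_len: "U W G (%s. length (W s))"
proof (rule UI[of _ _ "%s. 10 * length (W s) + 10" _ "%ad b. scan b (Suc b) ;; ungo (Suc b)"])
 have "pb (sz W G) (%s. length (W s))" by (rule pb_mono[OF pb_size]) (simp add: sz_def)
 then show "pb (sz W G) (%s. 10 * length (W s) + 10)" by (intro pb_intros)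
 fix ad b s c u assume "env W G ad b s c u"
 then have z: "c b = 0" "c (Suc b) = 0" and u: "u 0 = input_tape (W s)" by (auto simp: env_def)
 let ?n = "length (W s)" and ?f = "fst (input_tape (W s))"
 let ?c = "c(b := ?n, Suc b := ?n)" and ?u = "u(0 := (?f, int ?n))"
 have 1: "runs (scan b (Suc b)) (mk c u) (6 * ?n + 1) (mk ?c ?u)" by (rule runs_scan) (use z u in auto)
 have 2: "runs (ungo (Suc b)) (mk ?c ?u) (4 * ?c (Suc b) + 1)
   (mk (?c(Suc b := 0)) (?u(0 := (?f, int ?n - int (?c (Suc b))))))" by (rule runs_ungo) simp
 have "?c(Suc b := 0) = c(b := ?n)" using z by (auto simp: fun_eq_iff)
 moreover have "?u(0 := (?f, int ?n - int (?c (Suc b)))) = u" using u snd_input_tape[of "W s"] by (auto simp: fun_eq_iff prod_eq_iff)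
 ultimately show "runs (scan b (Suc b) ;; ungo (Suc b)) (mk c u) (10 * ?n + 10) (mk (c(b := ?n)) u)"
  using runs_Seq[OF 1 2, of "10 * ?n + 10"] by simp
qed simp_all

definition wbit :: "bool list => nat => bool" where
 "wbit w i <-> i < length w & w ! i"

definition UB :: "('a => bool list) => ('a => nat) list => ('a => bool) => bool" where
 "UB W G P <-> U W G (%s. if P s then 1 else 0)"

lemma UB_wbit: assumes "U W G e" shows "UB W G (%s. wbit (W s) (e s))" unfolding UB_def
proof -
 obtain T p where p: "cmpt W G e T p" by (rule UE[OF assms])
 let ?f = "%s. if wbit (W s) (e s) then 1 else 0 :: nat"
 let ?p = "%ad b. p ad b ;; goto b (Suc b) ;; Cond (%r. r 0 = 2) (inc b) nop ;; ungo (Suc b)"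
 show "U W G ?f"
 proof (rule UI[of _ _ "%s. 11 * T s + 20" _ ?p])
  show "pb (sz W G) (%s. 11 * T s + 20)" by (intro pb_intros cmptD(1)[OF p])
  show "well (?p ad b)" for ad b using cmptD(3)[OF p] well_Cond[OF local_rd0[of "%x. x = 2"], of "inc b" nop] by simp
  fix ad b s c u assume env: "env W G ad b s c u"
  then have z: "c b = 0" "c (Suc b) = 0" and u: "u 0 = input_tape (W s)" by (auto simp: env_def)
  let ?g = "fst (input_tape (W s))"
  have u': "u 0 = (?g, 0)" using u snd_input_tape[of "W s"] by (simp add: prod_eq_iff)
  let ?c1 = "c(b := e s)"
  let ?c2 = "?c1(b := 0, Suc b := ?c1 b)" and ?u2 = "u(0 := (?g, 0 + int (?c1 b)))"
  have 2: "runs (goto b (Suc b)) (mk ?c1 u) (6 * ?c1 b + 1) (mk ?c2 ?u2)" by (rule runs_goto) (use z u' in auto)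
  have r: "rd (mk ?c2 ?u2) 0 = 2 <-> wbit (W s) (e s)"
   by (cases "e s < length (W s)") (auto simp: rd_mk_0 fst_input_tape bit_symbol_def wbit_def)
  let ?c3 = "?c2(b := ?f s)"
  have 3: "runs (Cond (%r. r 0 = 2) (inc b) nop) (mk ?c2 ?u2) 2 (mk ?c3 ?u2)"
  proof (cases "wbit (W s) (e s)")
   case True
   then show ?thesis using runs_inc[of b ?c2 ?u2] r by (intro runs_CondT) auto
  next
   case False
   then have "?c3 = ?c2" by (auto simp: fun_eq_iff)
   then have "runs nop (mk ?c2 ?u2) 1 (mk ?c3 ?u2)" using runs_nop by simp
   then show ?thesis by (rule runs_CondF[rotated]) (use r False in auto)
  qed
  have 4: "runs (ungo (Suc b)) (mk ?c3 ?u2) (4 * ?c3 (Suc b) + 1)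
    (mk (?c3(Suc b := 0)) (?u2(0 := (?g, 0 + int (?c1 b) - int (?c3 (Suc b))))))" by (rule runs_ungo) simp
  have "?c3(Suc b := 0) = c(b := ?f s)" "?u2(0 := (?g, 0 + int (?c1 b) - int (?c3 (Suc b)))) = u" using z u' by (auto simp: fun_eq_iff)
  with 4 have 4: "runs (ungo (Suc b)) (mk ?c3 ?u2) (4 * e s + 1) (mk (c(b := ?f s)) u)" by simp
  have 2: "runs (goto b (Suc b)) (mk ?c1 u) (6 * e s + 1) (mk ?c2 ?u2)" using 2 by simp
  show "runs (?p ad b) (mk c u) (11 * T s + 20) (mk (c(b := ?f s)) u)"
   by (rule runs_Seq[OF cmptD(4)[OF p env] runs_Seq[OF 2 runs_Seq[OF 3 4 le_refl] le_refl]])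
    (use cmptD(2)[OF p, of s] in linarith)
 qed simp
qed

section \<open>Closure of the class under logic, arithmetic and bounded search\<close>

named_theorems U_intros

lemma U_if: "UB W G P ==> U W G f ==> U W G g ==> U W G (%s. if P s then f s else g s)"
proof -
 assume a: "UB W G P" "U W G f" "U W G g"
 have "(%s. if (if P s then 1 else 0 :: nat) = 0 then g s else f s) = (%s. if P s then f s else g s)" by auto
 then show ?thesis using U_case0[OF a(1)[unfolded UB_def] a(3,2)] by (simp only:)
qed

lemma UB_neq0: "U W G f ==> UB W G (%s. f s ~= 0)"
proof -
 assume a: "U W G f"
 have "(%s. if f s = 0 then 0 else 1 :: nat) = (%s. if f s ~= 0 then 1 else 0)" by auto
 then show ?thesis using U_case0[OF a U_const U_const, of 0 1] unfolding UB_def by (simp only:)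
qed

lemma UB_conv: "UB W G P ==> (!!s. P s = Q s) ==> UB W G Q" by (simp add: UB_def)

lemma U_conv: "U W G f ==> (!!s. f s = g s) ==> U W G g" by (metis ext)

lemma UB_not: "UB W G P ==> UB W G (%s. ~ P s)" unfolding UB_def[of W G "%s. ~ P s"]
 by (rule U_conv[OF U_if[of W G P "%s. 0" "%s. 1"]]) (auto intro: U_const)

lemma UB_conj: "UB W G P ==> UB W G Q ==> UB W G (%s. P s & Q s)" unfolding UB_def[of W G "%s. P s & Q s"]
 by (rule U_conv[OF U_if[of W G P "%s. if Q s then 1 else 0" "%s. 0"]]) (auto intro: U_const simp: UB_def)

lemma UB_disj: "UB W G P ==> UB W G Q ==> UB W G (%s. P s | Q s)"
 by (rule UB_conv[OF UB_not[OF UB_conj[OF UB_not[of W G P] UB_not[of W G Q]]]]) auto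

lemma UB_imp: "UB W G P ==> UB W G Q ==> UB W G (%s. P s --> Q s)" by (rule UB_conv[OF UB_disj[OF UB_not[of W G P]]]) auto

lemma UB_iff: "UB W G P ==> UB W G Q ==> UB W G (%s. P s = Q s)"
 by (rule UB_conv[OF UB_conj[OF UB_imp[of W G P Q] UB_imp[of W G Q P]]]) auto

lemma UB_const: "UB W G (%s. P)" unfolding UB_def by (rule U_const)

definition lift :: "('a => nat) list => ('a \<times> nat => nat) list" where
 "lift G = map (%v p. v (fst p)) G @ [snd]"

definition lift2 :: "('a => nat) list => ('a \<times> nat \<times> nat => nat) list" where
 "lift2 G = map (%v p. v (fst p)) G @ [%p. fst (snd p), %p. snd (snd p)]"

lemma lift_simps [simp]:
 "lift [] = [snd]" "lift (v # G) = (%p. v (fst p)) # lift G"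
 "lift2 [] = [%p. fst (snd p), %p. snd (snd p)]" "lift2 (v # G) = (%p. v (fst p)) # lift2 G" by (auto simp: lift_def lift2_def)

lemmas U_rec' = U_rec[folded lift2_def]

lemma U_weaken: "U W G f ==> U (%p. W (fst p)) (map (%v p. v (fst p)) G @ H) (%p. f (fst p))"
 by (rule U_comp[of W G f "%p. W (fst p)" _ fst]) (auto intro!: U_var)

lemma U_weaken2: "U W G f ==> U (%p. W (fst p)) (lift2 G) (%p. f (fst p))" unfolding lift2_def by (rule U_weaken)

lemma U_weaken1: "U W G f ==> U (%p. W (fst p)) (lift G) (%p. f (fst p))" unfolding lift_def by (rule U_weaken)

lemma U_add: assumes "U W G f" "U W G g" shows "U W G (%s. f s + g s)"
proof -
 have r: "rec_nat a (%i. Suc) n = a + n" for a n by (induction n) auto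
 have "U W G (%s. rec_nat (f s) ((%s i r. Suc r) s) (g s))"
  by (rule U_rec'[OF assms(2,1) pb_add[OF U_pb[OF assms(1)] U_pb[OF assms(2)]] U_Suc[OF U_var]])
   (auto simp: r lift2_def)
 then show ?thesis by (simp add: r)
qed

lemma U_mult: assumes "U W G f" "U W G g" shows "U W G (%s. f s * g s)"
proof -
 have r: "rec_nat 0 (%i r. r + a) n = n * a" for a n :: nat by (induction n) auto
 have "U W G (%s. rec_nat 0 ((%s i r. r + f s) s) (g s))"
  by (rule U_rec'[OF assms(2) U_const pb_mult[OF U_pb[OF assms(2)] U_pb[OF assms(1)]]
    U_add[OF U_var U_weaken2[OF assms(1)]]])
   (auto simp: r lift2_def)
 then show ?thesis by (simp add: r mult.commute)
qed

lemma U_pred: assumes "U W G f" shows "U W G (%s. f s - 1)"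
proof -
 have r: "rec_nat 0 (%i r. i) n = n - 1" for n :: nat by (cases n) auto
 have "U W G (%s. rec_nat 0 ((%s i r. i) s) (f s))" by (rule U_rec'[OF assms(1) U_const U_pb[OF assms(1)]])
   (auto simp: r intro: U_var simp: lift2_def)
 then show ?thesis by (simp add: r)
qed

lemma U_diff: assumes "U W G f" "U W G g" shows "U W G (%s. f s - g s)"
proof -
 have r: "rec_nat a (%i r. r - 1) n = a - n" for a n :: nat by (induction n) auto
 have "U W G (%s. rec_nat (f s) ((%s i r. r - 1) s) (g s))" by (rule U_rec'[OF assms(2,1) U_pb[OF assms(1)] U_pred[OF U_var]])
   (simp_all add: lift2_def r[simplified])
 then show ?thesis by (simp only: r)
qed

lemma UB_less: "U W G f ==> U W G g ==> UB W G (%s. f s < g s)" by (rule UB_conv[OF UB_neq0[OF U_diff[of W G g f]]]) auto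

lemma UB_le: "U W G f ==> U W G g ==> UB W G (%s. f s <= g s)" by (rule UB_conv[OF UB_not[OF UB_less[of W G g f]]]) auto

lemma UB_eq: "U W G f ==> U W G g ==> UB W G (%s. f s = g s)" by (rule UB_conv[OF UB_conj[OF UB_le[of W G f g] UB_le[of W G g f]]]) auto

text \<open>The bound demanded by recursion comes for free: every summand is polynomial in the size
  of the input plus \<open>N s\<close>, and there are \<open>N s\<close> of them.\<close>

lemma U_sum:
 assumes N: "U W G N" and f: "U (%p. W (fst p)) (lift G) (%p. f (fst p) (snd p))"
 shows "U W G (%s. \<Sum>i<N s. f s i)"
proof -
 have r: "rec_nat 0 (%i r. r + g i) n = (\<Sum>i<n. g i)" for g :: "nat => nat" and n by (induction n) auto
 obtain e where e: "ALL p. f (fst p) (snd p) <= (sz (%p. W (fst p)) (lift G) p + 2) ^ e" using U_pb[OF f] unfolding pb_def by (rule exE)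
 have "pb id (%x. (x + 2) ^ e)" unfolding pb_def by (intro exI[of _ e]) simp
 from pb_comp[OF this pb_add[OF pb_size U_pb[OF N]], of "%s. sz W G s + N s"]
 have B: "pb (sz W G) (%s. N s * (sz W G s + N s + 2) ^ e)" by (intro pb_mult U_pb[OF N]) simp
 have bnd: "(\<Sum>j<i. f s j) <= N s * (sz W G s + N s + 2) ^ e" if "i <= N s" for s i
 proof -
  have "(\<Sum>j<i. f s j) <= (\<Sum>j<i. (sz W G s + N s + 2) ^ e)"
  proof (rule sum_mono)
   fix j assume "j \<in> {..<i}"
   then have "sz (%p. W (fst p)) (lift G) (s, j) <= sz W G s + N s" using that by (simp add: sz_def lift_def comp_def)
   then have "(sz (%p. W (fst p)) (lift G) (s, j) + 2) ^ e <= (sz W G s + N s + 2) ^ e" by (intro power_mono) auto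
   then show "f s j <= (sz W G s + N s + 2) ^ e" using e[rule_format, of "(s, j)"] by simp
  qed
  then show ?thesis using that by (simp add: le_trans mult_le_mono1)
 qed
 have h: "U (%p. W (fst p)) (lift2 G) (%p. snd (snd p) + f (fst p) (fst (snd p)))"
 proof (rule U_add)
  show "U (%p. W (fst p)) (lift2 G) (%p. snd (snd p))" by (rule U_var) (simp add: lift2_def)
  show "U (%p. W (fst p)) (lift2 G) (%p. f (fst p) (fst (snd p)))"
  proof -
   have "U (%p. W (fst p)) (lift2 G) (%p. (%p. f (fst p) (snd p)) (fst p, fst (snd p)))"
    by (rule U_comp[OF f, of _ _ "%p. (fst p, fst (snd p))"]) (auto simp: lift_def lift2_def intro!: U_var)
   then show ?thesis by simp
  qed
 qed
 have "U W G (%s. rec_nat 0 ((%s i r. r + f s i) s) (N s))" by (rule U_rec'[OF N U_const B]) (use h in simp, simp only: r bnd)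
 then show ?thesis by (simp only: r)
qed

lemma UB_bex:
 assumes N: "U W G N" and f: "UB (%p. W (fst p)) (lift G) (%p. P (fst p) (snd p))"
 shows "UB W G (%s. EX i<N s. P s i)" by (rule UB_conv[OF UB_neq0[OF U_sum[OF N f[unfolded UB_def]]]]) auto

lemma UB_ball:
 assumes N: "U W G N" and f: "UB (%p. W (fst p)) (lift G) (%p. P (fst p) (snd p))"
 shows "UB W G (%s. ALL i<N s. P s i)" by (rule UB_conv[OF UB_not[OF UB_bex[OF N UB_not[OF f]]]]) auto

lemma sum_card: "(\<Sum>i<(n :: nat). if P i then 1 else 0 :: nat) = card {i. i < n & P i}"
proof -
 have "(\<Sum>i<n. if P i then 1 else 0 :: nat) = (\<Sum>i\<in>{i \<in> {..<n}. P i}. 1)" by (rule sum.inter_filter[symmetric]) simp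
 also have "... = card {i \<in> {..<n}. P i}" by (rule card_eq_sum[symmetric])
 also have "{i \<in> {..<n}. P i} = {i. i < n & P i}" by auto
 finally show ?thesis .
qed

lemma U_div: assumes "U W G f" "U W G g" shows "U W G (%s. f s div g s)"
proof -
 have r: "(if b = 0 then 0 else \<Sum>i<a. if Suc i * b <= a then 1 else 0) = a div b" for a b :: nat
 proof (cases "b = 0")
  case False
  have "(\<Sum>i<a. if Suc i * b <= a then 1 else 0 :: nat) = card {i. i < a & Suc i * b <= a}" by (rule sum_card)
  also have "{i. i < a & Suc i * b <= a} = {..<a div b}"
  proof -
   have 1: "i < a" if "Suc i * b <= a" for i
   proof -
    have "Suc i * 1 <= Suc i * b" using False by (intro mult_le_mono) auto
    from this that have "Suc i * 1 <= a" by (rule le_trans)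
    then show ?thesis by simp
   qed
   have 2: "i < a div b <-> Suc i * b <= a" for i using less_eq_div_iff_mult_less_eq[of b "Suc i" a] False by (simp only: Suc_le_eq)
   show ?thesis using 1 by (intro set_eqI) (simp only: mem_Collect_eq lessThan_iff 2, blast)
  qed
  finally show ?thesis by (simp only: if_not_P[OF False] card_lessThan)
 qed simp
 have "U W G (%s. if g s = 0 then 0 else \<Sum>i<f s. (%s i. if Suc i * g s <= f s then 1 else 0) s i)"
  by (intro U_if UB_eq assms U_const U_sum UB_le U_mult U_Suc U_weaken1)
   (auto intro: U_var simp: lift_def)
 then show ?thesis by (simp only: r)
qed

lemma U_mod: assumes "U W G f" "U W G g" shows "U W G (%s. f s mod g s)"
 by (rule U_conv[OF U_diff[OF assms(1) U_mult[OF U_div[OF assms] assms(2)]]])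
  (simp add: minus_div_mult_eq_mod)

lemma U_max: "U W G f ==> U W G g ==> U W G (%s. max (f s) (g s))" unfolding max_def by (intro U_if UB_le)

lemma U_pow: "U W G f ==> U W G (%s. f s ^ k)" by (induction k) (auto intro: U_mult U_const)

text \<open>The least \<open>i < n\<close> with property \<open>P\<close>, and \<open>n\<close> if there is none.\<close>

definition first :: "nat => (nat => bool) => nat" where
 "first n P = (\<Sum>i<n. if EX j<Suc i. P j then 0 else 1)"

lemma first_eq: "i < n ==> P i ==> (!!j. j < i ==> ~ P j) ==> first n P = i"
proof -
 assume a: "i < n" "P i" "!!j. j < i ==> ~ P j"
 have "first n P = card {k. k < n & ~ (EX j<Suc k. P j)}" unfolding first_def by (rule trans[OF _ sum_card]) (rule sum.cong, auto)
 also have "{k. k < n & ~ (EX j<Suc k. P j)} = {..<i}"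
  using a by (auto simp: not_less intro: ccontr) (meson le_less_trans less_Suc_eq_le not_le)+
 finally show ?thesis by simp
qed

lemma U_first:
 assumes N: "U W G N" and f: "UB (%p. W (fst p)) (lift G) (%p. P (fst p) (snd p))"
 shows "U W G (%s. first (N s) (P s))"
proof -
 have "U (%p. W (fst (fst p))) (lift (lift G))
   (%p. (%p. if P (fst p) (snd p) then 1 else 0) (fst (fst p), snd p))"
  by (rule U_comp[OF f[unfolded UB_def], of _ _ "%p. (fst (fst p), snd p)"]) (auto simp: lift_def comp_def intro!: U_var)
 then have 1: "UB (%p. W (fst (fst p))) (lift (lift G)) (%p. P (fst (fst p)) (snd p))" by (simp add: UB_def)
 have "UB (%p. W (fst p)) (lift G) (%p. EX j<Suc (snd p). P (fst p) j)"
  by (rule UB_bex[OF U_Suc[OF U_var]]) (use 1 in "auto simp: lift_def")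
 then show ?thesis unfolding first_def by (intro U_sum N U_if U_const)
qed

text \<open>A bounded argument is decoded by finitely many comparisons, so \<open>F\<close> may be
  any function, even one obtained by choice. This is how objects of constant size, such as
  enumerations of opinions and truth tables, get into the machines.\<close>

lemma U_finite: "U W G e ==> U W G (%s. if e s < k then F (e s) else 0)"
proof (induction k)
 case (Suc k)
 have "U W G (%s. if e s = k then F k else if e s < k then F (e s) else 0)" by (intro U_if UB_eq U_const Suc)
 then show ?case by (rule U_conv) auto
qed (simp add: U_const)

lemma U_fin: "U W G e ==> (!!s. e s < k) ==> U W G (%s. F (e s))" by (rule U_conv[OF U_finite[of W G e k F]]) auto

lemma UB_fin: "U W G e ==> (!!s. e s < k) ==> UB W G (%s. F (e s))" unfolding UB_def by (rule U_fin)

lemmas U_basic = U_const UB_const U_Suc U_if U_add U_mult U_diff U_div U_mod U_max U_pow U_len UB_wbit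
 UB_not UB_conj UB_disj UB_imp UB_less UB_le UB_eq UB_iff UB_bex UB_ball U_sum U_first
declare U_basic [U_intros]

section \<open>The Margulis expander\<close>

abbreviation "sum2 N f == \<Sum>x\<in>{0..<N :: int}. \<Sum>y\<in>{0..<N}. f x y"

text \<open>The additive character of the integers modulo \<open>N\<close>. Functions on the torus
  are represented by periodic functions on all integers, so that shears and shifts need no reduction
  modulo \<open>N\<close>.\<close>

definition ee :: "int => int => complex" where
 "ee N k = cis (2 * pi * k / N)"

lemma ee_add: "ee N (j + k) = ee N j * ee N k" by (simp add: ee_def cis_mult add_divide_distrib distrib_left)

lemma ee_0 [simp]: "ee N 0 = 1" by (simp add: ee_def)

lemma cnj_ee: "cnj (ee N k) = ee N (- k)" by (simp add: ee_def cis_cnj)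

lemma norm_ee [simp]: "cmod (ee N k) = 1" by (simp add: ee_def)

lemma ee_period: "0 < N ==> ee N (N * k) = 1"
proof -
 assume "0 < N"
 then have "2 * pi * real_of_int (N * k) / real_of_int N = 2 * pi * real_of_int k" by simp
 then show ?thesis by (simp add: ee_def cis_multiple_2pi del: of_int_mult)
qed

lemma ee_cong: "0 < N ==> (k - l) mod N = 0 ==> ee N k = ee N l"
proof -
 assume N: "0 < N" "(k - l) mod N = 0"
 then obtain d where "k = l + N * d" by (metis add.commute diff_add_cancel dvd_def mod_0_imp_dvd)
 then show ?thesis using ee_period[OF N(1), of d] by (simp add: ee_add)
qed

lemma ee_pow: "ee N k ^ j = ee N (k * int j)" by (induction j) (simp_all add: ee_add distrib_left)

lemma ee_eq_1: assumes "0 < N" "ee N k = 1" shows "k mod N = 0"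
proof -
 have "cos (2 * pi * k / N) = 1" using assms(2) by (simp add: ee_def complex_eq_iff)
 then obtain m :: int where "2 * pi * k / N = real_of_int m * 2 * pi" using cos_one_2pi_int by auto
 then have "real_of_int k = real_of_int m * real_of_int N" using assms(1) by (simp add: field_simps)
 then have "k = m * N" by (simp only: of_int_mult[symmetric] of_int_eq_iff)
 then show ?thesis by simp
qed

lemma sum_int_nat: "0 < N ==> (\<Sum>x\<in>{0..<N}. f x) = (\<Sum>j<nat N. f (int j))" by (rule sum.reindex_bij_witness[of _ int nat]) auto

text \<open>Orthogonality of characters: the powers of a non-trivial root of unity form a geometric
  series with sum zero.\<close>

lemma sum_ee: assumes "0 < N" shows "(\<Sum>a\<in>{0..<N}. ee N (a * k)) = (if k mod N = 0 then of_int N else 0)"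
proof (cases "k mod N = 0")
 case True
 have "ee N (a * k) = 1" for a using ee_cong[OF assms, of "a * k" 0] True by (simp add: mod_mult_right_eq[symmetric])
 then show ?thesis using assms True by simp
next
 case False
 have "(\<Sum>a\<in>{0..<N}. ee N (a * k)) = (\<Sum>j<nat N. ee N k ^ j)" unfolding sum_int_nat[OF assms] by (simp add: ee_pow mult.commute)
 also have "... = (ee N k ^ nat N - 1) / (ee N k - 1)" using ee_eq_1[OF assms] False by (intro geometric_sum) auto
 also have "ee N k ^ nat N = 1" using assms ee_period[OF assms, of k] by (simp add: ee_pow mult.commute)
 finally show ?thesis using False by simp
qed

definition per :: "int => (int => 'a) => bool" where
 "per N f <-> (ALL x. f (x + N) = f x)"

lemma per_mult: assumes "per N f" shows "f (x + N * k) = f x"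
proof -
 have 1: "f (x + N * int j) = f x" for x j
 proof (induction j)
  case (Suc j)
  have "f (x + N * int (Suc j)) = f ((x + N * int j) + N)" by (simp add: algebra_simps)
  then show ?case using assms Suc by (simp add: per_def)
 qed simp
 show ?thesis
 proof (cases "0 <= k")
  case True
  then show ?thesis using 1[of x "nat k"] by simp
 next
  case False
  then show ?thesis using 1[of "x + N * k" "nat (- k)"] by simp
 qed
qed

lemma per_cong: "per N f ==> x mod N = y mod N ==> f x = f y" by (metis per_mult mult_div_mod_eq add.commute)

lemma sum_shift: assumes "0 < N" "per N f" shows "(\<Sum>x\<in>{0..<N}. f (x + c)) = (\<Sum>x\<in>{0..<N}. f x)"
proof (rule sum.reindex_bij_witness[of _ "%x. (x - c) mod N" "%x. (x + c) mod N"])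
 show "f ((x + c) mod N) = f (x + c)" if "x \<in> {0..<N}" for x by (rule per_cong[OF assms(2)]) simp
qed (use assms(1) in "auto simp: mod_simps")

definition dft :: "int => (int => complex) => int => complex" where
 "dft N f a = (\<Sum>x\<in>{0..<N}. f x * ee N (- a * x))"

lemma dft_plancherel: assumes "0 < N"
 shows "(\<Sum>a\<in>{0..<N}. dft N f a * cnj (dft N g a)) = of_int N * (\<Sum>x\<in>{0..<N}. f x * cnj (g x))"
proof -
 have "(\<Sum>a\<in>{0..<N}. dft N f a * cnj (dft N g a)) =
   sum2 N (%a x. \<Sum>y\<in>{0..<N}. f x * cnj (g y) * ee N (a * (y - x)))" unfolding dft_def sum_product cnj_sum
  by (intro sum.cong refl) (simp add: cnj_ee ee_add[symmetric] algebra_simps flip: ee_add)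
 also have "... = sum2 N (%x y. f x * cnj (g y) * (\<Sum>a\<in>{0..<N}. ee N (a * (y - x))))"
  unfolding sum_distrib_left by (rule trans[OF sum.swap]) (intro sum.cong refl sum.swap)
 also have "... = sum2 N (%x y. if y = x then of_int N * (f x * cnj (g x)) else 0)"
 proof (intro sum.cong refl)
  fix x y assume "x \<in> {0..<N}" "y \<in> {0..<N}"
  then have "(y - x) mod N = 0 <-> y = x"
   by (smt (verit) atLeastLessThan_iff mod_pos_pos_trivial mod_eq_0_iff_dvd zdvd_imp_le dvd_minus_iff)
  then show "f x * cnj (g y) * (\<Sum>a\<in>{0..<N}. ee N (a * (y - x))) = (if y = x then of_int N * (f x * cnj (g x)) else 0)"
   by (simp add: sum_ee[OF assms])
 qed
 also have "... = of_int N * (\<Sum>x\<in>{0..<N}. f x * cnj (g x))" by (simp add: sum_distrib_left)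
 finally show ?thesis .
qed

lemma dft_shift: assumes "0 < N" "per N f" shows "dft N (%x. f (x + c)) a = ee N (a * c) * dft N f a"
proof -
 have "per N (%x. f x * ee N (a * c + - a * x))" unfolding per_def
 proof
  fix x
  have "ee N (a * c + - a * (x + N)) = ee N (a * c + - a * x)" by (rule ee_cong[OF assms(1)]) (simp add: algebra_simps)
  then show "f (x + N) * ee N (a * c + - a * (x + N)) = f x * ee N (a * c + - a * x)" using assms(2) by (simp add: per_def)
 qed
 from sum_shift[OF assms(1) this, of c]
 have "dft N (%x. f (x + c)) a = (\<Sum>x\<in>{0..<N}. f x * ee N (a * c + - a * x))" by (simp add: dft_def algebra_simps)
 then show ?thesis unfolding dft_def ee_add by (simp add: sum_distrib_left mult_ac)
qed

lemma dft_per: "0 < N ==> per N (dft N f)" unfolding per_def dft_def by (auto intro!: sum.cong ee_cong simp: algebra_simps)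

definition dft2 :: "int => (int => int => complex) => int => int => complex" where
 "dft2 N f a b = dft N (%y. dft N (%x. f x y) a) b"

lemma dft2_swap: "dft2 N (%x y. f y x) a b = dft2 N f b a" unfolding dft2_def dft_def sum_distrib_right
 by (subst sum.swap) (simp add: mult_ac)

lemma dft2_plancherel: assumes "0 < N"
 shows "sum2 N (%a b. dft2 N f a b * cnj (dft2 N g a b)) =
   of_int (N * N) * sum2 N (%x y. f x y * cnj (g x y))"
proof -
 have "sum2 N (%a b. dft2 N f a b * cnj (dft2 N g a b)) =
  (\<Sum>a\<in>{0..<N}. of_int N * (\<Sum>y\<in>{0..<N}. dft N (%x. f x y) a * cnj (dft N (%x. g x y) a)))"
  by (simp add: dft2_def dft_plancherel[OF assms])
 also have "... = of_int N * sum2 N (%y a. dft N (%x. f x y) a * cnj (dft N (%x. g x y) a))"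
  by (subst sum.swap) (simp add: sum_distrib_left)
 also have "... = of_int N * (\<Sum>y\<in>{0..<N}. of_int N * (\<Sum>x\<in>{0..<N}. f x y * cnj (g x y)))"
  by (simp add: dft_plancherel[OF assms])
 also have "... = of_int (N * N) * sum2 N (%x y. f x y * cnj (g x y))" by (subst sum.swap) (simp add: sum_distrib_left mult_ac)
 finally show ?thesis .
qed

text \<open>On the frequencies a shear becomes the transposed inverse shear, and a shift only a
  phase. Hence the Margulis generators act on the Fourier side as permutations with phases.\<close>

lemma dft2_shear: assumes "0 < N" "!!y. per N (%x. f x y)"
 shows "dft2 N (%x y. f (x + 2 * y + c) y) a b = ee N (a * c) * dft2 N f a (b - 2 * a)"
proof -
 have "dft N (%x. f (x + 2 * y + c) y) a = ee N (a * (2 * y + c)) * dft N (%x. f x y) a" for y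
  using dft_shift[OF assms(1) assms(2)[of y], of "2 * y + c" a] by (simp add: add.assoc)
 then have "dft2 N (%x y. f (x + 2 * y + c) y) a b =
   dft N (%y. ee N (a * (2 * y + c)) * dft N (%x. f x y) a) b" unfolding dft2_def by simp
 also have "... = (\<Sum>y\<in>{0..<N}. ee N (a * c) * (dft N (%x. f x y) a * ee N (- (b - 2 * a) * y)))"
  unfolding dft_def[of N "%y. ee N (a * (2 * y + c)) * dft N (%x. f x y) a"]
 proof (intro sum.cong refl)
  fix y
  have "a * (2 * y + c) + - b * y = a * c + - (b - 2 * a) * y" by (simp add: algebra_simps)
  then have "ee N (a * (2 * y + c)) * ee N (- b * y) = ee N (a * c) * ee N (- (b - 2 * a) * y)" by (simp only: ee_add[symmetric])
  then show "ee N (a * (2 * y + c)) * dft N (%x. f x y) a * ee N (- b * y) =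
   ee N (a * c) * (dft N (%x. f x y) a * ee N (- (b - 2 * a) * y))"
  proof -
   have 1: "p * d * q = d * (p * q)" and 2: "d * (p * q) = p * (d * q)" for p q d :: complex by (simp_all only: mult_ac)
   show ?thesis unfolding 1 \<open>ee N (a * (2 * y + c)) * ee N (- b * y) = _\<close> 2 ..
  qed
 qed
 also have "... = ee N (a * c) * dft2 N f a (b - 2 * a)" by (simp add: dft2_def dft_def sum_distrib_left)
 finally show ?thesis .
qed

section \<open>The Gabber-Galil estimate on the frequency side\<close>

lemma norm_1_ee: "cmod (1 + ee N a) = 2 * \<bar>cos (pi * a / N)\<bar>"
proof -
 let ?t = "pi * a / N"
 have "1 + ee N a = complex_of_real (2 * cos ?t) * cis ?t" using cos_double_cos[of ?t] sin_double[of ?t]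
  by (simp add: ee_def complex_eq_iff power2_eq_square algebra_simps)
 then show ?thesis by (simp add: norm_mult)
qed

text \<open>The distance of \<open>x\<close> to the nearest multiple of \<open>N\<close>.\<close>

definition nr :: "int => int => int" where
 "nr N x = min (x mod N) ((- x) mod N)"

text \<open>Weights for the inequality between arithmetic and geometric mean: a pair of frequencies
  is charged more to the one that lies farther from zero. The two weights of a pair are mutually
  inverse.\<close>

definition wt :: "int => int => int => real" where
 "wt N x y = (if nr N x < nr N y then 4/5 else if nr N y < nr N x then 5/4 else 1)"

definition ww :: "int => int => int => real" where
 "ww N a b = wt N b (b - 2 * a) + wt N b (b + 2 * a)"

lemma nr_minus [simp]: "nr N (- x) = nr N x" by (simp add: nr_def min.commute)

lemma nr_cong: "x mod N = y mod N ==> nr N x = nr N y" unfolding nr_def by (metis mod_minus_eq)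

lemma nr_abs: assumes "0 < N" "\<bar>y\<bar> < N" shows "nr N y = min \<bar>y\<bar> (N - \<bar>y\<bar>)"
proof -
 have 1: "nr N y = min y (N - y)" if "0 < y" "y < N" for y using that by (simp add: nr_def zmod_zminus1_eq_if)
 consider "0 < y" | "y = 0" | "y < 0" by linarith
 then show ?thesis
 proof cases
  case 3
  then show ?thesis using 1[of "- y"] assms by simp
 qed (use 1[of y] assms in "auto simp: nr_def")
qed

lemma nr_bounds: assumes "0 < N" shows "0 <= nr N x" "2 * nr N x <= N"
proof -
 have "nr N x = nr N (x mod N)" by (rule nr_cong) simp
 also have "... = min (x mod N) (N - x mod N)" using nr_abs[of N "x mod N"] assms by simp
 finally show "0 <= nr N x" "2 * nr N x <= N" using pos_mod_bound[OF assms, of x] pos_mod_sign[OF assms, of x] by (auto simp: min_def)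
qed

lemma nr_rep: assumes "0 < N" shows "x mod N = nr N x mod N | x mod N = (- nr N x) mod N"
 unfolding nr_def min_def by (auto simp: mod_minus_eq)

text \<open>A change of sign of \<open>a\<close> or \<open>b\<close> only exchanges or negates the
  two neighbours, so their distances can be computed from the representatives between 0 and
  \<open>N / 2\<close>.\<close>

lemma nr_pair: assumes "0 < N"
 shows "{nr N (b - 2 * a), nr N (b + 2 * a)} = {nr N (nr N b - 2 * nr N a), nr N (nr N b + 2 * nr N a)}"
proof -
 let ?A = "nr N a" and ?B = "nr N b"
 have c: "nr N (x + 2 * y) = nr N (x' + 2 * y')" if "x mod N = x' mod N" "y mod N = y' mod N" for x y x' y'
  by (rule nr_cong) (metis that mod_add_cong mod_mult_cong)
 have d: "nr N (x - 2 * y) = nr N (x' - 2 * y')" if "x mod N = x' mod N" "y mod N = y' mod N" for x y x' y'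
  by (rule nr_cong) (metis that mod_diff_cong mod_mult_cong)
 have e: "nr N (- x + 2 * y) = nr N (x - 2 * y)" "nr N (- x - 2 * y) = nr N (x + 2 * y)" for x y
  using nr_minus[of N "x - 2 * y"] nr_minus[of N "x + 2 * y"] by (simp_all add: algebra_simps)
 from nr_rep[OF assms, of a] nr_rep[OF assms, of b] show ?thesis
 proof (elim disjE)
  assume h: "a mod N = ?A mod N" "b mod N = ?B mod N"
  then show ?thesis using c[of b ?B a ?A] d[of b ?B a ?A] by simp
 next
  assume h: "a mod N = ?A mod N" "b mod N = (- ?B) mod N"
  then show ?thesis using c[of b "- ?B" a ?A] d[of b "- ?B" a ?A] e by auto
 next
  assume h: "a mod N = (- ?A) mod N" "b mod N = ?B mod N"
  then show ?thesis using c[of b ?B a "- ?A"] d[of b ?B a "- ?A"] e by auto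
 next
  assume h: "a mod N = (- ?A) mod N" "b mod N = (- ?B) mod N"
  then show ?thesis using c[of b "- ?B" a "- ?A"] d[of b "- ?B" a "- ?A"] e[of ?B "- ?A"] by auto
 qed
qed

lemma ww_nr: assumes "0 < N"
 shows "ww N a b = (let f = (%t. if nr N b < t then 4/5 else if t < nr N b then 5/4 else 1) in
   f (nr N (nr N b - 2 * nr N a)) + f (nr N (nr N b + 2 * nr N a)))"
proof -
 have *: "f p + f q = f p' + f q'" if "{p, q} = {p', q'}" for f :: "int => real" and p q p' q'
  using that by (metis add.commute doubleton_eq_iff)
 show ?thesis unfolding ww_def wt_def Let_def
  by (rule *[OF nr_pair[OF assms], of "%t. if nr N b < t then 4/5 else if t < nr N b then 5/4 else 1"])
qed

text \<open>Inside this diamond around zero the moved coordinate ends up farther out for at least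
  three of the four neighbours, or for two of them while it keeps its distance for the other two.
  The worst case is \<open>3 * 4/5 + 5/4 = 73/20\<close>.\<close>

lemma ww_sum: assumes "0 < N" "2 * (nr N a + nr N b) < N" "nr N a ~= 0 | nr N b ~= 0"
 shows "ww N a b + ww N b a <= 73/20"
proof -
 define A where "A = nr N a" define B where "B = nr N b"
 have AB: "0 <= A" "0 <= B" "2 * (A + B) < N" "A ~= 0 | B ~= 0" using assms nr_bounds[OF assms(1)] by (auto simp: A_def B_def)
 have n: "nr N (B - 2 * A) = min \<bar>B - 2 * A\<bar> (N - \<bar>B - 2 * A\<bar>)" "nr N (B + 2 * A) = min (B + 2 * A) (N - (B + 2 * A))"
  "nr N (A - 2 * B) = min \<bar>A - 2 * B\<bar> (N - \<bar>A - 2 * B\<bar>)" "nr N (A + 2 * B) = min (A + 2 * B) (N - (A + 2 * B))"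
  using AB by (subst nr_abs; auto)+
 define p where "p = nr N (B - 2 * A)" define q where "q = nr N (B + 2 * A)"
 define r where "r = nr N (A - 2 * B)" define t where "t = nr N (A + 2 * B)"
 note n = n[folded p_def q_def r_def t_def]
 have W: "ww N a b + ww N b a = (if B < p then 4/5 else if p < B then 5/4 else 1) + (if B < q then 4/5 else if q < B then 5/4 else 1)
   + ((if A < r then 4/5 else if r < A then 5/4 else 1) + (if A < t then 4/5 else if t < A then 5/4 else 1))"
  unfolding ww_nr[OF assms(1)] Let_def by (simp only: A_def B_def p_def q_def r_def t_def)
 have c: "A < B ==> A < r" "A < B ==> A < t" "B < A ==> B < p" "B < A ==> B < q"
  "0 < A ==> A <= B ==> B < q" "0 < B ==> B <= A ==> A < t" "A = 0 ==> p = B" "A = 0 ==> q = B" "B = 0 ==> r = A" "B = 0 ==> t = A"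
  "A = B ==> p = A" "A = B ==> r = A" unfolding n min_def abs_if using AB by (smt (verit))+
 consider "A < B" "A = 0" | "A < B" "0 < A" | "A = B" | "B < A" "B = 0" | "B < A" "0 < B" using AB by linarith
 then show ?thesis
 proof cases
  case 1
  then show ?thesis unfolding W using c by simp
 next
  case 2
  then have "A < r" "A < t" "B < q" using c by auto
  then show ?thesis unfolding W by simp
 next
  case 3
  then have "p = B" "r = A" "B < q" "A < t" using c AB by auto
  then show ?thesis unfolding W by simp
 next
  case 4
  then show ?thesis unfolding W using c by simp
 next
  case 5
  then have "B < p" "B < q" "A < t" using c by auto
  then show ?thesis unfolding W by simp
 qed
qed

lemma ww_le: "ww N a b <= 5/2" "0 <= ww N a b" by (auto simp: ww_def wt_def)

lemma cos_nr: assumes "0 < N" shows "\<bar>cos (pi * a / N)\<bar> = cos (pi * (nr N a) / N)"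
proof -
 have cong: "\<bar>cos (pi * x / N)\<bar> = \<bar>cos (pi * y / N)\<bar>" if "x mod N = y mod N" for x y
 proof -
  have "ee N x = ee N y" using that by (intro ee_cong[OF assms]) (simp add: mod_eq_dvd_iff)
  then show ?thesis using norm_1_ee[of N x] norm_1_ee[of N y] by simp
 qed
 have "\<bar>cos (pi * a / N)\<bar> = \<bar>cos (pi * (nr N a) / N)\<bar>" using nr_rep[OF assms, of a]
 proof
  assume "a mod N = (- nr N a) mod N"
  from cong[OF this] show ?thesis by simp
 qed (rule cong)
 moreover have "0 <= cos (pi * (nr N a) / N)"
 proof (rule cos_ge_zero)
  have "pi * (2 * real_of_int (nr N a)) <= pi * real_of_int N" using nr_bounds(2)[OF assms, of a] by (intro mult_left_mono) auto
  then show "pi * (nr N a) / N <= pi / 2" using assms by (simp add: field_simps)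
  have "0 <= pi * (nr N a) / N" using nr_bounds(1)[OF assms] assms by simp
  then show "- (pi / 2) <= pi * (nr N a) / N" using pi_ge_zero by linarith
 qed
 ultimately show ?thesis by simp
qed

text \<open>Monotonicity reduces the claim to the boundary \<open>s + t = pi / 2\<close>, where the
  sum is \<open>cos s + sin s\<close>.\<close>

lemma cos_sum_le: assumes "0 <= s" "0 <= t" "s <= pi / 2" "t <= pi / 2" "pi / 2 <= s + t"
 shows "cos s + cos t <= sqrt 2"
proof -
 have "cos t <= cos (pi / 2 - s)" using assms by (intro cos_monotone_0_pi_le) auto
 also have "... = sin s" by (simp add: cos_diff)
 finally have "cos s + cos t <= cos s + sin s" by simp
 also have "... <= sqrt 2"
 proof (rule real_le_rsqrt)
  have "(cos s + sin s)\<^sup>2 = 1 + 2 * (cos s * sin s)" using sin_cos_squared_add[of s] by (simp add: power2_eq_square algebra_simps)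
  moreover have "0 <= (cos s - sin s)\<^sup>2" by simp
  moreover have "(cos s - sin s)\<^sup>2 = 1 - 2 * (cos s * sin s)"
   using sin_cos_squared_add[of s] by (simp add: power2_eq_square algebra_simps)
  ultimately show "(cos s + sin s)\<^sup>2 <= 2" by linarith
 qed
 finally show ?thesis .
qed

text \<open>Near zero the cosines are bounded by one and the weights do the work; away from zero
  each sum of two weights is at most 5/2 and the sum of the cosines is small.\<close>

lemma key_bound: assumes "0 < N" "a \<in> {0..<N}" "b \<in> {0..<N}" "(a, b) ~= (0, 0)"
 shows "\<bar>cos (pi * a / N)\<bar> * ww N a b + \<bar>cos (pi * b / N)\<bar> * ww N b a <= 73/20"
proof (cases "2 * (nr N a + nr N b) < N")
 case True
 have "nr N a = 0 --> a = 0" "nr N b = 0 --> b = 0" using assms nr_abs[of N a] nr_abs[of N b] by auto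
 then have 1: "ww N a b + ww N b a <= 73/20" using assms by (intro ww_sum True) auto
 have "\<bar>cos x\<bar> * ww N c d <= ww N c d" for x c d using ww_le(2)[of N c d] by (simp add: mult_left_le_one_le)
 from this[of "pi * a / N" a b] this[of "pi * b / N" b a]
 1 show ?thesis by linarith
next
 case False
 let ?s = "pi * (nr N a) / N" and ?t = "pi * (nr N b) / N"
 have le: "?s <= pi / 2" "?t <= pi / 2"
 proof -
  have "pi * (2 * real_of_int (nr N x)) <= pi * real_of_int N" for x using nr_bounds(2)[OF assms(1), of x] by (intro mult_left_mono) auto
  then show "?s <= pi / 2" "?t <= pi / 2" using assms(1) by (simp_all add: field_simps)
 qed
 have "pi * real_of_int N <= pi * (2 * real_of_int (nr N a + nr N b))" using False by (intro mult_left_mono) auto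
 then have "pi / 2 <= ?s + ?t" using assms(1) by (simp add: field_simps)
 then have "cos ?s + cos ?t <= sqrt 2" using le nr_bounds(1)[OF assms(1)] assms(1) by (intro cos_sum_le) auto
 \<comment> \<open>The number \<open>73/50\<close> lies above \<open>sqrt 2\<close> and is chosen so
   that \<open>5/2 * 73/50\<close> is again \<open>73/20\<close>.\<close>
 moreover have "sqrt 2 <= 73/50" by (rule real_le_lsqrt) (auto simp: power2_eq_square)
 ultimately have c: "\<bar>cos (pi * a / N)\<bar> + \<bar>cos (pi * b / N)\<bar> <= 73/50" by (simp add: cos_nr[OF assms(1)])
 have "\<bar>cos x\<bar> * ww N c d <= \<bar>cos x\<bar> * (5/2)" for x c d using ww_le(1)[of N c d] by (intro mult_left_mono) auto
 from this[of "pi * a / N" a b] this[of "pi * b / N" b a] c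
 show ?thesis by linarith
qed

lemma wt_pos: "0 < wt N x y" and wt_inv: "wt N x y * wt N y x = 1" by (auto simp: wt_def)

lemma wt_amgm: "2 * (p * q) <= wt N x y * p\<^sup>2 + wt N y x * q\<^sup>2"
proof -
 let ?w = "wt N x y" and ?v = "wt N y x"
 have "0 <= ?w * (p - ?v * q)\<^sup>2" using wt_pos[of N x y] by simp
 also have "... = ?w * p\<^sup>2 - 2 * (?w * ?v) * (p * q) + (?w * ?v) * ?v * q\<^sup>2" by (simp add: power2_eq_square algebra_simps)
 finally show ?thesis by (simp add: wt_inv)
qed

text \<open>The square at the neighbour \<open>b - 2 * a\<close> is moved to \<open>b\<close> by
  shifting the summation, where it meets the weight for the other neighbour
  \<open>b + 2 * a\<close>; together they make up \<open>ww N a b\<close>.\<close>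

lemma comb_row:
 assumes N: "0 < N" and g: "per N g"
 shows "2 * (\<Sum>b\<in>{0..<N}. g b * g (b - 2 * a)) <= (\<Sum>b\<in>{0..<N}. (g b)\<^sup>2 * ww N a b)"
proof -
 let ?h = "%b. wt N b (b + 2 * a) * (g b)\<^sup>2"
 have "2 * (\<Sum>b\<in>{0..<N}. g b * g (b - 2 * a)) <=
   (\<Sum>b\<in>{0..<N}. wt N b (b - 2 * a) * (g b)\<^sup>2 + wt N (b - 2 * a) b * (g (b - 2 * a))\<^sup>2)"
  unfolding sum_distrib_left by (intro sum_mono wt_amgm)
 also have "... = (\<Sum>b\<in>{0..<N}. wt N b (b - 2 * a) * (g b)\<^sup>2) + (\<Sum>b\<in>{0..<N}. ?h (b + - 2 * a))"
  by (simp add: sum.distrib)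
 also have "(\<Sum>b\<in>{0..<N}. ?h (b + - 2 * a)) = (\<Sum>b\<in>{0..<N}. ?h b)"
 proof (rule sum_shift[OF N])
  have "nr N (x + N) = nr N x" for x by (rule nr_cong) simp
  from this[of "_ + 2 * a"] this show "per N ?h" using g by (simp add: per_def wt_def algebra_simps)
 qed
 also have "(\<Sum>b\<in>{0..<N}. wt N b (b - 2 * a) * (g b)\<^sup>2) + (\<Sum>b\<in>{0..<N}. ?h b) = (\<Sum>b\<in>{0..<N}. (g b)\<^sup>2 * ww N a b)"
  by (simp add: ww_def algebra_simps flip: sum.distrib)
 finally show ?thesis .
qed

lemma comb:
 assumes N: "0 < N" and g: "!!a. per N (g a)" "!!b. per N (%a. g a b)" and g0: "g 0 0 = 0"
 shows "sum2 N (%a b. g a b * (2 * \<bar>cos (pi * a / N)\<bar> * g a (b - 2 * a) +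
   2 * \<bar>cos (pi * b / N)\<bar> * g (a - 2 * b) b)) <= 73/20 * sum2 N (%a b. (g a b)\<^sup>2)"
proof -
 define C where "C a = \<bar>cos (pi * a / N)\<bar>" for a
 have C: "0 <= C a" for a by (simp add: C_def)
 have 1: "sum2 N (%a b. C a * (2 * (g a b * g a (b - 2 * a)))) <=
   sum2 N (%a b. C a * ((g a b)\<^sup>2 * ww N a b))"
  unfolding sum_distrib_left[symmetric] by (intro sum_mono mult_left_mono C comb_row N g)
 have "sum2 N (%b a. C b * (2 * (g a b * g (a - 2 * b) b))) <=
   sum2 N (%b a. C b * ((g a b)\<^sup>2 * ww N b a))" unfolding sum_distrib_left[symmetric]
  by (intro sum_mono mult_left_mono C comb_row[of N "%a. g a _", simplified] N g)
 then have 2: "sum2 N (%a b. C b * (2 * (g a b * g (a - 2 * b) b))) <=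
   sum2 N (%a b. C b * ((g a b)\<^sup>2 * ww N b a))" by (subst (1 2) sum.swap)
 have "sum2 N (%a b. g a b * (2 * C a * g a (b - 2 * a) + 2 * C b * g (a - 2 * b) b)) =
   sum2 N (%a b. C a * (2 * (g a b * g a (b - 2 * a)))) +
   sum2 N (%a b. C b * (2 * (g a b * g (a - 2 * b) b)))" by (simp add: algebra_simps sum.distrib)
 also have "... <= sum2 N (%a b. C a * ((g a b)\<^sup>2 * ww N a b)) +
   sum2 N (%a b. C b * ((g a b)\<^sup>2 * ww N b a))" by (rule add_mono[OF 1 2])
 also have "... = sum2 N (%a b. (g a b)\<^sup>2 * (C a * ww N a b + C b * ww N b a))" by (simp add: algebra_simps sum.distrib)
 also have "... <= sum2 N (%a b. 73/20 * (g a b)\<^sup>2)"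
 proof (intro sum_mono)
  fix a b assume ab: "a \<in> {0..<N}" "b \<in> {0..<N}"
  show "(g a b)\<^sup>2 * (C a * ww N a b + C b * ww N b a) <= 73/20 * (g a b)\<^sup>2"
  proof (cases "(a, b) = (0, 0)")
   case True
   then show ?thesis using g0 by simp
  next
   case False
   from mult_left_mono[OF key_bound[OF N ab False], of "(g a b)\<^sup>2"]
   show ?thesis by (simp add: C_def mult.commute)
  qed
 qed
 finally show ?thesis by (simp add: C_def sum_distrib_left)
qed

lemma dft2_add: "dft2 N (%x y. f x y + g x y) a b = dft2 N f a b + dft2 N g a b" by (simp add: dft2_def dft_def sum.distrib distrib_right)

lemma dft2_shear':
 assumes "0 < N" "!!x. per N (f x)"
 shows "dft2 N (%x y. f x (y + 2 * x + c)) a b = ee N (b * c) * dft2 N f (a - 2 * b) b"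
proof -
 have "dft2 N (%x y. f x (y + 2 * x + c)) a b = dft2 N (%u v. f v (u + 2 * v + c)) b a" by (rule dft2_swap)
 also have "... = ee N (b * c) * dft2 N (%u v. f v u) b (a - 2 * b)" by (rule dft2_shear[OF assms(1)]) (rule assms)
 also have "dft2 N (%u v. f v u) b (a - 2 * b) = dft2 N f (a - 2 * b) b" by (rule dft2_swap)
 finally show ?thesis .
qed

lemma dft2_per: assumes "0 < N" shows "per N (dft2 N f a)" "per N (%a. dft2 N f a b)"
proof -
 show "per N (dft2 N f a)" unfolding dft2_def by (rule dft_per[OF assms])
 have "per N (%a. dft N (%x. f x y) a)" for y by (rule dft_per[OF assms])
 then show "per N (%a. dft2 N f a b)" by (simp add: per_def dft2_def)
qed

text \<open>Four of the eight generators suffice here, the others being their inverses. By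
  Plancherel the form becomes a sum over frequencies; the factors \<open>1 + ee\<close> from the
  shifted copies supply the cosines, and mean zero removes the frequency zero, the only one at which
  \<open>key_bound\<close> would fail.\<close>

lemma torus_form:
 fixes f :: "int => int => real"
 assumes N: "0 < N" and f: "!!x. per N (f x)" "!!y. per N (%x. f x y)"
  and f0: "sum2 N (%x y. f x y) = 0"
 shows "sum2 N (%x y. f x y * (f (x + 2 * y) y + f (x + 2 * y + 1) y + f x (y + 2 * x) + f x (y + 2 * x + 1)))
  <= 73/20 * sum2 N (%x y. (f x y)\<^sup>2)"
proof -
 define fc where "fc x y = complex_of_real (f x y)" for x y
 define h where "h x y = f (x + 2 * y) y + f (x + 2 * y + 1) y + f x (y + 2 * x) + f x (y + 2 * x + 1)" for x y
 define F where "F = dft2 N fc"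
 define H where "H = dft2 N (%x y. complex_of_real (h x y))"
 define g where "g a b = cmod (F a b)" for a b
 have fp: "per N (fc x)" "per N (%x. fc x y)" for x y using f by (auto simp: fc_def per_def)
 have "(%x y. complex_of_real (h x y)) = (%x y. fc (x + 2 * y + 0) y + fc (x + 2 * y + 1) y + fc x (y + 2 * x + 0) + fc x (y + 2 * x + 1))"
  by (simp add: h_def fc_def)
 then have H: "H a b = (1 + ee N a) * F a (b - 2 * a) + (1 + ee N b) * F (a - 2 * b) b" for a b unfolding H_def F_def
  by (simp only: dft2_add dft2_shear[OF N fp(2)] dft2_shear'[OF N fp(1)]) (simp add: algebra_simps)
 have Hn: "cmod (H a b) <= 2 * \<bar>cos (pi * a / N)\<bar> * g a (b - 2 * a) +
   2 * \<bar>cos (pi * b / N)\<bar> * g (a - 2 * b) b" for a b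
  unfolding H g_def using norm_triangle_ineq[of "(1 + ee N a) * F a (b - 2 * a)" "(1 + ee N b) * F (a - 2 * b) b"]
  by (simp add: norm_mult norm_1_ee)
 have S: "complex_of_real (sum2 N (%x y. f x y * h x y)) * of_int (N * N) = sum2 N (%a b. F a b * cnj (H a b))"
  using dft2_plancherel[OF N, of fc "%x y. complex_of_real (h x y)"] by (simp add: F_def H_def fc_def mult.commute)
 have P: "sum2 N (%a b. (g a b)\<^sup>2) = sum2 N (%x y. (f x y)\<^sup>2) * of_int (N * N)"
 proof -
  have "complex_of_real (sum2 N (%a b. (g a b)\<^sup>2)) = sum2 N (%a b. F a b * cnj (F a b))"
   by (simp add: g_def flip: complex_norm_square)
  also have "... = of_int (N * N) * sum2 N (%x y. fc x y * cnj (fc x y))" unfolding F_def by (rule dft2_plancherel[OF N])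
  also have "... = complex_of_real (sum2 N (%x y. (f x y)\<^sup>2) * of_int (N * N))" by (simp add: fc_def power2_eq_square mult.commute)
  finally show ?thesis by (simp only: of_real_eq_iff)
 qed
 have g0: "g 0 0 = 0"
 proof -
  have "F 0 0 = complex_of_real (sum2 N (%y x. f x y))" by (simp add: F_def dft2_def dft_def fc_def)
  also have "sum2 N (%y x. f x y) = 0" using f0 by (subst sum.swap)
  finally show ?thesis by (simp add: g_def)
 qed
 have gp: "per N (g a)" "per N (%a. g a b)" for a b using dft2_per[OF N, of fc] by (auto simp: g_def F_def per_def)
 let ?Q = "sum2 N (%x y. f x y * h x y)"
 have NN: "0 < real_of_int (N * N)" using N by simp
 have "?Q * of_int (N * N) <= \<bar>?Q * of_int (N * N)\<bar>" by simp
 also have "... = cmod (complex_of_real ?Q * of_int (N * N))" by (simp only: norm_mult norm_of_real norm_of_int abs_mult of_int_abs)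
 also have "... <= sum2 N (%a b. g a b * (2 * \<bar>cos (pi * a / N)\<bar> * g a (b - 2 * a) +
   2 * \<bar>cos (pi * b / N)\<bar> * g (a - 2 * b) b))" unfolding S
 proof (intro order_trans[OF norm_sum] sum_mono)
  fix a b
  show "cmod (F a b * cnj (H a b)) <= g a b * (2 * \<bar>cos (pi * a / N)\<bar> * g a (b - 2 * a) +
   2 * \<bar>cos (pi * b / N)\<bar> * g (a - 2 * b) b)" using mult_left_mono[OF Hn, of "g a b" a b] by (simp add: norm_mult g_def)
 qed
 also have "... <= 73/20 * sum2 N (%a b. (g a b)\<^sup>2)" by (rule comb[OF N gp g0])
 also have "... = (73/20 * sum2 N (%x y. (f x y)\<^sup>2)) * of_int (N * N)" unfolding P by simp
 finally show ?thesis using NN unfolding h_def by (simp only: mult_le_cancel_right_pos)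
qed

text \<open>The Margulis graph on the \<open>n\<close> by \<open>n\<close> torus, a point being
  coded as \<open>x * n + y\<close>. Ports 0 to 3 are the shears by twice the other coordinate with
  shift 0 or 1, ports 4 to 7 their inverses; subtraction modulo \<open>n\<close> is written with
  complements to \<open>n\<close>.\<close>

definition mgg :: "nat => nat => nat => nat" where
 "mgg n p k = (let x = p div n; y = p mod n in
   if k = 0 then (x + 2 * y) mod n * n + y
   else if k = 1 then (x + 2 * y + 1) mod n * n + y
   else if k = 2 then x * n + (y + 2 * x) mod n
   else if k = 3 then x * n + (y + 2 * x + 1) mod n
   else if k = 4 then (x + 2 * (n - y)) mod n * n + y
   else if k = 5 then (x + 2 * (n - y) + (n - 1)) mod n * n + y
   else if k = 6 then x * n + (y + 2 * (n - x)) mod n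
   else x * n + (y + 2 * (n - x) + (n - 1)) mod n)"

definition opp :: "nat => nat" where "opp k = (k + 4) mod 8"

lemma opp_less: "opp k < 8" by (simp add: opp_def)

lemma less_8: "k < 8 ==> k = 0 | k = 1 | k = 2 | k = 3 | k = 4 | k = 5 | k = 6 | (k::nat) = 7" by auto

lemma opp_opp: "k < 8 ==> opp (opp k) = k" by (drule less_8) (auto simp: opp_def)

lemma pair_less: "a < (x :: nat) ==> b < y ==> a * y + b < x * y"
proof -
 assume "a < x" "b < y"
 then have "a * y + b < Suc a * y" by simp
 also have "... <= x * y" using \<open>a < x\<close> by (intro mult_le_mono1) simp
 finally show ?thesis .
qed

lemma mgg_less: "p < n * n ==> mgg n p k < n * n"
proof -
 assume p: "p < n * n"
 then have "0 < n" by (cases n) auto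
 moreover from this p have "p div n < n" "p mod n < n" by (auto simp: less_mult_imp_div_less)
 ultimately show ?thesis by (simp add: mgg_def Let_def pair_less)
qed

lemma modeq: "a = u + c * n ==> u < n ==> a mod n = (u :: nat)" by simp

lemma mgg_mgg: assumes p: "p < n * n" and k: "k < 8" shows "mgg n (mgg n p k) (opp k) = p"
proof -
 have n: "0 < n" using p by (cases n) auto
 define x y where "x = p div n" and "y = p mod n"
 have x: "x < n" and y: "y < n" and pe: "p = x * n + y" using p n by (auto simp: x_def y_def less_mult_imp_div_less)
 have d: "(u * n + v) div n = u" "(u * n + v) mod n = v" if "v < n" for u v using that n by auto
 have m1: "((u + 2 * v) mod n + 2 * (n - v)) mod n = u" if "u < n" "v < n" for u v
 proof -
  have "u + 2 * v + 2 * (n - v) = u + 2 * n" using that by simp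
  from modeq[OF this that(1)] have "(u + 2 * v + 2 * (n - v)) mod n = u" .
  then show ?thesis by (metis mod_add_left_eq)
 qed
 have m2: "((u + 2 * v + 1) mod n + 2 * (n - v) + (n - 1)) mod n = u" if "u < n" "v < n" for u v
 proof -
  have "u + 2 * v + 1 + (2 * (n - v) + (n - 1)) = u + 3 * n" using that n by simp
  from modeq[OF this that(1)] have "(u + 2 * v + 1 + (2 * (n - v) + (n - 1))) mod n = u" .
  then show ?thesis by (metis add.assoc mod_add_left_eq)
 qed
 have m3: "((u + 2 * (n - v)) mod n + 2 * v) mod n = u" if "u < n" "v < n" for u v
 proof -
  have "u + 2 * (n - v) + 2 * v = u + 2 * n" using that by simp
  from modeq[OF this that(1)] have "(u + 2 * (n - v) + 2 * v) mod n = u" .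
  then show ?thesis by (metis mod_add_left_eq)
 qed
 have m4: "((u + 2 * (n - v) + (n - 1)) mod n + 2 * v + 1) mod n = u" if "u < n" "v < n" for u v
 proof -
  have "u + 2 * (n - v) + (n - 1) + (2 * v + 1) = u + 3 * n" using that n by simp
  from modeq[OF this that(1)] have "(u + 2 * (n - v) + (n - 1) + (2 * v + 1)) mod n = u" .
  then show ?thesis by (metis add.assoc mod_add_left_eq)
 qed
 have m2': "(Suc (u + 2 * v) mod n + 2 * (n - v) + n - Suc 0) mod n = u" if "u < n" "v < n" for u v using m2[OF that] n by simp
 have m4': "Suc ((u + 2 * (n - v) + n - Suc 0) mod n + 2 * v) mod n = u" if "u < n" "v < n" for u v using m4[OF that] n by simp
 note m = m1 m2 m3 m4 m2' m4'
 have md: "z mod n < n" for z using n by simp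
 from less_8[OF k] show ?thesis unfolding pe using x y md
  by (elim disjE) (simp_all only: mgg_def Let_def opp_def d m, simp_all add: m[simplified] d[simplified] mgg_def)
qed

lemma sum_rect: "(\<Sum>p<a * b. f p) = (\<Sum>x<a. \<Sum>y<b. f (x * b + y :: nat))"
proof -
 have "sum f {x * b..<x * b + b} = (\<Sum>y<b. f (x * b + y))" for x
  using sum.shift_bounds_nat_ivl[of f 0 "x * b" b] by (simp add: lessThan_atLeast0 add.commute)
 then show ?thesis using sum.nat_group[of f b a] by simp
qed

lemma sum_int_lessThan: "(\<Sum>x\<in>{0..<int n}. f x) = (\<Sum>x<n. f (int x))" by (cases "n = 0") (simp_all add: sum_int_nat)

definition dirichlet :: "nat => nat => (nat => nat => nat) => (nat => real) => real" where
 "dirichlet m d nb f = (\<Sum>p<m. \<Sum>k<d. (f p - f (nb p k))\<^sup>2)"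

lemma mgg_form:
 fixes f :: "nat => real"
 assumes n: "0 < n" and f0: "(\<Sum>p<n * n. f p) = 0"
 shows "(\<Sum>p<n * n. \<Sum>k<4. f p * f (mgg n p k)) <= 73/20 * (\<Sum>p<n * n. (f p)\<^sup>2)"
proof -
 define N where "N = int n"
 define F where "F x y = f (nat (x mod N) * n + nat (y mod N))" for x y
 have N: "0 < N" using n by (simp add: N_def)
 have F: "F (int x) (int y) = f (x mod n * n + y mod n)" for x y by (simp add: F_def N_def zmod_int[symmetric])
 have F': "F (int x) (int y) = f (x * n + y)" if "x < n" "y < n" for x y using that by (simp add: F)
 have per: "per N (F x)" "per N (%x. F x y)" for x y by (auto simp: per_def F_def)
 have "(\<Sum>x\<in>{0..<N}. \<Sum>y\<in>{0..<N}. F x y) = 0" using f0 by (simp add: N_def sum_int_lessThan sum_rect F')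
 from torus_form[OF N per this]
 have "(\<Sum>x<n. \<Sum>y<n. F (int x) (int y) * (F (int x + 2 * int y) (int y) + F (int x + 2 * int y + 1) (int y) +
   F (int x) (int y + 2 * int x) + F (int x) (int y + 2 * int x + 1))) <= 73/20 * (\<Sum>x<n. \<Sum>y<n. (F (int x) (int y))\<^sup>2)"
  by (simp only: N_def sum_int_lessThan)
 also have "(\<Sum>x<n. \<Sum>y<n. (F (int x) (int y))\<^sup>2) = (\<Sum>p<n * n. (f p)\<^sup>2)" by (simp add: sum_rect F')
 also have "(\<Sum>x<n. \<Sum>y<n. F (int x) (int y) * (F (int x + 2 * int y) (int y) + F (int x + 2 * int y + 1) (int y) +
   F (int x) (int y + 2 * int x) + F (int x) (int y + 2 * int x + 1))) = (\<Sum>p<n * n. \<Sum>k<4. f p * f (mgg n p k))" unfolding sum_rect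
 proof (intro sum.cong refl)
  fix x y assume "x \<in> {..<n}" "y \<in> {..<n}"
  then have xy: "x < n" "y < n" by auto
  have d: "(x * n + y) div n = x" "(x * n + y) mod n = y" using xy by auto
  have s4: "(\<Sum>k<4. h k) = h 0 + h 1 + h 2 + h (3::nat)" for h :: "nat => real" by (simp add: eval_nat_numeral)
  have 1: "F (int x + 2 * int y) (int y) = f ((x + 2 * y) mod n * n + y)" using F[of "x + 2 * y" y] xy by simp
  have 2: "F (int x + 2 * int y + 1) (int y) = f ((x + 2 * y + 1) mod n * n + y)" using F[of "x + 2 * y + 1" y] xy by (simp add: ac_simps)
  have 3: "F (int x) (int y + 2 * int x) = f (x * n + (y + 2 * x) mod n)" using F[of x "y + 2 * x"] xy by simp
  have 4: "F (int x) (int y + 2 * int x + 1) = f (x * n + (y + 2 * x + 1) mod n)" using F[of x "y + 2 * x + 1"] xy by (simp add: ac_simps)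
  show "F (int x) (int y) * (F (int x + 2 * int y) (int y) + F (int x + 2 * int y + 1) (int y) +
   F (int x) (int y + 2 * int x) + F (int x) (int y + 2 * int x + 1)) =
   (\<Sum>k<4. f (x * n + y) * f (mgg n (x * n + y) k))"
  proof -
   have m: "mgg n (x * n + y) 0 = (x + 2 * y) mod n * n + y" "mgg n (x * n + y) 1 = (x + 2 * y + 1) mod n * n + y"
    "mgg n (x * n + y) 2 = x * n + (y + 2 * x) mod n" "mgg n (x * n + y) 3 = x * n + (y + 2 * x + 1) mod n"
    unfolding mgg_def Let_def d by simp_all
   show ?thesis unfolding s4 m 1 2 3 4 F'[OF xy] by (simp only: distrib_left)
  qed
 qed
 finally show ?thesis .
qed

lemma sum_mgg: assumes "k < 8"
 shows "(\<Sum>p<n * n. h (mgg n p k)) = (\<Sum>p<n * n. h p)"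
proof (rule sum.reindex_bij_witness[of _ "%p. mgg n p (opp k)" "%p. mgg n p k"])
 show "mgg n (mgg n p (opp k)) k = p" if "p \<in> {..<n * n}" for p using mgg_mgg[of p n "opp k"] that opp_less opp_opp[OF assms] by simp
qed (use mgg_mgg mgg_less assms in auto)

text \<open>With \<open>S\<close> for the sum of squares, each port contributes
  \<open>2 S - 2 X\<close>, and a port and its inverse have the same correlation \<open>X\<close>.
  The constant is \<open>16 - 4 * 73/20 = 7/5\<close>.\<close>

lemma mgg_gap0:
 fixes f :: "nat => real"
 assumes n: "0 < n" and f0: "(\<Sum>p<n * n. f p) = 0"
 shows "7/5 * (\<Sum>p<n * n. (f p)\<^sup>2) <= dirichlet (n * n) 8 (mgg n) f"
proof -
 let ?S = "\<Sum>p<n * n. (f p)\<^sup>2"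
 let ?X = "%k. \<Sum>p<n * n. f p * f (mgg n p k)"
 have "dirichlet (n * n) 8 (mgg n) f = (\<Sum>k<8. \<Sum>p<n * n. (f p - f (mgg n p k))\<^sup>2)" unfolding dirichlet_def by (rule sum.swap)
 also have "... = (\<Sum>k<8. 2 * ?S - 2 * ?X k)"
 proof (intro sum.cong refl)
  fix k :: nat assume "k \<in> {..<8}"
  then have "(\<Sum>p<n * n. (f (mgg n p k))\<^sup>2) = ?S" by (intro sum_mgg) simp
  moreover have "(\<Sum>p<n * n. (f p - f (mgg n p k))\<^sup>2) = ?S + (\<Sum>p<n * n. (f (mgg n p k))\<^sup>2) - 2 * ?X k"
   by (simp add: power2_diff sum_subtractf sum.distrib sum_distrib_left mult.assoc)
  ultimately show "(\<Sum>p<n * n. (f p - f (mgg n p k))\<^sup>2) = 2 * ?S - 2 * ?X k" by simp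
 qed
 also have "... = 16 * ?S - 2 * (\<Sum>k<8. ?X k)" by (simp add: sum_subtractf sum_distrib_left)
 also have "(\<Sum>k<8. ?X k) = (\<Sum>k<4. ?X k) + (\<Sum>k<4. ?X (k + 4))" by (simp add: eval_nat_numeral)
 also have "(\<Sum>k<4. ?X (k + 4)) = (\<Sum>k<4. ?X k)"
 proof (rule sum.cong[OF refl])
  fix k :: nat assume k: "k \<in> {..<4}"
  then have oq: "opp (k + 4) = k" "k + 4 < 8" by (auto simp: opp_def)
  have "?X k = (\<Sum>p<n * n. f (mgg n p (k + 4)) * f (mgg n (mgg n p (k + 4)) k))" by (rule sum_mgg[symmetric]) (use k in simp)
  also have "... = ?X (k + 4)"
  proof (intro sum.cong refl)
   fix p assume "p \<in> {..<n * n}"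
   then have "mgg n (mgg n p (k + 4)) k = p" using mgg_mgg[of p n "k + 4"] oq by simp
   then show "f (mgg n p (k + 4)) * f (mgg n (mgg n p (k + 4)) k) = f p * f (mgg n p (k + 4))" by simp
  qed
  finally show "?X (k + 4) = ?X k" ..
 qed
 also have "(\<Sum>k<4. ?X k) = (\<Sum>p<n * n. \<Sum>k<4. f p * f (mgg n p k))" by (rule sum.swap)
 finally have D: "dirichlet (n * n) 8 (mgg n) f = 16 * ?S - 2 * ((\<Sum>p<n * n. \<Sum>k<4. f p * f (mgg n p k)) + (\<Sum>p<n * n. \<Sum>k<4. f p * f (mgg n p k)))" .
 have "7/5 * S <= 16 * S - 2 * (T + T)" if "T <= 73/20 * S" for S T :: real using that by (simp add: field_simps)
 from this[OF mgg_form[OF n f0]] show ?thesis unfolding D .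
qed

lemma mgg_gap: assumes n: "0 < n"
 shows "EX a. 7/5 * (\<Sum>p<n * n. (f p - a)\<^sup>2) <= dirichlet (n * n) 8 (mgg n) f"
proof -
 define a where "a = (\<Sum>p<n * n. f p) / real (n * n)"
 have "(\<Sum>p<n * n. f p - a) = 0" using n by (simp add: sum_subtractf a_def)
 from mgg_gap0[OF n this] show ?thesis by (auto simp: dirichlet_def)
qed

section \<open>Expanders on any number of vertices\<close>

definition side :: "nat => nat" where "side m = (LEAST n. m <= n * n)"

lemma side: "m <= side m * side m" "1 <= m ==> side m * side m <= 4 * m" "side m <= m"
proof -
 have ex: "m <= m * m" by (cases m) auto
 show le: "m <= side m * side m" unfolding side_def by (rule LeastI[of "%n. m <= n * n", OF ex])
 show "side m <= m" unfolding side_def by (rule Least_le[of "%n. m <= n * n", OF ex])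
 show "side m * side m <= 4 * m" if m: "1 <= m"
 proof -
  obtain k where k: "side m = Suc k" using le m by (cases "side m") auto
  have "~ m <= k * k" using not_less_Least[of k "%n. m <= n * n"] k by (simp add: side_def)
  then have "k * k + 1 <= m" by simp
  moreover have "2 * k <= 3 * (k * k) + 3" by (cases k) auto
  ultimately show ?thesis by (simp add: k)
 qed
qed

text \<open>An expander with vertex set \<open>{..<m}\<close>: the quotient modulo \<open>m\<close> of the Margulis graph on
 \<open>side m\<^sup>2\<close> points. Classes have at most four points, giving 32 ports; unused ports are loops.\<close>

definition xnb :: "nat => nat => nat => nat" where
 "xnb m i k = (if i + k div 8 * m < side m * side m then mgg (side m) (i + k div 8 * m) (k mod 8) mod m else i)"

definition xpt :: "nat => nat => nat => nat" where
 "xpt m i k = (if i + k div 8 * m < side m * side m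
   then mgg (side m) (i + k div 8 * m) (k mod 8) div m * 8 + opp (k mod 8) else k)"

lemma xnb_less: assumes "i < m" shows "xnb m i k < m"
proof -
 have m: "q mod m < m" for q by (rule mod_less_divisor[OF le_less_trans[OF le0 assms]])
 show ?thesis
 proof (cases "i + k div 8 * m < side m * side m")
  case True
  show ?thesis unfolding xnb_def if_P[OF True] by (rule m)
 next
  case False
  show ?thesis unfolding xnb_def if_not_P[OF False] by (rule assms)
 qed
qed

lemma xpt_less: assumes "i < m" "k < 32" shows "xpt m i k < 32"
proof (cases "i + k div 8 * m < side m * side m")
 case True
 let ?p = "mgg (side m) (i + k div 8 * m) (k mod 8)"
 have "1 <= m" using assms(1) by simp
 then have "?p < 4 * m" using less_le_trans[OF mgg_less[OF True] side(2)] by simp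
 then have "?p div m < 4" by (simp add: less_mult_imp_div_less)
 then show ?thesis using opp_less[of "k mod 8"] True by (simp add: xpt_def)
qed (use assms in "simp add: xpt_def")

lemma x_involution: assumes "i < m" "k < 32"
 shows "xnb m (xnb m i k) (xpt m i k) = i" "xpt m (xnb m i k) (xpt m i k) = k"
proof -
 have "xnb m (xnb m i k) (xpt m i k) = i & xpt m (xnb m i k) (xpt m i k) = k"
 proof (cases "i + k div 8 * m < side m * side m")
  case True
  let ?q = "i + k div 8 * m"
  let ?p = "mgg (side m) ?q (k mod 8)"
  have p: "?p < side m * side m" by (rule mgg_less[OF True])
  have x: "xnb m i k = ?p mod m" "xpt m i k = ?p div m * 8 + opp (k mod 8)" using True by (auto simp: xnb_def xpt_def)
  have o8: "(?p div m * 8 + opp (k mod 8)) div 8 = ?p div m" "(?p div m * 8 + opp (k mod 8)) mod 8 = opp (k mod 8)"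
   using opp_less[of "k mod 8"] by auto
  have e: "?p mod m + ?p div m * m = ?p" by simp
  have ret: "mgg (side m) ?p (opp (k mod 8)) = ?q" by (rule mgg_mgg[OF True]) simp
  have "?q mod m = i" "?q div m = k div 8" using assms by auto
  then show ?thesis unfolding x unfolding xnb_def xpt_def o8 e using p by (simp add: ret opp_opp)
 qed (auto simp: xnb_def xpt_def)
 then show "xnb m (xnb m i k) (xpt m i k) = i" "xpt m (xnb m i k) (xpt m i k) = k" by auto
qed

text \<open>A function on the quotient is pulled back to the torus, where it has the same Dirichlet
  form. The constant \<open>a\<close> is the mean over the torus, in which classes of different
  sizes have different weights; therefore it is only asserted to exist.\<close>

lemma expander: assumes m: "1 <= m"
 shows "EX a. 7/5 * (\<Sum>i<m. (f i - a)\<^sup>2) <= dirichlet m 32 (xnb m) f"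
proof -
 let ?n = "side m" let ?g = "%p. f (p mod m)"
 have n: "0 < ?n" using side(1)[of m] m by (cases ?n) auto
 let ?t = "%p. \<Sum>k<8. (?g p - ?g (mgg ?n p k))\<^sup>2"
 have "dirichlet m 32 (xnb m) f = (\<Sum>i<m. \<Sum>c<4. \<Sum>k<8. (f i - f (xnb m i (c * 8 + k)))\<^sup>2)"
  unfolding dirichlet_def by (simp add: sum_rect[of _ 4 8, simplified])
 also have "... = (\<Sum>i<m. \<Sum>c<4. if c * m + i < ?n * ?n then ?t (c * m + i) else 0)"
 proof (intro sum.cong refl)
  fix i c :: nat assume "i \<in> {..<m}"
  then show "(\<Sum>k<8. (f i - f (xnb m i (c * 8 + k)))\<^sup>2) = (if c * m + i < ?n * ?n then ?t (c * m + i) else 0)"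
   by (auto simp: xnb_def add.commute intro!: sum.cong)
 qed
 also have "... = (\<Sum>c<4. \<Sum>i<m. if c * m + i < ?n * ?n then ?t (c * m + i) else 0)" by (rule sum.swap)
 also have "... = (\<Sum>p<4 * m. if p < ?n * ?n then ?t p else 0)" by (rule sum_rect[symmetric])
 also have "... = (\<Sum>p<?n * ?n. ?t p)" by (rule sum.mono_neutral_cong_right) (use side(2)[OF m] in auto)
 also have "... = dirichlet (?n * ?n) 8 (mgg ?n) ?g" by (simp add: dirichlet_def)
 finally have D: "dirichlet m 32 (xnb m) f = dirichlet (?n * ?n) 8 (mgg ?n) ?g" .
 obtain a where a: "7/5 * (\<Sum>p<?n * ?n. (?g p - a)\<^sup>2) <= dirichlet (?n * ?n) 8 (mgg ?n) ?g"
  using mgg_gap[OF n, of ?g] by (rule exE) (rule that)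
 have "(\<Sum>i<m. (f i - a)\<^sup>2) = (\<Sum>i<m. (?g i - a)\<^sup>2)" by simp
 also have "... <= (\<Sum>p<?n * ?n. (?g p - a)\<^sup>2)" by (rule sum_mono2) (use side(1)[of m] in auto)
 finally show ?thesis using a D by (intro exI[of _ a]) linarith
qed

text \<open>Applied to an indicator function: whatever \<open>a\<close> is, the deviation is at
  least \<open>card S * ((1 - a)^2 + a^2)\<close>, since the complement of \<open>S\<close> is no
  smaller than \<open>S\<close>, and this is at least half of \<open>card S\<close>.\<close>

lemma expander_cut:
 assumes S: "S \<subseteq> {..<m}" "2 * card S <= m"
 shows "7/10 * real (card S) <= (\<Sum>i<m. real (card {k. k < 32 & (i \<in> S) ~= (xnb m i k \<in> S)}))"
proof (cases "m = 0")
 case False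
 let ?f = "%i. if i \<in> S then 1 else 0 :: real"
 have fin: "finite S" using S finite_subset by blast
 obtain a where a: "7/5 * (\<Sum>i<m. (?f i - a)\<^sup>2) <= dirichlet m 32 (xnb m) ?f"
  using expander[of m ?f] False by (auto simp: Suc_le_eq)
 have "(\<Sum>i<m. (?f i - a)\<^sup>2) = (\<Sum>i\<in>S. (?f i - a)\<^sup>2) + (\<Sum>i\<in>{..<m} - S. (?f i - a)\<^sup>2)"
  using S by (simp add: sum.subset_diff)
 also have "... = real (card S) * (1 - a)\<^sup>2 + real (m - card S) * a\<^sup>2" using S fin by (simp add: card_Diff_subset)
 finally have 1: "(\<Sum>i<m. (?f i - a)\<^sup>2) = real (card S) * (1 - a)\<^sup>2 + real (m - card S) * a\<^sup>2" .
 have "real (card S) * a\<^sup>2 <= real (m - card S) * a\<^sup>2" using S by (intro mult_right_mono) auto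
 moreover have "real (card S) * (1/2) <= real (card S) * ((1 - a)\<^sup>2 + a\<^sup>2)"
 proof (rule mult_left_mono)
  have "0 <= (2 * a - 1)\<^sup>2" by simp
  then show "1/2 <= (1 - a)\<^sup>2 + a\<^sup>2" by (simp add: power2_eq_square algebra_simps)
 qed simp
 ultimately have 2: "real (card S) / 2 <= (\<Sum>i<m. (?f i - a)\<^sup>2)" unfolding 1 by (simp add: distrib_left)
 have "dirichlet m 32 (xnb m) ?f = (\<Sum>i<m. real (card {k. k < 32 & (i \<in> S) ~= (xnb m i k \<in> S)}))" unfolding dirichlet_def
 proof (intro sum.cong refl)
  fix i
  have "(\<Sum>k<32. (?f i - ?f (xnb m i k))\<^sup>2) = (\<Sum>k<32. if (i \<in> S) ~= (xnb m i k \<in> S) then 1 else 0)"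
   by (intro sum.cong refl) auto
  also have "... = (\<Sum>k\<in>{k \<in> {..<32}. (i \<in> S) ~= (xnb m i k \<in> S)}. 1)" by (rule sum.inter_filter[symmetric]) simp
  finally show "(\<Sum>k<32. (?f i - ?f (xnb m i k))\<^sup>2) = real (card {k. k < 32 & (i \<in> S) ~= (xnb m i k \<in> S)})" by simp
 qed
 then show ?thesis using a 2 by linarith
qed (use S in auto)

section \<open>Powering of constraint graphs\<close>

lemma sum_split_at: "i < n ==> (\<Sum>j<n. f j) = (\<Sum>j<i. f j) + f i + (\<Sum>j\<in>{Suc i..<n}. f j :: real)"
proof -
 assume i: "i < n"
 have "{..<n} = {..<i} \<union> ({i} \<union> {Suc i..<n})" using i by auto
 then have "(\<Sum>j<n. f j) = (\<Sum>j\<in>{..<i} \<union> ({i} \<union> {Suc i..<n}). f j)" by (rule arg_cong)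
 also have "... = (\<Sum>j<i. f j) + (\<Sum>j\<in>{i} \<union> {Suc i..<n}. f j)" by (rule sum.union_disjoint) auto
 also have "(\<Sum>j\<in>{i} \<union> {Suc i..<n}. f j) = (\<Sum>j\<in>{i}. f j) + (\<Sum>j\<in>{Suc i..<n}. f j)"
  by (rule sum.union_disjoint) auto
 finally show ?thesis by simp
qed

section \<open>Walks and rotation maps\<close>

fun path_end :: "(nat => nat => nat) => nat => nat list => nat" where
 "path_end nb v [] = v" | "path_end nb v (i # ls) = path_end nb (nb v i) ls"

fun path_rev :: "(nat => nat => nat) => (nat => nat => nat) => nat => nat list => nat list" where
 "path_rev nb pt v [] = []" | "path_rev nb pt v (i # ls) = path_rev nb pt (nb v i) ls @ [pt v i]"

locale rgraph =
 fixes m d :: nat and nb pt :: "nat => nat => nat"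
 assumes d_pos: "0 < d"
  and nb_less: "!!v i. v < m ==> i < d ==> nb v i < m"
  and pt_less: "!!v i. v < m ==> i < d ==> pt v i < d"
  and nb_nb: "!!v i. v < m ==> i < d ==> nb (nb v i) (pt v i) = v"
  and pt_pt: "!!v i. v < m ==> i < d ==> pt (nb v i) (pt v i) = i"
begin

definition L :: "nat => nat list set" where
 "L n = {ls. set ls \<subseteq> {..<d} & length ls = n}"

lemma finite_L [simp]: "finite (L n)" unfolding L_def by (rule finite_lists_length_eq) simp

lemma card_L: "card (L n) = d ^ n" unfolding L_def by (simp add: card_lists_length_eq)

lemma L_0 [simp]: "L 0 = {[]}" by (auto simp: L_def)

lemma L_length: "p \<in> L n ==> length p = n" and L_set: "p \<in> L n ==> set p \<subseteq> {..<d}" by (auto simp: L_def)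

lemma sumL_Suc: "(\<Sum>ls\<in>L (Suc n). f ls) = (\<Sum>i<d. \<Sum>ls\<in>L n. f (i # ls))"
proof -
 have "(\<Sum>ls\<in>L (Suc n). f ls) = (\<Sum>(i, ls)\<in>{..<d} \<times> L n. f (i # ls))"
  by (rule sum.reindex_bij_witness[of _ "%(i, ls). i # ls" "%ls. (hd ls, tl ls)"])
   (auto simp: L_def length_Suc_conv)
 then show ?thesis by (simp add: sum.cartesian_product)
qed

lemma sumL_add: "(\<Sum>ls\<in>L (a + b). f ls) = (\<Sum>p\<in>L a. \<Sum>q\<in>L b. f (p @ q))"
 by (induction a arbitrary: f) (simp_all add: sumL_Suc)

lemma sumL_1: "(\<Sum>ls\<in>L (Suc 0). f ls) = (\<Sum>i<d. f [i])" by (simp add: sumL_Suc)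

abbreviation "walk == path_end nb"
abbreviation "rl == path_rev nb pt"

lemma walk_append: "walk v (p @ q) = walk (walk v p) q" by (induction p arbitrary: v) auto

lemma length_rl [simp]: "length (rl v p) = length p" by (induction p arbitrary: v) auto

lemma rl_append: "rl v (p @ q) = rl (walk v p) q @ rl v p" by (induction p arbitrary: v) auto

lemma walk_less: "v < m ==> set p \<subseteq> {..<d} ==> walk v p < m" by (induction p arbitrary: v) (auto simp: nb_less)

lemma rl_set: "v < m ==> set p \<subseteq> {..<d} ==> set (rl v p) \<subseteq> {..<d}"
 by (induction p arbitrary: v) (auto simp: nb_less pt_less)

lemma walk_rl: "v < m ==> set p \<subseteq> {..<d} ==> walk (walk v p) (rl v p) = v & rl (walk v p) (rl v p) = p"
proof (induction p arbitrary: v)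
 case (Cons i p)
 have "nb v i < m" "set p \<subseteq> {..<d}" "i < d" using Cons.prems nb_less by auto
 then show ?case using Cons.IH[of "nb v i"] Cons.prems(1) by (simp add: walk_append rl_append nb_nb pt_pt)
qed simp

lemma sum_rot: "(\<Sum>v<m. \<Sum>i<d. f (nb v i) (pt v i)) = (\<Sum>v<m. \<Sum>i<d. f v i)"
proof -
 have "(\<Sum>(v, i)\<in>{..<m} \<times> {..<d}. f (nb v i) (pt v i)) = (\<Sum>(v, i)\<in>{..<m} \<times> {..<d}. f v i)"
  by (rule sum.reindex_bij_witness[of _ "%(v, i). (nb v i, pt v i)" "%(v, i). (nb v i, pt v i)"])
   (auto simp: nb_less pt_less nb_nb pt_pt)
 then show ?thesis by (simp add: sum.cartesian_product)
qed

text \<open>Reversal is a bijection on walks, so the end of a uniform walk is uniform and the way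
  back is again a uniform word of labels.\<close>

lemma sum_rl: "(\<Sum>v<m. \<Sum>p\<in>L n. f (walk v p) (rl v p)) = (\<Sum>u<m. \<Sum>r\<in>L n. f u r)"
proof (induction n arbitrary: f)
 case (Suc n)
 have "(\<Sum>v<m. \<Sum>p\<in>L (Suc n). f (walk v p) (rl v p)) =
   (\<Sum>v<m. \<Sum>i<d. (%w k. \<Sum>p\<in>L n. f (walk w p) (rl w p @ [k])) (nb v i) (pt v i))" by (simp add: sumL_Suc)
 also have "... = (\<Sum>v<m. \<Sum>k<d. \<Sum>p\<in>L n. f (walk v p) (rl v p @ [k]))" by (rule sum_rot)
 also have "... = (\<Sum>k<d. \<Sum>v<m. \<Sum>p\<in>L n. f (walk v p) (rl v p @ [k]))" by (rule sum.swap)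
 also have "... = (\<Sum>k<d. \<Sum>u<m. \<Sum>r\<in>L n. f u (r @ [k]))" by (rule sum.cong[OF refl]) (rule Suc)
 also have "... = (\<Sum>u<m. \<Sum>k<d. \<Sum>r\<in>L n. f u (r @ [k]))" by (rule sum.swap)
 also have "... = (\<Sum>u<m. \<Sum>r\<in>L n. \<Sum>k<d. f u (r @ [k]))" by (rule sum.cong[OF refl]) (rule sum.swap)
 also have "... = (\<Sum>u<m. \<Sum>r\<in>L (Suc n). f u r)" using sumL_add[of "f _" n 1] by (simp add: sumL_1)
 finally show ?case .
qed simp

definition Av :: "(nat => real) => nat => real" where
 "Av f v = (\<Sum>i<d. f (nb v i)) / real d"

lemma sum_walk: "(\<Sum>q\<in>L t. f (walk w q)) = real d ^ t * (Av ^^ t) f w"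
proof (induction t arbitrary: f w)
 case (Suc t)
 have "(\<Sum>q\<in>L (Suc t). f (walk w q)) = (\<Sum>q\<in>L t. \<Sum>i<d. f (walk w (q @ [i])))"
  using sumL_add[of "%q. f (walk w q)" t 1] by (simp add: sumL_1)
 also have "... = (\<Sum>q\<in>L t. real d * Av f (walk w q))" using d_pos by (simp add: walk_append Av_def)
 also have "... = real d ^ Suc t * (Av ^^ Suc t) f w" by (simp add: sum_distrib_left[symmetric] Suc funpow_swap1)
 finally show ?case .
qed simp

lemma sum_Av: "(\<Sum>v<m. Av f v) = (\<Sum>v<m. f v)"
proof -
 have "(\<Sum>v<m. \<Sum>i<d. f (nb v i)) = (\<Sum>v<m. \<Sum>i<d. f v)" by (rule sum_rot[of "%v i. f v"])
 then show ?thesis using d_pos by (simp add: Av_def sum_divide_distrib[symmetric] sum_distrib_left[symmetric])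
qed

lemma Av_add_const: "(Av ^^ t) (%v. f v + c) = (%v. (Av ^^ t) f v + c)"
proof (induction t arbitrary: f)
 case (Suc t)
 have "Av (%v. f v + c) = (%v. Av f v + c)" for f using d_pos by (simp add: Av_def fun_eq_iff sum.distrib add_divide_distrib)
 then show ?case by (simp only: funpow.simps o_apply Suc)
qed simp

end

text \<open>\<open>lam\<close> bounds the norm of the averaging operator on functions of mean zero,
  so it excludes eigenvalues near -1 as well; this is why loops will be added to the constraint
  graph.\<close>

locale egraph = rgraph +
 fixes lam :: real
 assumes lam: "0 <= lam" "lam < 1"
  and gap: "!!f. (\<Sum>v<m. f v) = 0 ==> (\<Sum>v<m. (Av f v)\<^sup>2) <= lam\<^sup>2 * (\<Sum>v<m. (f v)\<^sup>2)"
begin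

lemma gap_pow: "(\<Sum>v<m. f v) = 0 ==> (\<Sum>v<m. ((Av ^^ t) f v)\<^sup>2) <= (lam ^ t)\<^sup>2 * (\<Sum>v<m. (f v)\<^sup>2) & (\<Sum>v<m. (Av ^^ t) f v) = 0"
proof (induction t)
 case (Suc t)
 then have z: "(\<Sum>v<m. (Av ^^ t) f v) = 0" by simp
 have "(\<Sum>v<m. (Av ((Av ^^ t) f) v)\<^sup>2) <= lam\<^sup>2 * (\<Sum>v<m. ((Av ^^ t) f v)\<^sup>2)" by (rule gap[OF z])
 also have "... <= lam\<^sup>2 * ((lam ^ t)\<^sup>2 * (\<Sum>v<m. (f v)\<^sup>2))" using Suc by (intro mult_left_mono) auto
 finally show ?case using z sum_Av[of "(Av ^^ t) f"] by (simp add: power_mult_distrib mult_ac)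
qed simp

text \<open>Two steps of a random walk at distance \<open>t + 1\<close> are almost independent.\<close>

lemma mixing:
 assumes f: "!!v. v < m ==> 0 <= f v & f v <= 1" and g: "!!v. v < m ==> 0 <= g v & g v <= 1"
  and sf: "(\<Sum>v<m. f v) = real m * mu" and sg: "(\<Sum>v<m. g v) = real m * mu" and m: "0 < m"
 shows "(\<Sum>v<m. g v * (Av ^^ t) f v) <= real m * mu\<^sup>2 + lam ^ t * (real m * mu)"
proof -
 \<comment> \<open>Subtracting the mean splits off the term that exact independence would give; the
   rest is damped by the spectral gap.\<close>
 define f0 where "f0 v = f v - mu" for v
 have mu: "0 <= mu" using sf sum_nonneg[of "{..<m}" f] f m by (simp add: zero_le_mult_iff)
 have z: "(\<Sum>v<m. f0 v) = 0" by (simp add: f0_def sum_subtractf sf)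
 have "f = (%v. f0 v + mu)" by (simp add: f0_def)
 then have "(Av ^^ t) f = (%v. (Av ^^ t) f0 v + mu)" using Av_add_const[of t f0 mu] by simp
 then have "(\<Sum>v<m. g v * (Av ^^ t) f v) = (\<Sum>v<m. g v * (Av ^^ t) f0 v) + real m * mu\<^sup>2"
  by (simp add: distrib_left sum.distrib sg power2_eq_square flip: sum_distrib_right)
 moreover have "(\<Sum>v<m. g v * (Av ^^ t) f0 v) <= lam ^ t * (real m * mu)"
 proof -
  have sq: "(\<Sum>v<m. (h v)\<^sup>2) <= (\<Sum>v<m. h v)" if "!!v. v < m ==> 0 <= h v & h v <= (1 :: real)" for h
   using that by (intro sum_mono) (simp add: power2_eq_square mult_left_le)
  have "(\<Sum>v<m. (f0 v)\<^sup>2) = (\<Sum>v<m. (f v)\<^sup>2) - real m * mu\<^sup>2"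
  proof -
   have "(\<Sum>v<m. (f0 v)\<^sup>2) = (\<Sum>v<m. (f v)\<^sup>2 - 2 * mu * f v + mu\<^sup>2)"
    by (simp add: f0_def power2_diff algebra_simps)
   also have "... = (\<Sum>v<m. (f v)\<^sup>2) - 2 * mu * (\<Sum>v<m. f v) + real m * mu\<^sup>2"
    by (simp add: sum.distrib sum_subtractf sum_distrib_left)
   finally show ?thesis by (simp add: sf power2_eq_square)
  qed
  moreover have "0 <= real m * mu\<^sup>2" by simp
  moreover have "(\<Sum>v<m. (f v)\<^sup>2) <= (\<Sum>v<m. f v)" by (rule sq) (rule f)
  ultimately have f0: "(\<Sum>v<m. (f0 v)\<^sup>2) <= real m * mu" using sf by linarith
  have "(\<Sum>v<m. g v * (Av ^^ t) f0 v)\<^sup>2 <= (\<Sum>v<m. (g v)\<^sup>2) * (\<Sum>v<m. ((Av ^^ t) f0 v)\<^sup>2)"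
   by (rule Cauchy_Schwarz_ineq_sum)
  also have "... <= (real m * mu) * ((lam ^ t)\<^sup>2 * (real m * mu))"
  proof (rule mult_mono)
   have "(\<Sum>v<m. (g v)\<^sup>2) <= (\<Sum>v<m. g v)" by (rule sq) (rule g)
   then show "(\<Sum>v<m. (g v)\<^sup>2) <= real m * mu" using sg by linarith
   have "(\<Sum>v<m. ((Av ^^ t) f0 v)\<^sup>2) <= (lam ^ t)\<^sup>2 * (\<Sum>v<m. (f0 v)\<^sup>2)" using gap_pow[OF z] by blast
   also have "... <= (lam ^ t)\<^sup>2 * (real m * mu)" using f0 by (intro mult_left_mono) auto
   finally show "(\<Sum>v<m. ((Av ^^ t) f0 v)\<^sup>2) <= (lam ^ t)\<^sup>2 * (real m * mu)" .
  qed (use mu in "auto intro: sum_nonneg")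
  also have "... = (lam ^ t * (real m * mu))\<^sup>2" by (simp add: power2_eq_square mult_ac)
  finally have sq: "(\<Sum>v<m. g v * (Av ^^ t) f0 v)\<^sup>2 <= (lam ^ t * (real m * mu))\<^sup>2" .
  have "0 <= lam ^ t * (real m * mu)" using lam(1) mu by simp
  from power2_le_imp_le[OF sq this] show ?thesis .
 qed
 ultimately show ?thesis by linarith
qed

end

section \<open>The test on walks and its soundness\<close>

lemma power_alg:
 fixes P b s r K :: real
 assumes "P * (b / 2 / s) ^ 4 <= r * (b * b * K)" "0 < K" "0 < s" "0 < b"
 shows "P * b\<^sup>2 / (16 * s ^ 4 * K) <= r"
proof -
 have b: "0 < b * b * K" using assms by simp
 have "P * b\<^sup>2 / (16 * s ^ 4 * K) = P * (b / 2 / s) ^ 4 / (b * b * K)"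
  using assms by (simp add: power_divide power2_eq_square eval_nat_numeral)
 also have "... <= r * (b * b * K) / (b * b * K)" using assms(1) b by (intro divide_right_mono) auto
 also have "... = r" by (rule nonzero_mult_div_cancel_right) (rule less_imp_neq[OF b, symmetric])
 finally show ?thesis .
qed

locale powering = egraph +
 fixes S h :: nat and con :: "nat => nat => nat => nat => bool" and A :: "nat => nat list => nat"
 assumes S: "0 < S" and A: "!!v l. A v l < S" and m_pos: "0 < m"
begin

abbreviation "B == 2 * h + 1"

text \<open>\<open>A v p\<close> is the opinion of \<open>v\<close> on the vertex reached from \<open>v\<close> along \<open>p\<close>. The test with
 start \<open>v\<close>, length \<open>Suc l\<close> and labels \<open>ls\<close> compares the opinions of both ends on all edges.\<close>

definition rejects :: "nat => nat => nat list => bool" where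
 "rejects v l ls <-> (EX i<=l. let h = walk v (take (Suc i) ls); s = take (l - i) (drop (Suc i) ls) in
   ~ con (walk v (take i ls)) (ls ! i) (A v (take i ls)) (A (walk h s) (rl h s)))"

text \<open>The opinion about \<open>u\<close> of the vertex reached from \<open>u\<close> along
  \<open>r\<close>; that vertex refers to \<open>u\<close> by the reversed labels.\<close>

definition opin :: "nat => nat list => nat" where
 "opin u r = A (walk u r) (rl u r)"

definition cnt :: "nat => nat => nat => nat" where
 "cnt u c p = card {r \<in> L p. opin u r = c}"

text \<open>Lengths from 0 to \<open>h\<close> count equally. As the length of a test is uniform
  too, the numbers of steps before and after an edge range independently over 0 to \<open>h\<close>,
  so one plurality value for each vertex serves all positions in a test.\<close>

definition weight :: "nat => nat => real" where
 "weight u c = (\<Sum>p\<le>h. real (cnt u c p) / real d ^ p)"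

definition plur :: "nat => nat" where
 "plur u = (SOME c. c < S & (ALL c'<S. weight u c' <= weight u c))"

lemma plur: "plur u < S" "c < S ==> weight u c <= weight u (plur u)"
proof -
 have "EX c. c < S & (ALL c'<S. weight u c' <= weight u c)"
 proof -
  have "finite (weight u ` {..<S})" "weight u ` {..<S} ~= {}" using S by auto
  from Max_in[OF this] obtain c where "c < S" "weight u c = Max (weight u ` {..<S})" by auto
  then show ?thesis by (intro exI[of _ c]) auto
 qed
 from someI_ex[OF this] show "plur u < S" "c < S ==> weight u c <= weight u (plur u)" unfolding plur_def[symmetric] by auto
qed

lemma weight_plur: "real (h + 1) / real S <= weight u (plur u)"
proof -
 have "(\<Sum>c<S. real (cnt u c p)) = real d ^ p" for p
 proof -
  have "(\<Sum>c<S. card {r \<in> L p. opin u r = c}) = card (\<Union>c<S. {r \<in> L p. opin u r = c})"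
   by (rule card_UN_disjoint[symmetric]) auto
  also have "(\<Union>c<S. {r \<in> L p. opin u r = c}) = L p" using A by (auto simp: opin_def)
  finally have "(\<Sum>c<S. cnt u c p) = d ^ p" by (simp add: cnt_def card_L)
  then show ?thesis by (metis of_nat_power of_nat_sum)
 qed
 then have "(\<Sum>c<S. weight u c) = (\<Sum>p\<le>h. real d ^ p / real d ^ p)"
  unfolding weight_def by (subst sum.swap) (simp add: sum_divide_distrib[symmetric])
 also have "... = real (h + 1)" using d_pos by simp
 finally have "real (h + 1) <= (\<Sum>c<S. weight u (plur u))" using plur(2) by (metis lessThan_iff sum_mono)
 then show ?thesis using S by (simp add: field_simps)
qed

definition bad :: "nat => nat => bool" where
 "bad u k <-> ~ con u k (plur u) (plur (nb u k))"

definition viol :: nat where "viol = card {(u, k). u < m & k < d & bad u k}"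

definition mu :: real where "mu = real viol / real (m * d)"

definition faulty :: "nat => nat => nat list => nat => bool" where
 "faulty v l ls i <-> (let u = walk v (take i ls); w = walk v (take (Suc i) ls); s = take (l - i) (drop (Suc i) ls) in
   bad u (ls ! i) & A v (take i ls) = plur u & opin w s = plur w)"

text \<open>Second-moment method: the mean of \<open>NN\<close> is bounded below through the
  pluralities, its square is bounded above through \<open>NF\<close>, which counts all bad edges on
  the walk whatever the opinions on it are.\<close>

definition NN :: "nat => nat => nat list => real" where
 "NN v l ls = real (card {i. i <= l & i <= h & l - i <= h & faulty v l ls i})"

definition bb :: "nat => nat => real" where "bb u k = of_bool (bad u k)"

lemma bb_sq: "bb u k * bb u k = bb u k" and bb_nonneg: "0 <= bb u k" by (auto simp: bb_def)

definition NF :: "nat => nat list => real" where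
 "NF v ls = (\<Sum>i<B. bb (walk v (take i ls)) (ls ! i))"

lemma sum_bad: "(\<Sum>u<m. \<Sum>k<d. bb u k) = real viol"
proof -
 have "(\<Sum>u<m. \<Sum>k<d. bb u k) = (\<Sum>x\<in>{..<m} \<times> {..<d}. bb (fst x) (snd x))"
  unfolding sum.cartesian_product case_prod_beta ..
 also have "... = real (card ({..<m} \<times> {..<d} \<inter> {x. bad (fst x) (snd x)}))" unfolding bb_def by (simp add: sum_of_bool_eq)
 also have "{..<m} \<times> {..<d} \<inter> {x. bad (fst x) (snd x)} = {(u, k). u < m & k < d & bad u k}" by auto
 finally show ?thesis by (simp add: viol_def)
qed

lemma viol_mu: "real viol = real m * real d * mu" using d_pos m_pos by (simp add: mu_def)

lemma sum_one_step: assumes "i < n"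
 shows "(\<Sum>v<m. \<Sum>ls\<in>L n. f (walk v (take i ls)) (ls ! i)) = real d ^ (n - 1) * (\<Sum>u<m. \<Sum>k<d. f u k :: real)"
proof -
 obtain j where j: "n = i + Suc j" using less_imp_Suc_add[OF assms] by auto
 have "(\<Sum>v<m. \<Sum>ls\<in>L n. f (walk v (take i ls)) (ls ! i)) = (\<Sum>v<m. \<Sum>p\<in>L i. \<Sum>k<d. \<Sum>q\<in>L j. f (walk v p) k)"
  unfolding j sumL_add sumL_Suc by (intro sum.cong refl) (simp add: L_length nth_append)
 also have "... = (\<Sum>u<m. \<Sum>r\<in>L i. \<Sum>k<d. \<Sum>q\<in>L j. f u k)"
  by (rule sum_rl[of "%u r. \<Sum>k<d. \<Sum>q\<in>L j. f u k"])
 also have "... = real d ^ i * real d ^ j * (\<Sum>u<m. \<Sum>k<d. f u k)" by (simp add: card_L sum_distrib_left mult_ac)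
 finally show ?thesis by (simp add: j power_add)
qed

lemma sum_two_steps: assumes "i < j" "j < n"
 shows "(\<Sum>v<m. \<Sum>ls\<in>L n. bb (walk v (take i ls)) (ls ! i) * bb (walk v (take j ls)) (ls ! j))
  <= real d ^ n * real m * (mu\<^sup>2 + lam ^ (j - Suc i) * mu)"
proof -
 define t where "t = j - Suc i"
 obtain e where e: "n = i + Suc (t + Suc e)" "j = i + Suc t"
 proof -
  have "j = i + Suc t" using assms by (simp add: t_def)
  moreover obtain e where "n = j + Suc e" using less_imp_Suc_add[OF assms(2)] by auto
  ultimately show ?thesis using that by simp
 qed
 \<comment> \<open>\<open>f\<close> is the fraction of bad edges leaving a vertex, \<open>g\<close>
   that of bad edges entering it; the \<open>t\<close> steps between the two edges connect them
   through the averaging operator.\<close>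
 define f where "f u = (\<Sum>k<d. bb u k) / real d" for u
 define g where "g w = (\<Sum>k<d. bb (nb w k) (pt w k)) / real d" for w
 have "(\<Sum>v<m. \<Sum>ls\<in>L n. bb (walk v (take i ls)) (ls ! i) * bb (walk v (take j ls)) (ls ! j))
  = (\<Sum>v<m. \<Sum>p\<in>L i. \<Sum>k<d. \<Sum>q\<in>L t. \<Sum>k'<d. \<Sum>r\<in>L e. bb (walk v p) k * bb (walk v (p @ k # q)) k')"
  unfolding e sumL_add sumL_Suc by (intro sum.cong refl) (simp add: L_length nth_append)
 also have "... = (\<Sum>v<m. \<Sum>p\<in>L i. \<Sum>k<d. bb (walk v p) k * (\<Sum>q\<in>L t. f (walk (nb (walk v p) k) q)) * real d ^ Suc e)"
  using d_pos by (simp add: f_def sum_distrib_left sum_distrib_right card_L walk_append mult_ac sum_divide_distrib)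
 also have "... = (\<Sum>u<m. \<Sum>r\<in>L i. \<Sum>k<d. bb u k * (\<Sum>q\<in>L t. f (walk (nb u k) q)) * real d ^ Suc e)"
  by (rule sum_rl[of "%u r. \<Sum>k<d. bb u k * (\<Sum>q\<in>L t. f (walk (nb u k) q)) * real d ^ Suc e"])
 also have "... = real d ^ i * real d ^ t * real d ^ Suc e * (\<Sum>u<m. \<Sum>k<d. bb u k * (Av ^^ t) f (nb u k))"
  by (simp add: sum_walk card_L sum_distrib_left mult_ac)
 also have "(\<Sum>u<m. \<Sum>k<d. bb u k * (Av ^^ t) f (nb u k)) =
   (\<Sum>w<m. \<Sum>k<d. bb (nb w k) (pt w k) * (Av ^^ t) f w)"
 proof -
  have "(\<Sum>w<m. \<Sum>k<d. bb (nb w k) (pt w k) * (Av ^^ t) f w) =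
   (\<Sum>w<m. \<Sum>k<d. (%u k. bb u k * (Av ^^ t) f (nb u k)) (nb w k) (pt w k))" by (intro sum.cong refl) (simp add: nb_nb)
  also have "... = (\<Sum>u<m. \<Sum>k<d. bb u k * (Av ^^ t) f (nb u k))" by (rule sum_rot)
  finally show ?thesis ..
 qed
 also have "... = real d * (\<Sum>w<m. g w * (Av ^^ t) f w)"
 proof -
  have "(\<Sum>k<d. bb (nb w k) (pt w k) * (Av ^^ t) f w) = real d * (g w * (Av ^^ t) f w)" for w
   using d_pos by (simp add: g_def flip: sum_distrib_right)
  then show ?thesis by (simp add: sum_distrib_left)
 qed
 also have "real d ^ i * real d ^ t * real d ^ Suc e * (real d * (\<Sum>w<m. g w * (Av ^^ t) f w)) =
   real d ^ n * (\<Sum>w<m. g w * (Av ^^ t) f w)" by (simp add: e power_add mult_ac)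
 also have "... <= real d ^ n * (real m * mu\<^sup>2 + lam ^ t * (real m * mu))"
 proof (intro mult_left_mono mixing m_pos)
  have b: "(\<Sum>k<d. bb (P k) (Q k)) <= real d" for P Q
   using sum_mono[of "{..<d}" "%k. bb (P k) (Q k)" "%k. 1 :: real"] by (simp add: bb_def)
  show "0 <= f v & f v <= 1" "0 <= g v & g v <= 1" for v using b d_pos by (auto simp: f_def g_def sum_nonneg bb_nonneg)
  show "(\<Sum>v<m. f v) = real m * mu" using d_pos by (simp add: f_def sum_divide_distrib[symmetric] sum_bad viol_mu)
  show "(\<Sum>v<m. g v) = real m * mu" using d_pos sum_rot[of "%u k. bb u k"]
   by (simp add: g_def sum_divide_distrib[symmetric] sum_bad viol_mu)
 qed simp
 finally show ?thesis by (simp add: t_def algebra_simps)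
qed

definition lc :: real where "lc = 1 / (1 - lam)"

lemma lc: "1 <= lc" using lam by (simp add: lc_def)

lemma mu_nonneg: "0 <= mu" by (simp add: mu_def)

text \<open>The diagonal contributes the mean. Off the diagonal the error terms of mixing form a
  geometric series on either side, hence twice \<open>lc\<close>.\<close>

lemma sum_NF: "(\<Sum>v<m. \<Sum>ls\<in>L B. (NF v ls)\<^sup>2) <= real d ^ B * real m * mu * real B * (1 + real B * mu + 2 * lc)"
proof -
 define X where "X i v ls = (bb (walk v (take i ls)) (ls ! i) :: real)" for i v ls
 define Y where "Y i j = (\<Sum>v<m. \<Sum>ls\<in>L B. X i v ls * X j v ls)" for i j
 define D where "D = real d ^ B * real m"
 have D: "0 <= D" by (simp add: D_def)
 have "(\<Sum>v<m. \<Sum>ls\<in>L B. (NF v ls)\<^sup>2) = (\<Sum>v<m. \<Sum>ls\<in>L B. \<Sum>i<B. \<Sum>j<B. X i v ls * X j v ls)"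
  unfolding NF_def X_def power2_eq_square sum_product ..
 also have "... = (\<Sum>v<m. \<Sum>i<B. \<Sum>j<B. \<Sum>ls\<in>L B. X i v ls * X j v ls)"
  by (rule sum.cong[OF refl], rule trans[OF sum.swap], rule sum.cong[OF refl], rule sum.swap)
 also have "... = (\<Sum>i<B. \<Sum>j<B. Y i j)" unfolding Y_def by (rule trans[OF sum.swap], rule sum.cong[OF refl], rule sum.swap)
 also have "... <= (\<Sum>i<B. D * mu * (1 + real B * mu + 2 * lc))"
 proof (rule sum_mono)
  fix i assume i: "i \<in> {..<B}"
  have dp: "real d * real d ^ (B - 1) = real d ^ B" by simp
  have diag: "Y i i = D * mu"
  proof -
   have "Y i i = (\<Sum>v<m. \<Sum>ls\<in>L B. (%u k. bb u k) (walk v (take i ls)) (ls ! i))" by (simp add: Y_def X_def bb_sq)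
   also have "... = real d ^ (B - 1) * (\<Sum>u<m. \<Sum>k<d. bb u k)" by (rule sum_one_step) (use i in simp)
   also have "... = (real d * real d ^ (B - 1)) * real m * mu" unfolding sum_bad viol_mu by (simp only: mult_ac)
   finally show ?thesis unfolding dp D_def .
  qed
  have up: "Y i j <= D * (mu\<^sup>2 + lam ^ (j - Suc i) * mu)" if "i < j" "j < B" for i j
   using sum_two_steps[OF that] by (simp add: Y_def X_def D_def)
  have sym: "Y i j = Y j i" for i j by (simp add: Y_def mult.commute)
  have geo: "(\<Sum>k<n. lam ^ k) <= lc" for n using lam unfolding lc_def by (simp add: sum_gp_strict divide_right_mono)
  have split: "(\<Sum>j<B. Y i j) = (\<Sum>j<i. Y i j) + Y i i + (\<Sum>j\<in>{Suc i..<B}. Y i j)" by (rule sum_split_at) (use i in simp)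
  have "(\<Sum>j<i. Y i j) <= (\<Sum>j<i. D * (mu\<^sup>2 + lam ^ (i - Suc j) * mu))"
  proof (rule sum_mono)
   fix j assume "j \<in> {..<i}"
   then have "j < i" "i < B" using i by auto
   from up[OF this] show "Y i j <= D * (mu\<^sup>2 + lam ^ (i - Suc j) * mu)" by (simp only: sym[of i j])
  qed
  also have "... = D * (real i * mu\<^sup>2 + (\<Sum>k<i. lam ^ k) * mu)"
   by (simp only: sum_distrib_left[symmetric] sum.distrib sum_distrib_right[symmetric] sum_constant
    card_lessThan sum.nat_diff_reindex[of "%k. lam ^ k"])
  also have "... <= D * (real i * mu\<^sup>2 + lc * mu)" by (rule mult_left_mono[OF add_left_mono[OF mult_right_mono[OF geo mu_nonneg]] D])
  finally have low: "(\<Sum>j<i. Y i j) <= D * (real i * mu\<^sup>2 + lc * mu)" .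
  have "(\<Sum>j\<in>{Suc i..<B}. Y i j) <= (\<Sum>j\<in>{Suc i..<B}. D * (mu\<^sup>2 + lam ^ (j - Suc i) * mu))"
  proof (rule sum_mono)
   fix j assume "j \<in> {Suc i..<B}"
   then have "i < j" "j < B" by auto
   from up[OF this] show "Y i j <= D * (mu\<^sup>2 + lam ^ (j - Suc i) * mu)" .
  qed
  also have "... = D * (real (B - Suc i) * mu\<^sup>2 + (\<Sum>k<B - Suc i. lam ^ k) * mu)"
  proof -
   have "(\<Sum>j\<in>{Suc i..<B}. lam ^ (j - Suc i)) = (\<Sum>k<B - Suc i. lam ^ k)"
    by (rule sum.reindex_bij_witness[of _ "%k. k + Suc i" "%j. j - Suc i"]) auto
   then show ?thesis by (simp only: sum_distrib_left[symmetric] sum.distrib sum_distrib_right[symmetric]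
    sum_constant card_atLeastLessThan)
  qed
  also have "... <= D * (real (B - Suc i) * mu\<^sup>2 + lc * mu)"
   by (rule mult_left_mono[OF add_left_mono[OF mult_right_mono[OF geo mu_nonneg]] D])
  finally have high: "(\<Sum>j\<in>{Suc i..<B}. Y i j) <= D * (real (B - Suc i) * mu\<^sup>2 + lc * mu)" .
  have "(\<Sum>j<B. Y i j) <= D * (real i * mu\<^sup>2 + lc * mu) + Y i i + D * (real (B - Suc i) * mu\<^sup>2 + lc * mu)"
   unfolding split using low high by (intro add_mono) auto
  also have "D * (real i * mu\<^sup>2 + lc * mu) + Y i i + D * (real (B - Suc i) * mu\<^sup>2 + lc * mu) =
   D * mu * (1 + real (i + (B - Suc i)) * mu + 2 * lc)" unfolding diag by (simp add: power2_eq_square algebra_simps)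
  also have "... <= D * mu * (1 + real B * mu + 2 * lc)"
  proof (rule mult_left_mono)
   have "i + (B - Suc i) <= B" using i by auto
   then have "real (i + (B - Suc i)) * mu <= real B * mu" using mu_nonneg by (intro mult_right_mono) (simp_all only: of_nat_le_iff)
   then show "1 + real (i + (B - Suc i)) * mu + 2 * lc <= 1 + real B * mu + 2 * lc" by linarith
  qed (use D mu_nonneg in simp)
  finally show "(\<Sum>j<B. Y i j) <= D * mu * (1 + real B * mu + 2 * lc)" by simp
 qed
 also have "... = real d ^ B * real m * mu * real B * (1 + real B * mu + 2 * lc)" by (simp add: D_def mult_ac)
 finally show ?thesis .
qed

abbreviation "pc u i == real (cnt u (plur u) i)"

abbreviation "pq i s u k == bb u k * (pc u i / real d ^ i) * (pc (nb u k) s / real d ^ s)"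

text \<open>Seen from the edge at position \<open>i\<close>, the walk consists of a backward walk of
  length \<open>i\<close> from the start of the edge and an independent forward walk of length
  \<open>s\<close> from its end. So the two agreements with the plurality are independent and the
  count factorises.\<close>

lemma sum_faulty: assumes "i <= h" "s <= h"
 shows "(\<Sum>v<m. \<Sum>ls\<in>L B. of_bool (faulty v (i + s) ls i)) =
  real d ^ B / real d * (\<Sum>u<m. \<Sum>k<d. pq i s u k)"
proof -
 define e where "e = 2 * h - (i + s)"
 have B: "B = i + Suc (s + e)" using assms by (simp add: e_def)
 define ob where "ob u q = (of_bool (opin u q = plur u) :: real)" for u q
 define Z where "Z u r = real d ^ e * (\<Sum>k<d. bb u k * ob u r * pc (nb u k) s)" for u r
 have c: "(\<Sum>q\<in>L n. ob u q) = pc u n" for u n by (simp add: cnt_def ob_def sum_of_bool_eq Int_def)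
 have "(\<Sum>v<m. \<Sum>ls\<in>L B. of_bool (faulty v (i + s) ls i)) =
   (\<Sum>v<m. \<Sum>p\<in>L i. \<Sum>k<d. \<Sum>q\<in>L s. \<Sum>r\<in>L e. of_bool (faulty v (i + s) (p @ k # q @ r) i))"
  unfolding B sumL_add sumL_Suc ..
 also have "... = (\<Sum>v<m. \<Sum>p\<in>L i. Z (walk v p) (rl v p))"
 proof (intro sum.cong refl)
  fix v p assume v: "v \<in> {..<m}" and p: "p \<in> L i"
  have A: "A v p = opin (walk v p) (rl v p)" using walk_rl[of v p] v L_set[OF p] by (simp add: opin_def)
  have f: "faulty v (i + s) (p @ k # q @ r) i <-> bad (walk v p) k & opin (walk v p) (rl v p) = plur (walk v p) &
    opin (nb (walk v p) k) q = plur (nb (walk v p) k)" if "q \<in> L s" for k q r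
   using L_length[OF p] L_length[OF that] A by (simp add: faulty_def Let_def nth_append walk_append)
  have "(\<Sum>k<d. \<Sum>q\<in>L s. \<Sum>r\<in>L e. of_bool (faulty v (i + s) (p @ k # q @ r) i) :: real) =
    (\<Sum>k<d. \<Sum>q\<in>L s. \<Sum>r\<in>L e. bb (walk v p) k * ob (walk v p) (rl v p) *
     ob (nb (walk v p) k) q)" by (intro sum.cong refl) (simp add: f bb_def ob_def)
  also have "... = (\<Sum>k<d. real d ^ e * (bb (walk v p) k * ob (walk v p) (rl v p) *
     (\<Sum>q\<in>L s. ob (nb (walk v p) k) q)))" by (simp add: card_L sum_distrib_left)
  finally show "(\<Sum>k<d. \<Sum>q\<in>L s. \<Sum>r\<in>L e. of_bool (faulty v (i + s) (p @ k # q @ r) i)) = Z (walk v p) (rl v p)"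
   unfolding Z_def c sum_distrib_left .
 qed
 also have "... = (\<Sum>u<m. \<Sum>r\<in>L i. Z u r)" by (rule sum_rl)
 also have "... = (\<Sum>u<m. real d ^ e * (\<Sum>k<d. bb u k * pc u i * pc (nb u k) s))"
 proof (rule sum.cong[OF refl])
  fix u
  have "(\<Sum>r\<in>L i. Z u r) = real d ^ e * (\<Sum>r\<in>L i. \<Sum>k<d. bb u k * ob u r * pc (nb u k) s)"
   by (simp add: Z_def sum_distrib_left)
  also have "(\<Sum>r\<in>L i. \<Sum>k<d. bb u k * ob u r * pc (nb u k) s) =
    (\<Sum>k<d. \<Sum>r\<in>L i. bb u k * ob u r * pc (nb u k) s)" by (rule sum.swap)
  also have "... = (\<Sum>k<d. bb u k * (\<Sum>r\<in>L i. ob u r) * pc (nb u k) s)" by (simp only: sum_distrib_left sum_distrib_right)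
  finally show "(\<Sum>r\<in>L i. Z u r) = real d ^ e * (\<Sum>k<d. bb u k * pc u i * pc (nb u k) s)" unfolding c .
 qed
 also have "... = (\<Sum>u<m. \<Sum>k<d. real d ^ B / real d * pq i s u k)"
 proof (rule sum.cong[OF refl])
  have dB: "real d ^ B / real d = real d ^ i * real d ^ s * real d ^ e" unfolding B using d_pos by (simp add: power_add)
  have pw: "real d ^ i * real d ^ s * real d ^ e * (x * (y / real d ^ i) * (z / real d ^ s)) = real d ^ e * (x * y * z)" for x y z
   using d_pos by simp
  show "real d ^ e * (\<Sum>k<d. bb u k * pc u i * pc (nb u k) s) =
   (\<Sum>k<d. real d ^ B / real d * pq i s u k)" for u unfolding dB pw sum_distrib_left ..
 qed
 finally show ?thesis by (simp only: sum_distrib_left)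
qed

lemma NN_sum: assumes "l < B"
 shows "NN v l ls = (\<Sum>i\<le>h. \<Sum>s\<le>h. of_bool (l = i + s) * of_bool (faulty v (i + s) ls i))"
proof -
 have "(\<Sum>s\<le>h. of_bool (l = i + s) * of_bool (faulty v (i + s) ls i)) = (of_bool (i <= l & l - i <= h & faulty v l ls i) :: real)" for i
 proof (cases "i <= l & l - i <= h")
  case True
  have "(\<Sum>s\<le>h. of_bool (l = i + s) * of_bool (faulty v (i + s) ls i)) = (\<Sum>s\<le>h. if s = l - i then of_bool (faulty v l ls i) else 0 :: real)"
   using True by (intro sum.cong refl) auto
  then show ?thesis using True by simp
 next
  case False
  have "(\<Sum>s\<le>h. of_bool (l = i + s) * of_bool (faulty v (i + s) ls i)) = (\<Sum>s\<le>h. 0 :: real)"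
   using False by (intro sum.cong refl) auto
  then show ?thesis using False by auto
 qed
 then have "(\<Sum>i\<le>h. \<Sum>s\<le>h. of_bool (l = i + s) * of_bool (faulty v (i + s) ls i)) = (\<Sum>i\<le>h. of_bool (i <= l & l - i <= h & faulty v l ls i) :: real)"
  by simp
 also have "... = real (card {i. i <= h & (i <= l & l - i <= h & faulty v l ls i)})" by (simp add: sum_of_bool_eq Int_def)
 also have "{i. i <= h & (i <= l & l - i <= h & faulty v l ls i)} = {i. i <= l & i <= h & l - i <= h & faulty v l ls i}" by auto
 finally show ?thesis unfolding NN_def by simp
qed

lemma sum_NN: "real d ^ B * real m * mu * (real (h + 1) / real S)\<^sup>2 <= (\<Sum>v<m. \<Sum>l<B. \<Sum>ls\<in>L B. NN v l ls)"
proof -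
 define T where "T i s l v ls = (of_bool (l = i + s) * of_bool (faulty v (i + s) ls i) :: real)" for i s l v ls
 have "(\<Sum>v<m. \<Sum>l<B. \<Sum>ls\<in>L B. NN v l ls) = (\<Sum>v<m. \<Sum>l<B. \<Sum>ls\<in>L B. \<Sum>i\<le>h. \<Sum>s\<le>h. T i s l v ls)"
  by (intro sum.cong refl) (simp only: NN_sum T_def lessThan_iff)
 also have "... = (\<Sum>v<m. \<Sum>l<B. \<Sum>i\<le>h. \<Sum>s\<le>h. \<Sum>ls\<in>L B. T i s l v ls)"
  by (rule sum.cong[OF refl], rule sum.cong[OF refl], rule trans[OF sum.swap], rule sum.cong[OF refl], rule sum.swap)
 also have "... = (\<Sum>v<m. \<Sum>i\<le>h. \<Sum>s\<le>h. \<Sum>l<B. \<Sum>ls\<in>L B. T i s l v ls)"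
  by (rule sum.cong[OF refl], rule trans[OF sum.swap], rule sum.cong[OF refl], rule sum.swap)
 also have "... = (\<Sum>i\<le>h. \<Sum>s\<le>h. \<Sum>v<m. \<Sum>l<B. \<Sum>ls\<in>L B. T i s l v ls)"
  by (rule trans[OF sum.swap], rule sum.cong[OF refl], rule sum.swap)
 also have "... = (\<Sum>i\<le>h. \<Sum>s\<le>h. \<Sum>v<m. \<Sum>ls\<in>L B. of_bool (faulty v (i + s) ls i))"
 proof (intro sum.cong refl)
  fix i s v assume ihs: "i \<in> {..h}" "s \<in> {..h}"
  have "(\<Sum>l<B. \<Sum>ls\<in>L B. T i s l v ls) = (\<Sum>l<B. if l = i + s then \<Sum>ls\<in>L B. of_bool (faulty v (i + s) ls i) else 0)"
   by (intro sum.cong refl) (simp add: T_def del: sum_of_bool_eq)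
  then show "(\<Sum>l<B. \<Sum>ls\<in>L B. T i s l v ls) = (\<Sum>ls\<in>L B. of_bool (faulty v (i + s) ls i))"
   using ihs by (simp del: sum_of_bool_eq sum.lessThan_Suc)
 qed
 also have "... = (\<Sum>i\<le>h. \<Sum>s\<le>h. real d ^ B / real d * (\<Sum>u<m. \<Sum>k<d. pq i s u k))"
  by (intro sum.cong refl sum_faulty) auto
 also have "... = real d ^ B / real d * (\<Sum>i\<le>h. \<Sum>s\<le>h. \<Sum>u<m. \<Sum>k<d. pq i s u k)" by (simp only: sum_distrib_left)
 also have "(\<Sum>i\<le>h. \<Sum>s\<le>h. \<Sum>u<m. \<Sum>k<d. pq i s u k) =
   (\<Sum>u<m. \<Sum>i\<le>h. \<Sum>s\<le>h. \<Sum>k<d. pq i s u k)"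
  by (rule sym, rule trans[OF sum.swap], rule sum.cong[OF refl], rule sum.swap)
 also have "... = (\<Sum>u<m. \<Sum>k<d. \<Sum>i\<le>h. \<Sum>s\<le>h. pq i s u k)"
  by (rule sum.cong[OF refl], rule sym, rule trans[OF sum.swap], rule sum.cong[OF refl], rule sum.swap)
 also have "... = (\<Sum>u<m. \<Sum>k<d. bb u k * (weight u (plur u) * weight (nb u k) (plur (nb u k))))"
  unfolding weight_def sum_product by (simp only: sum_distrib_left mult.assoc)
 finally have E: "(\<Sum>v<m. \<Sum>l<B. \<Sum>ls\<in>L B. NN v l ls) = real d ^ B / real d * (\<Sum>u<m. \<Sum>k<d. bb u k * (weight u (plur u) * weight (nb u k) (plur (nb u k))))" .
 have "real viol * (real (h + 1) / real S)\<^sup>2 = (\<Sum>u<m. \<Sum>k<d. bb u k * (real (h + 1) / real S * (real (h + 1) / real S)))"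
  unfolding sum_bad[symmetric] by (simp only: sum_distrib_right power2_eq_square)
 also have "... <= (\<Sum>u<m. \<Sum>k<d. bb u k * (weight u (plur u) * weight (nb u k) (plur (nb u k))))"
 proof (intro sum_mono mult_left_mono bb_nonneg mult_mono weight_plur)
  show "0 <= weight u (plur u)" for u using weight_plur[of u] by (rule order_trans[rotated]) simp
 qed simp
 finally have "real d ^ B / real d * (real viol * (real (h + 1) / real S)\<^sup>2) <= (\<Sum>v<m. \<Sum>l<B. \<Sum>ls\<in>L B. NN v l ls)"
  unfolding E by (intro mult_left_mono) auto
 moreover have "real d ^ B / real d * (real viol * (real (h + 1) / real S)\<^sup>2) = real d ^ B * real m * mu * (real (h + 1) / real S)\<^sup>2"
  unfolding viol_mu using d_pos by simp
 ultimately show ?thesis by (simp only:)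
qed

lemma NN_le_NF: assumes "l < B" shows "NN v l ls <= NF v ls"
proof -
 have "NN v l ls <= real (card {i. i < B & bad (walk v (take i ls)) (ls ! i)})"
  unfolding NN_def using assms by (intro of_nat_mono card_mono) (auto simp: faulty_def Let_def)
 also have "... = NF v ls" unfolding NF_def bb_def by (simp add: sum_of_bool_eq Int_def del: sum.lessThan_Suc)
 finally show ?thesis .
qed

lemma NN_rejects: assumes "l < B" "ls \<in> L B" "NN v l ls ~= 0" shows "rejects v l ls"
proof -
 have "{i. i <= l & i <= h & l - i <= h & faulty v l ls i} ~= {}" using assms(3) unfolding NN_def by (metis card.empty of_nat_0)
 then obtain i where i: "i <= l" "faulty v l ls i" by auto
 have "walk v (take (Suc i) ls) = nb (walk v (take i ls)) (ls ! i)"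
  using i(1) assms(1) L_length[OF assms(2)] by (simp add: take_Suc_conv_app_nth walk_append)
 then show ?thesis unfolding rejects_def Let_def using i by (intro exI[of _ i]) (simp add: faulty_def Let_def bad_def opin_def)
qed

text \<open>Cauchy-Schwarz for the indicator of rejection and \<open>NN\<close>, which vanishes on
  accepted tests. What remains is \<open>x / (1 + x + 2 * lc)\<close> with
  \<open>x = B * mu\<close>, at least \<open>min x 1 / (2 + 2 * lc)\<close>. The fourth power of
  \<open>S\<close> arises because the product of two plurality weights \<open>(h + 1) / S\<close>
  gets squared, and 16 because \<open>h + 1 >= B / 2\<close>.\<close>

theorem power_gap:
 "real (card {(v, l, ls). v < m & l < B & ls \<in> L B & rejects v l ls}) >=
   real (m * B * d ^ B) * (min (real B * mu) 1 / (16 * real S ^ 4 * (2 + 2 * lc)))"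
proof (cases "mu = 0")
 case False
 then have mu: "0 < mu" using mu_nonneg by simp
 let ?X = "{..<m} \<times> {..<B} \<times> L B"
 let ?N = "%(v, l, ls). NN v l ls" and ?R = "%(v, l, ls). of_bool (rejects v l ls) :: real"
 define P where "P = real d ^ B * real m * mu"
 have P: "0 < P" using mu d_pos m_pos by (simp add: P_def)
 define r where "r = real (card {(v, l, ls). v < m & l < B & ls \<in> L B & rejects v l ls})"
 define K where "K = 1 + real B * mu + 2 * lc"
 have K: "0 < K" using mu lc by (simp add: K_def add_pos_nonneg)
 have r: "(\<Sum>x\<in>?X. (?R x)\<^sup>2) = r"
 proof -
  have "(\<Sum>x\<in>?X. (?R x)\<^sup>2) = (\<Sum>x\<in>?X. of_bool (case x of (v, l, ls) => rejects v l ls))" by (intro sum.cong refl) auto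
  also have "... = real (card (?X \<inter> {x. case x of (v, l, ls) => rejects v l ls}))" by (subst sum_of_bool_eq) auto
  also have "?X \<inter> {x. case x of (v, l, ls) => rejects v l ls} = {(v, l, ls). v < m & l < B & ls \<in> L B & rejects v l ls}" by auto
  finally show ?thesis by (simp add: r_def)
 qed
 have trip: "(\<Sum>x\<in>?X. case x of (v, l, ls) => f v l ls) = (\<Sum>v<m. \<Sum>l<B. \<Sum>ls\<in>L B. f v l ls)" for f :: "nat => nat => nat list => real"
  unfolding sum.cartesian_product ..
 have "P * (real (h + 1) / real S)\<^sup>2 <= (\<Sum>x\<in>?X. ?N x)" unfolding trip P_def by (rule sum_NN)
 also have "(\<Sum>x\<in>?X. ?N x) = (\<Sum>x\<in>?X. ?R x * ?N x)"
 proof (rule sum.cong[OF refl])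
  fix x assume "x \<in> ?X"
  then obtain v l ls where x: "x = (v, l, ls)" "l < B" "ls \<in> L B" by auto
  show "?N x = ?R x * ?N x" using NN_rejects[OF x(2,3), of v] unfolding x(1) by (cases "rejects v l ls") auto
 qed
 finally have 1: "P * (real (h + 1) / real S)\<^sup>2 <= (\<Sum>x\<in>?X. ?R x * ?N x)" .
 have "(P * (real (h + 1) / real S)\<^sup>2)\<^sup>2 <= (\<Sum>x\<in>?X. ?R x * ?N x)\<^sup>2" by (rule power_mono[OF 1]) (use P in simp)
 also have "... <= (\<Sum>x\<in>?X. (?R x)\<^sup>2) * (\<Sum>x\<in>?X. (?N x)\<^sup>2)" by (rule Cauchy_Schwarz_ineq_sum)
 also have "... <= r * (real B * (P * real B * K))" unfolding r
 proof (rule mult_left_mono)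
  have "(\<Sum>x\<in>?X. (?N x)\<^sup>2) = (\<Sum>v<m. \<Sum>l<B. \<Sum>ls\<in>L B. (NN v l ls)\<^sup>2)"
   unfolding trip[symmetric] by (intro sum.cong refl) auto
  also have "... <= (\<Sum>v<m. \<Sum>l<B. \<Sum>ls\<in>L B. (NF v ls)\<^sup>2)" by (intro sum_mono power_mono NN_le_NF) (auto simp: NN_def)
  also have "... = real B * (\<Sum>v<m. \<Sum>ls\<in>L B. (NF v ls)\<^sup>2)" by (simp add: sum_distrib_left)
  also have "... <= real B * (P * real B * K)" unfolding P_def K_def by (rule mult_left_mono[OF sum_NF]) simp
  finally show "(\<Sum>x\<in>?X. (?N x)\<^sup>2) <= real B * (P * real B * K)" .
 qed (simp add: r_def)
 finally have 2: "(P * (real (h + 1) / real S)\<^sup>2)\<^sup>2 <= r * (real B * (P * real B * K))" .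
 have h: "real B / 2 <= real (h + 1)" by simp
 have "P * (P * (real B / 2 / real S) ^ 4) <= P * (P * (real (h + 1) / real S) ^ 4)"
  using P h by (intro mult_left_mono power_mono divide_right_mono) auto
 also have "... = (P * (real (h + 1) / real S)\<^sup>2)\<^sup>2" by (simp add: power2_eq_square eval_nat_numeral mult_ac)
 finally have "P * (P * (real B / 2 / real S) ^ 4) <= P * (r * (real B * real B * K))" using 2 by (simp add: mult_ac)
 then have "P * (real B / 2 / real S) ^ 4 <= r * (real B * real B * K)" using mult_le_cancel_left_pos[OF P] by blast
 then have 3: "P * (real B)\<^sup>2 / (16 * real S ^ 4 * K) <= r" by (rule power_alg) (use K S in auto)
 have "min (real B * mu) 1 / (2 + 2 * lc) <= (real B * mu) / K"
 proof (cases "real B * mu <= 1")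
  case True
  then show ?thesis using lc mu K unfolding K_def by (intro frac_le) auto
 next
  case False
  define x where "x = real B * mu"
  have "1 + x + 2 * lc <= x * (2 + 2 * lc)" using False lc mult_left_mono[of 1 x lc] by (simp add: x_def algebra_simps)
  then show ?thesis using False lc K unfolding K_def x_def[symmetric] by (simp add: field_simps)
 qed
 then have "real (m * B * d ^ B) / (16 * real S ^ 4) * (min (real B * mu) 1 / (2 + 2 * lc)) <=
   real (m * B * d ^ B) / (16 * real S ^ 4) * ((real B * mu) / K)" by (rule mult_left_mono) simp
 also have "... = P * (real B)\<^sup>2 / (16 * real S ^ 4 * K)"
 proof -
  have "x * b * y / c * (b * z / k) = y * x * z * b\<^sup>2 / (c * k)" for x b y c z k :: real by (simp add: power2_eq_square)
  then show ?thesis unfolding P_def of_nat_mult of_nat_power .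
 qed
 also note 3
 finally have "real (m * B * d ^ B) / (16 * real S ^ 4) * (min (real B * mu) 1 / (2 + 2 * lc)) <= r" .
 moreover have "x / c * (y / z) = x * (y / (c * z))" for x c y z :: real by simp
 ultimately show ?thesis unfolding r_def by (simp only:)
qed simp

end

section \<open>The linearity test and long codes\<close>

definition avg :: "'a set => ('a => real) => real" where
 "avg X f = (\<Sum>x\<in>X. f x) / real (card X)"

lemma avg_mono: "(!!x. x \<in> X ==> f x <= g x) ==> avg X f <= avg X g" unfolding avg_def by (intro divide_right_mono sum_mono) auto

lemma avg_const [simp]: "finite X ==> X ~= {} ==> avg X (%x. c) = c" by (simp add: avg_def card_gt_0_iff)

lemma avg_add: "avg X (%x. f x + g x) = avg X f + avg X g" by (simp add: avg_def sum.distrib add_divide_distrib)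

lemma avg_cong: "(!!x. x \<in> X ==> f x = g x) ==> avg X f = avg X g" by (simp add: avg_def cong: sum.cong)

text \<open>Subsets stand for vectors over the field with two elements, so this is addition;
  \<open>lin z\<close> below is the linear functional with coefficient vector
  \<open>z\<close>.\<close>

definition sdf :: "'a set => 'a set => 'a set" where
 "sdf x y = (x - y) \<union> (y - x)"

lemma xor_in: "x \<in> Pow S ==> y \<in> Pow S ==> sdf x y \<in> Pow S" by (auto simp: sdf_def)

lemma xor_xor [simp]: "sdf (sdf x y) y = x" "sdf y (sdf y x) = x" by (auto simp: sdf_def)

lemma sum_xor: assumes "c \<in> Pow S" shows "(\<Sum>x\<in>Pow S. f (sdf x c)) = (\<Sum>x\<in>Pow S. f x)"
 by (rule sum.reindex_bij_witness[of _ "%x. sdf x c" "%x. sdf x c"])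
  (use assms in "auto simp: xor_in[unfolded Pow_def, simplified] intro: xor_in[THEN PowD]")

lemma avg_xor: assumes "c \<in> Pow S" shows "avg (Pow S) (%x. f (sdf x c)) = avg (Pow S) f" unfolding avg_def sum_xor[OF assms] ..

definition lin :: "'a set => 'a set => bool" where
 "lin z x <-> odd (card (x \<inter> z))"

lemma lin_xor: assumes "finite z" shows "lin z (sdf x y) <-> (lin z x ~= lin z y)"
proof -
 let ?a = "card ((x - y) \<inter> z)" and ?b = "card ((y - x) \<inter> z)" and ?c = "card (x \<inter> y \<inter> z)"
 have 1: "card (sdf x y \<inter> z) = ?a + ?b"
 proof -
  have "sdf x y \<inter> z = ((x - y) \<inter> z) \<union> ((y - x) \<inter> z)" by (auto simp: sdf_def)
  then show ?thesis using assms by (simp add: card_Un_disjoint disjoint_iff)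
 qed
 have 2: "card (u \<inter> z) = card ((u - v) \<inter> z) + card (u \<inter> v \<inter> z)" for u v
 proof -
  have "u \<inter> z = ((u - v) \<inter> z) \<union> (u \<inter> v \<inter> z)" by auto
  then have "card (u \<inter> z) = card (((u - v) \<inter> z) \<union> (u \<inter> v \<inter> z))" by (rule arg_cong)
  also have "... = card ((u - v) \<inter> z) + card (u \<inter> v \<inter> z)" by (rule card_Un_disjoint) (use assms in auto)
  finally show ?thesis .
 qed
 show ?thesis unfolding lin_def 1 2[of x y] 2[of y x] Int_commute[of y x] by auto
qed

definition sg :: "bool => real" where "sg b = (if b then -1 else 1)"

lemma sg_neq: "sg (a ~= b) = sg a * sg b" and sg_sq: "sg a * sg a = 1" by (auto simp: sg_def)

lemma sg_of_bool: "sg a * sg b = 1 - 2 * of_bool (a ~= b)" by (auto simp: sg_def)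

lemma lin_commute: "lin z x = lin x z" by (simp add: lin_def Int_commute)

lemma sum_lin: assumes S: "finite S" and z: "z \<in> Pow S"
 shows "(\<Sum>x\<in>Pow S. sg (lin z x)) = (if z = {} then real (card (Pow S)) else 0)"
proof (cases "z = {}")
 case False
 then obtain s where s: "s \<in> z" by auto
 have fz: "finite z" using S z finite_subset by blast
 have "(\<Sum>x\<in>Pow S. sg (lin z x)) = (\<Sum>x\<in>Pow S. sg (lin z (sdf x {s})))" by (rule sum_xor[symmetric]) (use s z in auto)
 also have "... = (\<Sum>x\<in>Pow S. - sg (lin z x))"
 proof (rule sum.cong[OF refl])
  have "lin z {s}" using s by (simp add: lin_def)
  then show "sg (lin z (sdf x {s})) = - sg (lin z x)" for x using lin_xor[OF fz, of x "{s}"] by (simp add: sg_def)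
 qed
 finally show ?thesis using False by (simp add: sum_negf)
qed (simp add: lin_def sg_def)

lemma sum_lin2: assumes "finite S" "x \<in> Pow S" "y \<in> Pow S"
 shows "(\<Sum>z\<in>Pow S. sg (lin z x) * sg (lin z y)) = (if x = y then real (card (Pow S)) else 0)"
proof -
 have "sg (lin z x) * sg (lin z y) = sg (lin (sdf x y) z)" if "z \<in> Pow S" for z
  using lin_xor[of z x y] finite_subset[of z S] assms(1) that by (auto simp: lin_commute[of _ z] simp flip: sg_neq)
 then have "(\<Sum>z\<in>Pow S. sg (lin z x) * sg (lin z y)) = (\<Sum>z\<in>Pow S. sg (lin (sdf x y) z))" by simp
 also have "... = (if sdf x y = {} then real (card (Pow S)) else 0)" by (rule sum_lin[OF assms(1) xor_in[OF assms(2,3)]])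
 also have "sdf x y = {} <-> x = y" by (auto simp: sdf_def)
 finally show ?thesis .
qed

text \<open>The Blum-Luby-Rubinfeld linearity test, by Fourier analysis.\<close>

lemma blr:
 fixes F :: "'a set => bool"
 assumes S: "finite S"
 shows "EX z:Pow S. avg (Pow S) (%x. of_bool (F x ~= lin z x)) <=
   avg (Pow S) (%g. avg (Pow S) (%h. of_bool ((F g ~= F h) ~= F (sdf g h))))"
proof -
 let ?P = "Pow S" let ?N = "real (card ?P)"
 have fP: "finite ?P" "?P ~= {}" using S by auto
 have N: "0 < ?N" using fP by (simp add: card_gt_0_iff)
 define f where "f x = sg (F x)" for x
 define H where "H z = (\<Sum>x\<in>?P. f x * sg (lin z x))" for z
 let ?K = "%x y z. f x * (f y * (sg (lin z x) * sg (lin z y) * H z))"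
 let ?C = "\<Sum>x\<in>?P. \<Sum>y\<in>?P. f x * (f y * f (sdf x y))"
 let ?E = "\<Sum>x\<in>?P. \<Sum>y\<in>?P. of_bool ((F x ~= F y) ~= F (sdf x y)) :: real"
 have ff: "f x * f x = 1" for x by (simp add: f_def sg_sq)
 have inv: "(\<Sum>z\<in>?P. sg (lin z y) * H z) = ?N * f y" if y: "y \<in> ?P" for y
 proof -
  have "(\<Sum>z\<in>?P. sg (lin z y) * H z) = (\<Sum>x\<in>?P. f x * (\<Sum>z\<in>?P. sg (lin z x) * sg (lin z y)))"
   unfolding H_def sum_distrib_left by (subst sum.swap) (simp add: mult_ac)
  also have "... = (\<Sum>x\<in>?P. if x = y then ?N * f y else 0)" by (intro sum.cong refl) (simp add: sum_lin2[OF S _ y])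
  finally show ?thesis using y fP by simp
 qed
 have pars: "(\<Sum>z\<in>?P. H z * H z) = ?N * ?N"
 proof -
  have "(\<Sum>z\<in>?P. H z * H z) = (\<Sum>z\<in>?P. \<Sum>y\<in>?P. f y * (sg (lin z y) * H z))"
  proof (rule sum.cong[OF refl])
   fix z
   have "(\<Sum>y\<in>?P. f y * sg (lin z y)) * H z = (\<Sum>y\<in>?P. f y * (sg (lin z y) * H z))"
    by (simp add: sum_distrib_right mult.assoc)
   then show "H z * H z = (\<Sum>y\<in>?P. f y * (sg (lin z y) * H z))" by (simp only: H_def[of z, symmetric])
  qed
  also have "... = (\<Sum>y\<in>?P. f y * (\<Sum>z\<in>?P. sg (lin z y) * H z))" by (subst sum.swap) (simp add: sum_distrib_left)
  also have "... = (\<Sum>y\<in>?P. f y * (?N * f y))" by (intro sum.cong refl) (simp add: inv)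
  also have "... = (\<Sum>y\<in>?P. ?N * (f y * f y))" by (simp only: mult_ac)
  finally show ?thesis by (simp add: ff)
 qed
 have cube: "(\<Sum>z\<in>?P. H z * (H z * H z)) = ?N * ?C"
 proof -
  have "(\<Sum>z\<in>?P. H z * (H z * H z)) = (\<Sum>z\<in>?P. \<Sum>x\<in>?P. \<Sum>y\<in>?P. ?K x y z)"
  proof (rule sum.cong[OF refl])
   fix z
   have "(\<Sum>x\<in>?P. f x * sg (lin z x)) * ((\<Sum>y\<in>?P. f y * sg (lin z y)) * H z) =
     (\<Sum>x\<in>?P. \<Sum>y\<in>?P. ?K x y z)" unfolding sum_distrib_right sum_distrib_left by (intro sum.cong refl) (simp only: mult_ac)
   then show "H z * (H z * H z) = (\<Sum>x\<in>?P. \<Sum>y\<in>?P. ?K x y z)" by (simp only: H_def[of z, symmetric])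
  qed
  also have "... = (\<Sum>x\<in>?P. \<Sum>z\<in>?P. \<Sum>y\<in>?P. ?K x y z)" by (rule sum.swap)
  also have "... = (\<Sum>x\<in>?P. \<Sum>y\<in>?P. \<Sum>z\<in>?P. ?K x y z)" by (rule sum.cong[OF refl], rule sum.swap)
  also have "... = (\<Sum>x\<in>?P. \<Sum>y\<in>?P. f x * (f y * (?N * f (sdf x y))))"
  proof (intro sum.cong refl)
   fix x y assume xy: "x \<in> ?P" "y \<in> ?P"
   have "sg (lin z x) * sg (lin z y) = sg (lin z (sdf x y))" if "z \<in> ?P" for z
    unfolding lin_xor[OF finite_subset[OF PowD[OF that] S]] by (rule sg_neq[symmetric])
   then have "(\<Sum>z\<in>?P. ?K x y z) = f x * (f y * (\<Sum>z\<in>?P. sg (lin z (sdf x y)) * H z))" by (simp add: sum_distrib_left)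
   then show "(\<Sum>z\<in>?P. ?K x y z) = f x * (f y * (?N * f (sdf x y)))" using inv[OF xor_in[OF xy]] by simp
  qed
  finally show ?thesis by (simp add: sum_distrib_left mult_ac)
 qed
 have "finite (H ` ?P)" "H ` ?P ~= {}" using fP by auto
 from Max_in[OF this] obtain z where z: "z \<in> ?P" "H z = Max (H ` ?P)" by auto
 have Hz: "H y <= H z" if "y \<in> ?P" for y using z(2) fP that by simp
 \<comment> \<open>\<open>H\<close> consists of unnormalised Fourier coefficients. The sum of their
   cubes measures acceptance; it is at most the largest coefficient times the sum of squares, which
   is fixed by Parseval.\<close>
 have "(\<Sum>y\<in>?P. H y * (H y * H y)) <= (\<Sum>y\<in>?P. H z * (H y * H y))" by (intro sum_mono mult_right_mono Hz) auto
 also have "... = H z * (?N * ?N)" using pars by (simp add: sum_distrib_left[symmetric])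
 finally have "?N * ?C <= H z * (?N * ?N)" unfolding cube .
 then have "?N * ?C <= ?N * (H z * ?N)" by (simp only: mult_ac)
 then have 1: "?C <= H z * ?N" using mult_le_cancel_left_pos[OF N] by blast
 have 2: "?C = ?N * ?N - 2 * ?E"
 proof -
  have "f x * (f y * f (sdf x y)) = 1 - 2 * of_bool ((F x ~= F y) ~= F (sdf x y))" for x y by (auto simp: f_def sg_def)
  then show ?thesis by (simp add: sum_subtractf sum_distrib_left del: sum_of_bool_eq)
 qed
 have 3: "H z = ?N - 2 * (\<Sum>x\<in>?P. of_bool (F x ~= lin z x))"
  unfolding H_def f_def sg_of_bool by (simp add: sum_subtractf sum_distrib_left del: sum_of_bool_eq)
 have "?N * (\<Sum>x\<in>?P. of_bool (F x ~= lin z x)) <= ?E" using 1 unfolding 2 3 by (simp add: algebra_simps del: sum_of_bool_eq)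
 then have "(\<Sum>x\<in>?P. of_bool (F x ~= lin z x)) / ?N <= ?E / ?N / ?N" using N by (simp add: field_simps del: sum_of_bool_eq)
 then show ?thesis using z(1) by (intro bexI[of _ z]) (simp_all add: avg_def sum_divide_distrib del: sum_of_bool_eq)
qed

text \<open>Of the four pairs obtained by adding \<open>s\<close> to \<open>g\<close> or not and
  \<open>t\<close> to \<open>h\<close> or not, at least one violates the product rule, since the
  mixed difference of the product is one and that of the linear side is zero. Averaging over the
  shifts gives a quarter.\<close>

lemma not_product:
 assumes S: "finite S" and z: "z \<in> Pow S" and st: "s \<in> z" "t \<in> z" "s ~= t"
 shows "1/4 <= avg (Pow S) (%g. avg (Pow S) (%h. of_bool ((lin z g & lin z h) ~= lin z (g \<inter> h))))"
proof -
 define D where "D g h <-> (lin z g & lin z h) ~= lin z (g \<inter> h)" for g h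
 define d where "d g h = (of_bool (D g h) :: real)" for g h
 let ?A = "%f. avg (Pow S) (%g. avg (Pow S) (%h. f g h))"
 have fz: "finite z" using S z finite_subset by blast
 have ss: "{s} \<in> Pow S" "{t} \<in> Pow S" using st z by auto
 have one: "lin z {s}" "lin z {t}" using st by (auto simp: lin_def)
 have "1 <= d g h + d (sdf g {s}) h + d g (sdf h {t}) + d (sdf g {s}) (sdf h {t})" for g h
 proof -
  have a: "sdf g {s} \<inter> h = sdf (g \<inter> h) ({s} \<inter> h)" "g \<inter> sdf h {t} = sdf (g \<inter> h) (g \<inter> {t})"
   "sdf g {s} \<inter> sdf h {t} = sdf (sdf (g \<inter> h) ({s} \<inter> h)) (g \<inter> {t})" using st(3) by (auto simp: sdf_def)
  have b: "lin z ({s} \<inter> h) = (s \<in> h)" "lin z (g \<inter> {t}) = (t \<in> g)"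
  proof -
   have "{s} \<inter> h \<inter> z = (if s \<in> h then {s} else {})" "g \<inter> {t} \<inter> z = (if t \<in> g then {t} else {})" using st by auto
   then show "lin z ({s} \<inter> h) = (s \<in> h)" "lin z (g \<inter> {t}) = (t \<in> g)" by (simp_all add: lin_def)
  qed
  have "D g h | D (sdf g {s}) h | D g (sdf h {t}) | D (sdf g {s}) (sdf h {t})" unfolding D_def a lin_xor[OF fz] b using one by blast
  then show ?thesis by (auto simp: d_def)
 qed
 then have "avg (Pow S) (%g. avg (Pow S) (%h. 1)) <= ?A (%g h. d g h + d (sdf g {s}) h + d g (sdf h {t}) + d (sdf g {s}) (sdf h {t}))"
  by (intro avg_mono)
 also have "... = ?A d + ?A (%g h. d (sdf g {s}) h) + ?A (%g h. d g (sdf h {t})) + ?A (%g h. d (sdf g {s}) (sdf h {t}))"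
  by (simp only: avg_add)
 also have "?A (%g h. d g (sdf h {t})) = ?A d" by (simp only: avg_xor[OF ss(2)])
 also have "?A (%g h. d (sdf g {s}) h) = ?A d" by (rule avg_xor[OF ss(1), of "%g. avg (Pow S) (d g)"])
 also have "?A (%g h. d (sdf g {s}) (sdf h {t})) = ?A d"
  using avg_xor[OF ss(1), of "%g. avg (Pow S) (d g)"] by (simp only: avg_xor[OF ss(2)])
 also have "avg (Pow S) (%g. avg (Pow S) (%h. 1)) = 1"
 proof -
  have "finite (Pow S)" "Pow S ~= {}" using S by auto
  then show ?thesis by simp
 qed
 finally have "1 <= 4 * ?A d" by simp
 then show ?thesis unfolding d_def D_def by simp
qed

text \<open>The test of the alphabet reduction: \<open>F\<close> should be the long code of an element of \<open>R\<close>,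
 and \<open>fa\<close>, \<open>fb\<close> the long codes of its components.\<close>

definition passes :: "nat => (nat \<times> nat) set => ((nat \<times> nat) set => bool) => (nat set => bool) => (nat set => bool) =>
  (nat \<times> nat) set => (nat \<times> nat) set => (nat \<times> nat) set => nat set => nat set => bool" where
 "passes n R F fa fb g h w x y <->
   (F g ~= F h) = F (sdf g h) & (F g & F h) = (F (sdf w (g \<inter> h)) ~= F w) & F (sdf w R) ~= F w &
   fa x = (F (sdf w (x \<times> {..<n})) ~= F w) & fb y = (F (sdf w ({..<n} \<times> y)) ~= F w)"

lemma passes_dictator:
 assumes "(al, be) \<in> R" "al < n" "be < n"
 shows "passes n R (%X. (al, be) \<in> X) (%x. al \<in> x) (%y. be \<in> y) g h w x y" using assms by (auto simp: passes_def sdf_def)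

text \<open>Origin of 1/20: by the linearity test \<open>F\<close> is close to some
  \<open>lin z\<close>, and replacing \<open>F\<close> by \<open>lin z\<close> in the product check
  costs four more errors, so \<open>lin z\<close> fails it with probability at most
  \<open>5 * pr < 1/4\<close> and \<open>z\<close> has at most one element. The check on
  \<open>R\<close> makes \<open>z\<close> meet \<open>R\<close>. The tables \<open>fa\<close> and
  \<open>fb\<close> are off by at most \<open>3 * pr < 1/4\<close>, within the range of unique
  decoding.\<close>

lemma test_sound:
 fixes F fa fb n R
 defines "P == Pow ({..<n} \<times> {..<n})" and "Q == Pow {..<n :: nat}"
 assumes R: "R \<in> P"
  and p: "avg P (%g. avg P (%h. avg P (%w. avg Q (%x. avg Q (%y. of_bool (~ passes n R F fa fb g h w x y)))))) < 1/20"
 shows "EX al be. (al, be) \<in> R & al < n & be < n & avg Q (%x. of_bool (fa x ~= (al \<in> x))) < 1/4 &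
   avg Q (%y. of_bool (fb y ~= (be \<in> y))) < 1/4"
proof -
 define pr where "pr = avg P (%g. avg P (%h. avg P (%w. avg Q (%x. avg Q (%y. of_bool (~ passes n R F fa fb g h w x y))))))"
 have fin [simp]: "finite P" "P ~= {}" "finite Q" "Q ~= {}" unfolding P_def Q_def by auto
 have sub: "avg P (%g. avg P (%h. avg P (%w. avg Q (%x. avg Q (%y. of_bool (B g h w x y)))))) <= pr"
  if "!!g h w x y. B g h w x y ==> ~ passes n R F fa fb g h w x y" for B unfolding pr_def using that by (intro avg_mono) auto
 have "avg P (%g. avg P (%h. of_bool ((F g ~= F h) ~= F (sdf g h)))) <= pr"
  using sub[of "%g h w x y. (F g ~= F h) ~= F (sdf g h)"] by (simp add: passes_def)
 moreover obtain z where z: "z \<in> P" "avg P (%x. of_bool (F x ~= lin z x)) <= avg P (%g. avg P (%h. of_bool ((F g ~= F h) ~= F (sdf g h))))"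
  using blr[of "{..<n} \<times> {..<n}" F] unfolding P_def by auto
 ultimately have e: "avg P (%x. of_bool (F x ~= lin z x)) <= pr" by linarith
 define E where "E x = (of_bool (F x ~= lin z x) :: real)" for x
 have E: "avg P E <= pr" using e unfolding E_def .
 have Ex: "avg P (%w. E (sdf w c)) <= pr" if "c \<in> P" for c using avg_xor[of c _ E] that E unfolding P_def by simp
 have fz: "finite z" using z(1) by (auto simp: P_def intro: finite_subset)
 have le: "of_bool A <= of_bool B + X" if "A ==> ~ B ==> 1 <= X" "0 <= X" for A B and X :: real using that by auto
 have E1: "F c = lin z c | 1 <= E c" and E0: "0 <= E c" for c by (auto simp: E_def)
 have mult: "avg P (%g. avg P (%h. of_bool ((lin z g & lin z h) ~= lin z (g \<inter> h)))) <= 5 * pr"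
 proof -
  let ?B = "%g h w. (F g & F h) ~= (F (sdf w (g \<inter> h)) ~= F w)"
  have "avg P (%g. avg P (%h. of_bool ((lin z g & lin z h) ~= lin z (g \<inter> h)))) =
    avg P (%g. avg P (%h. avg P (%w. of_bool ((lin z g & lin z h) ~= lin z (g \<inter> h)))))" by simp
  also have "... <= avg P (%g. avg P (%h. avg P (%w. of_bool (?B g h w) + (E g + E h + E (sdf w (g \<inter> h)) + E w))))"
  proof (intro avg_mono le)
   fix g h w assume "(lin z g & lin z h) ~= lin z (g \<inter> h)" "~ ?B g h w"
   then have "F g ~= lin z g | F h ~= lin z h | F (sdf w (g \<inter> h)) ~= lin z (sdf w (g \<inter> h)) | F w ~= lin z w"
    using lin_xor[OF fz, of w "g \<inter> h"] by blast
   then show "1 <= E g + E h + E (sdf w (g \<inter> h)) + E w"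
    using E0[of g] E0[of h] E0[of w] E0[of "sdf w (g \<inter> h)"] by (auto simp: E_def)
  next
   fix g h w show "0 <= E g + E h + E (sdf w (g \<inter> h)) + E w" by (simp add: E_def)
  qed
  also have "... = avg P (%g. avg P (%h. avg P (%w. of_bool (?B g h w)))) + (avg P E + avg P E + avg P (%g. avg P (%h. avg P (%w. E (sdf w (g \<inter> h))))) + avg P E)"
   by (simp add: avg_add)
  also have "... <= pr + (pr + pr + pr + pr)"
  proof (intro add_mono E)
   show "avg P (%g. avg P (%h. avg P (%w. of_bool (?B g h w)))) <= pr" using sub[of "%g h w x y. ?B g h w"] by (simp add: passes_def)
   have "avg P (%g. avg P (%h. avg P (%w. E (sdf w (g \<inter> h))))) <= avg P (%g. avg P (%h. pr))"
    by (intro avg_mono Ex) (auto simp: P_def)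
   then show "avg P (%g. avg P (%h. avg P (%w. E (sdf w (g \<inter> h))))) <= pr" by simp
  qed
  finally show ?thesis by simp
 qed
 have p': "pr < 1/20" using p by (simp add: pr_def)
 have single: "s = t" if "s \<in> z" "t \<in> z" for s t
  using not_product[of "{..<n} \<times> {..<n}" z s t] z(1) that mult p' unfolding P_def by (cases "s = t") auto
 \<comment> \<open>Self-correction: closeness of \<open>F\<close> to \<open>lin z\<close> says
   nothing at a given point \<open>c\<close>, but \<open>sdf w c\<close> and \<open>w\<close> are
   both uniform when \<open>w\<close> is.\<close>
 have shift: "avg P (%w. of_bool (b ~= lin z c)) <= avg P (%w. of_bool (b ~= (F (sdf w c) ~= F w))) + 2 * pr" if "c \<in> P" for b c
 proof -
  have "avg P (%w. of_bool (b ~= lin z c)) <= avg P (%w. of_bool (b ~= (F (sdf w c) ~= F w)) + (E (sdf w c) + E w))"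
  proof (intro avg_mono le)
   fix w assume "b ~= lin z c" "~ b ~= (F (sdf w c) ~= F w)"
   then have "F (sdf w c) ~= lin z (sdf w c) | F w ~= lin z w" using lin_xor[OF fz, of w c] by blast
   then show "1 <= E (sdf w c) + E w" using E0[of w] E0[of "sdf w c"] by (auto simp: E_def)
  qed (simp add: E_def)
  also have "... <= avg P (%w. of_bool (b ~= (F (sdf w c) ~= F w))) + (pr + pr)"
   unfolding avg_add using Ex[OF that] E by (intro add_left_mono add_mono)
  finally show ?thesis by simp
 qed
 have "lin z R"
 proof (rule ccontr)
  assume "~ lin z R"
  then have "1 <= avg P (%w. of_bool (True ~= (F (sdf w R) ~= F w))) + 2 * pr" using shift[OF R, of True] by simp
  moreover have "avg P (%w. of_bool (True ~= (F (sdf w R) ~= F w))) <= pr"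
   using sub[of "%g h w x y. True ~= (F (sdf w R) ~= F w)"] by (simp add: passes_def)
  ultimately show False using p' by linarith
 qed
 then have "R \<inter> z ~= {}" by (auto simp: lin_def)
 then obtain al be where ab: "(al, be) \<in> R" "(al, be) \<in> z" by auto
 then have zs: "z = {(al, be)}" using single by auto
 have lt: "al < n" "be < n" using ab R by (auto simp: P_def)
 have side: "avg Q (%x. of_bool (fc x ~= (k \<in> x))) <= 3 * pr"
  if c: "!!x. x \<in> Q ==> c x \<in> P & (lin z (c x) <-> k \<in> x)"
   and le: "avg P (%w. avg Q (%x. of_bool (fc x ~= (F (sdf w (c x)) ~= F w)))) <= pr" for fc c k
 proof -
  have "avg Q (%x. of_bool (fc x ~= (k \<in> x))) = avg Q (%x. avg P (%w. of_bool (fc x ~= lin z (c x))))" using c by (intro avg_cong) simp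
  also have "... <= avg Q (%x. avg P (%w. of_bool (fc x ~= (F (sdf w (c x)) ~= F w))) + 2 * pr)" using c by (intro avg_mono shift) blast
  also have "... = avg P (%w. avg Q (%x. of_bool (fc x ~= (F (sdf w (c x)) ~= F w)))) + 2 * pr"
   unfolding avg_add by (simp add: avg_def sum_divide_distrib[symmetric] sum.swap[of _ P Q] mult.commute del: sum_of_bool_eq)
  finally show ?thesis using le by linarith
 qed
 have "avg Q (%x. of_bool (fa x ~= (al \<in> x))) <= 3 * pr"
 proof (rule side)
  show "x \<times> {..<n} \<in> P & (lin z (x \<times> {..<n}) <-> al \<in> x)" if "x \<in> Q" for x
   using lt that by (cases "al \<in> x") (auto simp: P_def Q_def zs lin_def Int_insert_right)
 qed (use sub[of "%g h w x y. fa x ~= (F (sdf w (x \<times> {..<n})) ~= F w)"] in \<open>simp add: passes_def\<close>)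
 moreover have "avg Q (%y. of_bool (fb y ~= (be \<in> y))) <= 3 * pr"
 proof (rule side)
  show "{..<n} \<times> x \<in> P & (lin z ({..<n} \<times> x) <-> be \<in> x)" if "x \<in> Q" for x
   using lt that by (cases "be \<in> x") (auto simp: P_def Q_def zs lin_def Int_insert_right)
 qed (use sub[of "%g h w y x. fb x ~= (F (sdf w ({..<n} \<times> x)) ~= F w)"] in \<open>simp add: passes_def\<close>)
 ultimately show ?thesis using ab(1) lt p' by (intro exI[of _ al] exI[of _ be]) auto
qed

text \<open>Two different dictators disagree on half of all subsets, too many for a function at
  distance less than 1/4 from both.\<close>

lemma dictator_unique:
 fixes n :: nat
 assumes "al < n" "al' < n" "avg (Pow {..<n}) (%x. of_bool (f x ~= (al \<in> x))) < 1/4"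
  "avg (Pow {..<n}) (%x. of_bool (f x ~= (al' \<in> x))) < 1/4"
 shows "al = al'"
proof (rule ccontr)
 assume ne: "al ~= al'"
 let ?Q = "Pow {..<n}"
 define D where "D x = (of_bool ((al \<in> x) ~= (al' \<in> x)) :: real)" for x
 have "1 = avg ?Q (%x. D x + D (sdf x {al}))" using ne by (subst avg_const[symmetric, of ?Q]) (auto simp: D_def sdf_def intro!: avg_cong)
 also have "... = 2 * avg ?Q D" unfolding avg_add using assms(1) by (subst avg_xor) auto
 finally have "1/2 = avg ?Q D" by simp
 also have "... <= avg ?Q (%x. of_bool (f x ~= (al \<in> x)) + of_bool (f x ~= (al' \<in> x)))" by (intro avg_mono) (auto simp: D_def)
 also have "... < 1/2" unfolding avg_add using assms(3,4) by linarith
 finally show False by simp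
qed

section \<open>Gap amplification\<close>

definition vbit :: "nat => nat => bool" where "vbit v k = odd (v div 2 ^ k)"

fun vcode :: "nat => (nat => bool) => nat" where
 "vcode 0 f = 0"
| "vcode (Suc q) f = (if f 0 then 1 else 0) + 2 * vcode q (%k. f (Suc k))"

lemma vcode_less: "vcode q f < 2 ^ q"
proof (induction q arbitrary: f)
 case (Suc q)
 from Suc[of "%k. f (Suc k)"] show ?case by simp
qed simp

lemma vbit_Suc: "vbit v (Suc k) = vbit (v div 2) k" by (simp add: vbit_def div_mult2_eq)

lemma vbit_vcode: "k < q ==> vbit (vcode q f) k = f k"
proof (induction q arbitrary: f k)
 case (Suc q)
 show ?case
 proof (cases k)
  case (Suc j)
  have "vcode (Suc q) f div 2 = vcode q (%k. f (Suc k))" by simp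
  then show ?thesis using Suc.IH[of j "%k. f (Suc k)"] Suc.prems Suc by (simp add: vbit_Suc)
 qed (simp add: vbit_def)
qed simp

lemma vcode_vbit: "v < 2 ^ q ==> vcode q (vbit v) = v"
proof (induction q arbitrary: v)
 case (Suc q)
 have "v div 2 < 2 ^ q" using Suc.prems by auto
 then have "vcode q (%k. vbit v (Suc k)) = v div 2" using Suc.IH[of "v div 2"] by (simp add: vbit_Suc)
 then show ?case by (simp add: vbit_def)
qed simp

lemma vcode_cong: "(!!k. k < q ==> f k = g k) ==> vcode q f = vcode q g"
proof (induction q arbitrary: f g)
 case (Suc q)
 have "vcode q (%k. f (Suc k)) = vcode q (%k. g (Suc k))" by (rule Suc.IH) (simp add: Suc.prems)
 then show ?case using Suc.prems[of 0] by simp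
qed simp

text \<open>A constraint satisfaction problem over bits: constraint \<open>j < M\<close> reads the variables \<open>x j k\<close>,
 \<open>k < q\<close>, and \<open>P j v\<close> says whether it accepts the view \<open>v < 2^q\<close>.\<close>

type_synonym scope = "nat => nat => nat"
type_synonym pred = "nat => nat => bool"
type_synonym opinion = "nat => nat list => nat"

definition sat :: "nat => scope => pred => (nat => bool) => nat => bool" where
 "sat q x P a j <-> P j (vcode q (%k. a (x j k)))"

definition unsat :: "nat => nat => scope => pred => (nat => bool) => nat" where
 "unsat q M x P a = card {j. j < M & ~ sat q x P a j}"

text \<open>Vertices of the constraint graph are the occurrences \<open>v = j * q + k\<close> of
  variables in constraints. The occurrences of one variable form its cloud; \<open>ocnt\<close>,
  \<open>orank\<close> and \<open>onth\<close> number it, so that an expander on an initial segment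
  of the naturals can be laid over it.\<close>

definition ovar :: "nat => scope => nat => nat" where
 "ovar q x v = x (v div q) (v mod q)"

definition ocnt :: "nat => nat => scope => nat => nat" where
 "ocnt q M x v = (\<Sum>w<q * M. if ovar q x w = ovar q x v then 1 else 0)"

definition orank :: "nat => scope => nat => nat" where
 "orank q x v = (\<Sum>w<v. if ovar q x w = ovar q x v then 1 else 0)"

definition onth :: "nat => nat => scope => nat => nat => nat" where
 "onth q M x v r = first (q * M) (%w. ovar q x w = ovar q x v & orank q x w = r)"

text \<open>Four kinds of ports: 0 to 31 form an expander inside the cloud, 32 to 63 an expander on
  all vertices, which supplies the spectral gap, 64 to \<open>63 + q\<close> lead to the occurrences
  in the same constraint, and from \<open>64 + q\<close> on there are loops.\<close>

definition gnb :: "nat => nat => scope => nat => nat => nat" where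
 "gnb q M x v i = (if i < 32 then onth q M x v (xnb (ocnt q M x v) (orank q x v) i)
   else if i < 64 then xnb (q * M) v (i - 32)
   else if i < 64 + q then v div q * q + (i - 64) else v)"

definition gpt :: "nat => nat => scope => nat => nat => nat" where
 "gpt q M x v i = (if i < 32 then xpt (ocnt q M x v) (orank q x v) i
   else if i < 64 then 32 + xpt (q * M) v (i - 32)
   else if i < 64 + q then 64 + v mod q else i)"

text \<open>The value of a vertex is a view of its whole constraint. Cloud edges compare the bits
  that the two views assign to the common variable, edges inside a constraint demand equal and
  accepted views, and the global expander and the loops impose nothing.\<close>

definition gcon :: "nat => nat => scope => pred => nat => nat => nat => nat => bool" where
 "gcon q M x P v i a b <-> (if i < 32 then vbit a (v mod q) = vbit b (gnb q M x v i mod q)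
   else 64 <= i & i < 64 + q --> a = b & P (v div q) a)"

lemma rank_bij:
 fixes C :: "nat set"
 assumes "finite C"
 shows "bij_betw (%v. card {w \<in> C. w < v}) C {..<card C}"
proof -
 let ?r = "%v. card {w \<in> C. w < v}"
 have mono: "?r v < ?r v'" if "v \<in> C" "v < v'" for v v'
 proof (rule psubset_card_mono)
  have "v \<in> {w \<in> C. w < v'}" "v ~: {w \<in> C. w < v}" using that by auto
  moreover have "{w \<in> C. w < v} \<subseteq> {w \<in> C. w < v'}" using that(2) by auto
  ultimately show "{w \<in> C. w < v} \<subset> {w \<in> C. w < v'}" by blast
 qed (use assms in simp)
 have inj: "inj_on ?r C"
 proof (rule inj_onI)
  fix v v' assume "v \<in> C" "v' \<in> C" "?r v = ?r v'"
  then show "v = v'" using mono[of v v'] mono[of v' v] by (cases v v' rule: linorder_cases) auto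
 qed
 have "?r v < card C" if "v \<in> C" for v
 proof (rule psubset_card_mono[OF assms])
  show "{w \<in> C. w < v} \<subset> C" using that by blast
 qed
 then have "?r ` C \<subseteq> {..<card C}" by auto
 moreover have "card (?r ` C) = card {..<card C}" using inj by (simp add: card_image)
 ultimately have "?r ` C = {..<card C}" by (intro card_subset_eq) auto
 then show ?thesis using inj by (simp add: bij_betw_def)
qed

locale prep =
 fixes q M :: nat and x :: "nat => nat => nat" and P :: "nat => nat => bool"
 assumes q: "1 <= q" and M: "1 <= M"
begin

abbreviation "m == q * M"
abbreviation "D == 64 + q"
abbreviation "nb == gnb q M x"
abbreviation "pt == gpt q M x"

definition cloud :: "nat => nat set" where "cloud y = {v. v < m & ovar q x v = y}"

lemma finite_cloud [simp]: "finite (cloud y)" by (simp add: cloud_def)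

lemma cnt_cloud: "ocnt q M x v = card (cloud (ovar q x v))" unfolding ocnt_def cloud_def by (rule sum_card)

lemma rank_cloud: "v < m ==> orank q x v = card {w \<in> cloud (ovar q x v). w < v}"
 unfolding orank_def sum_card by (rule arg_cong[of _ _ card]) (auto simp: cloud_def)

lemma rank_bij_cloud: "bij_betw (orank q x) (cloud y) {..<card (cloud y)}"
proof -
 have "orank q x v = card {w \<in> cloud y. w < v}" if "v \<in> cloud y" for v using that rank_cloud[of v] by (simp add: cloud_def)
 then show ?thesis using rank_bij[OF finite_cloud, of y] by (simp cong: bij_betw_cong)
qed

lemma rank_less: "v < m ==> orank q x v < ocnt q M x v"
 using bij_betwE[OF rank_bij_cloud[of "ovar q x v"]] by (auto simp: cnt_cloud cloud_def)

lemma onth: assumes v: "v < m" and r: "r < ocnt q M x v"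
 shows "onth q M x v r < m" "ovar q x (onth q M x v r) = ovar q x v" "orank q x (onth q M x v r) = r"
  "w \<in> cloud (ovar q x v) ==> orank q x w = r ==> onth q M x v r = w"
proof -
 let ?C = "cloud (ovar q x v)"
 obtain w where w: "w \<in> ?C" "orank q x w = r"
  using rank_bij_cloud[of "ovar q x v"] r unfolding bij_betw_def cnt_cloud by (metis imageE lessThan_iff)
 have u: "w' = w" if "w' \<in> ?C" "orank q x w' = r" for w'
  using rank_bij_cloud[of "ovar q x v"] w that unfolding bij_betw_def by (metis inj_onD)
 have "onth q M x v r = w" unfolding onth_def
 proof (rule first_eq)
  fix j assume j: "j < w"
  then have "j < m" using w by (auto simp: cloud_def)
  then show "~ (ovar q x j = ovar q x v & orank q x j = r)" using u[of j] j by (auto simp: cloud_def)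
 qed (use w in "auto simp: cloud_def")
 then show "onth q M x v r < m" "ovar q x (onth q M x v r) = ovar q x v" "orank q x (onth q M x v r) = r"
  "w' \<in> ?C ==> orank q x w' = r ==> onth q M x v r = w'" for w' using w u[of w'] by (auto simp: cloud_def)
qed

lemma cnt_eq: "ovar q x v = ovar q x w ==> ocnt q M x v = ocnt q M x w" by (simp add: cnt_cloud)

lemma onth_eq: "ovar q x v = ovar q x w ==> onth q M x v r = onth q M x w r" by (simp add: onth_def)

lemma rot: assumes v: "v < m" and i: "i < 2 * D"
 shows "nb v i < m & pt v i < 2 * D & (i < D --> pt v i < D) & nb (nb v i) (pt v i) = v & pt (nb v i) (pt v i) = i"
proof -
 consider "i < 32" | "32 <= i" "i < 64" | "64 <= i" "i < D" | "D <= i" by linarith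
 then show ?thesis
 proof cases
  case 1
  let ?c = "ocnt q M x v" and ?r = "orank q x v"
  have r: "?r < ?c" by (rule rank_less[OF v])
  let ?s = "xnb ?c ?r i" and ?p = "xpt ?c ?r i"
  have s: "?s < ?c" "?p < 32" using xnb_less[OF r] xpt_less[OF r 1] by auto
  let ?w = "onth q M x v ?s"
  note w = onth[OF v s(1)]
  have c: "ocnt q M x ?w = ?c" by (rule cnt_eq[OF w(2)])
  have "onth q M x ?w ?r = onth q M x v ?r" by (rule onth_eq[OF w(2)])
  also have "... = v" by (rule onth(4)[OF v r]) (use v in "auto simp: cloud_def")
  finally have ret: "onth q M x ?w ?r = v" .
  have n: "nb v i = ?w" "pt v i = ?p" using 1 by (auto simp: gnb_def gpt_def)
  show ?thesis unfolding n gnb_def[of _ _ _ ?w] gpt_def[of _ _ _ ?w] c w(3) using s w(1) x_involution[OF r 1] ret by auto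
 next
  case 2
  have p: "i - 32 < 32" using 2 by simp
  let ?w = "xnb m v (i - 32)" and ?p = "xpt m v (i - 32)"
  have n: "nb v i = ?w" "pt v i = 32 + ?p" using 2 by (auto simp: gnb_def gpt_def)
  show ?thesis unfolding n gnb_def[of _ _ _ ?w] gpt_def[of _ _ _ ?w] using 2 xnb_less[OF v] xpt_less[OF v p] x_involution[OF v p] by simp
 next
  case 3
  let ?w = "v div q * q + (i - 64)"
  have lt: "i - 64 < q" using 3 by simp
  have n: "nb v i = ?w" "pt v i = 64 + v mod q" using 3 by (auto simp: gnb_def gpt_def)
  have "v div q < M" using v by (simp add: less_mult_imp_div_less mult.commute)
  then have "?w < M * q" using lt by (metis add_less_cancel_left less_le_trans mult_le_mono1 Suc_leI mult_Suc add.commute)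
  moreover have "?w div q = v div q" "?w mod q = i - 64" using lt by auto
  moreover have "v mod q < q" using q by simp
  moreover from this have "64 + v mod q < 2 * D" by (rule less_le_trans[OF add_strict_left_mono]) simp
  ultimately show ?thesis unfolding n gnb_def[of _ _ _ ?w] gpt_def[of _ _ _ ?w] using 3 v by (simp add: mult.commute)
 next
  case 4
  then show ?thesis using v i by (auto simp: gnb_def gpt_def)
 qed
qed

text \<open>The ports below \<open>D\<close> are closed under the rotation map, so sums over the
  graph without loops can be rearranged as well.\<close>

sublocale half: rgraph m D nb pt using rot by unfold_locales (auto intro: trans_less_add1)

sublocale full: rgraph m "2 * D" nb pt using rot by unfold_locales auto

lemma m_pos: "0 < m" using q M by simp

definition lam :: real where "lam = sqrt (1 - 7 / (20 * real D))"

lemma lam: "0 <= lam" "lam < 1" "lam\<^sup>2 = 1 - 7 / (20 * real D)"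
proof -
 have "7 / (20 * real D) <= 1" "0 < 7 / (20 * real D)" by auto
 then show "0 <= lam" "lam < 1" "lam\<^sup>2 = 1 - 7 / (20 * real D)" by (auto simp: lam_def)
qed

text \<open>With \<open>D\<close> loops the operator is the average of the identity and the loopless
  one, so its norm is controlled by the inner product of \<open>f\<close> and \<open>g\<close>.
  There the global expander alone yields 7/5, the other ports having a non-negative Dirichlet form;
  \<open>7/5 * D / (2 * D)^2\<close> is the \<open>7 / (20 * D)\<close> in
  \<open>lam\<close>.\<close>

lemma spectral:
 assumes f0: "(\<Sum>v<m. f v) = 0"
 shows "(\<Sum>v<m. (full.Av f v)\<^sup>2) <= lam\<^sup>2 * (\<Sum>v<m. (f v)\<^sup>2)"
proof -
 define s where "s = (\<Sum>v<m. (f v)\<^sup>2)"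
 define g where "g v = (\<Sum>i<D. f (nb v i))" for v
 have "(\<Sum>i<2 * D. h i) = (\<Sum>i<D. h i) + (\<Sum>i\<in>{D..<2 * D}. h i)" for h :: "nat => real"
  unfolding lessThan_atLeast0 by (rule sum.atLeastLessThan_concat[symmetric]) simp_all
 then have "(\<Sum>i<2 * D. f (nb v i)) = g v + (\<Sum>i\<in>{D..<2 * D}. f (nb v i))" for v unfolding g_def .
 moreover have "(\<Sum>i\<in>{D..<2 * D}. f (nb v i)) = (\<Sum>i\<in>{D..<2 * D}. f v)" for v by (intro sum.cong refl) (auto simp: gnb_def)
 ultimately have Av: "full.Av f v = (g v + real D * f v) / (2 * real D)" for v
  by (simp only: full.Av_def of_nat_mult of_nat_numeral sum_constant card_atLeastLessThan) simp
 have sq: "(\<Sum>v<m. \<Sum>i<D. (f (nb v i))\<^sup>2) = real D * s"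
  using half.sum_rot[of "%v i. (f v)\<^sup>2"] by (simp add: s_def sum_distrib_left)
 have g2: "(\<Sum>v<m. (g v)\<^sup>2) <= real D * (real D * s)"
 proof -
  have "(g v)\<^sup>2 <= real D * (\<Sum>i<D. (f (nb v i))\<^sup>2)" for v
   using Cauchy_Schwarz_ineq_sum[of "%i. 1" "%i. f (nb v i)" "{..<D}"] by (simp add: g_def)
  then have "(\<Sum>v<m. (g v)\<^sup>2) <= (\<Sum>v<m. real D * (\<Sum>i<D. (f (nb v i))\<^sup>2))" by (intro sum_mono)
  then show ?thesis unfolding sum_distrib_left[symmetric] sq .
 qed
 have dir: "7/5 * s <= 2 * real D * s - 2 * (\<Sum>v<m. f v * g v)"
 proof -
  obtain a where a: "7/5 * (\<Sum>v<m. (f v - a)\<^sup>2) <= dirichlet m 32 (xnb m) f" using expander[of m f] m_pos by auto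
  have "(\<Sum>v<m. (f v - a)\<^sup>2) = s - 2 * a * (\<Sum>v<m. f v) + real m * a\<^sup>2"
   by (simp add: s_def power2_diff sum.distrib sum_subtractf sum_distrib_left mult_ac)
  then have "s <= (\<Sum>v<m. (f v - a)\<^sup>2)" using f0 by simp
  moreover have "dirichlet m 32 (xnb m) f <= (\<Sum>v<m. \<Sum>i<D. (f v - f (nb v i))\<^sup>2)" unfolding dirichlet_def
  proof (rule sum_mono)
   fix v
   have "(\<Sum>k<32. (f v - f (xnb m v k))\<^sup>2) = (\<Sum>i\<in>{32..<64}. (f v - f (nb v i))\<^sup>2)"
    by (rule sum.reindex_bij_witness[of _ "%i. i - 32" "%k. k + 32"]) (auto simp: gnb_def)
   also have "... <= (\<Sum>i<D. (f v - f (nb v i))\<^sup>2)" by (rule sum_mono2) auto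
   finally show "(\<Sum>k<32. (f v - f (xnb m v k))\<^sup>2) <= (\<Sum>i<D. (f v - f (nb v i))\<^sup>2)" .
  qed
  moreover have "(\<Sum>v<m. \<Sum>i<D. (f v - f (nb v i))\<^sup>2) = 2 * real D * s - 2 * (\<Sum>v<m. f v * g v)"
  proof -
   have "(\<Sum>v<m. \<Sum>i<D. (f v - f (nb v i))\<^sup>2) = (\<Sum>v<m. real D * (f v)\<^sup>2 + (\<Sum>i<D. (f (nb v i))\<^sup>2) - 2 * (f v * g v))"
    by (intro sum.cong refl) (simp add: power2_diff sum.distrib sum_subtractf g_def sum_distrib_left mult_ac)
   also have "... = real D * s + (\<Sum>v<m. \<Sum>i<D. (f (nb v i))\<^sup>2) - 2 * (\<Sum>v<m. f v * g v)"
    by (simp add: sum.distrib sum_subtractf s_def sum_distrib_left)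
   finally show ?thesis unfolding sq by simp
  qed
  ultimately show ?thesis using a by linarith
 qed
 have "(\<Sum>v<m. (full.Av f v)\<^sup>2) = (\<Sum>v<m. ((g v)\<^sup>2 + 2 * real D * (f v * g v) + (real D)\<^sup>2 * (f v)\<^sup>2) / (2 * real D)\<^sup>2)"
 proof (rule sum.cong[OF refl])
  have "((a + b * c) / (2 * b))\<^sup>2 = (a\<^sup>2 + 2 * b * (c * a) + b\<^sup>2 * c\<^sup>2) / (2 * b)\<^sup>2" for a b c :: real
   by (simp add: power_divide power2_sum power_mult_distrib mult_ac)
  then show "(full.Av f v)\<^sup>2 = ((g v)\<^sup>2 + 2 * real D * (f v * g v) + (real D)\<^sup>2 * (f v)\<^sup>2) / (2 * real D)\<^sup>2" for v
   unfolding Av .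
 qed
 also have "... = ((\<Sum>v<m. (g v)\<^sup>2) + 2 * real D * (\<Sum>v<m. f v * g v) + (real D)\<^sup>2 * s) / (2 * real D)\<^sup>2"
  by (simp add: sum_divide_distrib[symmetric] sum.distrib sum_distrib_left s_def)
 also have "... <= (real D * (real D * s) + real D * (2 * real D * s - 7/5 * s) + (real D)\<^sup>2 * s) / (2 * real D)\<^sup>2"
 proof (intro divide_right_mono add_mono g2)
  have "2 * (\<Sum>v<m. f v * g v) <= 2 * real D * s - 7/5 * s" using dir by linarith
  from mult_left_mono[OF this, of "real D"]
  show "2 * real D * (\<Sum>v<m. f v * g v) <= real D * (2 * real D * s - 7/5 * s)" by (simp only: mult_ac of_nat_0_le_iff simp_thms)
 qed auto
 also have "... = (1 - 7 / (20 * real D)) * s"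
 proof -
  have "(b * (b * s) + b * (2 * b * s - 7/5 * s) + b\<^sup>2 * s) / (2 * b)\<^sup>2 = (1 - 7 / (20 * b)) * s" if "0 < b" for b :: real
   using that by (simp add: field_simps power2_eq_square)
  from this[of "real D"] show ?thesis by simp
 qed
 finally show ?thesis unfolding lam(3) s_def .
qed

sublocale egraph m "2 * D" nb pt lam using lam spectral by unfold_locales auto

abbreviation "con == gcon q M x P"

definition dviol :: "(nat => nat) => nat" where
 "dviol s = card {(v, i). v < m & i < 2 * D & ~ con v i (s v) (s (nb v i))}"

lemma occ: "j < M ==> k < q ==> j * q + k < m & ovar q x (j * q + k) = x j k & (j * q + k) div q = j & (j * q + k) mod q = k"
proof -
 assume a: "j < M" "k < q"
 have "j * q + k < Suc j * q" using a by simp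
 also have "... <= M * q" using a by (intro mult_le_mono1) simp
 finally show ?thesis using a by (simp add: ovar_def mult.commute)
qed

lemma prep_complete:
 assumes "!!j. j < M ==> sat q x P a j" "v < m"
 shows "con v i (vcode q (%k. a (x (v div q) k))) (vcode q (%k. a (x (nb v i div q) k)))"
proof -
 have vq: "w mod q < q" for w using q by simp
 have M': "v div q < M" using assms(2) by (simp add: less_mult_imp_div_less mult.commute)
 show ?thesis
 proof (cases "i < 32")
  case True
  have "ovar q x (nb v i) = ovar q x v" using onth(2)[OF assms(2) xnb_less[OF rank_less[OF assms(2)]]] True by (simp add: gnb_def)
  then show ?thesis using True vq by (simp add: gcon_def vbit_vcode ovar_def)
 next
  case False
  have "nb v i div q = v div q" if "64 <= i" "i < 64 + q"
  proof -
   obtain k where "i = 64 + k" using \<open>64 <= i\<close> le_Suc_ex by blast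
   then show ?thesis using that by (simp add: gnb_def)
  qed
  then show ?thesis using False assms(1)[OF M'] by (auto simp: gcon_def sat_def)
 qed
qed

text \<open>Majority decoding on each cloud. A violated constraint contains a minority occurrence or
  a violated inner edge, and by expansion the minority occurrences are at most \<open>10/7\<close>
  times as many as the violated cloud edges.\<close>

lemma prep_sound:
 assumes s: "!!v. v < m ==> s v < 2 ^ q"
 shows "EX a. unsat q M x P a <= 3 * dviol s"
proof -
 define bt where "bt v = vbit (s v) (v mod q)" for v
 define a where "a y <-> card (cloud y) <= 2 * card {v \<in> cloud y. bt v}" for y
 define Mi where "Mi y = {v \<in> cloud y. bt v ~= a y}" for y
 define V where "V = {(v, i). v < m & i < 2 * D & ~ con v i (s v) (s (nb v i))}"
 define V1 where "V1 = {(v, i). v < m & i < 32 & bt v ~= bt (nb v i)}"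
 have finV: "finite V" by (rule finite_subset[of _ "{..<m} \<times> {..<2 * D}"]) (auto simp: V_def)
 have V1V: "V1 \<subseteq> V" by (auto simp: V1_def V_def gcon_def bt_def)
 have Mi_half: "2 * card (Mi y) <= card (cloud y)" for y
 proof -
  have "card {v \<in> cloud y. bt v} + card {v \<in> cloud y. ~ bt v} = card (cloud y)"
   by (subst card_Un_disjoint[symmetric]) (auto intro!: arg_cong[of _ _ card])
  then show ?thesis by (cases "a y") (auto simp: Mi_def a_def)
 qed
 let ?C = "%y. {(v, i). v \<in> cloud y & i < 32 & bt v ~= bt (nb v i)}"
 have cut: "7/10 * real (card (Mi y)) <= real (card (?C y))" for y
 proof -
  let ?c = "card (cloud y)" and ?r = "orank q x"
  have bij: "bij_betw ?r (cloud y) {..<?c}" by (rule rank_bij_cloud)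
  let ?S = "?r ` Mi y"
  have sub: "Mi y \<subseteq> cloud y" by (auto simp: Mi_def)
  have inj: "inj_on ?r (cloud y)" using bij by (simp add: bij_betw_def)
  have cS: "card ?S = card (Mi y)" by (rule card_image[OF inj_on_subset[OF inj sub]])
  have SS: "?S \<subseteq> {..<?c}" using bij sub by (auto simp: bij_betw_def)
  have inS: "?r v \<in> ?S <-> bt v ~= a y" if "v \<in> cloud y" for v
   using inj_on_image_mem_iff[OF inj that sub] that by (auto simp: Mi_def)
  have "7/10 * real (card (Mi y)) <= (\<Sum>t<?c. real (card {k. k < 32 & (t \<in> ?S) ~= (xnb ?c t k \<in> ?S)}))"
   using expander_cut[OF SS] Mi_half[of y] cS by simp
  also have "... = (\<Sum>v\<in>cloud y. real (card {k. k < 32 & (?r v \<in> ?S) ~= (xnb ?c (?r v) k \<in> ?S)}))"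
   by (rule sum.reindex_bij_betw[OF bij, symmetric])
  also have "... = (\<Sum>v\<in>cloud y. real (card {k. k < 32 & bt v ~= bt (nb v k)}))"
  proof (rule sum.cong[OF refl])
   fix v assume v: "v \<in> cloud y"
   then have vm: "v < m" and vy: "ovar q x v = y" by (auto simp: cloud_def)
   have c: "ocnt q M x v = ?c" by (simp add: cnt_cloud vy)
   have "(xnb ?c (?r v) k \<in> ?S) = (bt (nb v k) ~= a y)" if k: "k < 32" for k
   proof -
    have lt: "xnb ?c (?r v) k < ocnt q M x v" using xnb_less[OF rank_less[OF vm]] c by simp
    note w = onth[OF vm lt]
    have nbk: "nb v k = onth q M x v (xnb ?c (?r v) k)" using k c by (simp add: gnb_def)
    have "nb v k \<in> cloud y" using w(1,2) vy unfolding nbk by (simp add: cloud_def)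
    from inS[OF this] show ?thesis unfolding nbk w(3) .
   qed
   then show "real (card {k. k < 32 & (?r v \<in> ?S) ~= (xnb ?c (?r v) k \<in> ?S)}) = real (card {k. k < 32 & bt v ~= bt (nb v k)})"
    using inS[OF v] by (intro arg_cong[of _ _ "%X. real (card X)"]) auto
  qed
  also have "... = real (card (SIGMA v:cloud y. {k. k < 32 & bt v ~= bt (nb v k)}))" by simp
  also have "(SIGMA v:cloud y. {k. k < 32 & bt v ~= bt (nb v k)}) = ?C y" by auto
  finally show ?thesis .
 qed
 define Y where "Y = ovar q x ` {..<m}"
 have finY: "finite Y" by (simp add: Y_def)
 define Min where "Min = (\<Union>y\<in>Y. Mi y)"
 have cMin: "card Min = (\<Sum>y\<in>Y. card (Mi y))"
  unfolding Min_def by (rule card_UN_disjoint) (use finY in "auto simp: Mi_def cloud_def")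
 have "7/10 * real (card Min) <= (\<Sum>y\<in>Y. real (card (?C y)))" unfolding cMin using cut by (simp add: sum_distrib_left sum_mono)
 also have "... = real (card (\<Union>y\<in>Y. ?C y))"
 proof -
  have "finite (?C y)" for y by (rule finite_subset[of _ "cloud y \<times> {..<32}"]) auto
  then show ?thesis by (subst card_UN_disjoint) (use finY in "auto simp: cloud_def")
 qed
 also have "... <= real (card V1)" by (intro of_nat_mono card_mono finite_subset[OF V1V finV]) (auto simp: V1_def cloud_def)
 finally have m1: "7/10 * real (card Min) <= real (card V1)" .
 define V2 where "V2 = {(v, i). v < m & 64 <= i & i < D & ~ (s v = s (nb v i) & P (v div q) (s v))}"
 have V2V: "V2 \<subseteq> V" by (auto simp: V2_def V_def gcon_def)
 have disj: "V1 \<inter> V2 = {}" by (auto simp: V1_def V2_def)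
 \<comment> \<open>If neither happens at \<open>j\<close>, all its occurrences carry one accepted
   view and every bit of it is the majority bit, so it is the view under \<open>a\<close>.\<close>
 have "{j. j < M & ~ sat q x P a j} \<subseteq> (%v. v div q) ` Min \<union> (%(v, i). v div q) ` V2"
 proof
  fix j assume "j \<in> {j. j < M & ~ sat q x P a j}"
  then have j: "j < M" "~ sat q x P a j" by auto
  show "j \<in> (%v. v div q) ` Min \<union> (%(v, i). v div q) ` V2"
  proof (rule ccontr)
   assume n: "~ ?thesis"
   have v0: "j * q < m" "j * q div q = j" using occ[OF j(1), of 0] q by auto
   have loc: "s (j * q) = s (j * q + k)" "P j (s (j * q))" if k: "k < q" for k
   proof -
    have "(j * q, 64 + k) ~: V2" using n v0 by force
    then show "s (j * q) = s (j * q + k)" "P j (s (j * q))" using v0 k by (auto simp: V2_def gnb_def)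
   qed
   have "a (x j k) = vbit (s (j * q)) k" if k: "k < q" for k
   proof -
    have o: "j * q + k < m" "ovar q x (j * q + k) = x j k" "(j * q + k) div q = j" "(j * q + k) mod q = k" using occ[OF j(1) k] by auto
    have "j * q + k ~: Min" using n o(3) by force
    moreover have "x j k \<in> Y" using o by (auto simp: Y_def intro!: image_eqI[of _ _ "j * q + k"])
    ultimately have "bt (j * q + k) = a (x j k)" using o by (auto simp: Min_def Mi_def cloud_def)
    then show ?thesis using loc(1)[OF k] o by (simp add: bt_def)
   qed
   then have "vcode q (%k. a (x j k)) = vcode q (vbit (s (j * q)))" by (rule vcode_cong)
   also have "... = s (j * q)" by (rule vcode_vbit) (rule s[OF v0(1)])
   finally show False using loc(2)[of 0] q j(2) by (simp add: sat_def)
  qed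
 qed
 then have "unsat q M x P a <= card ((%v. v div q) ` Min \<union> (%(v, i). v div q) ` V2)"
  unfolding unsat_def using finite_subset[OF V2V finV] finY by (intro card_mono) (auto simp: Min_def Mi_def)
 also have "... <= card Min + card V2" by (rule order_trans[OF card_Un_le add_mono[OF card_image_le card_image_le]])
   (use finite_subset[OF V2V finV] finY in "auto simp: Min_def Mi_def")
 finally have "real (unsat q M x P a) <= real (card Min) + real (card V2)" by linarith
 also have "... <= 2 * real (card V1) + 2 * real (card V2)" using m1 by linarith
 also have "... = 2 * real (card (V1 \<union> V2))"
  using disj finite_subset[OF V1V finV] finite_subset[OF V2V finV] by (simp add: card_Un_disjoint)
 also have "... <= 3 * real (card V)" using card_mono[OF finV, of "V1 \<union> V2"] V1V V2V by simp
 finally show ?thesis unfolding dviol_def V_def[symmetric] by (intro exI[of _ a]) linarith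
qed

end

definition deg :: "nat => nat" where "deg q = 2 * (64 + q)"

text \<open>One twentieth of the constant of \<open>power_gap\<close> for alphabet size
  \<open>2 ^ q\<close>; the factor is the soundness of the long-code test. The walk length does not
  enter, so it can be chosen large in terms of this number.\<close>

definition kap :: "nat => real" where
 "kap q = 1 / (320 * real (2 ^ q) ^ 4 * (2 + 2 / (1 - sqrt (1 - 7 / (20 * real (64 + q))))))"

text \<open>The parameters of the gap amplification step: \<open>dc\<close> enumerates the opinion functions on
 walks of length at most \<open>2 h + 1\<close>, and \<open>en\<close>, \<open>e1\<close> enumerate the subsets of the alphabet
 \<open>{..<n}\<close> of opinions and of its square.\<close>

locale params =
 fixes q h n :: nat and dc :: "nat => nat list => nat" and en :: "nat => (nat \<times> nat) set" and e1 :: "nat => nat set"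
  and N1 N2 :: nat
 assumes q10: "10 <= q" and n: "0 < n"
  and dc_out: "!!al p. ~ set p \<subseteq> {..<deg q} ==> dc al p = 0"
  and dc_less: "!!al p. dc al p < 2 ^ q"
  and dc_surj: "!!f. (!!p. f p < 2 ^ q) ==>
    EX al<n. ALL p. length p <= 2 * h + 1 & set p \<subseteq> {..<deg q} --> dc al p = f p"
  and en: "bij_betw en {..<N2} (Pow ({..<n} \<times> {..<n}))"
  and e1: "bij_betw e1 {..<N1} (Pow {..<n})"

lemma params_exist:
 assumes q: "10 <= q"
 obtains n dc en e1 N1 N2 where "params q h n dc en e1 N1 N2"
proof -
 let ?X = "{p. length p <= 2 * h + 1 & set p \<subseteq> {..<deg q}}"
 have X: "finite ?X" using finite_lists_length_le[of "{..<deg q}" "2 * h + 1"] by (simp add: conj_commute)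
 let ?F = "?X \<rightarrow>\<^sub>E {..<2 ^ q :: nat}"
 have F: "finite ?F" by (intro finite_PiE X) simp
 define n where "n = card ?F"
 obtain e where e: "bij_betw e {..<n} ?F" using ex_bij_betw_nat_finite[OF F] unfolding n_def atLeast0LessThan by blast
 obtain en where en: "bij_betw en {..<card (Pow ({..<n} \<times> {..<n}))} (Pow ({..<n} \<times> {..<n}))"
  using ex_bij_betw_nat_finite[of "Pow ({..<n} \<times> {..<n})"] unfolding atLeast0LessThan by auto
 obtain e1 where e1: "bij_betw e1 {..<card (Pow {..<n})} (Pow {..<n})"
  using ex_bij_betw_nat_finite[of "Pow {..<n}"] unfolding atLeast0LessThan by auto
 define dc where "dc al p = (if al < n & p \<in> ?X then e al p else 0)" for al p
 have "params q h n dc en e1 (card (Pow {..<n})) (card (Pow ({..<n} \<times> {..<n})))"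
 proof
  have "(%p. if p \<in> ?X then 0 else undefined) \<in> ?F" by (auto simp: PiE_def extensional_def)
  then show "0 < n" unfolding n_def card_gt_0_iff using F by blast
  show "dc al p = 0" if "~ set p \<subseteq> {..<deg q}" for al p using that by (simp add: dc_def)
  show "dc al p < 2 ^ q" for al p using bij_betwE[OF e] by (auto simp: dc_def PiE_def Pi_def)
  fix f :: "nat list => nat" assume f: "!!p. f p < 2 ^ q"
  then have "restrict f ?X \<in> e ` {..<n}" unfolding bij_betw_imp_surj_on[OF e] by auto
  then obtain al where al: "al < n" "e al = restrict f ?X" by auto
  have "dc al p = f p" if "length p <= 2 * h + 1 & set p \<subseteq> {..<deg q}" for p using al that by (simp add: dc_def)
  then show "EX al<n. ALL p. length p <= 2 * h + 1 & set p \<subseteq> {..<deg q} --> dc al p = f p" using al(1) by blast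
 qed (use q en e1 in auto)
 then show thesis by (rule that)
qed

section \<open>Composition with the long-code test\<close>

lemma div_pair: "r < k ==> (a * k + r) div k = (a :: nat)" "r < k ==> (a * k + r) mod k = r" by (cases "k = 0", simp_all)+

lemma div_mod_pair: assumes "0 < k" shows "(c * (b * k) + r) div k mod b = r div k mod (b :: nat)"
proof -
 have e: "c * (b * k) + r = r + (c * b) * k" by (simp add: mult_ac)
 have "(c * (b * k) + r) div k = c * b + r div k" unfolding e using div_mult_self1[of k r "c * b"] assms by simp
 then show ?thesis by simp
qed

definition sB :: "nat => nat" where "sB h = 2 * h + 1"

text \<open>The number of tests, each given by a start, a length and a word of labels;
  \<open>tv\<close>, \<open>tl'\<close> and \<open>tls\<close> extract these from its index.
  \<open>sO\<close> counts the choices of \<open>g\<close>, \<open>h\<close>, \<open>w\<close>,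
  \<open>x\<close> and \<open>y\<close> in the long-code test, and \<open>og\<close> to
  \<open>oy\<close> are the corresponding digits.\<close>

definition sT :: "nat => nat => nat => nat" where "sT q h M = q * M * sB h * deg q ^ sB h"

definition sO :: "nat => nat => nat" where "sO N1 N2 = N2 * N2 * N2 * N1 * N1"

definition tv :: "nat => nat => nat => nat" where "tv q h t = t div deg q ^ sB h div sB h"

definition tl' :: "nat => nat => nat => nat" where "tl' q h t = t div deg q ^ sB h mod sB h"

definition tls :: "nat => nat => nat => nat list" where
 "tls q h t = map (%i. t mod deg q ^ sB h div deg q ^ i mod deg q) [0..<sB h]"

definition tb :: "nat => nat => nat => scope => nat => nat" where
 "tb q h M x t = path_end (gnb q M x) (tv q h t) (take (Suc (tl' q h t)) (tls q h t))"

text \<open>The relation that turns a test along a walk into one binary constraint: the opinion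
  \<open>al\<close> at the start and \<open>be\<close> at the end, taken together, satisfy every
  edge of the walk.\<close>

definition tR :: "nat => nat => nat => opinion => nat => scope => pred => nat => nat => nat => bool" where
 "tR q h n dc M x P t al be <-> (ALL i<sB h. i <= tl' q h t -->
   (let v = tv q h t; ls = tls q h t; w = path_end (gnb q M x) v (take (Suc i) ls) in
   gcon q M x P (path_end (gnb q M x) v (take i ls)) (ls ! i) (dc al (take i ls))
    (dc be (path_rev (gnb q M x) (gpt q M x) w (take (tl' q h t - i) (drop (Suc i) ls))))))"

definition tRs :: "nat => nat => nat => opinion => nat => scope => pred => nat => (nat \<times> nat) set" where
 "tRs q h n dc M x P t = {(al, be). al < n & be < n & tR q h n dc M x P t al be}"

definition sM :: "nat => nat => nat => nat => nat => nat" where "sM q h N1 N2 M = sT q h M * sO N1 N2"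

definition og where "og (N1::nat) N2 r = r div (N2 * N2 * N1 * N1)"
definition oh where "oh (N1::nat) N2 r = r div (N2 * N1 * N1) mod N2"
definition ow where "ow (N1::nat) N2 r = r div (N1 * N1) mod N2"
definition ox where "ox (N1::nat) r = r div N1 mod N1"
definition oy where "oy (N1::nat) r = r mod N1"

text \<open>There are \<open>N2\<close> variables for each test, the table that should be the long
  code of a pair in its relation, followed by \<open>N1\<close> variables for each vertex, shared by
  all tests that meet there. Position 4 and the positions from 10 on read \<open>F w\<close>, the
  latter to fill up the arity \<open>q\<close>.\<close>

definition sx where
 "sx q h n dc en e1 N1 N2 M x P j (k :: nat) =
  (let t = j div sO N1 N2; r = j mod sO N1 N2;
     F = (%Y. t * N2 + inv_into {..<N2} en Y);
     f = (%v X. sT q h M * N2 + v * N1 + X);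
     g = en (og N1 N2 r); h' = en (oh N1 N2 r); w = en (ow N1 N2 r) in
   if k = 0 then F g else if k = 1 then F h' else if k = 2 then F (sdf g h')
   else if k = 3 then F (sdf w (g \<inter> h')) else if k = 5 then F (sdf w (tRs q h n dc M x P t))
   else if k = 6 then f (tv q h t) (ox N1 r) else if k = 7 then F (sdf w (e1 (ox N1 r) \<times> {..<n}))
   else if k = 8 then f (tb q h M x t) (oy N1 r) else if k = 9 then F (sdf w ({..<n} \<times> e1 (oy N1 r)))
   else F w)"

text \<open>The checks of \<open>passes\<close> on the ten bits read; everything that varies between
  constraints is in the choice of the variables.\<close>

definition sP :: "nat => bool" where
 "sP v <-> (vbit v 0 ~= vbit v 1) = vbit v 2 & (vbit v 0 & vbit v 1) = (vbit v 3 ~= vbit v 4) &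
   vbit v 5 ~= vbit v 4 & vbit v 6 = (vbit v 7 ~= vbit v 4) & vbit v 8 = (vbit v 9 ~= vbit v 4)"

locale dstep = params + prep
begin

abbreviation "BB == sB h"
abbreviation "T == sT q h M"
abbreviation "Om == sO N1 N2"
abbreviation "x' == sx q h n dc en e1 N1 N2 M x P"
abbreviation "Rel t == tRs q h n dc M x P t"
abbreviation "SS == {..<n} \<times> {..<n}"
abbreviation "Tv == tv q h"
abbreviation "Tb == tb q h M x"
abbreviation "Tl == tl' q h"
abbreviation "Ts == tls q h"
abbreviation "iF t Y == t * N2 + inv_into {..<N2} en Y"
abbreviation "iA v X == T * N2 + v * N1 + inv_into {..<N1} e1 X"
abbreviation "st a == sat q x' (%j. sP) a"
abbreviation "uns a t == {r. r < Om & ~ st a (t * Om + r)}"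
abbreviation "gg r == og N1 N2 r"
abbreviation "hh r == oh N1 N2 r"
abbreviation "vw r == ow N1 N2 r"
abbreviation "xx r == ox N1 r"
abbreviation "yy r == oy N1 r"

lemma degD: "deg q = 2 * D" by (simp add: deg_def)

lemma N2: "N2 = card (Pow SS)" using bij_betw_same_card[OF en] by simp
lemma N1: "N1 = card (Pow {..<n})" using bij_betw_same_card[OF e1] by simp
lemma N2_pos: "0 < N2" unfolding N2 by (simp add: card_Pow)
lemma N1_pos: "0 < N1" unfolding N1 by (simp add: card_Pow)
lemma Om_pos: "0 < Om" using N1_pos N2_pos by (simp add: sO_def)

lemma tls: "length (Ts t) = BB" "set (Ts t) \<subseteq> {..<2 * D}" by (auto simp: tls_def deg_def)

lemma tl_less: "Tl t < BB" by (simp add: tl'_def sB_def)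

lemma tv_less: "t < T ==> Tv t < m"
proof -
 assume "t < T"
 then have "t < m * BB * deg q ^ BB" by (simp add: sT_def)
 then have "t div deg q ^ BB < m * BB" by (rule less_mult_imp_div_less)
 then show ?thesis unfolding tv_def by (rule less_mult_imp_div_less)
qed

lemma take_set: "set (take i (Ts t)) \<subseteq> {..<2 * D}" "set (take i (drop j (Ts t))) \<subseteq> {..<2 * D}"
 using tls(2)[of t] by (meson order_trans set_take_subset set_drop_subset)+

lemma tb_less: "t < T ==> Tb t < m" unfolding tb_def by (rule full.walk_less[OF tv_less take_set(1)])

lemma tb_walk: assumes "i <= Tl t"
 shows "full.walk (full.walk (Tv t) (take (Suc i) (Ts t))) (take (Tl t - i) (drop (Suc i) (Ts t))) = Tb t"
proof -
 have "take (Suc i) (Ts t) @ take (Tl t - i) (drop (Suc i) (Ts t)) = take (Suc i + (Tl t - i)) (Ts t)" by (rule take_add[symmetric])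
 moreover have "Suc i + (Tl t - i) = Suc (Tl t)" using assms by simp
 ultimately show ?thesis unfolding tb_def full.walk_append[symmetric] by simp
qed

lemma Rel_sub: "Rel t \<in> Pow SS" by (auto simp: tRs_def)

lemma en_inv: "Y \<in> Pow SS ==> inv_into {..<N2} en Y < N2 & en (inv_into {..<N2} en Y) = Y"
 using bij_betw_imp_surj_on[OF en] inv_into_into[of Y en "{..<N2}"] f_inv_into_f[of Y en "{..<N2}"] by simp

lemma en_in: "k < N2 ==> en k \<in> Pow SS" using bij_betwE[OF en] by blast

lemma e1_in: "k < N1 ==> e1 k \<in> Pow {..<n}" using bij_betwE[OF e1] by blast

lemma om_less: assumes "r < Om" shows "gg r < N2" "hh r < N2" "vw r < N2" "xx r < N1" "yy r < N1"
proof -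
 have "r < N2 * (N2 * N2 * N1 * N1)" using assms by (simp add: sO_def mult_ac)
 then show "gg r < N2" unfolding og_def by (rule less_mult_imp_div_less)
qed (use N1_pos N2_pos in "auto simp: oh_def ow_def ox_def oy_def")

lemma sum_om: "(\<Sum>r<Om. f (gg r) (hh r) (vw r) (xx r) (yy r)) =
  (\<Sum>a<N2. \<Sum>b<N2. \<Sum>c<N2. \<Sum>d<N1. \<Sum>e<N1. f a b c d e :: real)"
proof -
 have "(\<Sum>r<Om. f (gg r) (hh r) (vw r) (xx r) (yy r)) =
   (\<Sum>a<N2. \<Sum>r<N2 * (N2 * (N1 * N1)). f a (hh r) (vw r) (xx r) (yy r))"
 proof -
  have O: "Om = N2 * (N2 * (N2 * (N1 * N1)))" by (simp add: sO_def mult_ac)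
  show ?thesis unfolding O sum_rect[of _ N2 "N2 * (N2 * (N1 * N1))"]
  proof (intro sum.cong refl)
   fix a r assume "a \<in> {..<N2}" "r \<in> {..<N2 * (N2 * (N1 * N1))}"
   then have r: "r < N2 * (N2 * (N1 * N1))" by simp
   let ?r = "a * (N2 * (N2 * (N1 * N1))) + r"
   have "gg ?r = a" unfolding og_def mult.assoc by (rule div_pair(1)[OF r])
   moreover have "hh ?r = hh r" unfolding oh_def mult.assoc by (rule div_mod_pair) (use N1_pos N2_pos in simp)
   moreover have "vw ?r = vw r" unfolding ow_def using div_mod_pair[of "N1 * N1" "a * N2" N2 r] N1_pos by (simp add: mult.assoc)
   moreover have "xx ?r = xx r" unfolding ox_def using div_mod_pair[of N1 "a * N2 * N2" N1 r] N1_pos by (simp add: mult.assoc)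
   moreover have "yy ?r = yy r"
   proof -
    have e: "?r = r + a * N2 * N2 * N1 * N1" by (simp add: mult_ac)
    show ?thesis unfolding oy_def e by simp
   qed
   ultimately show "f (gg ?r) (hh ?r) (vw ?r) (xx ?r) (yy ?r) = f a (hh r) (vw r) (xx r) (yy r)" by simp
  qed
 qed
 also have "... = (\<Sum>a<N2. \<Sum>b<N2. \<Sum>r<N2 * (N1 * N1). f a b (vw r) (xx r) (yy r))" unfolding sum_rect[of _ N2 "N2 * (N1 * N1)"]
 proof (intro sum.cong refl)
  fix a b r assume b: "b \<in> {..<N2}" and "r \<in> {..<N2 * (N1 * N1)}"
  then have r: "r < N2 * (N1 * N1)" by simp
  let ?r = "b * (N2 * (N1 * N1)) + r"
  have "hh ?r = b" unfolding oh_def mult.assoc div_pair(1)[OF r] using b by simp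
  moreover have "vw ?r = vw r" unfolding ow_def by (rule div_mod_pair) (use N1_pos in simp)
  moreover have "xx ?r = xx r" unfolding ox_def using div_mod_pair[of N1 "b * N2" N1 r] N1_pos by (simp add: mult.assoc)
  moreover have "yy ?r = yy r"
  proof -
   have e: "?r = r + b * N2 * N1 * N1" by (simp add: mult_ac)
   show ?thesis unfolding oy_def e by simp
  qed
  ultimately show "f a (hh ?r) (vw ?r) (xx ?r) (yy ?r) = f a b (vw r) (xx r) (yy r)" by simp
 qed
 also have "... = (\<Sum>a<N2. \<Sum>b<N2. \<Sum>c<N2. \<Sum>r<N1 * N1. f a b c (xx r) (yy r))" unfolding sum_rect[of _ N2 "N1 * N1"]
 proof (intro sum.cong refl)
  fix a b c r assume c: "c \<in> {..<N2}" and "r \<in> {..<N1 * N1}"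
  then have r: "r < N1 * N1" by simp
  let ?r = "c * (N1 * N1) + r"
  have "vw ?r = c" unfolding ow_def div_pair(1)[OF r] using c by simp
  moreover have "xx ?r = xx r" unfolding ox_def by (rule div_mod_pair[OF N1_pos])
  moreover have "yy ?r = yy r"
  proof -
   have e: "?r = r + c * N1 * N1" by (simp add: mult_ac)
   show ?thesis unfolding oy_def e by simp
  qed
  ultimately show "f a b (vw ?r) (xx ?r) (yy ?r) = f a b c (xx r) (yy r)" by simp
 qed
 also have "... = (\<Sum>a<N2. \<Sum>b<N2. \<Sum>c<N2. \<Sum>d<N1. \<Sum>e<N1. f a b c d e)"
  unfolding sum_rect[of _ N1 N1] by (intro sum.cong refl) (simp add: ox_def oy_def)
 finally show ?thesis .
qed

lemma sat_passes:
 assumes "t < T" "r < Om"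
 shows "st a (t * Om + r) <->
  passes n (Rel t) (%Y. a (iF t Y)) (%X. a (iA (Tv t) X))
   (%X. a (iA (Tb t) X))
   (en (gg r)) (en (hh r)) (en (vw r)) (e1 (xx r)) (e1 (yy r))"
proof -
 have d: "(t * Om + r) div Om = t" "(t * Om + r) mod Om = r" using assms(2) by auto
 have v: "vbit (vcode q (%k. a (x' (t * Om + r) k))) i = a (x' (t * Om + r) i)" if "i < 10" for i using that q10 by (intro vbit_vcode) simp
 have e: "inv_into {..<N1} e1 (e1 k) = k" if "k < N1" for k using bij_betw_imp_inj_on[OF e1] that by simp
 let ?g = "en (gg r)" and ?h = "en (hh r)" and ?w = "en (vw r)" and ?j = "t * Om + r"
 let ?F = "%Y. iF t Y"
 have x: "x' ?j 0 = ?F ?g" "x' ?j 1 = ?F ?h" "x' ?j 2 = ?F (sdf ?g ?h)" "x' ?j 3 = ?F (sdf ?w (?g \<inter> ?h))"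
  "x' ?j 4 = ?F ?w" "x' ?j 5 = ?F (sdf ?w (Rel t))" "x' ?j 6 = T * N2 + Tv t * N1 + xx r"
  "x' ?j 7 = ?F (sdf ?w (e1 (xx r) \<times> {..<n}))" "x' ?j 8 = T * N2 + Tb t * N1 + yy r"
  "x' ?j 9 = ?F (sdf ?w ({..<n} \<times> e1 (yy r)))" unfolding sx_def Let_def d by simp_all
 let ?v = "vbit (vcode q (%k. a (x' ?j k)))"
 have V: "?v 0 = a (?F ?g)" "?v 1 = a (?F ?h)"
  "?v 2 = a (?F (sdf ?g ?h))" "?v 3 = a (?F (sdf ?w (?g \<inter> ?h)))"
  "?v 4 = a (?F ?w)" "?v 5 = a (?F (sdf ?w (Rel t)))"
  "?v 6 = a (T * N2 + Tv t * N1 + xx r)"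
  "?v 7 = a (?F (sdf ?w (e1 (xx r) \<times> {..<n})))"
  "?v 8 = a (T * N2 + Tb t * N1 + yy r)"
  "?v 9 = a (?F (sdf ?w ({..<n} \<times> e1 (yy r))))" unfolding x[symmetric] by (rule v, simp)+
 show ?thesis unfolding sat_def sP_def passes_def V e[OF om_less(4)[OF assms(2)]] e[OF om_less(5)[OF assms(2)]] by blast
qed

text \<open>The encoding of constraint problems as words provides for \<open>q * M\<close> variables
  only.\<close>

lemma x'_less: assumes "j < sM q h N1 N2 M" shows "x' j k < q * sM q h N1 N2 M"
proof -
 define t r where "t = j div Om" and "r = j mod Om"
 have t: "t < T" using assms unfolding t_def sM_def by (rule less_mult_imp_div_less)
 have r: "r < Om" using Om_pos by (simp add: r_def)
 have F: "iF t Y < q * (T * Om)" if "Y \<in> Pow SS" for Y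
 proof -
  have "iF t Y < Suc t * N2" using en_inv[OF that] by simp
  also have "... <= T * N2" using t by (intro mult_le_mono1) simp
  also have "... <= T * Om" using N1_pos N2_pos by (intro mult_le_mono2) (simp add: sO_def)
  also have "... <= q * (T * Om)" using q by simp
  finally show ?thesis .
 qed
 have f: "T * N2 + v * N1 + X < q * (T * Om)" if "v < m" "X < N1" for v X
 proof -
  have "T * N2 + v * N1 + X < T * N2 + Suc v * N1" using that by simp
  also have "... <= T * N2 + m * N1" using that by (intro add_left_mono mult_le_mono1) simp
  also have "... <= T * Om + T * Om"
  proof (intro add_mono mult_le_mono)
   have "m * 1 <= m * (BB * deg q ^ BB)" by (rule mult_le_mono2) (simp add: sB_def deg_def Suc_le_eq)
   then show "m <= T" by (simp add: sT_def mult.assoc)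
   show "N2 <= Om" "N1 <= Om" using N1_pos N2_pos by (auto simp: sO_def)
  qed simp
  also have "... = 2 * (T * Om)" by simp
  also have "... <= q * (T * Om)" using q10 by (intro mult_le_mono1) simp
  finally show ?thesis .
 qed
 note ol = om_less[OF r]
 note i = en_in[OF ol(1)] en_in[OF ol(2)] en_in[OF ol(3)] e1_in[OF ol(4)] e1_in[OF ol(5)]
 have "sdf (en (gg r)) (en (hh r)) \<in> Pow SS" "sdf (en (vw r)) (en (gg r) \<inter> en (hh r)) \<in> Pow SS"
  "sdf (en (vw r)) (Rel t) \<in> Pow SS" "sdf (en (vw r)) (e1 (xx r) \<times> {..<n}) \<in> Pow SS"
  "sdf (en (vw r)) ({..<n} \<times> e1 (yy r)) \<in> Pow SS" using i Rel_sub[of t] by (auto simp: sdf_def)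
 note F' = this[THEN F] i(1-3)[THEN F] f[OF tv_less[OF t] ol(4)] f[OF tb_less[OF t] ol(5)]
 have I: "(b ==> y < z) ==> (~ b ==> y' < z) ==> (if b then y else y') < z" for b and y y' z :: nat by simp
 show ?thesis unfolding sM_def sx_def Let_def t_def[symmetric] r_def[symmetric] by (intro I F')
qed

abbreviation "M' == sM q h N1 N2 M"

lemma sum_bij_en: "(\<Sum>k<N2. f (en k)) = (\<Sum>Y\<in>Pow SS. f Y)" by (rule sum.reindex_bij_betw[OF en])

lemma sum_bij_e1: "(\<Sum>k<N1. f (e1 k)) = (\<Sum>Y\<in>Pow {..<n}. f Y)" by (rule sum.reindex_bij_betw[OF e1])

lemma avg_en: "avg (Pow SS) f = (\<Sum>k<N2. f (en k)) / real N2" unfolding avg_def by (simp only: sum_bij_en N2[symmetric])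

lemma avg_e1: "avg (Pow {..<n}) f = (\<Sum>k<N1. f (e1 k)) / real N1" unfolding avg_def by (simp only: sum_bij_e1 N1[symmetric])

text \<open>If no long code is near, the value is arbitrary; otherwise it is determined by
  \<open>dictator_unique\<close>. It depends on the vertex only and not on the test through which
  the vertex is reached, as an assignment of opinions requires.\<close>

definition decode :: "(nat => bool) => nat => nat" where
 "decode a v = (SOME al. al < n & avg (Pow {..<n}) (%X. of_bool (a (iA v X) ~= (al \<in> X))) < 1/4)"

lemma decode_eq:
 assumes "al < n" "avg (Pow {..<n}) (%X. of_bool (a (iA v X) ~= (al \<in> X))) < 1/4"
 shows "decode a v = al"
proof -
 let ?P = "%al. al < n & avg (Pow {..<n}) (%X. of_bool (a (iA v X) ~= (al \<in> X))) < 1/4"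
 have "?P al" using assms by blast
 then have P: "?P (decode a v)" unfolding decode_def by (rule someI[of ?P])
 show ?thesis by (rule dictator_unique[OF conjunct1[OF P] assms(1) conjunct2[OF P] assms(2)])
qed

definition rej :: "(nat => bool) => nat => bool" where
 "rej a t <-> (decode a (Tv t), decode a (Tb t)) ~: Rel t"

text \<open>Fewer violations would, by \<open>test_sound\<close>, exhibit a pair in the relation
  close to both tables, and by unique decoding that pair is the decoded one.\<close>

lemma unsat_block:
 assumes t: "t < T" and r: "rej a t"
 shows "real Om / 20 <= real (card (uns a t))"
proof (rule ccontr)
 assume c: "~ ?thesis"
 let ?F = "%Y. a (iF t Y)"
 let ?fa = "%X. a (iA (Tv t) X)"
 let ?fb = "%X. a (iA (Tb t) X)"
 define f where "f g h' w x y = (of_bool (~ passes n (Rel t) ?F ?fa ?fb g h' w x y) :: real)" for g h' w x y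
 let ?S = "\<Sum>g<N2. \<Sum>h'<N2. \<Sum>w<N2. \<Sum>x<N1. \<Sum>y<N1. f (en g) (en h') (en w) (e1 x) (e1 y)"
 let ?A = "avg (Pow SS) (%g. avg (Pow SS) (%h'. avg (Pow SS) (%w. avg (Pow {..<n}) (%x. avg (Pow {..<n}) (%y. f g h' w x y)))))"
 have "real (card (uns a t)) = (\<Sum>r<Om. of_bool (~ st a (t * Om + r)))" by (simp add: sum_of_bool_eq Int_def)
 also have "... = (\<Sum>r<Om. f (en (gg r)) (en (hh r)) (en (vw r)) (e1 (xx r)) (e1 (yy r)))"
  by (intro sum.cong refl) (simp add: sat_passes[OF t] f_def)
 also have "... = ?S" by (rule sum_om)
 finally have card: "real (card (uns a t)) =
   ?S" .
 have "?A
  = ?S / real N1 / real N1 / real N2 / real N2 / real N2" unfolding avg_en avg_e1 sum_divide_distrib[symmetric] ..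
 also have "... = real (card (uns a t)) / real Om" unfolding card by (simp add: sO_def mult_ac)
 also have "... < 1/20" using c Om_pos by (simp add: field_simps)
 finally have "?A < 1/20" .
 from test_sound[OF Rel_sub this[unfolded f_def]]
 obtain al be where ab: "(al, be) \<in> Rel t" "al < n" "be < n" "avg (Pow {..<n}) (%x. of_bool (?fa x ~= (al \<in> x))) < 1/4"
   "avg (Pow {..<n}) (%y. of_bool (?fb y ~= (be \<in> y))) < 1/4" by (elim exE conjE) (rule that)
 have "decode a (Tv t) = al" "decode a (Tb t) = be" using decode_eq[OF ab(2,4)] decode_eq[OF ab(3,5)] by auto
 then show False using r ab(1) by (simp add: rej_def)
qed

lemma unsat_blocks: "real Om / 20 * real (card {t. t < T & rej a t}) <= real (unsat q M' x' (%j. sP) a)"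
proof -
 have "real (unsat q M' x' (%j. sP) a) = (\<Sum>j<T * Om. of_bool (~ st a j))" by (simp add: unsat_def sM_def sum_of_bool_eq Int_def)
 also have "... = (\<Sum>t<T. \<Sum>r<Om. of_bool (~ st a (t * Om + r)))" by (rule sum_rect)
 also have "... = (\<Sum>t<T. real (card (uns a t)))" by (simp add: sum_of_bool_eq Int_def)
 also have "... >= (\<Sum>t<T. if rej a t then real Om / 20 else 0)" by (intro sum_mono) (auto dest: unsat_block)
 also have "(\<Sum>t<T. if rej a t then real Om / 20 else 0) = (\<Sum>t\<in>{t \<in> {..<T}. rej a t}. real Om / 20)"
  by (rule sum.inter_filter[symmetric]) simp
 finally show ?thesis by (simp add: mult.commute)
qed

lemma digits_surj: "set ls \<subseteq> {..<2 * D} ==> EX k<(2 * D) ^ length ls. map (%i. k div (2 * D) ^ i mod (2 * D)) [0..<length ls] = ls"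
proof (induction ls)
 case (Cons i ls)
 let ?d = "2 * D"
 obtain k where k: "k < ?d ^ length ls" "map (%i. k div ?d ^ i mod ?d) [0..<length ls] = ls" using Cons by auto
 have i: "i < ?d" using Cons.prems by simp
 have "k * ?d + i < Suc k * ?d" using i by simp
 also have "... <= ?d ^ length ls * ?d" using k(1) by (intro mult_le_mono1) simp
 finally have lt: "k * ?d + i < ?d ^ length (i # ls)" by (simp add: mult.commute)
 have ds: "(k * ?d + i) div ?d ^ Suc j = k div ?d ^ j" for j
  unfolding power_Suc div_mult2_eq[of "k * ?d + i" ?d "?d ^ j"] div_pair(1)[OF i] ..
 have mp: "map (%i'. (k * ?d + i) div ?d ^ i' mod ?d) [0..<length (i # ls)] = i # ls"
 proof (rule nth_equalityI)
  fix i' assume "i' < length (map (%i'. (k * ?d + i) div ?d ^ i' mod ?d) [0..<length (i # ls)])"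
  then have i': "i' < length (i # ls)" by (simp only: length_map length_upt diff_zero)
  then have e: "map (%i'. (k * ?d + i) div ?d ^ i' mod ?d) [0..<length (i # ls)] ! i' = (k * ?d + i) div ?d ^ i' mod ?d"
   by (simp only: length_map length_upt diff_zero nth_map nth_upt add_0)
  show "map (%i'. (k * ?d + i) div ?d ^ i' mod ?d) [0..<length (i # ls)] ! i' = (i # ls) ! i'"
  proof (cases i')
   case 0
   show ?thesis unfolding e unfolding 0 using div_pair(2)[OF i, of k] by (simp only: power_0 div_by_1 nth_Cons_0)
  next
   case (Suc j)
   then have j: "j < length ls" using i' by simp
   have "k div ?d ^ j mod ?d = map (%i. k div ?d ^ i mod ?d) [0..<length ls] ! j"
    using j by (simp only: length_map length_upt diff_zero nth_map nth_upt add_0)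
   then show ?thesis unfolding e unfolding Suc ds k(2) by (simp only: nth_Cons_Suc)
  qed
 qed (simp only: length_map length_upt diff_zero)
 show ?case by (rule exI[of _ "k * ?d + i"], rule conjI, rule lt, rule mp)
qed simp

lemma index_surj:
 assumes "v < m" "l < BB" "length ls = BB" "set ls \<subseteq> {..<2 * D}"
 shows "EX t<T. Tv t = v & Tl t = l & Ts t = ls"
proof -
 obtain k where k: "k < deg q ^ BB" "map (%i. k div deg q ^ i mod deg q) [0..<BB] = ls"
  using digits_surj[OF assms(4)] unfolding assms(3) degD by blast
 let ?t = "(v * BB + l) * deg q ^ BB + k"
 have "?t < Suc (v * BB + l) * deg q ^ BB" using k(1) by simp
 also have "... <= m * BB * deg q ^ BB"
 proof (rule mult_le_mono1)
  have "v * BB + l < Suc v * BB" using assms by simp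
  also have "... <= m * BB" using assms by (intro mult_le_mono1) simp
  finally show "Suc (v * BB + l) <= m * BB" by simp
 qed
 finally have "?t < T" by (simp add: sT_def)
 moreover have "Tv ?t = v" "Tl ?t = l" "Ts ?t = ls"
  unfolding tv_def tl'_def tls_def div_pair[OF k(1)] div_pair[OF assms(2)] using k(2) by auto
 ultimately show ?thesis by blast
qed

lemma rejects_rej:
 defines "A == %a v. dc (decode a v)"
 assumes "powering.rejects nb pt con (A a) (Tv t) (Tl t) (Ts t)"
 shows "rej a t" unfolding rej_def
proof (rule notI)
 have pw: "powering m (2 * D) nb pt lam (2 ^ q) (A a)" using dc_less m_pos by unfold_locales (auto simp: A_def)
 assume "(decode a (Tv t), decode a (Tb t)) \<in> Rel t"
 then have R: "tR q h n dc M x P t (decode a (Tv t)) (decode a (Tb t))" by (simp add: tRs_def)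
 obtain i where i: "i <= Tl t" and
  "~ con (full.walk (Tv t) (take i (Ts t))) (Ts t ! i) (A a (Tv t) (take i (Ts t)))
   (A a (full.walk (full.walk (Tv t) (take (Suc i) (Ts t))) (take (Tl t - i) (drop (Suc i) (Ts t))))
    (full.rl (full.walk (Tv t) (take (Suc i) (Ts t))) (take (Tl t - i) (drop (Suc i) (Ts t)))))"
  using assms(2) unfolding powering.rejects_def[OF pw] Let_def by blast
 moreover have "i < BB" using i tl_less[of t] by simp
 ultimately show False using R unfolding tR_def Let_def tb_walk[OF i] A_def by blast
qed

text \<open>Balance of a round: degree reduction leaves a fraction of at least
  \<open>\<epsilon> / (3 * q * deg q)\<close> violated edges, the walks gain a factor
  \<open>sB h\<close>, and the remaining constants are collected in \<open>kap q\<close>. The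
  hypothesis on \<open>h\<close> makes the product at least \<open>2 * \<epsilon>\<close> until
  saturation.\<close>

lemma step_sound:
 assumes gap: "!!a. \<epsilon> * real M <= real (unsat q M x P a)" and eps: "0 <= \<epsilon>"
  and h: "6 * real q * real (deg q) <= kap q * real (sB h)"
 shows "min (2 * \<epsilon>) (kap q) * real M' <= real (unsat q M' x' (%j. sP) a)"
proof -
 define A where "A v = dc (decode a v)" for v
 interpret pw: powering m "2 * D" nb pt lam "2 ^ q" h con A using dc_less m_pos by unfold_locales (auto simp: A_def)
 obtain b where b: "unsat q M x P b <= 3 * dviol pw.plur" using prep_sound[of pw.plur] pw.plur(1) by blast
 have "dviol pw.plur = pw.viol" unfolding dviol_def pw.viol_def pw.bad_def ..
 then have v: "\<epsilon> * real M <= 3 * real pw.viol" using gap[of b] b by linarith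
 have kp: "0 < kap q" using lam unfolding kap_def lam_def by (simp add: add_pos_nonneg)
 let ?X = "{(v, l, ls). v < m & l < sB h & ls \<in> full.L (sB h) & pw.rejects v l ls}"
 have "?X \<subseteq> (%t. (Tv t, Tl t, Ts t)) ` {t. t < T & rej a t}"
 proof
  fix z assume "z \<in> ?X"
  then obtain v l ls where z: "z = (v, l, ls)" "v < m" "l < sB h" "ls \<in> full.L (sB h)" "pw.rejects v l ls" by blast
  obtain t where t: "t < T" "Tv t = v" "Tl t = l" "Ts t = ls"
   using index_surj[OF z(2,3) full.L_length[OF z(4)] full.L_set[OF z(4)]] by blast
  have "rej a t" by (rule rejects_rej) (use z(5) t in "simp add: A_def[abs_def]")
  then show "z \<in> (%t. (Tv t, Tl t, Ts t)) ` {t. t < T & rej a t}" using z(1) t by blast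
 qed
 then have "card ?X <= card ((%t. (Tv t, Tl t, Ts t)) ` {t. t < T & rej a t})" by (intro card_mono) auto
 also have "... <= card {t. t < T & rej a t}" by (rule card_image_le) simp
 finally have X: "card ?X <= card {t. t < T & rej a t}" .
 define mn where "mn = min (real (sB h) * pw.mu) 1"
 have "real T * (mn * (20 * kap q)) = real (m * sB h * (2 * D) ^ sB h) * (mn / (16 * real (2 ^ q) ^ 4 * (2 + 2 * pw.lc)))"
 proof -
  have "real T = real (m * sB h * (2 * D) ^ sB h)" by (simp only: sT_def degD)
  moreover have "pw.lc = 1 / (1 - sqrt (1 - 7 / (20 * real D)))" unfolding pw.lc_def unfolding lam_def ..
  then have "20 * kap q = 1 / (16 * real (2 ^ q) ^ 4 * (2 + 2 * pw.lc))" unfolding kap_def by simp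
  ultimately show ?thesis by simp
 qed
 also have "... <= real (card ?X)" using pw.power_gap unfolding mn_def sB_def by simp
 finally have "real T * (mn * (20 * kap q)) <= real (card {t. t < T & rej a t})" using X by linarith
 then have "real Om / 20 * (real T * (mn * (20 * kap q))) <= real Om / 20 * real (card {t. t < T & rej a t})" by (intro mult_left_mono) auto
 then have u: "real M' * (mn * kap q) <= real (unsat q M' x' (%j. sP) a)" using unsat_blocks[of a] by (simp add: sM_def mult_ac)
 have "min (2 * \<epsilon>) (kap q) <= mn * kap q"
 proof (cases "real (sB h) * pw.mu <= 1")
  case True
  have mu: "pw.mu = real pw.viol / (real q * real M * real (deg q))" unfolding pw.mu_def degD by (simp only: of_nat_mult)
  have pos: "0 < real q" "0 < real M" "0 < real (deg q)" using q M by (auto simp: deg_def)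
  have "\<epsilon> / (3 * real q * real (deg q)) <= pw.mu" using v pos unfolding mu by (simp add: field_simps)
  then have "kap q * real (sB h) * (\<epsilon> / (3 * real q * real (deg q))) <= kap q * real (sB h) * pw.mu"
   using kp by (intro mult_left_mono) auto
  moreover have "6 * real q * real (deg q) * (\<epsilon> / (3 * real q * real (deg q))) <= kap q * real (sB h) * (\<epsilon> / (3 * real q * real (deg q)))"
   using h eps pos by (intro mult_right_mono) auto
  moreover have "6 * real q * real (deg q) * (\<epsilon> / (3 * real q * real (deg q))) = 2 * \<epsilon>" using pos by simp
  ultimately have "2 * \<epsilon> <= kap q * real (sB h) * pw.mu" by linarith
  then show ?thesis using True by (simp add: mn_def min_def mult_ac)
 qed (simp add: mn_def)
 then have "min (2 * \<epsilon>) (kap q) * real M' <= mn * kap q * real M'" by (intro mult_right_mono) auto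
 then show ?thesis using u by (simp add: mult_ac)
qed

lemma step_complete:
 assumes s: "!!j. j < M ==> sat q x P a j"
 shows "EX b. ALL j<M'. sat q x' (%j. sP) b j"
proof -
 define sg where "sg v = vcode q (%k. a (x (v div q) k))" for v
 have "EX A. ALL v. A v < n & (ALL p. length p <= 2 * h + 1 & set p \<subseteq> {..<deg q} --> dc (A v) p = sg (full.walk v p))"
 proof (rule choice, rule allI)
  fix v
  show "EX al. al < n & (ALL p. length p <= 2 * h + 1 & set p \<subseteq> {..<deg q} --> dc al p = sg (full.walk v p))"
   using dc_surj[of "%p. sg (full.walk v p)"] vcode_less by (auto simp: sg_def)
 qed
 then obtain A where A: "!!v. A v < n" "!!v p. length p <= sB h ==> set p \<subseteq> {..<2 * D} ==> dc (A v) p = sg (full.walk v p)"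
  unfolding sB_def degD by blast
 \<comment> \<open>The honest proof: the table of a test is the long code of the pair of opinions at
   its ends, the table of a vertex the long code of its opinion.\<close>
 define b where "b y = (if y < T * N2 then (A (Tv (y div N2)), A (Tb (y div N2))) \<in> en (y mod N2)
   else A ((y - T * N2) div N1) \<in> e1 ((y - T * N2) mod N1))" for y
 have R: "(A (Tv t), A (Tb t)) \<in> Rel t" if t: "t < T" for t
 proof -
  let ?v = "Tv t" and ?ls = "Ts t" and ?l = "Tl t"
  have "con (full.walk ?v (take i ?ls)) (?ls ! i) (dc (A ?v) (take i ?ls))
    (dc (A (Tb t)) (full.rl (full.walk ?v (take (Suc i) ?ls)) (take (?l - i) (drop (Suc i) ?ls))))"
   if i: "i < sB h" "i <= ?l" for i
  proof -
   let ?u = "full.walk ?v (take i ?ls)" and ?w = "full.walk ?v (take (Suc i) ?ls)" and ?s = "take (?l - i) (drop (Suc i) ?ls)"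
   have v: "?v < m" by (rule tv_less[OF t])
   have u: "?u < m" and w: "?w < m" by (rule full.walk_less[OF v take_set(1)])+
   have "dc (A ?v) (take i ?ls) = sg ?u" by (rule A(2)[OF _ take_set(1)]) (simp add: tls)
   moreover have "dc (A (Tb t)) (full.rl ?w ?s) = sg (full.walk (Tb t) (full.rl ?w ?s))"
    by (rule A(2)) (use full.rl_set[OF w take_set(2)] tls(1)[of t] in auto)
   moreover have "full.walk (Tb t) (full.rl ?w ?s) = ?w" unfolding tb_walk[OF i(2), symmetric] using full.walk_rl[OF w take_set(2)] by blast
   moreover have "?w = nb ?u (?ls ! i)" using i(1) tls(1)[of t] by (simp add: take_Suc_conv_app_nth full.walk_append)
   ultimately show ?thesis using prep_complete[OF s u, of "?ls ! i"] by (simp add: sg_def)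
  qed
  then show ?thesis unfolding tRs_def tR_def Let_def using A(1) by blast
 qed
 have "sat q x' (%j. sP) b j" if "j < M'" for j
 proof -
  define t r where "t = j div Om" and "r = j mod Om"
  have t: "t < T" using that unfolding t_def sM_def by (rule less_mult_imp_div_less)
  have r: "r < Om" using Om_pos by (simp add: r_def)
  have j: "j = t * Om + r" by (simp only: t_def r_def div_mult_mod_eq)
  have F: "b (iF t Y) <-> (A (Tv t), A (Tb t)) \<in> Y" if Y: "Y \<in> Pow SS" for Y
  proof -
   note e = en_inv[OF Y]
   have "iF t Y < Suc t * N2" using e by simp
   also have "... <= T * N2" using t by (intro mult_le_mono1) simp
   finally show ?thesis using e by (simp add: b_def)
  qed
  have f: "b (iA v X) <-> A v \<in> X" if X: "X \<in> Pow {..<n}" for X v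
  proof -
   have e: "inv_into {..<N1} e1 X < N1" "e1 (inv_into {..<N1} e1 X) = X"
    using bij_betw_imp_surj_on[OF e1] X inv_into_into[of X e1 "{..<N1}"] f_inv_into_f[of X e1 "{..<N1}"] by simp_all
   have "iA v X - T * N2 = v * N1 + inv_into {..<N1} e1 X" by simp
   then show ?thesis using e by (simp add: b_def)
  qed
  note ol = om_less[OF r]
  note i = en_in[OF ol(1)] en_in[OF ol(2)] en_in[OF ol(3)] e1_in[OF ol(4)] e1_in[OF ol(5)]
  let ?g = "en (gg r)" and ?h = "en (hh r)" and ?w = "en (vw r)"
  have i': "sdf ?g ?h \<in> Pow SS" "sdf ?w (?g \<inter> ?h) \<in> Pow SS" "sdf ?w (Rel t) \<in> Pow SS"
   "sdf ?w (e1 (xx r) \<times> {..<n}) \<in> Pow SS" "sdf ?w ({..<n} \<times> e1 (yy r)) \<in> Pow SS"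
   using i Rel_sub[of t] by (auto simp: sdf_def)
  show ?thesis unfolding j sat_passes[OF t r]
   using passes_dictator[OF R[OF t] A(1) A(1)] unfolding passes_def F[OF i(1)] F[OF i(2)] F[OF i(3)] i'[THEN F] f[OF i(4)] f[OF i(5)] .
 qed
 then show ?thesis by blast
qed

end

section \<open>Polynomial-time computability of a round\<close>

lemma U_cases: "U W G e ==> (!!c. c < k ==> U W G (f c)) ==> U W G (%s. if e s < k then f (e s) s else 0)"
proof (induction k)
 case (Suc k)
 have "U W G (%s. if e s = k then f k s else if e s < k then f (e s) s else 0)" by (intro U_if UB_eq U_const Suc) auto
 then show ?case by (rule U_conv) auto
qed (simp add: U_const)

lemma U_cases': "U W G e ==> (!!s. e s < k) ==> (!!c. c < k ==> U W G (f c)) ==> U W G (%s. f (e s) s)"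
 by (rule U_conv[OF U_cases[of W G e k f]]) auto

lemma UB_cases': "U W G e ==> (!!s. e s < k) ==> (!!c. c < k ==> UB W G (f c)) ==> UB W G (%s. f (e s) s)"
 unfolding UB_def by (rule U_cases'[of W G e k "%c s. if f c s then 1 else 0"])

lemma UB_if: "UB W G P ==> UB W G Q ==> UB W G R ==> UB W G (%s. if P s then Q s else R s)"
 by (rule UB_conv[OF UB_conj[OF UB_imp[of W G P Q] UB_imp[OF UB_not[of W G P], of R]]]) auto

lemma UB_ball_const: "(!!i. i < k ==> UB W G (P i)) ==> UB W G (%s. ALL i<(k::nat). P i s)"
proof (induction k)
 case (Suc k)
 have "UB W G (%s. P k s & (ALL i<k. P i s))" by (intro UB_conj Suc) auto
 then show ?case by (rule UB_conv) (auto simp: less_Suc_eq)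
qed (simp add: UB_const)

text \<open>One conditional for each element of \<open>A\<close>; generalising \<open>F\<close> lets
  the induction absorb the elements already decided.\<close>

lemma U_finite_set:
 assumes "finite A" "!!z. z \<in> A ==> UB W G (R z)"
 shows "U W G (%s. F {z \<in> A. R z s})" using assms
proof (induction A arbitrary: F)
 case (insert a A)
 have "U W G (%s. if R a s then F (insert a {z \<in> A. R z s}) else F {z \<in> A. R z s})"
  using insert.prems by (intro U_if insert.IH[of "%X. F (insert a X)"] insert.IH[of F]) auto
 then show ?case
 proof (rule U_conv)
  fix s
  have "{z \<in> insert a A. R z s} = (if R a s then insert a {z \<in> A. R z s} else {z \<in> A. R z s})" by auto
  then show "(if R a s then F (insert a {z \<in> A. R z s}) else F {z \<in> A. R z s}) = F {z \<in> insert a A. R z s}" by simp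
 qed
qed (simp add: U_const)

text \<open>Lists of constant length with entries in \<open>U\<close>. The walks have constant
  length, so recursion along them unrolls into fixed programs.\<close>

definition UL :: "('a => bool list) => ('a => nat) list => ('a => nat list) => bool" where
 "UL W G f <-> (EX gs. (ALL g:set gs. U W G g) & f = (%s. map (%g. g s) gs))"

lemma UL_map: "(!!i. U W G (f i)) ==> UL W G (%s. map (%i. f i s) xs)" unfolding UL_def by (rule exI[of _ "map f xs"]) (auto simp: comp_def)

lemma UL_take: "UL W G f ==> UL W G (%s. take i (f s))"
 unfolding UL_def by (elim exE, rule_tac x = "take i gs" in exI) (auto simp: take_map dest: in_set_takeD)

lemma UL_drop: "UL W G f ==> UL W G (%s. drop i (f s))"
 unfolding UL_def by (elim exE, rule_tac x = "drop i gs" in exI) (auto simp: drop_map dest: in_set_dropD)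

lemma U_nth: "UL W G f ==> U W G (%s. f s ! i)"
proof -
 have "ALL g:set gs. U W G g ==> U W G (%s. map (%g. g s) gs ! i)" for gs
 proof (induction gs arbitrary: i)
  case (Cons g gs)
  then show ?case by (cases i) auto
 qed (simp add: U_const)
 then show "UL W G f ==> U W G (%s. f s ! i)" by (auto simp: UL_def)
qed

lemma U_path_end:
 assumes nb: "!!v i. U W G v ==> U W G i ==> U W G (%s. nb s (v s) (i s))"
  and v: "U W G v" and ls: "UL W G ls"
 shows "U W G (%s. path_end (nb s) (v s) (ls s))"
proof -
 have "ALL g:set gs. U W G g ==> U W G v ==> U W G (%s. path_end (nb s) (v s) (map (%g. g s) gs))" for gs v
 proof (induction gs arbitrary: v)
  case (Cons g gs)
  then show ?case using Cons.IH[OF _ nb[OF Cons.prems(2), of g]] by simp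
 qed simp
 then show ?thesis using v ls by (auto simp: UL_def)
qed

lemma UL_path_rev:
 assumes nb: "!!v i. U W G v ==> U W G i ==> U W G (%s. nb s (v s) (i s))"
  and pt: "!!v i. U W G v ==> U W G i ==> U W G (%s. pt s (v s) (i s))"
  and v: "U W G v" and ls: "UL W G ls"
 shows "UL W G (%s. path_rev (nb s) (pt s) (v s) (ls s))"
proof -
 have "ALL g:set gs. U W G g ==> U W G v ==> UL W G (%s. path_rev (nb s) (pt s) (v s) (map (%g. g s) gs))" for gs v
 proof (induction gs arbitrary: v)
  case Nil
  show ?case by (auto simp: UL_def intro: exI[of _ "[]"])
 next
  case (Cons g gs)
  have "UL W G (%s. path_rev (nb s) (pt s) (nb s (v s) (g s)) (map (%g. g s) gs))"
   using Cons.IH[OF _ nb[OF Cons.prems(2), of g]] Cons.prems by simp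
  then obtain hs where hs: "ALL g:set hs. U W G g"
   "(%s. path_rev (nb s) (pt s) (nb s (v s) (g s)) (map (%g. g s) gs)) = (%s. map (%g. g s) hs)" by (auto simp: UL_def)
  show ?case unfolding UL_def by (rule exI[of _ "hs @ [%s. pt s (v s) (g s)]"])
    (use hs(1) fun_cong[OF hs(2)] pt[OF Cons.prems(2), of g] Cons.prems(1) in auto)
 qed
 then show ?thesis using v ls by (auto simp: UL_def)
qed

text \<open>Vanishing outside \<open>{..<d}\<close> makes this a finite case distinction; it is the
  reason for the requirement \<open>dc_out\<close> on opinions.\<close>

lemma U_finite_list:
 assumes "UL W G ls" "!!p. ~ set p \<subseteq> {..<d} ==> F p = 0"
 shows "U W G (%s. F (ls s))"
proof -
 have "ALL g:set gs. U W G g ==> (!!p. ~ set p \<subseteq> {..<d} ==> F p = 0) ==> U W G (%s. F (map (%g. g s) gs))" for gs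
 proof (induction gs arbitrary: F)
  case (Cons g gs)
  have "U W G (%s. if g s < d then (%c s. F (c # map (%g. g s) gs)) (g s) s else 0)"
  proof (rule U_cases)
   fix c assume "c < d"
   then show "U W G (%s. F (c # map (%g. g s) gs))" using Cons.prems by (intro Cons.IH[of "%p. F (c # p)"]) auto
  qed (use Cons.prems in simp)
  then show ?case by (rule U_conv) (simp add: Cons.prems(2))
 qed (simp add: U_const)
 then show ?thesis using assms by (auto simp: UL_def)
qed

text \<open>A constraint satisfaction problem is encoded by the table of the characteristic functions of
 all \<open>x j k\<close>, followed by the table of the predicates.\<close>

definition csz :: "nat => nat => nat" where "csz q M = M * q * (q * M) + M * 2 ^ q"

definition cword where
 "cword q M x P = map (%i. if i < M * q * (q * M) then x (i div (q * M) div q) (i div (q * M) mod q) = i mod (q * M)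
   else P ((i - M * q * (q * M)) div 2 ^ q) ((i - M * q * (q * M)) mod 2 ^ q)) [0..<csz q M]"

text \<open>The size is recovered from the length alone, which is strictly increasing in
  \<open>M\<close>.\<close>

definition cM :: "nat => bool list => nat" where
 "cM q w = first (Suc (length w)) (%M. csz q M = length w)"

text \<open>On a word that is no proper table the row may be empty, and the search returns its bound
  \<open>q * cM q w\<close>, just above all proper variables.\<close>

definition cx :: "nat => bool list => nat => nat => nat" where
 "cx q w j k = first (q * cM q w) (%y. wbit w ((j * q + k) * (q * cM q w) + y))"

definition cP :: "nat => bool list => nat => nat => bool" where
 "cP q w j v = wbit w (cM q w * q * (q * cM q w) + (j * 2 ^ q + v))"

lemma length_cword: "length (cword q M x P) = csz q M" by (simp add: cword_def)

lemma csz_less: "M < M' ==> csz q M < csz q M'" unfolding csz_def by (intro add_le_less_mono mult_le_mono) auto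

lemma cM_cword [simp]: "cM q (cword q M x P) = M" unfolding cM_def length_cword
proof (rule first_eq)
 have "M * 1 <= M * 2 ^ q" by (intro mult_le_mono) auto
 then show "M < Suc (csz q M)" unfolding csz_def by linarith
 show "csz q j ~= csz q M" if "j < M" for j using csz_less[OF that, of q] by simp
qed simp

lemma cx_cword: assumes "j < M" "k < q" "x j k < q * M"
 shows "cx q (cword q M x P) j k = x j k" unfolding cx_def cM_cword
proof (rule first_eq[OF assms(3)])
 have b: "wbit (cword q M x P) ((j * q + k) * (q * M) + y) <-> x j k = y" if y: "y < q * M" for y
 proof -
  have l: "(j * q + k) * (q * M) + y < M * q * (q * M)" by (rule pair_less[OF pair_less[OF assms(1,2)] y])
  then have "(j * q + k) * (q * M) + y < csz q M" by (simp add: csz_def)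
  then show ?thesis unfolding wbit_def length_cword
   using l div_pair[OF y, of "j * q + k"] div_pair[OF assms(2), of j] by (simp add: cword_def)
 qed
 show "wbit (cword q M x P) ((j * q + k) * (q * M) + x j k)" using b[OF assms(3)] by simp
 show "~ wbit (cword q M x P) ((j * q + k) * (q * M) + y)" if "y < x j k" for y using b[of y] assms(3) that by simp
qed

lemma cP_cword: assumes "j < M" "v < 2 ^ q"
 shows "cP q (cword q M x P) j v = P j v"
proof -
 let ?a = "M * q * (q * M)" and ?b = "j * 2 ^ q + v"
 have "?a + ?b < csz q M" using pair_less[OF assms] by (simp add: csz_def)
 then show ?thesis unfolding cP_def cM_cword wbit_def length_cword using div_pair[OF assms(2), of j] by (simp add: cword_def)
qed

definition cunsat :: "nat => bool list => (nat => bool) => nat" where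
 "cunsat q w a = unsat q (cM q w) (cx q w) (cP q w) a"

lemma cunsat_cword:
 assumes "!!j k. j < M ==> k < q ==> x j k < q * M"
 shows "cunsat q (cword q M x P) a = unsat q M x P a"
proof -
 have "sat q (cx q (cword q M x P)) (cP q (cword q M x P)) a j <-> sat q x P a j" if j: "j < M" for j
 proof -
  have "vcode q (%k. a (cx q (cword q M x P) j k)) = vcode q (%k. a (x j k))" by (rule vcode_cong) (simp add: cx_cword j assms)
  then show ?thesis unfolding sat_def by (simp add: cP_cword[OF j vcode_less])
 qed
 then show ?thesis unfolding cunsat_def unsat_def cM_cword by (metis (no_types, lifting))
qed

text \<open>A word read as a number would be exponentially large in unary, so outputs are described
  by their length and their single bits.\<close>

definition UF :: "(bool list => bool list) => bool" where
 "UF F <-> U (%w. w) [] (%w. length (F w)) & UB fst [snd] (%p. wbit (F (fst p)) (snd p))"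

lemma U_snd [U_intros]: "U (%p. W (fst p)) (lift G) snd" by (rule U_var) (simp add: lift_def)

lemma U_cM [U_intros]: "U W G (%s. cM q (W s))" unfolding cM_def csz_def by (rule U_intros | assumption | erule U_weaken1)+

lemma U_cx [U_intros]: "U W G j ==> U W G k ==> U W G (%s. cx q (W s) (j s) (k s))" unfolding cx_def
 by (rule U_intros | assumption | erule U_weaken1)+

lemma UB_cP [U_intros]: "U W G j ==> U W G v ==> UB W G (%s. cP q (W s) (j s) (v s))" unfolding cP_def
 by (rule U_intros | assumption | erule U_weaken1)+

lemma U_mgg [U_intros]: "U W G n ==> U W G p ==> U W G k ==> U W G (%s. mgg (n s) (p s) (k s))" unfolding mgg_def Let_def
 by (rule U_intros | assumption | erule U_weaken1)+

lemma U_opp [U_intros]: "U W G k ==> U W G (%s. opp (k s))" unfolding opp_def by (rule U_intros | assumption | erule U_weaken1)+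

lemma side_first: "side m = first (Suc m) (%n. m <= n * n)"
proof (rule first_eq[symmetric])
 have ex: "m <= m * m" by (cases m) auto
 show "m <= side m * side m" unfolding side_def by (rule LeastI[of "%n. m <= n * n", OF ex])
 have "side m <= m" unfolding side_def by (rule Least_le[of "%n. m <= n * n", OF ex])
 then show "side m < Suc m" by simp
 show "~ m <= n * n" if "n < side m" for n using not_less_Least that unfolding side_def by blast
qed

lemma U_side [U_intros]: "U W G m ==> U W G (%s. side (m s))" unfolding side_first by (rule U_intros | assumption | erule U_weaken1)+

lemma U_xnb [U_intros]: "U W G m ==> U W G i ==> U W G k ==> U W G (%s. xnb (m s) (i s) (k s))" unfolding xnb_def
 by (rule U_intros | assumption | erule U_weaken1)+

lemma U_xpt [U_intros]: "U W G m ==> U W G i ==> U W G k ==> U W G (%s. xpt (m s) (i s) (k s))" unfolding xpt_def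
 by (rule U_intros | assumption | erule U_weaken1)+

lemma U_ovar [U_intros]: "U W G v ==> U W G (%s. ovar q (cx q (W s)) (v s))" unfolding ovar_def
 by (rule U_intros | assumption | erule U_weaken1)+

lemma U_ocnt [U_intros]: "U W G v ==> U W G (%s. ocnt q (cM q (W s)) (cx q (W s)) (v s))" unfolding ocnt_def
 by (rule U_intros | assumption | erule U_weaken1)+

lemma U_orank [U_intros]: "U W G v ==> U W G (%s. orank q (cx q (W s)) (v s))" unfolding orank_def
 by (rule U_intros | assumption | erule U_weaken1)+

lemma U_onth [U_intros]: "U W G v ==> U W G r ==> U W G (%s. onth q (cM q (W s)) (cx q (W s)) (v s) (r s))" unfolding onth_def
 by (rule U_intros | assumption | erule U_weaken1)+

lemma U_gnb [U_intros]: "U W G v ==> U W G i ==> U W G (%s. gnb q (cM q (W s)) (cx q (W s)) (v s) (i s))" unfolding gnb_def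
 by (rule U_intros | assumption | erule U_weaken1)+

lemma U_gpt [U_intros]: "U W G v ==> U W G i ==> U W G (%s. gpt q (cM q (W s)) (cx q (W s)) (v s) (i s))" unfolding gpt_def
 by (rule U_intros | assumption | erule U_weaken1)+

lemma UB_vbit: assumes a: "U W G a" "!!s. a s < 2 ^ q" and v: "U W G v" and q: "0 < q"
 shows "UB W G (%s. vbit (a s) (v s mod q))"
proof (rule UB_cases'[OF a(1,2), where f = "%a s. vbit a (v s mod q)"])
 fix c show "UB W G (%s. vbit c (v s mod q))" by (rule UB_fin[OF U_mod[OF v U_const], where k = q]) (simp add: q)
qed

lemma UB_gcon: assumes "U W G v" "U W G i" "U W G a" "!!s. a s < 2 ^ q" "U W G b" "!!s. b s < 2 ^ q" "0 < q"
 shows "UB W G (%s. gcon q (cM q (W s)) (cx q (W s)) (cP q (W s)) (v s) (i s) (a s) (b s))"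
proof -
 have "UB W G (%s. (i s < 32 --> vbit (a s) (v s mod q) = vbit (b s) (gnb q (cM q (W s)) (cx q (W s)) (v s) (i s) mod q)) &
  (~ i s < 32 --> 64 <= i s & i s < 64 + q --> a s = b s & cP q (W s) (v s div q) (a s)))"
  by (intro UB_conj UB_imp UB_not UB_less UB_le UB_iff UB_vbit UB_eq UB_cP U_gnb U_div U_const assms)
 then show ?thesis by (rule UB_conv) (simp add: gcon_def)
qed

lemma wbit_cword: "wbit (cword q M x P) i <-> i < csz q M &
  (if i < M * q * (q * M) then x (i div (q * M) div q) (i div (q * M) mod q) = i mod (q * M)
   else P ((i - M * q * (q * M)) div 2 ^ q) ((i - M * q * (q * M)) mod 2 ^ q))"
proof (cases "i < csz q M")
 case True
 then have "cword q M x P ! i = (if i < M * q * (q * M) then x (i div (q * M) div q) (i div (q * M) mod q) = i mod (q * M)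
   else P ((i - M * q * (q * M)) div 2 ^ q) ((i - M * q * (q * M)) mod 2 ^ q))" unfolding cword_def by (subst nth_map) auto
 then show ?thesis using True unfolding wbit_def length_cword by blast
qed (simp add: wbit_def length_cword)

lemma UF_cword:
 assumes M: "U (%w. w) [] M"
  and x: "!!j k. U fst [snd] j ==> U fst [snd] k ==> U fst [snd] (%p. x (fst p) (j p) (k p))"
  and P: "!!j v. U fst [snd] j ==> U fst [snd] v ==> (!!p. v p < 2 ^ q) ==> UB fst [snd] (%p. P (fst p) (j p) (v p))"
 shows "UF (%w. cword q (M w) (x w) (P w))"
proof -
 have c: "U W G f ==> U W G (%s. csz q (f s))" for W G and f :: "'a => nat" unfolding csz_def by (intro U_add U_mult U_const)
 have "U (%w. w) [] (%w. csz q (M w))" unfolding csz_def by (intro U_add U_mult U_const M)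
 then have 1: "U (%w. w) [] (%w. length (cword q (M w) (x w) (P w)))" unfolding length_cword .
 have M': "U fst [snd] (%p. M (fst p))" using U_weaken1[OF M] by simp
 have snd: "U fst [snd] snd" by (rule U_var) simp
 let ?t = "%p. snd p - M (fst p) * q * (q * M (fst p))"
 have "UB fst [snd] (%p. snd p < csz q (M (fst p)) &
   (if snd p < M (fst p) * q * (q * M (fst p)) then x (fst p) (snd p div (q * M (fst p)) div q) (snd p div (q * M (fst p)) mod q) = snd p mod (q * M (fst p))
    else P (fst p) (?t p div 2 ^ q) (?t p mod 2 ^ q)))"
  by (intro UB_conj UB_if UB_less UB_eq x U_div U_mod U_mult U_const U_diff M' snd P c) auto
 then have 2: "UB fst [snd] (%p. wbit (cword q (M (fst p)) (x (fst p)) (P (fst p))) (snd p))" unfolding wbit_cword .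
 show ?thesis unfolding UF_def using 1 2 by blast
qed

lemma unsat_0: "unsat q M x P a = 0 <-> (ALL j<M. sat q x P a j)" by (auto simp: unsat_def)

context params begin

lemma N_pos: "0 < N1" "0 < N2" "0 < sO N1 N2" using bij_betw_same_card[OF en] bij_betw_same_card[OF e1] by (auto simp: sO_def card_Pow)

lemma q_pos: "0 < q" using q10 by simp

lemma U_tv [U_intros]: "U W G t ==> U W G (%s. tv q h (t s))" unfolding tv_def by (rule U_intros | assumption)+

lemma U_tl [U_intros]: "U W G t ==> U W G (%s. tl' q h (t s))" unfolding tl'_def by (rule U_intros | assumption)+

lemma UL_tls: "U W G t ==> UL W G (%s. tls q h (t s))" unfolding tls_def by (rule UL_map) (rule U_intros | assumption)+

lemma U_tb [U_intros]: "U W G t ==> U W G (%s. tb q h (cM q (W s)) (cx q (W s)) (t s))"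
proof -
 assume t: "U W G t"
 show ?thesis unfolding tb_def
  by (rule U_cases'[OF U_tl[OF t], where k = "sB h" and f = "%l s. path_end (gnb q (cM q (W s)) (cx q (W s))) (tv q h (t s)) (take (Suc l) (tls q h (t s)))"])
   (auto intro!: U_path_end U_gnb U_tv UL_take UL_tls t simp: tl'_def sB_def)
qed

lemma UB_tR: assumes t: "U W G t"
 shows "UB W G (%s. tR q h n dc (cM q (W s)) (cx q (W s)) (cP q (W s)) (t s) al be)"
proof -
 let ?nb = "%s. gnb q (cM q (W s)) (cx q (W s))" and ?pt = "%s. gpt q (cM q (W s)) (cx q (W s))"
 have dc: "U W G p ==> UL W G r ==> U W G (%s. dc al' (r s))" for al' p r by (rule U_finite_list[where d = "deg q"]) (use dc_out in auto)
 note UL = UL_take UL_drop UL_tls t U_path_end U_gnb U_gpt U_tv U_nth UL_path_rev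
 \<comment> \<open>\<open>take\<close> and \<open>drop\<close> need constant arguments, so the
   length of the test is replaced by a constant \<open>l\<close> ranging over its finitely many
   values.\<close>
 have "UB W G (%s. ALL i<sB h. ALL l<sB h. tl' q h (t s) = l --> i <= l -->
   gcon q (cM q (W s)) (cx q (W s)) (cP q (W s)) (path_end (?nb s) (tv q h (t s)) (take i (tls q h (t s)))) (tls q h (t s) ! i)
   (dc al (take i (tls q h (t s))))
    (dc be (path_rev (?nb s) (?pt s) (path_end (?nb s) (tv q h (t s)) (take (Suc i) (tls q h (t s)))) (take (l - i) (drop (Suc i) (tls q h (t s)))))))"
  by (intro UB_ball_const UB_imp UB_eq U_tl UB_const U_const UB_gcon dc[OF t] UL) (auto intro: dc_less q_pos)
 then show ?thesis by (rule UB_conv) (auto simp: tR_def Let_def tl'_def sB_def)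
qed

lemma U_tRs:
 assumes t: "U W G t"
 shows "U W G (%s. F (tRs q h n dc (cM q (W s)) (cx q (W s)) (cP q (W s)) (t s)))"
proof -
 let ?Z = "%s. {z \<in> {..<n} \<times> {..<n}. (%(al, be) s. tR q h n dc (cM q (W s)) (cx q (W s)) (cP q (W s)) (t s) al be) z s}" and ?R = "%s. tRs q h n dc (cM q (W s)) (cx q (W s)) (cP q (W s)) (t s)"
 have "U W G (%s. F (?Z s))" by (rule U_finite_set) (auto intro: UB_tR t)
 then show ?thesis
 proof (rule U_conv)
  fix s
  have "?Z s =
   ?R s" unfolding tRs_def by auto
  then show "F (?Z s) =
   F (?R s)" by simp
 qed
qed

lemma U_o: assumes "U W G r"
 shows "U W G (%s. ox N1 (r s))" "U W G (%s. oy N1 (r s))" "U W G (%s. oh N1 N2 (r s))" "U W G (%s. ow N1 N2 (r s))"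
  "U W G (%s. og N1 N2 (r s))" unfolding ox_def oy_def oh_def ow_def og_def by (intro U_mod U_div U_const assms)+

lemma o_less: "ox N1 r < N1" "oy N1 r < N1" "oh N1 N2 r < N2" "ow N1 N2 r < N2" "og N1 N2 (r mod sO N1 N2) < N2"
proof -
 have "r mod sO N1 N2 < N2 * (N2 * N2 * N1 * N1)" using N_pos(3) by (simp add: sO_def mult_ac)
 then show "og N1 N2 (r mod sO N1 N2) < N2" unfolding og_def by (rule less_mult_imp_div_less)
qed (use N_pos in "auto simp: oh_def ow_def ox_def oy_def")

lemma U_fin2: "U W G a ==> (!!s. a s < k) ==> U W G b ==> (!!s. b s < k') ==> U W G (%s. F (a s) (b s))"
 by (rule U_cases'[of W G a k "%a s. F a (b s)"], assumption, blast, rule U_fin)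

lemma U_sx [U_intros]:
 assumes j: "U W G j" and k: "U W G k"
 shows "U W G (%s. sx q h n dc en e1 N1 N2 (cM q (W s)) (cx q (W s)) (cP q (W s)) (j s) (k s))"
proof -
 let ?r = "%s. j s mod sO N1 N2"
 have r: "U W G ?r" and t: "U W G (%s. j s div sO N1 N2)" by (intro U_mod U_div j U_const)+
 note o = U_o[OF r]
 let ?i = "inv_into {..<N2} en" and ?g = "%s. en (og N1 N2 (?r s))" and ?h = "%s. en (oh N1 N2 (?r s))" and ?w = "%s. en (ow N1 N2 (?r s))"
 have 0: "U W G (%s. ?i (?g s))" "U W G (%s. ?i (?h s))"
  "U W G (%s. ?i (?w s))" by (rule U_fin[OF o(5), where k = N2 and F = "%a. ?i (en a)"] U_fin[OF o(4), where k = N2 and F = "%a. ?i (en a)"]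
   U_fin[OF o(3), where k = N2 and F = "%a. ?i (en a)"], rule o_less)+
 have 2: "U W G (%s. ?i (sdf (?g s) (?h s)))"
  by (rule U_fin2[OF o(5) _ o(3), where F = "%a b. ?i (sdf (en a) (en b))" and k = N2 and k' = N2]; rule o_less)
 have 3: "U W G (%s. ?i (sdf (?w s) (?g s \<inter> ?h s)))"
  by (rule U_cases'[OF o(4), where k = N2 and f = "%w s. ?i (sdf (en w) (?g s \<inter> ?h s))"],
    rule o_less, rule U_fin2[OF o(5) _ o(3), where k = N2 and k' = N2], (rule o_less)+)
 have 5: "U W G (%s. ?i (sdf (?w s) (tRs q h n dc (cM q (W s)) (cx q (W s)) (cP q (W s)) (j s div sO N1 N2))))"
  by (rule U_cases'[OF o(4), where k = N2 and f = "%w s. ?i (sdf (en w) (tRs q h n dc (cM q (W s)) (cx q (W s)) (cP q (W s)) (j s div sO N1 N2)))"],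
    rule o_less, rule U_tRs[OF t])
 have 7: "U W G (%s. ?i (sdf (?w s) (e1 (ox N1 (?r s)) \<times> {..<n})))"
  by (rule U_fin2[OF o(4) _ o(1), where F = "%a b. ?i (sdf (en a) (e1 b \<times> {..<n}))" and k = N2 and k' = N1]; rule o_less)
 have 9: "U W G (%s. ?i (sdf (?w s) ({..<n} \<times> e1 (oy N1 (?r s)))))"
  by (rule U_fin2[OF o(4) _ o(2), where F = "%a b. ?i (sdf (en a) ({..<n} \<times> e1 b))" and k = N2 and k' = N1]; rule o_less)
 show ?thesis unfolding sx_def Let_def sT_def by (intro U_if UB_eq k U_const U_add U_mult t 0 2 3 5 7 9 o U_tv U_tb U_cM)
qed

definition dstepF :: "bool list => bool list" where
 "dstepF w = cword q (sM q h N1 N2 (cM q w)) (sx q h n dc en e1 N1 N2 (cM q w) (cx q w) (cP q w)) (%j. sP)"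

lemma UF_dstepF: "UF dstepF"
proof -
 have "UF (%w. cword q (sM q h N1 N2 (cM q w)) (sx q h n dc en e1 N1 N2 (cM q w) (cx q w) (cP q w)) (%j. sP))"
 proof (rule UF_cword)
  show "U (%w. w) [] (%w. sM q h N1 N2 (cM q w))" unfolding sM_def sT_def by (rule U_intros)+
  show "UB fst [snd] (%p. sP (v p))" if "U fst [snd] v" "!!p. v p < 2 ^ q" for v :: "bool list \<times> nat => nat"
   by (rule UB_fin[OF that])
 qed (rule U_sx)
 then show ?thesis unfolding dstepF_def[abs_def] .
qed

lemma cM_dstepF: "cM q (dstepF w) = sM q h N1 N2 1 * cM q w" "length (dstepF w) = csz q (cM q (dstepF w))"
 by (simp_all add: dstepF_def length_cword sM_def sT_def)

lemma cP_dstepF: "j < cM q (dstepF w) ==> v < 2 ^ q ==> cP q (dstepF w) j v = sP v" unfolding dstepF_def cM_cword by (rule cP_cword)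

lemma unsat_dstepF:
 assumes "1 <= cM q w"
 shows "cunsat q (dstepF w) a = unsat q (sM q h N1 N2 (cM q w)) (sx q h n dc en e1 N1 N2 (cM q w) (cx q w) (cP q w)) (%j. sP) a"
proof -
 interpret dstep q h n dc en e1 N1 N2 "cM q w" "cx q w" "cP q w" using q_pos assms by unfold_locales auto
 show ?thesis unfolding dstepF_def by (rule cunsat_cword) (rule x'_less)
qed

lemma dstepF_sound:
 assumes M: "1 <= cM q w" and h: "6 * real q * real (deg q) <= kap q * real (sB h)"
  and gp: "!!a. \<epsilon> * real (cM q w) <= real (cunsat q w a)" "0 <= \<epsilon>"
 shows "min (2 * \<epsilon>) (kap q) * real (cM q (dstepF w)) <= real (cunsat q (dstepF w) a)"
proof -
 interpret dstep q h n dc en e1 N1 N2 "cM q w" "cx q w" "cP q w" using q_pos M by unfold_locales auto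
 have "cM q (dstepF w) = sM q h N1 N2 (cM q w)" by (simp add: dstepF_def)
 then show ?thesis using step_sound[OF gp(1)[unfolded cunsat_def] gp(2) h, of a] unfolding unsat_dstepF[OF M] by simp
qed

lemma dstepF_complete:
 assumes M: "1 <= cM q w" and s: "cunsat q w a = 0"
 shows "EX b. cunsat q (dstepF w) b = 0"
proof -
 interpret dstep q h n dc en e1 N1 N2 "cM q w" "cx q w" "cP q w" using q_pos M by unfold_locales auto
 have "!!j. j < cM q w ==> sat q (cx q w) (cP q w) a j" using s by (simp add: cunsat_def unsat_0)
 then show ?thesis using step_complete unfolding unsat_dstepF[OF M] unsat_0 by blast
qed

end

lemma kap_pos: "0 < kap q"
proof -
 have "7 / (20 * real (64 + q)) < 1" "0 < 7 / (20 * real (64 + q))" by auto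
 then have "sqrt (1 - 7 / (20 * real (64 + q))) < 1" by simp
 then show ?thesis unfolding kap_def by (simp add: add_pos_nonneg)
qed

text \<open>The factor \<open>K\<close> does not depend on \<open>w\<close>, and
  \<open>kap q\<close> does not depend on the walk length, so rounds can be iterated with the same
  constants.\<close>

theorem gap_doubling:
 assumes q: "10 <= q"
 shows "EX F K. UF F & 0 < K & (ALL w. cM q (F w) = K * cM q w & length (F w) = csz q (cM q (F w)) &
   (ALL j<cM q (F w). ALL v<2 ^ q. cP q (F w) j v = sP v) & (1 <= cM q w -->
   (ALL a. cunsat q w a = 0 --> (EX b. cunsat q (F w) b = 0)) &
   (ALL \<epsilon>>=0. (ALL a. \<epsilon> * real (cM q w) <= real (cunsat q w a)) -->
    (ALL a. min (2 * \<epsilon>) (kap q) * real (cM q (F w)) <= real (cunsat q (F w) a)))))"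
proof -
 obtain h where h: "6 * real q * real (deg q) / kap q <= real h" using real_arch_simple by blast
 have "6 * real q * real (deg q) <= kap q * real h" using h kap_pos[of q] by (simp add: field_simps)
 also have "... <= kap q * real (sB h)" using kap_pos[of q] by (intro mult_left_mono) (auto simp: sB_def)
 finally have h': "6 * real q * real (deg q) <= kap q * real (sB h)" .
 obtain n dc en e1 N1 N2 where "params q h n dc en e1 N1 N2" by (rule params_exist[OF q])
 then interpret params q h n dc en e1 N1 N2 .
 have "0 < sM q h N1 N2 1" using N_pos q by (simp add: sM_def sT_def sB_def deg_def)
 then show ?thesis using UF_dstepF cM_dstepF cP_dstepF dstepF_complete dstepF_sound[OF _ h']
  by (intro exI[of _ dstepF] exI[of _ "sM q h N1 N2 1"] conjI allI impI) blast+
qed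

section \<open>Composition of polynomial-time functions\<close>

lemma runs_Do_even:
 assumes "!!r v. odd v ==> F r v = (r v, Stay)"
 shows "runs (Do F) (mk c u) 1 (mk c (%i. act (F (rd (mk c u)) (2 * i)) (u i)))"
proof -
 have "exec (Do F) (mk c u) 1 (%t. act (F (rd (mk c u)) t) (mk c u t))" by (rule exec_Do) simp
 moreover have "(%t. act (F (rd (mk c u)) t) (mk c u t)) = mk c (%i. act (F (rd (mk c u)) (2 * i)) (u i))"
 proof
  fix t
  show "act (F (rd (mk c u)) t) (mk c u t) = mk c (%i. act (F (rd (mk c u)) (2 * i)) (u i)) t"
  proof (cases "odd t")
   case True
   then show ?thesis unfolding assms[OF True] act_stay by (simp add: mk_def)
  next
   case False
   then obtain i where "t = 2 * i" by (metis evenE)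
   then show ?thesis by (simp only: mk_even)
  qed
 qed
 ultimately show ?thesis unfolding runs_def by auto
qed

lemma rd_even: "rd (mk c u) (2 * i) = read (u i)" by (simp only: rd_def mk_even)

definition xact :: "nat => nat => (nat => nat) => nat => nat \<times> head_move" where
 "xact s d r v = (if v = 2 * s then 0 else if v = 2 * d then (if r (2 * s) < 3 then r (2 * s) else 0) else r v, if v = 2 * s | v = 2 * d then Move_Right else Stay)"

definition bact :: "nat => nat => (nat => nat) => nat => nat \<times> head_move" where
 "bact s d r v = (r v, if v = 2 * s | v = 2 * d then Move_Left else Stay)"

text \<open>Moves the word on tape \<open>s\<close> to tape \<open>d\<close>, and erases it if \<open>s = d\<close>.\<close>

definition xfer :: "nat => nat => nat => prog" where
 "xfer s d j = Loop (%r. r (2 * s) ~= 0) (Do (xact s d) ;; inc j) ;; Loop (pos j) (dec j ;; Do (bact s d))"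

lemma local_cond_read: "local_cond (Suc i) (%r. P (r i))" by (auto simp: local_cond_def)

lemma well_xfer [simp]: "well (xfer s d j)"
proof -
 have "local_act (2 * s + 2 * d + 1) 3 (xact s d)" "local_act (2 * s + 2 * d + 1) 3 (bact s d)"
  by (auto simp: local_act_def xact_def bact_def)
 then have "well (Do (xact s d))" "well (Do (bact s d))" unfolding well_def wfpr.simps by blast+
 then show ?thesis unfolding xfer_def well_Seq by (intro conjI well_Loop[OF local_cond_read[of "2 * s" "%x. x ~= 0"]] well_Loop_pos) auto
qed

lemma runs_xfer:
 assumes s: "u s = (f, 0)" and f: "!!i. i < l ==> f (int i) ~= 0 & f (int i) < 3" "f (int l) = 0"
  and d: "d = s | u d = blank_tape" and j: "c j = 0"
 shows "runs (xfer s d j) (mk c u) (8 * l + 3)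
  (mk c (u(d := (%i. if 0 <= i & i < int l then f i else 0, 0), s := (%i. if 0 <= i & i < int l then 0 else f i, 0))))"
proof -
 define U where "U k h = u(d := (%i. if 0 <= i & i < int k then f i else 0, int h), s := (%i. if 0 <= i & i < int k then 0 else f i, int h))" for k h
 have U0: "U 0 0 = u" using s d by (auto simp: U_def blank_tape_def fun_eq_iff)
 have 1: "runs (Loop (%r. r (2 * s) ~= 0) (Do (xact s d) ;; inc j)) (mk (c(j := 0)) (U 0 0)) (l * (3 + 1) + 1) (mk (c(j := l)) (U l l))"
 proof (rule runs_Loop[of l "%r. r (2 * s) ~= 0" "%k. mk (c(j := k)) (U k k)"])
  fix k assume k: "k < l"
  have r: "read (U k k s) = f (int k)" by (simp add: U_def)
  have "(%i. act (xact s d (rd (mk (c(j := k)) (U k k))) (2 * i)) (U k k i)) = U (Suc k) (Suc k)"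
  proof
   fix i
   have n: "act (read x, Stay) x = x" for x by (cases x) simp
   show "act (xact s d (rd (mk (c(j := k)) (U k k))) (2 * i)) (U k k i) = U (Suc k) (Suc k) i" using f(1)[OF k] unfolding xact_def rd_even r
    by (auto simp: U_def n fun_eq_iff)
  qed
  moreover have "runs (Do (xact s d)) (mk (c(j := k)) (U k k)) 1
    (mk (c(j := k)) (%i. act (xact s d (rd (mk (c(j := k)) (U k k))) (2 * i)) (U k k i)))" by (rule runs_Do_even) (auto simp: xact_def)
  ultimately have 1: "runs (Do (xact s d)) (mk (c(j := k)) (U k k)) 1 (mk (c(j := k)) (U (Suc k) (Suc k)))" by simp
  have "runs (Do (xact s d) ;; inc j) (mk (c(j := k)) (U k k)) 3 (mk ((c(j := k))(j := Suc ((c(j := k)) j))) (U (Suc k) (Suc k)))"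
   by (rule runs_Seq[OF 1 runs_inc]) simp
  then show "rd (mk (c(j := k)) (U k k)) (2 * s) ~= 0 &
    runs (Do (xact s d) ;; inc j) (mk (c(j := k)) (U k k)) 3 (mk (c(j := Suc k)) (U (Suc k) (Suc k)))"
   using f(1)[OF k] by (simp add: rd_even r del: read.simps)
 next
  show "~ rd (mk (c(j := l)) (U l l)) (2 * s) ~= 0" using f(2) by (simp add: rd_even) (simp add: U_def)
 qed
 have 2: "runs (Loop (pos j) (dec j ;; Do (bact s d))) (mk (c(j := l - 0)) (U l (l - 0))) (l * (3 + 1) + 1) (mk (c(j := l - l)) (U l (l - l)))"
 proof (rule runs_Loop[of l "pos j" "%k. mk (c(j := l - k)) (U l (l - k))"])
  fix k assume k: "k < l"
  let ?c = "(c(j := l - k))(j := (c(j := l - k)) j - 1)"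
  have c: "?c = c(j := l - Suc k)" by simp
  have "(%i. act (bact s d (rd (mk ?c (U l (l - k)))) (2 * i)) (U l (l - k) i)) = U l (l - Suc k)"
  proof
   fix i
   have n: "act (read x, m) x = (fst x, snd x + head_shift m)" for x m by (cases x) simp
   show "act (bact s d (rd (mk ?c (U l (l - k)))) (2 * i)) (U l (l - k) i) = U l (l - Suc k) i"
    unfolding bact_def rd_even n using k by (auto simp: U_def of_nat_diff)
  qed
  moreover have "runs (Do (bact s d)) (mk ?c (U l (l - k))) 1
    (mk ?c (%i. act (bact s d (rd (mk ?c (U l (l - k)))) (2 * i)) (U l (l - k) i)))" by (rule runs_Do_even) (auto simp: bact_def)
  ultimately have 1: "runs (Do (bact s d)) (mk ?c (U l (l - k))) 1 (mk ?c (U l (l - Suc k)))" by simp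
  have "runs (dec j ;; Do (bact s d)) (mk (c(j := l - k)) (U l (l - k))) 3 (mk ?c (U l (l - Suc k)))"
   by (rule runs_Seq[OF runs_dec 1]) (use k in auto)
  then show "pos j (rd (mk (c(j := l - k)) (U l (l - k)))) &
    runs (dec j ;; Do (bact s d)) (mk (c(j := l - k)) (U l (l - k))) 3 (mk (c(j := l - Suc k)) (U l (l - Suc k)))"
   using k unfolding c by simp
 qed simp
 have c0: "c(j := 0) = c" using j by auto
 have "runs (xfer s d j) (mk (c(j := 0)) (U 0 0)) (8 * l + 3) (mk (c(j := l - l)) (U l (l - l)))"
  unfolding xfer_def by (rule runs_Seq[OF 1 2[unfolded diff_zero]]) simp
 then show ?thesis unfolding U0 by (simp add: c0) (simp add: U_def)
qed

lemma input_tape_eq: "(%i. if 0 <= i & i < int (length w) then fst (input_tape w) i else 0, 0) = input_tape w"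
 "(%i. if 0 <= i & i < int (length w) then 0 else fst (input_tape w) i, 0) = blank_tape" by (auto simp: input_tape_def blank_tape_def)

lemma runs_xfer_word:
 assumes "u s = input_tape w" "d = s | u d = blank_tape" "c j = 0"
 shows "runs (xfer s d j) (mk c u) (8 * length w + 3) (mk c (u(d := input_tape w, s := blank_tape)))"
proof -
 have "runs (xfer s d j) (mk c u) (8 * length w + 3)
  (mk c (u(d := (%i. if 0 <= i & i < int (length w) then fst (input_tape w) i else 0, 0),
    s := (%i. if 0 <= i & i < int (length w) then 0 else fst (input_tape w) i, 0))))"
  by (rule runs_xfer[where u = u and c = c and f = "fst (input_tape w)" and l = "length w", OF _ _ _ assms(2,3)]) (auto simp: assms(1) fst_input_tape bit_symbol_def input_tape_def)
 then show ?thesis unfolding input_tape_eq .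
qed

text \<open>Word functions computed in polynomial time by programs that leave the counters below a
 given \<open>b\<close> and the other tapes unchanged.\<close>

definition wcmp :: "bool list set => (bool list => bool list) => (bool list => nat) => (nat => prog) => bool" where
 "wcmp X F T P <-> (ALL b. well (P b)) & (ALL w:X. length (F w) <= T w) &
   (ALL b c u. ALL w:X. (ALL j>=b. c j = 0) & u 0 = input_tape w & u 1 = blank_tape -->
    runs (P b) (mk c u) (T w) (mk c (u(0 := input_tape (F w)))))"

definition WP :: "bool list set => (bool list => bool list) => bool" where
 "WP X F <-> (EX e P. wcmp X F (%w. (length w + 2) ^ e) P)"

lemma WPI:
 assumes "pb length T" "!!w. w \<in> X ==> length (F w) <= T w" "!!b. well (P b)"
  "!!b w c u. w \<in> X ==> ALL j>=b. c j = 0 ==> u 0 = input_tape w ==> u 1 = blank_tape ==>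
    runs (P b) (mk c u) (T w) (mk c (u(0 := input_tape (F w))))"
 shows "WP X F"
proof -
 obtain e where e: "!!w. T w <= (length w + 2) ^ e" using assms(1) by (auto simp: pb_def)
 show ?thesis unfolding WP_def wcmp_def using assms(3) le_trans[OF assms(2) e] runs_mono[OF assms(4) e] by blast
qed

lemma wcmpD:
 assumes "wcmp X F T P"
 shows "well (P b)" "w \<in> X ==> length (F w) <= T w"
  "w \<in> X ==> ALL j>=b. c j = 0 ==> u 0 = input_tape w ==> u 1 = blank_tape ==>
    runs (P b) (mk c u) (T w) (mk c (u(0 := input_tape (F w))))" using assms by (auto simp: wcmp_def)

lemma pb_power: "pb z T ==> pb z (%s. T s ^ e)" by (induction e) (auto intro: pb_const pb_mult)

lemma WP_comp:
 assumes "WP X F" "WP Y G" "!!w. w \<in> X ==> F w \<in> Y"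
 shows "WP X (%w. G (F w))"
proof -
 obtain e P where P: "wcmp X F (%w. (length w + 2) ^ e) P" using assms(1) by (auto simp: WP_def)
 obtain g Q where Q: "wcmp Y G (%w. (length w + 2) ^ g) Q" using assms(2) by (auto simp: WP_def)
 let ?S = "%w. ((length w + 2) ^ e + 2) ^ g"
 have S: "(length (F w) + 2) ^ g <= ?S w" if "w \<in> X" for w using wcmpD(2)[OF P that] by (intro power_mono) auto
 show ?thesis
 proof (rule WPI[of "%w. (length w + 2) ^ e + ?S w + 1" _ _ "%b. P b ;; Q b"])
  show "pb length (%w. (length w + 2) ^ e + ?S w + 1)" by (intro pb_Suc pb_add pb_power pb_const pb_size)
  show "length (G (F w)) <= (length w + 2) ^ e + ?S w + 1" if "w \<in> X" for w
   using wcmpD(2)[OF Q assms(3)[OF that]] S[OF that] by linarith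
  fix b :: nat and w and c :: "nat => nat" and u :: "nat => tape" assume a: "w \<in> X" "ALL j>=b. c j = 0" "u 0 = input_tape w" "u 1 = blank_tape"
  have "runs (Q b) (mk c (u(0 := input_tape (F w)))) ((length (F w) + 2) ^ g) (mk c (u(0 := input_tape (G (F w)))))"
   using wcmpD(3)[OF Q assms(3)[OF a(1)] a(2), of "u(0 := input_tape (F w))"] a(4) by simp
  from runs_Seq[OF wcmpD(3)[OF P a] this] S[OF a(1)]
  show "runs (P b ;; Q b) (mk c u) ((length w + 2) ^ e + ?S w + 1) (mk c (u(0 := input_tape (G (F w)))))" by simp
 qed (simp add: wcmpD(1)[OF P] wcmpD(1)[OF Q])
qed

text \<open>The bound \<open>B\<close> on the lengths along the iteration is essential: repeated
  application of a polynomial-time function may make words grow exponentially.\<close>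

lemma WP_iter:
 assumes F: "WP X F" "!!w. w \<in> X ==> F w \<in> X" and N: "U (%w. w) [] N"
  and len: "pb length B" "!!w i. w \<in> X ==> i <= N w ==> length ((F ^^ i) w) <= B w"
 shows "WP X (%w. (F ^^ N w) w)"
proof -
 obtain e P where P: "wcmp X F (%w. (length w + 2) ^ e) P" using F(1) by (auto simp: WP_def)
 obtain T p where p: "cmpt (%w. w) [] N T p" by (rule UE[OF N])
 have "sz (%w. w) [] = length" by (simp add: sz_def fun_eq_iff)
 then have pT: "pb length T" using cmptD(1)[OF p] by simp
 have X: "(F ^^ i) w \<in> X" if "w \<in> X" for w i using that F(2) by (induction i) auto
 let ?I = "%w. (B w + 2) ^ e"
 let ?R = "%w. T w * (?I w + 2 + 1) + 1"
 let ?p = "%b. p [] b ;; Loop (pos b) (dec b ;; P (Suc b))"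
 show ?thesis
 proof (rule WPI[of "%w. T w + ?R w + 1 + B w" _ _ ?p])
  show "pb length (%w. T w + ?R w + 1 + B w)" by (intro pb_Suc pb_add pb_mult pb_const pb_power len(1) pT)
  show "length ((F ^^ N w) w) <= T w + ?R w + 1 + B w" if "w \<in> X" for w using len(2)[OF that le_refl] by simp
  fix b :: nat and w and c :: "nat => nat" and u :: "nat => tape" assume a: "w \<in> X" "ALL j>=b. c j = 0" "u 0 = input_tape w" "u 1 = blank_tape"
  have 1: "runs (p [] b) (mk c u) (T w) (mk (c(b := N w)) u)" by (rule cmptD(4)[OF p]) (use a in "auto simp: env_def")
  let ?st = "%i. mk (c(b := N w - i)) (u(0 := input_tape ((F ^^ i) w)))"
  have 2: "runs (Loop (pos b) (dec b ;; P (Suc b))) (?st 0) (N w * (?I w + 2 + 1) + 1) (?st (N w))"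
  proof (rule runs_Loop[of "N w" "pos b" ?st])
   fix i assume i: "i < N w"
   let ?c = "(c(b := N w - i))(b := (c(b := N w - i)) b - 1)" and ?u = "u(0 := input_tape ((F ^^ i) w))"
   have "runs (P (Suc b)) (mk ?c ?u) ((length ((F ^^ i) w) + 2) ^ e) (mk ?c (?u(0 := input_tape (F ((F ^^ i) w)))))"
    by (rule wcmpD(3)[OF P]) (use a X in auto)
   moreover have "(length ((F ^^ i) w) + 2) ^ e <= ?I w" using len(2)[OF a(1), of i] i by (intro power_mono) auto
   ultimately have "runs (P (Suc b)) (mk ?c ?u) (?I w) (mk ?c (?u(0 := input_tape (F ((F ^^ i) w)))))" by (rule runs_mono)
   moreover have "?u(0 := input_tape (F ((F ^^ i) w))) = u(0 := input_tape ((F ^^ Suc i) w))" "?c = c(b := N w - Suc i)" by simp_all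
   ultimately have 2: "runs (P (Suc b)) (mk ?c ?u) (?I w) (?st (Suc i))" by (simp only:)
   have "runs (dec b ;; P (Suc b)) (?st i) (?I w + 2) (?st (Suc i))" by (rule runs_Seq[OF runs_dec 2]) (use i in auto)
   then show "pos b (rd (?st i)) & runs (dec b ;; P (Suc b)) (?st i) (?I w + 2) (?st (Suc i))" using i by simp
  qed simp
  have st0: "?st 0 = mk (c(b := N w)) u" using a(3) by (simp add: fun_upd_idem)
  have stN: "?st (N w) = mk c (u(0 := input_tape ((F ^^ N w) w)))" using a(2) by (simp add: fun_upd_idem)
  have "N w * (?I w + 2 + 1) <= T w * (?I w + 2 + 1)" using cmptD(2)[OF p] by (rule mult_le_mono1)
  then show "runs (?p b) (mk c u) (T w + ?R w + 1 + B w) (mk c (u(0 := input_tape ((F ^^ N w) w))))"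
   using runs_Seq[OF 1 2[unfolded st0 stN], of "T w + ?R w + 1 + B w"] by simp
 qed (simp add: cmptD(3)[OF p] wcmpD(1)[OF P])
qed

lemma runs_Mv_even: "runs (Mv (2 * i) m) (mk c u) 1 (mk c (u(i := (fst (u i), snd (u i) + head_shift m))))"
 using runs_Mv[of "2 * i" m "mk c u"] by (simp only: mk_even mk_upd_even)

lemma runs_Wr_even: "runs (Wr (2 * i) s) (mk c u) 1 (mk c (u(i := ((fst (u i))(snd (u i) := s), snd (u i)))))"
 using runs_Wr[of "2 * i" s "mk c u"] by (simp only: mk_even mk_upd_even)

abbreviation "bit_out b == Cond (pos (b + 2)) (dec (b + 2) ;; Wr (2 * 1) 2) (Wr (2 * 1) 1)"
abbreviation "wbody p b == p ;; bit_out b ;; Mv (2 * 1) Move_Right ;; inc (b + 1) ;; dec b"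
abbreviation "wback b == Loop (pos (b + 1)) (dec (b + 1) ;; Mv (2 * 1) Move_Left)"

text \<open>The output is collected on word tape 1, because every bit is computed from the input,
  which has to stay intact until the end.\<close>

lemma UF_loop:
 fixes F :: "bool list => bool list" and w b
 assumes B: "!!k c u. k < length (F w) ==> ALL j>=b + 2. c j = 0 ==> c (b + 1) = k ==> u 0 = input_tape w ==>
   runs pB (mk c u) S (mk (c(b + 2 := if wbit (F w) k then 1 else 0)) u)"
  and c: "ALL j>=b. c j = 0" and u: "u 0 = input_tape w" "u 1 = blank_tape"
 shows "runs (Loop (pos b) (wbody pB b) ;;
   wback b)
   (mk (c(b := length (F w))) u) (length (F w) * (S + 20) + 10) (mk c (u(1 := input_tape (F w))))"
proof -
 let ?n = "length (F w)"
 define V where "V k h = u(1 := (%i. if 0 <= i & i < int k then bit_symbol (F w ! nat i) else 0, int h))" for k h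
 let ?st = "%k. mk (c(b := ?n - k, b + 1 := k)) (V k k)"
 have 1: "runs (Loop (pos b) (wbody pB b))
   (?st 0) (?n * (S + 12 + 1) + 1) (?st ?n)"
 proof (rule runs_Loop[of ?n "pos b" ?st])
  fix k assume k: "k < ?n"
  let ?c = "c(b := ?n - k, b + 1 := k)"
  let ?d = "?c(b + 2 := if F w ! k then 1 else 0)"
  have wb: "wbit (F w) k = F w ! k" using k by (simp add: wbit_def)
  have 1: "runs pB (mk ?c (V k k)) S (mk ?d (V k k))" unfolding wb[symmetric] by (rule B) (use k c u in "auto simp: V_def")
  let ?V = "(V k k)(1 := ((fst (V k k 1))(snd (V k k 1) := bit_symbol (F w ! k)), snd (V k k 1)))"
  have 2: "runs (bit_out b) (mk ?d (V k k)) 4 (mk ?c ?V)"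
  proof (cases "F w ! k")
   case True
   let ?e = "?d(b + 2 := ?d (b + 2) - 1)"
   have e: "?e = ?c" using c True by (auto simp: fun_eq_iff)
   have d: "runs (dec (b + 2)) (mk ?d (V k k)) 1 (mk ?e (V k k))" by (rule runs_dec) (simp add: True)
   have "runs (dec (b + 2) ;; Wr (2 * 1) 2) (mk ?d (V k k)) 3 (mk ?e ((V k k)(1 := ((fst (V k k 1))(snd (V k k 1) := 2), snd (V k k 1)))))"
    by (rule runs_Seq[OF d runs_Wr_even]) simp
   then show ?thesis unfolding e by (intro runs_CondT) (auto simp: True bit_symbol_def)
  next
   case False
   have e: "?d = ?c" using c False by (auto simp: fun_eq_iff)
   have "runs (Wr (2 * 1) 1) (mk ?d (V k k)) 1 (mk ?d ((V k k)(1 := ((fst (V k k 1))(snd (V k k 1) := 1), snd (V k k 1)))))"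
    by (rule runs_Wr_even)
   then show ?thesis unfolding e by (intro runs_CondF) (use c in "auto simp: False bit_symbol_def")
  qed
  let ?V' = "?V(1 := (fst (?V 1), snd (?V 1) + head_shift Move_Right))"
  have V': "?V' = V (Suc k) (Suc k)" by (auto simp: V_def fun_eq_iff nat_eq_iff)
  have 3: "runs (Mv (2 * 1) Move_Right) (mk ?c ?V) 1 (mk ?c (V (Suc k) (Suc k)))" unfolding V'[symmetric] by (rule runs_Mv_even)
  let ?c1 = "?c(b + 1 := Suc (?c (b + 1)))" let ?c2 = "?c1(b := ?c1 b - 1)"
  have c2: "?c2 = c(b := ?n - Suc k, b + 1 := Suc k)" by (auto simp: fun_eq_iff)
  have 4: "runs (inc (b + 1)) (mk ?c (V (Suc k) (Suc k))) 1 (mk ?c1 (V (Suc k) (Suc k)))" by (rule runs_inc)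
  have 5: "runs (dec b) (mk ?c1 (V (Suc k) (Suc k))) 1 (mk ?c2 (V (Suc k) (Suc k)))" by (rule runs_dec) (use k in simp)
  have "runs (wbody pB b)
    (?st k) (S + 12) (mk ?c2 (V (Suc k) (Suc k)))"
   by (rule runs_Seq[OF 1 runs_Seq[OF 2 runs_Seq[OF 3 runs_Seq[OF 4 5 le_refl] le_refl] le_refl]]) simp
  then show "pos b (rd (?st k)) & runs (wbody pB b)
    (?st k) (S + 12) (?st (Suc k))" unfolding c2 using k by simp
 qed simp
 let ?s2 = "%k. mk (c(b + 1 := ?n - k)) (V ?n (?n - k))"
 have 2: "runs (wback b) (?s2 0) (?n * (3 + 1) + 1) (?s2 ?n)"
 proof (rule runs_Loop[of ?n "pos (b + 1)" ?s2])
  fix k assume k: "k < ?n"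
  let ?c = "c(b + 1 := ?n - k)" let ?d = "?c(b + 1 := ?c (b + 1) - 1)" let ?V = "V ?n (?n - k)"
  let ?V' = "?V(1 := (fst (?V 1), snd (?V 1) + head_shift Move_Left))"
  have V': "?V' = V ?n (?n - Suc k)" using k by (auto simp: V_def fun_eq_iff of_nat_diff)
  have 1: "runs (dec (b + 1)) (mk ?c ?V) 1 (mk ?d ?V)" by (rule runs_dec) (use k in simp)
  have "runs (dec (b + 1) ;; Mv (2 * 1) Move_Left) (mk ?c ?V) 3 (mk ?d ?V')" by (rule runs_Seq[OF 1 runs_Mv_even]) simp
  moreover have "?d = c(b + 1 := ?n - Suc k)" by simp
  ultimately show "pos (b + 1) (rd (?s2 k)) & runs (dec (b + 1) ;; Mv (2 * 1) Move_Left) (?s2 k) 3 (?s2 (Suc k))"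
   unfolding V' using k by simp
 qed simp
 have V0: "V 0 0 = u" using u by (auto simp: V_def blank_tape_def fun_eq_iff)
 have Vn: "V ?n 0 = u(1 := input_tape (F w))" by (auto simp: V_def input_tape_def fun_eq_iff)
 have "c(b := ?n - 0, b + 1 := 0) = c(b := ?n)" using c by (auto simp: fun_eq_iff)
 then have s0: "?st 0 = mk (c(b := ?n)) u" by (simp only: V0)
 have "c(b := ?n - ?n, b + 1 := ?n) = c(b + 1 := ?n - 0)" using c by (auto simp: fun_eq_iff)
 then have s1: "?st ?n = ?s2 0" by (simp only: diff_zero)
 have "c(b + 1 := ?n - ?n) = c" using c by (auto simp: fun_eq_iff)
 then have s2: "?s2 ?n = mk c (u(1 := input_tape (F w)))" by (simp only: diff_self_eq_0 Vn)
 show ?thesis using 1 2 unfolding s0 s1 s2 by (rule runs_Seq) (simp add: algebra_simps)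
qed

lemma WP_UF:
 assumes "UF F"
 shows "WP X F"
proof -
 have L: "U (%w. w) [] (%w. length (F w))" and B: "U fst [snd] (%p. if wbit (F (fst p)) (snd p) then 1 else 0)"
  using assms by (auto simp: UF_def UB_def)
 obtain T pL where pL: "cmpt (%w. w) [] (%w. length (F w)) T pL" by (rule UE[OF L])
 obtain R pB where pB: "cmpt fst [snd] (%p. if wbit (F (fst p)) (snd p) then 1 else 0) R pB" by (rule UE[OF B])
 obtain e where e: "!!w k. R (w, k) <= (length w + k + 2) ^ e" using cmptD(1)[OF pB] by (fastforce simp: pb_def sz_def)
 have "sz (%w. w) [] = length" by (simp add: sz_def fun_eq_iff)
 then have pT: "pb length T" using cmptD(1)[OF pL] by simp
 note T = cmptD(2)[OF pL]
 let ?S = "%w. (length w + T w + 2) ^ e"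
 let ?Q = "%w. T w + (T w * (?S w + 20) + 10) + (8 * length w + 3) + (8 * T w + 3) + 3"
 let ?l = "%b. Loop (pos b) (wbody (pB [b + 1] (b + 2)) b) ;;
   wback b"
 let ?p = "%b. pL [] b ;; ?l b ;; xfer 0 0 b ;; xfer 1 0 b"
 show ?thesis
 proof (rule WPI[of ?Q _ _ ?p])
  show "pb length ?Q" by (intro pb_add pb_mult pb_const pb_size pT pb_power)
  show "length (F w) <= ?Q w" for w using T[of w] by linarith
  fix b :: nat and w and c :: "nat => nat" and u :: "nat => tape" assume a: "ALL j>=b. c j = 0" "u 0 = input_tape w" "u 1 = blank_tape"
  have 1: "runs (pL [] b) (mk c u) (T w) (mk (c(b := length (F w))) u)" by (rule cmptD(4)[OF pL]) (use a in "auto simp: env_def")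
  have 2: "runs (?l b) (mk (c(b := length (F w))) u) (length (F w) * (?S w + 20) + 10) (mk c (u(1 := input_tape (F w))))"
  proof (rule UF_loop[OF _ a])
   fix k and c :: "nat => nat" and u :: "nat => tape" assume k: "k < length (F w)" "ALL j>=b + 2. c j = 0" "c (b + 1) = k" "u 0 = input_tape w"
   then have "env fst [snd] [b + 1] (b + 2) (w, k) c u" by (simp add: env_def)
   from cmptD(4)[OF pB this] have "runs (pB [b + 1] (b + 2)) (mk c u) (R (w, k)) (mk (c(b + 2 := if wbit (F w) k then 1 else 0)) u)" by simp
   moreover have "R (w, k) <= ?S w" using k(1) T[of w] by (intro le_trans[OF e] power_mono) auto
   ultimately show "runs (pB [b + 1] (b + 2)) (mk c u) (?S w) (mk (c(b + 2 := if wbit (F w) k then 1 else 0)) u)" by (rule runs_mono)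
  qed
  let ?u1 = "u(1 := input_tape (F w))"
  let ?u2 = "?u1(0 := input_tape w, 0 := blank_tape)"
  have 3: "runs (xfer 0 0 b) (mk c ?u1) (8 * length w + 3) (mk c ?u2)" by (rule runs_xfer_word) (use a in auto)
  have 4: "runs (xfer 1 0 b) (mk c ?u2) (8 * length (F w) + 3) (mk c (?u2(0 := input_tape (F w), 1 := blank_tape)))"
   by (rule runs_xfer_word) (use a in auto)
  have 5: "?u2(0 := input_tape (F w), 1 := blank_tape) = u(0 := input_tape (F w))" using a(3) by (auto simp: fun_eq_iff)
  have t: "length (F w) * (?S w + 20) <= T w * (?S w + 20)" by (rule mult_le_mono1[OF T])
  show "runs (?p b) (mk c u) (?Q w) (mk c (u(0 := input_tape (F w))))"
   by (rule runs_Seq[OF 1 runs_Seq[OF 2 runs_Seq[OF 3 4[unfolded 5] le_refl] le_refl]]) (use t T[of w] in linarith)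
 qed (simp add: cmptD(3)[OF pL] cmptD(3)[OF pB])
qed

text \<open>Simulation of a Turing machine: its tape \<open>i\<close> becomes the word tape \<open>i + 4\<close>, its state is stored on
 word tape 3, and the head of word tape 2, whose cell 0 is marked, follows the head of its first tape.\<close>

definition tact :: "turing_machine => (nat => nat) => nat => nat \<times> head_move" where
 "tact M r v = (let ss = map (%i. r (2 * (i + 4))) [0..<tapes M]; qa = delta M (r 6) ss in
   if r 6 < states M & set ss \<subseteq> {..<symbols M} then
    (if v = 6 then (fst qa, Stay) else if v = 4 then (r v, snd (snd qa ! 0))
    else if even v & 4 <= v div 2 & v div 2 < tapes M + 4 then snd qa ! (v div 2 - 4) else (r v, Stay))
   else (r v, Stay))"

definition tst :: "turing_machine => nat => tape list => (nat => tape) => nat => tape" where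
 "tst M q ts u = (%i. if i = 2 then (%j. if j = 0 then 1 else 0, snd (ts ! 0)) else if i = 3 then (%j. if j = 0 then q else 0, 0)
   else if 4 <= i & i < tapes M + 4 then ts ! (i - 4) else u i)"

definition tinv :: "turing_machine => nat => tape list => bool" where
 "tinv M q ts <-> length ts = tapes M & q < states M & (ALL i<tapes M. ALL j. fst (ts ! i) j < symbols M)"

lemma wf_tm_delta:
 assumes "wf_tm M" "q < states M" "length ss = tapes M" "set ss \<subseteq> {..<symbols M}"
 shows "fst (delta M q ss) < states M" "length (snd (delta M q ss)) = tapes M"
  "i < tapes M ==> fst (snd (delta M q ss) ! i) < symbols M"
proof -
 have a: "fst (delta M q ss) < states M & length (snd (delta M q ss)) = tapes M & fst ` set (snd (delta M q ss)) \<subseteq> {..<symbols M}"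
 proof -
  have "case delta M q ss of (q', acts) => q' < states M & length acts = tapes M & fst ` set acts \<subseteq> {..<symbols M}"
   by (rule assms(1)[unfolded wf_tm_def, THEN conjunct2, THEN conjunct2, THEN conjunct2, THEN spec, THEN spec, THEN mp])
    (use assms in simp)
  then show ?thesis by (cases "delta M q ss") simp
 qed
 then show "fst (delta M q ss) < states M" "length (snd (delta M q ss)) = tapes M" by auto
 show "fst (snd (delta M q ss) ! i) < symbols M" if "i < tapes M"
 proof -
  have "snd (delta M q ss) ! i \<in> set (snd (delta M q ss))" using a that by (intro nth_mem) simp
  then show ?thesis using a by auto
 qed
qed

lemma well_tact: assumes M: "wf_tm M" shows "well (Do (tact M))"
proof -
 let ?k = "2 * (tapes M + 4)" and ?m = "states M + symbols M"
 have "local_act ?k ?m (tact M)" unfolding local_act_def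
 proof (intro conjI allI impI)
  fix r :: "nat => nat" and t assume t: "t < ?k"
  let ?ss = "map (%i. r (2 * (i + 4))) [0..<tapes M]"
  show "fst (tact M r t) < ?m | fst (tact M r t) = r t"
  proof (cases "r 6 < states M & set ?ss \<subseteq> {..<symbols M}")
   case True
   note w = wf_tm_delta[OF M, of "r 6" ?ss, OF conjunct1[OF True] _ conjunct2[OF True], simplified]
   have x: "4 <= t div 2 ==> t div 2 < tapes M + 4 ==> t div 2 - 4 < tapes M" by linarith
   show ?thesis unfolding tact_def Let_def using True w(1) w(3)[OF x] by (auto intro: trans_less_add1 trans_less_add2)
  qed (auto simp: tact_def Let_def)
 next
  fix r :: "nat => nat" and t assume t: "?k <= t"
  then have "tapes M + 4 <= t div 2" by simp
  then show "tact M r t = (r t, Stay)" using t by (auto simp: tact_def Let_def)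
 next
  fix r r' :: "nat => nat" and t assume a: "ALL u<?k. r u = r' u" "t < ?k"
  have "map (%i. r (2 * (i + 4))) [0..<tapes M] = map (%i. r' (2 * (i + 4))) [0..<tapes M]" using a by auto
  moreover have "r 6 = r' 6" "r t = r' t" using a by auto
  ultimately show "tact M r t = tact M r' t" unfolding tact_def by (simp only:)
 qed
 then show ?thesis unfolding well_def wfpr.simps by blast
qed

lemma step_inv:
 assumes M: "wf_tm M" and i: "tinv M q ts" and s: "step M (q, ts) = (q', ts')"
 shows "tinv M q' ts'"
proof (cases "q = 1")
 case False
 let ?d = "delta M q (map read ts)"
 have ss: "length (map read ts) = tapes M" "set (map read ts) \<subseteq> {..<symbols M}"
  using i by (auto simp: tinv_def in_set_conv_nth) (metis read.elims fst_conv)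
 note w = wf_tm_delta[OF M _ ss, of q]
 have q: "q' = fst ?d" "ts' = map2 act (snd ?d) ts" using s False by (auto simp: case_prod_unfold)
 have l: "length ts = tapes M" "q < states M" using i by (auto simp: tinv_def)
 have "fst (ts' ! k) j < symbols M" if k: "k < tapes M" for k j
 proof -
  have "ts' ! k = act (snd ?d ! k) (ts ! k)" using k w(2) l unfolding q by simp
  moreover obtain f h where "ts ! k = (f, h)" by fastforce
  moreover have "f x < symbols M" for x using i k calculation(2) unfolding tinv_def by (metis fst_conv)
  moreover obtain a m where "snd ?d ! k = (a, m)" by fastforce
  moreover have "a < symbols M" using w(3)[OF l(2) k] calculation by simp
  ultimately show ?thesis by simp
 qed
 then show ?thesis using w(1,2) l q by (simp add: tinv_def)
qed (use i s in simp)

lemma runs_tact: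
 assumes M: "wf_tm M" and i: "tinv M q ts" and q1: "q ~= 1"
 shows "runs (Do (tact M)) (mk c (tst M q ts u)) 1 (mk c (tst M (fst (step M (q, ts))) (snd (step M (q, ts))) u))"
proof -
 let ?d = "delta M q (map read ts)" and ?u = "tst M q ts u"
 let ?r = "rd (mk c ?u)"
 have l: "length ts = tapes M" "q < states M" using i by (auto simp: tinv_def)
 have k: "0 < tapes M" using M by (simp add: wf_tm_def)
 have r: "?r (2 * i) = read (?u i)" for i by (rule rd_even)
 have r6: "?r 6 = q" using r[of 3] by (simp add: tst_def)
 have ss: "map (%i. ?r (2 * (i + 4))) [0..<tapes M] = map read ts" by (rule nth_equalityI) (simp_all only: r, simp_all add: l tst_def)
 have ss': "set (map read ts) \<subseteq> {..<symbols M}" using i by (auto simp: tinv_def in_set_conv_nth) (metis read.elims fst_conv)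
 have w: "length (snd ?d) = tapes M" using wf_tm_delta[OF M l(2) _ ss'] l by simp
 have s: "step M (q, ts) = (fst ?d, map2 act (snd ?d) ts)" using q1 by (simp add: case_prod_unfold)
 have t: "tact M ?r v = (if v = 6 then (fst ?d, Stay) else if v = 4 then (?r v, snd (snd ?d ! 0))
    else if even v & 4 <= v div 2 & v div 2 < tapes M + 4 then snd ?d ! (v div 2 - 4) else (?r v, Stay))" for v
  unfolding tact_def Let_def ss r6 using l(2) ss' by simp
 have "(%i. act (tact M ?r (2 * i)) (?u i)) = tst M (fst (step M (q, ts))) (snd (step M (q, ts))) u"
 proof
  fix i
  have n: "act (read x, m) x = (fst x, snd x + head_shift m)" for x m by (cases x) simp
  have a: "snd (act a x) = snd x + head_shift (snd a)" for a x by (cases a; cases x) simp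
  consider "i = 2" | "i = 3" | "4 <= i" "i < tapes M + 4" | "i ~= 2" "i ~= 3" "~ (4 <= i & i < tapes M + 4)" by blast
  then show "act (tact M ?r (2 * i)) (?u i) = tst M (fst (step M (q, ts))) (snd (step M (q, ts))) u i"
  proof cases
   case 1
   then show ?thesis unfolding t r n s using k w l by (auto simp: tst_def a fun_eq_iff)
  next
   case 2
   then show ?thesis unfolding t s by (auto simp: tst_def)
  next
   case 3
   then show ?thesis unfolding t s using w l by (simp add: tst_def)
  next
   case 4
   then have U: "tst M q' ts' u i = u i" for q' ts' by (auto simp: tst_def)
   have "tact M ?r (2 * i) = (read (u i), Stay)" using 4 unfolding t r U by auto
   then show ?thesis unfolding U using n[of "u i" Stay] by simp
  qed
 qed
 moreover have "tact M r v = (r v, Stay)" if "odd v" for r v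
 proof -
  have "v ~= 6" "v ~= 4" using that by auto
  then show ?thesis using that by (simp add: tact_def Let_def)
 qed
 ultimately show ?thesis using runs_Do_even[of "tact M" c ?u] by simp
qed

text \<open>Bounds the length of an output by the running time, and tells how far from cell 0 the
  head can be after halting.\<close>

lemma run_inv:
 assumes M: "wf_tm M"
 shows "tinv M (fst (run M w t)) (snd (run M w t)) & \<bar>snd (snd (run M w t) ! 0)\<bar> <= int t &
  (ALL j>=int (length w) + int t. fst (snd (run M w t) ! 0) j = 0)"
proof (induction t)
 case 0
 have "tapes M >= 1" "symbols M >= 3" "states M >= 2" using M by (auto simp: wf_tm_def)
 then show ?case by (auto simp: run_def initial_config_def tinv_def input_tape_def blank_tape_def nth_Cons bit_symbol_def split: nat.splits)
next
 case (Suc t)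
 obtain q ts where qt: "run M w t = (q, ts)" by fastforce
 have R: "run M w (Suc t) = step M (q, ts)" using qt by (simp add: run_def)
 have i: "tinv M q ts" "\<bar>snd (ts ! 0)\<bar> <= int t" "!!j. j >= int (length w) + int t ==> fst (ts ! 0) j = 0" using Suc qt by auto
 obtain q' ts' where s: "step M (q, ts) = (q', ts')" by fastforce
 have inv: "tinv M q' ts'" by (rule step_inv[OF M i(1) s])
 have "\<bar>snd (ts' ! 0)\<bar> <= int (Suc t) & (ALL j>=int (length w) + int (Suc t). fst (ts' ! 0) j = 0)"
 proof (cases "q = 1")
  case False
  let ?d = "delta M q (map read ts)"
  have q: "ts' = map2 act (snd ?d) ts" using s False by (auto simp: case_prod_unfold)
  have k: "0 < tapes M" "length ts' = tapes M" "length ts = tapes M" using M inv i by (auto simp: wf_tm_def tinv_def)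
  obtain f h where fh: "ts ! 0 = (f, h)" by fastforce
  obtain a m where am: "snd ?d ! 0 = (a, m)" by fastforce
  have "0 < length (snd ?d)" using k unfolding q by (auto simp: min_def split: if_splits)
  then have "ts' ! 0 = act (snd ?d ! 0) (ts ! 0)" using k unfolding q by (subst nth_map) auto
  then have "ts' ! 0 = (f(h := a), h + head_shift m)" by (simp add: fh am)
  moreover have "\<bar>head_shift m\<bar> <= 1" by (cases m) auto
  ultimately show ?thesis using i(2,3) by (auto simp: fh)
 qed (use s i in auto)
 then show ?case using inv unfolding R s by simp
qed

abbreviation "mv2 d == Mv (2 * 2) d ;; Mv (2 * 4) d"

lemma run_halted: "fst (run V z t) = 1 ==> t <= t' ==> run V z t' = run V z t"
proof -
 assume h: "fst (run V z t) = 1" and "t <= t'"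
 have "run V z (t + n) = run V z t" for n
 proof (induction n)
  case (Suc n)
  have "run V z (t + Suc n) = step V (run V z (t + n))" by (simp add: run_def)
  also have "... = run V z t" unfolding Suc using h by (cases "run V z t") simp
  finally show ?case .
 qed simp
 from this[of "t' - t"] show ?thesis using \<open>t <= t'\<close> by simp
qed

lemma hd_run: "wf_tm V ==> hd (snd (run V z t)) = snd (run V z t) ! 0"
proof -
 assume V: "wf_tm V"
 then have "0 < tapes V" by (simp add: wf_tm_def)
 then have "snd (run V z t) ~= []" using run_inv[OF V, of z t] by (auto simp: tinv_def)
 then show ?thesis by (rule hd_conv_nth)
qed

text \<open>After \<open>N\<close> steps the head of the simulated first tape may be anywhere
  between \<open>-N\<close> and \<open>N\<close>, on a tape with arbitrary symbols, so no mark could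
  be recognised there. Moving \<open>N\<close> cells to the right brings it to a non-negative
  position, from which it goes left until the companion tape 2 shows its mark at cell 0.\<close>

definition tmprog :: "turing_machine => prog" where
 "tmprog M = xfer 0 4 0 ;; Wr (2 * 2) 1 ;; Loop (%r. r (2 * 3) ~= 1) (Do (tact M) ;; inc 0) ;;
   Loop (pos 0) (dec 0 ;; mv2 Move_Right) ;;
   Loop (%r. r (2 * 2) ~= 1) (mv2 Move_Left) ;; xfer 4 0 0"

lemma well_tmprog: "wf_tm M ==> well (tmprog M)" unfolding tmprog_def well_Seq
 by (intro conjI well_Loop_pos well_Loop[OF local_cond_read[of "2 * 3" "%x. x ~= 1"]] well_Loop[OF local_cond_read[of "2 * 2" "%x. x ~= 1"]])
  (auto intro: well_tact)

lemma runs_tmprog: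
 assumes M: "wf_tm M" and h: "halts_within M w T" and o: "outputs M w y"
  and u: "u 0 = input_tape w" "!!i. 1 <= i ==> u i = blank_tape" and c: "!!i. c i = 0"
 shows "length y <= length w + T & (EX u'. runs (tmprog M) (mk c u) (100 * (length w + T + 1)) (mk c u') &
  u' 0 = input_tape y & u' 1 = blank_tape)"
proof -
 \<comment> \<open>The simulation stops at the first halting time, for which \<open>T\<close> is
   only a bound.\<close>
 define N where "N = (LEAST t. fst (run M w t) = 1)"
 have hN: "fst (run M w N) = 1" unfolding N_def by (rule LeastI[of "%t. fst (run M w t) = 1" T]) (use h in "simp add: halts_within_def")
 have NT: "N <= T" unfolding N_def by (rule Least_le) (use h in "simp add: halts_within_def")
 have nN: "fst (run M w t) ~= 1" if "t < N" for t using not_less_Least that unfolding N_def by blast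
 define f p where "f = fst (snd (run M w N) ! 0)" and "p = snd (snd (run M w N) ! 0)"
 have inv: "tinv M (fst (run M w t)) (snd (run M w t))" for t using run_inv[OF M] by blast
 have k: "0 < tapes M" using M by (simp add: wf_tm_def)
 have y: "(ALL i<length y. f (int i) = bit_symbol (y ! i)) & f (int (length y)) = 0"
 proof -
  obtain t where t: "fst (run M w t) = 1" "(ALL i<length y. fst (snd (run M w t) ! 0) (int i) = bit_symbol (y ! i)) & fst (snd (run M w t) ! 0) (int (length y)) = 0"
   using o unfolding outputs_def halts_within_def hd_run[OF M] Let_def by blast
  have "N <= t" unfolding N_def by (rule Least_le) (rule t(1))
  then have "run M w t = run M w N" by (rule run_halted[OF hN])
  then show ?thesis using t(2) by (simp add: f_def)
 qed
 have p: "\<bar>p\<bar> <= int N" and f0: "!!j. j >= int (length w) + int N ==> f j = 0"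
  using run_inv[OF M, of w N] by (auto simp: p_def f_def)
 have ly: "length y <= length w + N"
 proof (rule ccontr)
  assume "~ ?thesis"
  then have "f (int (length w + N)) = bit_symbol (y ! (length w + N))" using y by (meson not_le)
  then show False using f0[of "int (length w + N)"] by (simp add: bit_symbol_def split: if_splits)
 qed
 let ?S = "%t. tst M (fst (run M w t)) (snd (run M w t)) (u(0 := blank_tape))"
 have "runs (xfer 0 4 0) (mk c u) (8 * length w + 3) (mk c (u(4 := input_tape w, 0 := blank_tape)))"
  by (rule runs_xfer_word) (use u c in auto)
 moreover
 let ?u1 = "u(4 := input_tape w, 0 := blank_tape)"
 have "runs (Wr (2 * 2) 1) (mk c ?u1) 1 (mk c (?u1(2 := ((fst (?u1 2))(snd (?u1 2) := 1), snd (?u1 2)))))" by (rule runs_Wr_even)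
 moreover have "?u1(2 := ((fst (?u1 2))(snd (?u1 2) := 1), snd (?u1 2))) = ?S 0"
 proof
  fix i
  have "(input_tape w # replicate (tapes M - 1) blank_tape) ! (i - 4) = blank_tape" if "4 < i" "i < tapes M + 4"
   using that by (simp add: nth_Cons' nth_replicate)
  then show "(?u1(2 := ((fst (?u1 2))(snd (?u1 2) := 1), snd (?u1 2)))) i = ?S 0 i"
   using u k by (cases "i = 4") (auto simp: tst_def run_def initial_config_def blank_tape_def input_tape_def fun_eq_iff)
 qed
 ultimately have 2: "runs (xfer 0 4 0) (mk c u) (8 * length w + 3) (mk c ?u1)" "runs (Wr (2 * 2) 1) (mk c ?u1) 1 (mk c (?S 0))" by simp_all
 have c0: "c(0 := 0) = c" using c[of 0] by auto
 have "runs (Loop (%r. r (2 * 3) ~= 1) (Do (tact M) ;; inc 0)) (mk (c(0 := 0)) (?S 0)) (N * (3 + 1) + 1) (mk (c(0 := N)) (?S N))"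
 proof (rule runs_Loop[of N "%r. r (2 * 3) ~= 1" "%t. mk (c(0 := t)) (?S t)"])
  fix t assume t: "t < N"
  have S: "run M w (Suc t) = step M (fst (run M w t), snd (run M w t))" by (simp add: run_def)
  have 1: "runs (Do (tact M)) (mk (c(0 := t)) (?S t)) 1 (mk (c(0 := t)) (?S (Suc t)))" unfolding S by (rule runs_tact[OF M inv nN[OF t]])
  have "runs (Do (tact M) ;; inc 0) (mk (c(0 := t)) (?S t)) 3 (mk ((c(0 := t))(0 := Suc ((c(0 := t)) 0))) (?S (Suc t)))"
   by (rule runs_Seq[OF 1 runs_inc]) simp
  then show "rd (mk (c(0 := t)) (?S t)) (2 * 3) ~= 1 & runs (Do (tact M) ;; inc 0) (mk (c(0 := t)) (?S t)) 3 (mk (c(0 := Suc t)) (?S (Suc t)))"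
   unfolding rd_even using nN[OF t] by (simp add: tst_def)
 next
  show "~ rd (mk (c(0 := N)) (?S N)) (2 * 3) ~= 1" unfolding rd_even using hN by (simp add: tst_def)
 qed
 then have 3: "runs (Loop (%r. r (2 * 3) ~= 1) (Do (tact M) ;; inc 0)) (mk c (?S 0)) (N * (3 + 1) + 1) (mk (c(0 := N)) (?S N))"
  unfolding c0 .
 let ?m = "%j. if j = 0 then 1 else 0 :: nat"
 define V where "V h = (?S N)(2 := (?m, h), 4 := (f, h))" for h :: int
 have V0: "?S N = V p" using k by (auto simp: V_def tst_def f_def p_def fun_eq_iff)
 have mv: "runs (mv2 d) (mk c' (V h)) 3 (mk c' (V (h + head_shift d)))" for c' h d
 proof -
  let ?W = "(V h)(2 := (fst (V h 2), snd (V h 2) + head_shift d))"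
  have W: "?W(4 := (fst (?W 4), snd (?W 4) + head_shift d)) = V (h + head_shift d)" by (auto simp: V_def fun_eq_iff)
  show ?thesis unfolding W[symmetric] by (rule runs_Seq[OF runs_Mv_even runs_Mv_even]) simp
 qed
 have 4: "runs (Loop (pos 0) (dec 0 ;; mv2 Move_Right)) (mk (c(0 := N - 0)) (V (p + int 0))) (N * (5 + 1) + 1) (mk (c(0 := N - N)) (V (p + int N)))"
 proof (rule runs_Loop[of N "pos 0" "%t. mk (c(0 := N - t)) (V (p + int t))"])
  fix t assume t: "t < N"
  let ?c = "(c(0 := N - t))(0 := (c(0 := N - t)) 0 - 1)"
  have 1: "runs (dec 0) (mk (c(0 := N - t)) (V (p + int t))) 1 (mk ?c (V (p + int t)))" by (rule runs_dec) (use t in simp)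
  have e: "?c = c(0 := N - Suc t)" "p + int t + head_shift Move_Right = p + int (Suc t)" by auto
  then show "pos 0 (rd (mk (c(0 := N - t)) (V (p + int t)))) & runs (dec 0 ;; mv2 Move_Right)
    (mk (c(0 := N - t)) (V (p + int t))) 5 (mk (c(0 := N - Suc t)) (V (p + int (Suc t))))"
   using runs_Seq[OF 1 mv[of Move_Right ?c "p + int t"], of 5] t unfolding e(2) unfolding e(1) by simp
 qed simp
 have 4: "runs (Loop (pos 0) (dec 0 ;; mv2 Move_Right)) (mk (c(0 := N)) (?S N)) (N * (5 + 1) + 1) (mk c (V (p + int N)))"
  using 4 c0 unfolding V0 by simp
 define R where "R = nat (p + int N)"
 have R: "p + int N = int R" "R <= 2 * N" using p by (auto simp: R_def)
 have 5: "runs (Loop (%r. r (2 * 2) ~= 1) (mv2 Move_Left)) (mk c (V (int R - int 0))) (R * (3 + 1) + 1) (mk c (V (int R - int R)))"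
 proof (rule runs_Loop[of R "%r. r (2 * 2) ~= 1" "%t. mk c (V (int R - int t))"])
  fix t assume t: "t < R"
  have e: "int R - int t + head_shift Move_Left = int R - int (Suc t)" by simp
  then show "rd (mk c (V (int R - int t))) (2 * 2) ~= 1 & runs (mv2 Move_Left) (mk c (V (int R - int t))) 3 (mk c (V (int R - int (Suc t))))"
   using mv[of Move_Left c "int R - int t"] t unfolding rd_even e by (simp add: V_def[of "int R - int t", THEN fun_cong, of 2])
 next
  show "~ rd (mk c (V (int R - int R))) (2 * 2) ~= 1" unfolding rd_even by (simp add: V_def)
 qed
 have V4: "V (int R - int R) 4 = (f, 0)" "V (int R - int R) 0 = blank_tape" "V (int R - int R) 1 = blank_tape"
  using u(2)[of 1] by (auto simp: V_def tst_def)
 \<comment> \<open>Only the output word is moved; what else the machine wrote stays on tape 4, which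
   is harmless because the machine is run once.\<close>
 let ?u' = "(V (int R - int R))(0 := (%i. if 0 <= i & i < int (length y) then f i else 0, 0), 4 := (%i. if 0 <= i & i < int (length y) then 0 else f i, 0))"
 have 6: "runs (xfer 4 0 0) (mk c (V (int R - int R))) (8 * length y + 3) (mk c ?u')"
  by (rule runs_xfer[where u = "V (int R - int R)" and f = f]) (use V4 y c in "auto simp: bit_symbol_def")
 have "runs (tmprog M) (mk c u) (100 * (length w + T + 1)) (mk c ?u')" unfolding tmprog_def
  by (rule runs_Seq[OF 2(1) runs_Seq[OF 2(2) runs_Seq[OF 3 runs_Seq[OF 4[unfolded R(1)] runs_Seq[OF 5[unfolded of_nat_0 diff_zero] 6 le_refl] le_refl] le_refl] le_refl]])
   (use NT ly R(2) in simp)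
 moreover have "?u' 0 = input_tape y"
 proof -
  have "f i = bit_symbol (y ! nat i)" if "0 <= i" "i < int (length y)" for i using that y[THEN conjunct1, rule_format, of "nat i"] by simp
  then show ?thesis by (auto simp: input_tape_def fun_eq_iff)
 qed
 moreover have "?u' 1 = blank_tape" using V4 by simp
 ultimately show ?thesis using ly NT by (intro conjI exI[of _ ?u']) auto
qed

lemma local_cond_agree: "local_cond k b ==> ALL t<k. a t = a' t ==> b (rd a') = b (rd a)" unfolding local_cond_def rd_def by metis

text \<open>A local program sees only its first \<open>k\<close> tapes. This bridges the gap between
  \<open>mk\<close>, where all odd tapes are counters, and a real start, where only finitely many
  tapes can be marked.\<close>

lemma exec_agree:
 "exec p a n b ==> wfpr k m p ==> ALL t<k. a t = a' t ==> EX b'. exec p a' n b' & (ALL t<k. b t = b' t)"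
proof (induction arbitrary: a' rule: exec.induct)
 case (exec_Do ts' F ts)
 have "ALL u<k. rd ts u = rd a' u" using exec_Do by (simp add: rd_def)
 then have "ALL t<k. F (rd ts) t = F (rd a') t" using exec_Do(2) unfolding wfpr.simps local_act_def by blast
 then show ?case using exec_Do using exec.exec_Do[OF refl, of F a'] by (intro exI[of _ "%t. act (F (rd a') t) (a' t)"]) auto
next
 case (exec_Seq p a m' b q n c)
 obtain b' where b: "exec p a' m' b'" "ALL t<k. b t = b' t" using exec_Seq.IH(1)[of a'] exec_Seq.prems by auto
 obtain c' where "exec q b' n c'" "ALL t<k. c t = c' t" using exec_Seq.IH(2)[of b'] exec_Seq.prems b(2) by auto
 then show ?case using b(1) exec.exec_Seq by blast
next
 case (exec_CondT b a p n c q)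
 then have "b (rd a')" using local_cond_agree[of k b a a'] by simp
 moreover obtain c' where "exec p a' n c'" "ALL t<k. c t = c' t" using exec_CondT.IH[of a'] exec_CondT.prems by auto
 ultimately show ?case using exec.exec_CondT by blast
next
 case (exec_CondF b a q n c p)
 then have "~ b (rd a')" using local_cond_agree[of k b a a'] by simp
 moreover obtain c' where "exec q a' n c'" "ALL t<k. c t = c' t" using exec_CondF.IH[of a'] exec_CondF.prems by auto
 ultimately show ?case using exec.exec_CondF by blast
next
 case (exec_LoopF b a p)
 then have "~ b (rd a')" using local_cond_agree[of k b a a'] by simp
 then show ?case using exec.exec_LoopF exec_LoopF.prems by blast
next
 case (exec_LoopT b a p m' c n d)
 have t: "b (rd a')" using local_cond_agree[of k b a a'] exec_LoopT.hyps(1) exec_LoopT.prems by auto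
 obtain c' where c: "exec p a' m' c'" "ALL t<k. c t = c' t" using exec_LoopT.IH(1)[of a'] exec_LoopT.prems by auto
 obtain d' where "exec (Loop b p) c' n d'" "ALL t<k. d t = d' t" using exec_LoopT.IH(2)[of c'] exec_LoopT.prems c(2) by blast
 then show ?case using t c(1) exec.exec_LoopT by blast
qed

text \<open>Machines start with blank tapes, so the marks at cell 0 that turn odd tapes into
  counters have to be written before a compiled program runs.\<close>

fun marks :: "nat => prog" where
 "marks 0 = nop" | "marks (Suc K) = marks K ;; Wr (Suc (2 * K)) 1"

lemma well_marks [simp]: "well (marks K)" by (induction K) auto

lemma runs_marks: "runs (marks K) (start x) (2 * K + 1) (%t. if odd t & t < 2 * K then ctr 0 else start x t)"
proof (induction K)
 case (Suc K)
 let ?s = "%t. if odd t & t < 2 * K then ctr 0 else start x t"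
 have "?s(Suc (2 * K) := ((fst (?s (Suc (2 * K))))(snd (?s (Suc (2 * K))) := 1), snd (?s (Suc (2 * K))))) =
   (%t. if odd t & t < 2 * Suc K then ctr 0 else start x t)"
 proof
  fix t
  have "t < Suc (Suc (2 * K)) <-> t < 2 * K | t = 2 * K | t = Suc (2 * K)" by auto
  then show "(?s(Suc (2 * K) := ((fst (?s (Suc (2 * K))))(snd (?s (Suc (2 * K))) := 1), snd (?s (Suc (2 * K)))))) t =
   (if odd t & t < 2 * Suc K then ctr 0 else start x t)" by (auto simp: start_def blank_tape_def ctr_def fun_eq_iff)
 qed
 then show ?case using runs_Seq[OF Suc runs_Wr[of "Suc (2 * K)" 1], of "2 * Suc K + 1"] by simp
qed (use runs_nop in simp)

lemma poly_pb: "pb (%n. n) (poly (P :: nat poly))"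
proof (induction P)
 case (pCons a P)
 have "pb (%n. n) (%n. a + n * poly P n)" by (intro pb_add pb_const pb_mult pCons pb_size)
 then show ?case by simp
qed (use pb_const[of "%n. n" 0] in simp)

text \<open>\<open>M\<close> has to behave well only on the words \<open>F1 x\<close>, which is all
  that is known of an approximation algorithm. It may leave its own tapes dirty, since
  \<open>F2\<close> needs just its input, a blank word tape 1 and zero counters.\<close>

lemma pipeline:
 assumes F1: "WP UNIV F1" and M: "wf_tm M" "!!x. halts_within M (F1 x) (poly P (length (F1 x)))" "!!x. outputs M (F1 x) (R x)"
  and F2: "WP UNIV F2" and L: "!!x. F2 (R x) = [x \<in> L]"
 shows "L \<in> class_P"
proof -
 obtain e1 q1 where q1: "wcmp UNIV F1 (%w. (length w + 2) ^ e1) q1" using F1 by (auto simp: WP_def)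
 obtain e2 q2 where q2: "wcmp UNIV F2 (%w. (length w + 2) ^ e2) q2" using F2 by (auto simp: WP_def)
 note p1 = wcmpD(1,3)[OF q1, where b = 0] and p2 = wcmpD(1,3)[OF q2, where b = 0]
 obtain g where g: "!!n. poly P n <= (n + 2) ^ g" using poly_pb[of P] by (auto simp: pb_def)
 let ?q = "q1 0 ;; tmprog M ;; q2 0"
 have wq: "well ?q" using p1(1) p2(1) well_tmprog[OF M(1)] by simp
 then obtain k' m where "wfpr k' m ?q" by (auto simp: well_def)
 then have "wfpr (Suc k') m ?q" by (rule wfpr_mono) auto
 then obtain k where km: "wfpr k m ?q" and k: "0 < k" by blast
 let ?A = "%x :: bool list. (length x + 2) ^ e1"
 let ?B = "%x. ?A x + (?A x + 2) ^ g"
 let ?T = "%x. (2 * k + 1) + (?A x + 100 * (?B x + 1) + (?B x + 2) ^ e2 + 2) + 1"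
 have "pb length ?T" by (intro pb_add pb_mult pb_const pb_power pb_size)
 then obtain E where E: "!!x. ?T x <= (length x + 2) ^ E" by (auto simp: pb_def)
 show ?thesis
 proof (rule prog_class_P[of "marks k ;; ?q" E L])
  fix x
  define c where "c = (%i :: nat. 0 :: nat)"
  define u where "u = (%i :: nat. if i = 0 then input_tape x else blank_tape)"
  have lF: "length (F1 x) <= ?A x" using wcmpD(2)[OF q1] by simp
  have T: "poly P (length (F1 x)) <= (?A x + 2) ^ g" using lF by (intro le_trans[OF g] power_mono) auto
  have 1: "runs (q1 0) (mk c u) (?A x) (mk c (u(0 := input_tape (F1 x))))" by (rule p1(2)) (auto simp: c_def u_def)
  have tm: "length (R x) <= length (F1 x) + poly P (length (F1 x)) &
   (EX u'. runs (tmprog M) (mk c (u(0 := input_tape (F1 x)))) (100 * (length (F1 x) + poly P (length (F1 x)) + 1)) (mk c u') &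
    u' 0 = input_tape (R x) & u' 1 = blank_tape)" by (rule runs_tmprog[OF M(1,2,3)]) (auto simp: c_def u_def)
  then obtain u' where u': "runs (tmprog M) (mk c (u(0 := input_tape (F1 x)))) (100 * (length (F1 x) + poly P (length (F1 x)) + 1)) (mk c u')"
    "u' 0 = input_tape (R x)" "u' 1 = blank_tape" by blast
  have lR: "length (R x) <= ?B x" using tm lF T by linarith
  have 3: "runs (q2 0) (mk c u') ((length (R x) + 2) ^ e2) (mk c (u'(0 := input_tape (F2 (R x)))))"
   by (rule p2(2)) (use u' in "auto simp: c_def")
  have gen: "a <= A ==> t <= B ==> r <= C ==> A + (100 * (a + t + 1) + r + 1) + 1 <= A + 100 * (A + B + 1) + C + 2"
   for a A t B r C :: nat by simp
  have "(length (R x) + 2) ^ e2 <= (?B x + 2) ^ e2" using lR by (intro power_mono) auto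
  then have "runs ?q (mk c u) (?A x + 100 * (?B x + 1) + (?B x + 2) ^ e2 + 2) (mk c (u'(0 := input_tape (F2 (R x)))))"
   by (intro runs_Seq[OF 1 runs_Seq[OF u'(1) 3 le_refl]] gen lF T)
  then obtain n where n: "n <= ?A x + 100 * (?B x + 1) + (?B x + 2) ^ e2 + 2" "exec ?q (mk c u) n (mk c (u'(0 := input_tape (F2 (R x)))))"
   by (auto simp: runs_def)
  let ?s = "%t. if odd t & t < 2 * k then ctr 0 else start x t"
  have agree: "ALL t<k. mk c u t = ?s t" by (auto simp: mk_def c_def u_def start_def elim!: evenE)
  obtain b' where b': "exec ?q ?s n b'" "ALL t<k. mk c (u'(0 := input_tape (F2 (R x)))) t = b' t"
   using exec_agree[OF n(2) km agree] by blast
  obtain n0 where n0: "n0 <= 2 * k + 1" "exec (marks k) (start x) n0 ?s" using runs_marks[of k x] by (auto simp: runs_def)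
  have b0: "b' 0 = input_tape [x \<in> L]" using b'(2) k L mk_0[of c "u'(0 := input_tape (F2 (R x)))"] by simp
  have "exec (marks k ;; ?q) (start x) (Suc (n0 + n)) b'" by (rule exec.exec_Seq[OF n0(2) b'(1)])
  moreover have "Suc (n0 + n) <= (length x + 2) ^ E" using E[of x] n0(1) n(1) by linarith
  moreover have "fst (b' 0) 0 = bit_symbol (x \<in> L)" "fst (b' 0) 1 = 0" unfolding b0 by (simp_all add: input_tape_def)
  ultimately show "EX n ts. n <= (length x + 2) ^ E & exec (marks k ;; ?q) (start x) n ts & fst (ts 0) 0 = bit_symbol (x \<in> L) & fst (ts 0) 1 = 0"
   by blast
 qed (use wq in simp)
qed

section \<open>From gaps to fill-ins\<close>

text \<open>Split graphs are chordal: on an induced cycle of length at least four, one of two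
  consecutive vertices is in the clique, but two vertices of the clique cannot lie at distance two
  or more along the cycle.\<close>

lemma split_chordal:
 assumes K: "!!u v. u \<in> K ==> v \<in> K ==> u ~= v ==> {u, v} \<in> E"
  and R: "!!u v. u \<in> V ==> v \<in> V ==> u ~: K ==> v ~: K ==> {u, v} ~: E"
 shows "chordal V E" unfolding chordal_def
proof (rule notI, elim exE conjE)
 fix c assume c: "induced_cycle V E c" and l: "4 <= length c"
 have e: "{c ! i, c ! j} \<in> E <-> j = (i + 1) mod length c | i = (j + 1) mod length c" if "i < length c" "j < length c" for i j
  using c that by (simp add: induced_cycle_def)
 have d: "c ! i ~= c ! j" if "i < length c" "j < length c" "i ~= j" for i j
  using c that by (simp add: induced_cycle_def nth_eq_iff_index_eq)
 have V: "c ! i \<in> V" if "i < length c" for i using c that by (auto simp: induced_cycle_def)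
 have ok: "{c ! i, c ! j} \<in> E" if "i < length c" "j < length c" "i ~= j" "c ! i \<in> K" "c ! j \<in> K" for i j using K d that by blast
 have m4: "4 mod length c ~= 1" using l by (cases "length c = 4") auto
 have n: "c ! 0 ~: K | c ! 2 ~: K" "c ! 1 ~: K | c ! 3 ~: K"
 proof -
  show "c ! 0 ~: K | c ! 2 ~: K" using ok[of 0 2] e[of 0 2] l by force
  have "0 < length c" "1 < length c" "2 < length c" "3 < length c" using l by linarith+
  then show "c ! 1 ~: K | c ! 3 ~: K" using ok[of 1 3] e[of 1 3] m4 by auto
 qed
 have r: "c ! i \<in> K | c ! Suc i \<in> K" if "Suc i < length c" for i using R[OF V V, of i "Suc i"] e[of i "Suc i"] that by auto
 have ne: "c ~= []" using l by auto
 have r3: "c ! 0 \<in> K | c ! (length c - 1) \<in> K"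
  using R[OF V V, of 0 "length c - 1"] e[of 0 "length c - 1"] l ne by (auto simp: mod_Suc)
 show False
 proof (cases "c ! 0 \<in> K")
  case True
  then have "c ! 2 ~: K" using n by blast
  then have "c ! 1 \<in> K" "c ! 3 \<in> K" using r[of 1] r[of 2] l by (auto simp: numeral_eq_Suc)
  then show False using n by blast
 next
  case False
  then have 1: "c ! 1 \<in> K" and 2: "c ! (length c - 1) \<in> K" using r[of 0] r3 l by auto
  have "{c ! 1, c ! (length c - 1)} \<in> E" by (rule ok) (use 1 2 l in auto)
  then show False using e[of 1 "length c - 1"] l ne by (auto simp: mod_Suc)
 qed
qed

text \<open>The vertices below \<open>n\<close> carry a conflict graph with proper colouring \<open>col\<close>; the others form a
 clique of \<open>c\<close> blocks of size \<open>N\<close>, and a valid vertex \<open>u\<close> misses exactly the block \<open>col u\<close>.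
 An edge \<open>uv\<close> of the conflict graph and any two vertices of the blocks missed by \<open>u\<close> and \<open>v\<close> span
 a 4-cycle, so a fill-in has to complete \<open>u\<close> or \<open>v\<close>.\<close>

definition fadj :: "nat => nat => (nat => bool) => (nat => nat) => (nat => nat => bool) => nat => nat => bool" where
 "fadj n N valid col conf u v <-> u ~= v &
   (if u < n then if v < n then conf u v else ~ (valid u & (v - n) div N = col u)
   else v < n --> ~ (valid v & (u - n) div N = col v))"

definition fE where
 "fE V n N valid col conf = {{u, v} | u v. u < V & v < V & fadj n N valid col conf u v}"

locale fillred =
 fixes n N c :: nat and valid :: "nat => bool" and col :: "nat => nat" and conf :: "nat => nat => bool"
 assumes col: "!!u. u < n ==> col u < c" and conf_sym: "!!u v. conf u v ==> conf v u"
  and conf: "!!u v. u < n ==> v < n ==> conf u v ==> valid u & valid v & col u ~= col v"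
begin

abbreviation "V == n + c * N"
abbreviation "E == fE V n N valid col conf"
abbreviation "adj == fadj n N valid col conf"

lemma adj_sym: "adj u v ==> adj v u" using conf_sym by (auto simp: fadj_def split: if_splits)

lemma E_iff: "{u, v} \<in> E <-> u < V & v < V & adj u v" unfolding fE_def using adj_sym by (auto simp: doubleton_eq_iff)

lemma E_pairs: "E \<subseteq> vertex_pairs {..<V}" by (auto simp: fE_def vertex_pairs_def fadj_def)

lemma simple: "simple_graph {..<V} E" using E_pairs by (simp add: simple_graph_def)

definition bl :: "nat => nat => nat" where "bl k i = n + (k * N + i)"

lemma bl: "k < c ==> i < N ==> bl k i < V & ~ bl k i < n & (bl k i - n) div N = k"
 using pair_less[of k c i N] by (simp add: bl_def div_pair)

lemma bl_inj: "i < N ==> i' < N ==> bl k i = bl k' i' ==> k = k' & i = i'" by (metis add_left_cancel bl_def div_pair)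

lemma lower:
 assumes F: "fill_in {..<V} E F"
 shows "EX S. S \<subseteq> {u. u < n & valid u} & (ALL u<n. ALL v<n. conf u v --> u \<in> S | v \<in> S) & card S * N <= card F"
proof -
 define S where "S = {u. u < n & valid u & (ALL i<N. {u, bl (col u) i} \<in> F)}"
 have Fp: "F \<subseteq> vertex_pairs {..<V}" and ch: "chordal {..<V} (E \<union> F)" using F by (auto simp: fill_in_def)
 have finF: "finite F"
 proof (rule finite_subset[OF Fp])
  have "vertex_pairs {..<V} \<subseteq> Pow {..<V}" by (auto simp: vertex_pairs_def)
  then show "finite (vertex_pairs {..<V})" by (rule finite_subset) simp
 qed
 have cov: "u \<in> S | v \<in> S" if uv: "u < n" "v < n" "conf u v" for u v
 proof (rule ccontr)
  assume a: "~ ?thesis"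
  note cf = conf[OF uv]
  obtain i j where i: "i < N" "{u, bl (col u) i} ~: F" and j: "j < N" "{v, bl (col v) j} ~: F" using a cf uv by (auto simp: S_def)
  let ?x = "bl (col u) i" and ?y = "bl (col v) j"
  note x = bl[OF col[OF uv(1)] i(1)] and y = bl[OF col[OF uv(2)] j(1)]
  have ne: "u ~= v" "?x ~= ?y" "u ~= ?x" "u ~= ?y" "v ~= ?x" "v ~= ?y" using cf x y uv by auto
  \<comment> \<open>As the colours differ, \<open>v\<close> sees the block missed by
    \<open>u\<close> and conversely; the two diagonals are the pairs that were not filled
    in.\<close>
  have e: "{u, v} \<in> E" "{v, ?x} \<in> E" "{?x, ?y} \<in> E" "{?y, u} \<in> E" "{u, ?x} ~: E" "{v, ?y} ~: E"
   unfolding E_iff fadj_def using uv cf x y ne by auto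
  have s: "{z} ~: E \<union> F" for z using E_pairs Fp by (auto simp: vertex_pairs_def)
  let ?c = "[u, v, ?x, ?y]"
  have "induced_cycle {..<V} (E \<union> F) ?c" unfolding induced_cycle_def
  proof (intro conjI allI impI)
   show "distinct ?c" using ne by auto
   show "set ?c \<subseteq> {..<V}" using x y uv by auto
   fix i' j' assume "i' < length ?c" "j' < length ?c"
   then have "i' = 0 | i' = 1 | i' = 2 | i' = 3" "j' = 0 | j' = 1 | j' = 2 | j' = 3" by auto
   then show "{?c ! i', ?c ! j'} \<in> E \<union> F <-> j' = (i' + 1) mod length ?c | i' = (j' + 1) mod length ?c"
    using e i(2) j(2) s by (elim disjE) (simp_all add: insert_commute)
  qed simp
  then show False using ch unfolding chordal_def by force
 qed
 let ?g = "%(u, i). {u, bl (col u) i}"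
 have "card S * N = card (S \<times> {..<N})" by (simp add: card_cartesian_product)
 also have "... <= card F"
 proof (rule card_inj_on_le[OF _ _ finF])
  show "?g ` (S \<times> {..<N}) \<subseteq> F" by (auto simp: S_def)
  show "inj_on ?g (S \<times> {..<N})"
  proof (rule inj_onI)
   fix a b assume a: "a \<in> S \<times> {..<N}" "b \<in> S \<times> {..<N}" "?g a = ?g b"
   obtain u i v j where ab: "a = (u, i)" "b = (v, j)" by fastforce
   have uv: "u < n" "v < n" "i < N" "j < N" "{u, bl (col u) i} = {v, bl (col v) j}" using a ab by (auto simp: S_def)
   have "~ bl (col u) i < n" "~ bl (col v) j < n" using bl col uv by blast+
   then have "u = v" "bl (col u) i = bl (col v) j" using uv by (auto simp: doubleton_eq_iff)
   then show "a = b" using bl_inj uv ab by blast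
  qed
 qed
 finally show ?thesis using cov by (intro exI[of _ S]) (auto simp: S_def)
qed

text \<open>Joining the cover completely to the blocks and making it a clique leaves a split graph,
  since the rest is free of conflicts. The clique on the cover accounts for the term
  \<open>n * n\<close>.\<close>

lemma upper:
 assumes S: "S \<subseteq> {..<n}" and cov: "!!u v. u < n ==> v < n ==> conf u v ==> u \<in> S | v \<in> S"
 shows "min_fill_in {..<V} E <= card S * N + n * n"
proof -
 define F where "F = (%(u, i). {u, bl (col u) i}) ` (S \<times> {..<N}) \<union> (%(u, v). {u, v}) ` (S \<times> S) - E - {e. card e ~= 2}"
 let ?K = "S \<union> {n..<V}"
 have finS: "finite S" using S finite_subset by blast
 have Fi: "e \<in> F <-> ((EX u:S. EX i<N. e = {u, bl (col u) i}) | (EX u:S. EX v:S. e = {u, v})) & e ~: E & card e = 2" for e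
  unfolding F_def by auto
 have "fill_in {..<V} E F" unfolding fill_in_def
 proof
  show "F \<subseteq> vertex_pairs {..<V} - E"
  proof
   fix e assume "e \<in> F"
   then have e: "(EX u:S. EX i<N. e = {u, bl (col u) i}) | (EX u:S. EX v:S. e = {u, v})" "e ~: E" "card e = 2" unfolding Fi by blast+
   have u: "u < V" "u \<in> S ==> i < N ==> bl (col u) i < V" if "u \<in> S" for u i
   proof -
    have "u < n" using that S by auto
    then show "u < V" "u \<in> S ==> i < N ==> bl (col u) i < V" using bl[OF col[of u]] by auto
   qed
   have "e \<subseteq> {..<V}" using e(1) u by auto
   then show "e \<in> vertex_pairs {..<V} - E" using e by (simp add: vertex_pairs_def)
  qed
  have cl: "{u, v} \<in> E \<union> F" if uv: "u \<in> S" "v \<in> ?K" "u ~= v" for u v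
  proof (rule ccontr)
   assume nE: "{u, v} ~: E \<union> F"
   have u: "u < n" using uv S by auto
   show False
   proof (cases "v \<in> S")
    case True
    then have "{u, v} \<in> F" using nE uv unfolding Fi by auto
    then show False using nE by blast
   next
    case False
    then have v: "n <= v" "v < V" using uv by auto
    have "~ adj u v" using nE u v unfolding Un_iff E_iff by auto
    then have b: "(v - n) div N = col u" using u v by (auto simp: fadj_def)
    have "0 < N" using v by (cases N) auto
    then have i: "(v - n) mod N < N" by simp
    have "v = bl (col u) ((v - n) mod N)" unfolding bl_def b[symmetric] using v by simp
    then obtain i0 where i0: "i0 < N" "v = bl (col u) i0" using i by blast
    have "EX u':S. EX i<N. {u, v} = {u', bl (col u') i}" by (rule bexI[of _ u], rule exI[of _ i0]) (use i0 uv in auto)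
    then have "{u, v} \<in> F" using nE uv unfolding Fi by auto
    then show False using nE by blast
   qed
  qed
  show "chordal {..<V} (E \<union> F)"
  proof (rule split_chordal[of ?K])
   fix u v assume uv: "u \<in> ?K" "v \<in> ?K" "u ~= v"
   consider "u \<in> S" | "v \<in> S" | "n <= u" "n <= v" "u < V" "v < V" using uv by auto
   then show "{u, v} \<in> E \<union> F"
   proof cases
    case 1 then show ?thesis using cl uv by blast
   next
    case 2 then show ?thesis using cl[of v u] uv by (simp add: insert_commute)
   next
    case 3
    then have "{u, v} \<in> E" unfolding E_iff fadj_def using uv by auto
    then show ?thesis by blast
   qed
  next
   fix u v assume "u \<in> {..<V}" "v \<in> {..<V}" "u ~: ?K" "v ~: ?K"
   then have uv: "u < n" "v < n" "u ~: S" "v ~: S" by auto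
   have "{u, v} ~: E" unfolding E_iff fadj_def using uv cov by auto
   moreover have "{u, v} ~: F"
   proof
    assume "{u, v} \<in> F"
    then obtain w where "w \<in> S" "w \<in> {u, v}" unfolding Fi by blast
    then show False using uv by auto
   qed
   ultimately show "{u, v} ~: E \<union> F" by blast
  qed
 qed
 then have "min_fill_in {..<V} E <= card F" unfolding min_fill_in_def by (intro Least_le) blast
 also have "... <= card ((%(u, i). {u, bl (col u) i}) ` (S \<times> {..<N}) \<union> (%(u, v). {u, v}) ` (S \<times> S))"
  unfolding F_def using finS by (intro card_mono) auto
 also have "... <= card ((%(u, i). {u, bl (col u) i}) ` (S \<times> {..<N})) + card ((%(u, v). {u, v}) ` (S \<times> S))"
  by (rule card_Un_le)
 also have "... <= card (S \<times> {..<N}) + card (S \<times> S)" using finS by (intro add_mono card_image_le) auto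
 also have "... <= card S * N + n * n"
 proof -
  have "card S <= n" using card_mono[OF _ S] by simp
  then show ?thesis by (simp add: card_cartesian_product mult_le_mono)
 qed
 finally show ?thesis .
qed

end

section \<open>Adjacency matrices as words\<close>

lemma concat_upt: "concat (map (%i. map (f i) [0..<n]) [0..<m]) = map (%k. f (k div n) (k mod n)) [0..<m * n]"
proof (induction m)
 case (Suc m)
 have "[0..<Suc m * n] = [0..<m * n] @ map (%j. j + m * n) [0..<n]"
  unfolding map_add_upt using upt_add_eq_append[of 0 "m * n" n] by (simp add: add.commute)
 moreover have "map ((%k. f (k div n) (k mod n)) \<circ> (%j. j + m * n)) [0..<n] = map (f m) [0..<n]" by (rule map_cong) auto
 ultimately show ?case using Suc by simp
qed simp

lemma encode_alt: "encode n E = map (%k. {k div n, k mod n} \<in> E) [0..<n * n]" unfolding encode_def by (rule concat_upt)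

lemma wbit_encode: "wbit (encode n E) k <-> k < n * n & {k div n, k mod n} \<in> E" by (auto simp: wbit_def encode_alt)

lemma card_bits_encode:
 assumes F: "F \<subseteq> vertex_pairs {..<n}"
 shows "card {i. i < n * n & wbit (encode n F) i} = 2 * card F"
proof -
 have "card {i. i < n * n & wbit (encode n F) i} = (\<Sum>i<n * n. if wbit (encode n F) i then 1 else 0)" by (rule sum_card[symmetric])
 also have "... = (\<Sum>i<n * n. if {i div n, i mod n} \<in> F then 1 else 0)" by (rule sum.cong[OF refl]) (simp add: wbit_encode)
 also have "... = card {i. i < n * n & {i div n, i mod n} \<in> F}" by (rule sum_card)
 also have "... = card {(a, b). {a, b} \<in> F}"
 proof (rule bij_betw_same_card[of "%i. (i div n, i mod n)"], rule bij_betw_imageI)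
  show "inj_on (%i. (i div n, i mod n)) {i. i < n * n & {i div n, i mod n} \<in> F}" by (rule inj_onI) (metis div_mult_mod_eq prod.inject)
  show "(%i. (i div n, i mod n)) ` {i. i < n * n & {i div n, i mod n} \<in> F} = {(a, b). {a, b} \<in> F}"
  proof (intro equalityI subsetI)
   fix p assume "p \<in> {(a, b). {a, b} \<in> F}"
   then obtain a b where p: "p = (a, b)" "{a, b} \<in> F" by blast
   then have ab: "a < n" "b < n" using F by (auto simp: vertex_pairs_def)
   then have "a * n + b < n * n" "(a * n + b) div n = a" "(a * n + b) mod n = b" using pair_less[of a n b n] div_pair[of b n a] by auto
   then show "p \<in> (%i. (i div n, i mod n)) ` {i. i < n * n & {i div n, i mod n} \<in> F}"
    using p by (intro image_eqI[of _ _ "a * n + b"]) auto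
  qed auto
 qed
 also have "{(a, b). {a, b} \<in> F} = (\<Union>e\<in>F. {(a, b). {a, b} = e})" by auto
 also have "card ... = (\<Sum>e\<in>F. card {(a, b). {a, b} = e})"
 proof (rule card_UN_disjoint)
  have "F \<subseteq> Pow {..<n}" using F by (auto simp: vertex_pairs_def)
  then show "finite F" by (rule finite_subset) simp
  show "ALL e:F. finite {(a, b). {a, b} = e}"
  proof
   fix e assume "e \<in> F"
   then have "finite e" using F by (auto simp: vertex_pairs_def intro: finite_subset)
   moreover have "{(a, b). {a, b} = e} \<subseteq> e \<times> e" by auto
   ultimately show "finite {(a, b). {a, b} = e}" using finite_subset by blast
  qed
 qed auto
 also have "... = (\<Sum>e\<in>F. 2)"
 proof (rule sum.cong[OF refl])
  fix e assume "e \<in> F"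
  then have "card e = 2" using F by (auto simp: vertex_pairs_def)
  then obtain a b where ab: "e = {a, b}" "a ~= b" by (auto simp: card_2_iff)
  then have "{(x, y). {x, y} = e} = {(a, b), (b, a)}" by (auto simp: doubleton_eq_iff)
  then show "card {(a, b). {a, b} = e} = 2" using ab by simp
 qed
 finally show ?thesis by simp
qed

text \<open>Vertices for each constraint: residues below \<open>2 ^ q\<close> are its views, and
  residue \<open>2 ^ q + 2 * k + b\<close> states that the variable at position \<open>k\<close> has
  value \<open>b\<close>.\<close>

definition gR :: "nat => nat" where "gR q = 2 ^ q + 2 * q"

definition isA :: "nat => nat => bool" where "isA q u <-> u mod gR q < 2 ^ q"

definition bpos :: "nat => nat => nat" where "bpos q u = (u mod gR q - 2 ^ q) div 2"

definition bbit :: "nat => nat => bool" where "bbit q u = odd (u mod gR q - 2 ^ q)"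

definition claims :: "nat => scope => nat => nat => bool => bool" where
 "claims q x u y b <-> (if isA q u then EX k<q. x (u div gR q) k = y & vbit (u mod gR q) k = b
   else x (u div gR q) (bpos q u) = y & bbit q u = b)"

definition gvalid :: "nat => (nat => bool) => nat => bool" where
 "gvalid q Pf u <-> (isA q u --> Pf (u mod gR q))"

definition gcol :: "nat => nat => nat" where
 "gcol q u = (if isA q u then u mod gR q else 2 ^ q + (u mod gR q - 2 ^ q) mod 2)"

text \<open>The vertices stand for a view of a constraint or for a value of one of its variables; an independent
 set that contains neither value of a variable \<open>y\<close> loses one vertex for each occurrence of \<open>y\<close>.\<close>

definition gconf where
 "gconf q M x Pf u v <-> gvalid q Pf u & gvalid q Pf v &
   (if isA q u & isA q v then u div gR q = v div gR q & u mod gR q ~= v mod gR q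
   else EX y<Suc (q * M). claims q x u y True & claims q x v y False | claims q x u y False & claims q x v y True)"

definition nval :: "nat => (nat => bool) => nat" where "nval q Pf = card {v. v < 2 ^ q & Pf v}"

lemma card_rect: "0 < R ==> card {u. u < M * R & Q (u div R) (u mod R)} = (\<Sum>j<M. card {r. r < (R :: nat) & Q j r})"
proof -
 assume R: "0 < R"
 have "card {u. u < M * R & Q (u div R) (u mod R)} = (\<Sum>u<M * R. if Q (u div R) (u mod R) then 1 else 0)" by (rule sum_card[symmetric])
 also have "... = (\<Sum>j<M. \<Sum>r<R. if Q ((j * R + r) div R) ((j * R + r) mod R) then 1 else 0)" by (rule sum_rect)
 also have "... = (\<Sum>j<M. \<Sum>r<R. if Q j r then 1 else 0)" by (intro sum.cong[OF refl] if_cong refl) (simp add: div_pair)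
 finally show ?thesis by (simp only: sum_card)
qed

lemma card_split: "card {r. r < a + b & (if r < a then P r else Q (r - a))} = card {r. r < (a::nat) & P r} + card {r. r < b & Q r}"
proof -
 have "{r. r < a + b & (if r < a then P r else Q (r - a))} = {r. r < a & P r} \<union> (%r. r + a) ` {r. r < b & Q r}" (is "?L = ?A \<union> ?B")
 proof (intro equalityI subsetI)
  fix r assume r: "r \<in> ?L"
  show "r \<in> ?A \<union> ?B"
  proof (cases "r < a")
   case False
   then have "r - a < b" "r = r - a + a" "Q (r - a)" using r by auto
   then have "r \<in> ?B" by blast
   then show ?thesis by blast
  qed (use r in auto)
 qed auto
 moreover have "card (?A \<union> ?B) = card ?A + card ?B" by (rule card_Un_disjoint) auto
 moreover have "card ?B = card {r. r < b & Q r}" by (rule card_image) (auto simp: inj_on_def)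
 ultimately show ?thesis by simp
qed

lemma card_odd: "card {r. r < 2 * q & odd r ~= f (r div 2)} = (q :: nat)"
proof -
 have "card {r. r < q * 2 & (%k b. odd b ~= f k) (r div 2) (r mod 2)} = (\<Sum>k<q. card {b. b < (2::nat) & odd b ~= f k})"
  by (rule card_rect) simp
 also have "... = (\<Sum>k<q. 1)"
 proof (rule sum.cong[OF refl])
  fix k
  have "{b. b < (2::nat) & odd b ~= f k} = {if f k then 0 else 1}" by (auto simp: less_2_cases_iff)
  then show "card {b. b < (2::nat) & odd b ~= f k} = 1" by simp
 qed
 finally show ?thesis by (simp add: mult.commute odd_iff_mod_2_eq_one)
qed

text \<open>The bound is not strict because \<open>cx\<close> may return \<open>q * M\<close> on
  malformed words; this is why \<open>gconf\<close> lets \<open>y\<close> range below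
  \<open>Suc (q * M)\<close>.\<close>

locale cgraph =
 fixes q M :: nat and x :: "nat => nat => nat" and Pf :: "nat => bool"
 assumes x_le: "!!j k. x j k <= q * M"
begin

abbreviation "R == gR q"
abbreviation "n == M * R"
abbreviation "val == gvalid q Pf"
abbreviation "conf == gconf q M x Pf"

lemma R_pos: "0 < R" by (simp add: gR_def)

lemma gcol_less: "gcol q u < 2 ^ q + 2" by (auto simp: gcol_def isA_def)

lemma gconf_col: "conf u v ==> gcol q u ~= gcol q v"
proof -
 assume c: "conf u v"
 show ?thesis
 proof (cases "isA q u | isA q v")
  case True
  then show ?thesis using c by (auto simp: gconf_def gcol_def isA_def)
 next
  case False
  then have "bbit q u ~= bbit q v" using c by (auto simp: gconf_def claims_def)
  then have "(u mod R - 2 ^ q) mod 2 ~= (v mod R - 2 ^ q) mod 2" unfolding bbit_def by (metis odd_iff_mod_2_eq_one)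
  then show ?thesis using False by (simp add: gcol_def)
 qed
qed

sublocale fillred n N "2 ^ q + 2" val "gcol q" conf for N using gcol_less gconf_col by unfold_locales (auto simp: gconf_def)

lemma card_val: "card {u. u < n & val u} = M * (nval q Pf + 2 * q)"
proof -
 have "card {u. u < n & val u} = card {u. u < n & (%j r. if r < 2 ^ q then Pf r else True) (u div R) (u mod R)}"
  by (rule arg_cong[of _ _ card]) (auto simp: gvalid_def isA_def split: if_splits)
 also have "... = (\<Sum>j<M. card {r. r < R & (if r < 2 ^ q then Pf r else True)})" by (rule card_rect[OF R_pos])
 also have "card {r. r < R & (if r < 2 ^ q then Pf r else True)} = nval q Pf + 2 * q"
  unfolding gR_def nval_def using card_split[of "2 ^ q" "2 * q" Pf "%r. True"] by simp
 finally show ?thesis by simp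
qed

text \<open>The valid vertices outside the cover are the view of each constraint under
  \<open>a\<close> and the values of its \<open>q\<close> occurrences, that is \<open>1 + q\<close>
  for each constraint. Adding \<open>M\<close> on the left avoids subtraction.\<close>

lemma cover_sat:
 assumes s: "!!j. j < M ==> sat q x (%j. Pf) a j"
 shows "\<exists>S\<subseteq>{..<n}. (ALL u<n. ALL v<n. conf u v --> u \<in> S | v \<in> S) & card S + M = M * (nval q Pf + q)"
proof -
 define vw where "vw j = vcode q (%k. a (x j k))" for j
 define Q where "Q j r = (if r < 2 ^ q then Pf r & r ~= vw j else odd (r - 2 ^ q) ~= a (x j ((r - 2 ^ q) div 2)))" for j r
 define S where "S = {u. u < n & Q (u div R) (u mod R)}"
 have Pv: "j < M ==> Pf (vw j)" for j using s by (simp add: sat_def vw_def)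
 have c: "b = a y" if "u < n" "u ~: S" "val u" "claims q x u y b" for u y b
 proof (cases "isA q u")
  case True
  then have "u mod R = vw (u div R)" using that by (auto simp: S_def Q_def isA_def gvalid_def)
  then show ?thesis using that(4) True by (auto simp: claims_def vw_def vbit_vcode)
 next
  case False
  then show ?thesis using that by (auto simp: S_def Q_def isA_def claims_def bbit_def bpos_def)
 qed
 have cov: "u \<in> S | v \<in> S" if uv: "u < n" "v < n" "conf u v" for u v
 proof (rule ccontr)
  assume n: "~ ?thesis"
  have val: "val u" "val v" using uv by (auto simp: gconf_def)
  show False
  proof (cases "isA q u & isA q v")
   case True
   then have "u mod R = vw (u div R)" "v mod R = vw (v div R)" using n uv val by (auto simp: S_def Q_def isA_def gvalid_def)
   then show False using uv(3) True by (auto simp: gconf_def)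
  next
   case False
   then obtain y b where "claims q x u y b" "claims q x v y (~ b)" using uv(3) unfolding gconf_def by (metis (full_types))
   then show False using c[OF uv(1) _ val(1)] c[OF uv(2) _ val(2)] n by blast
  qed
 qed
 have "card S = (\<Sum>j<M. card {r. r < R & Q j r})" unfolding S_def by (rule card_rect[OF R_pos])
 also have "... = (\<Sum>j<M. nval q Pf - 1 + q)"
 proof (rule sum.cong[OF refl])
  fix j assume j: "j \<in> {..<M}"
  have "card {r. r < R & Q j r} = card {r. r < 2 ^ q & (Pf r & r ~= vw j)} + card {r. r < 2 * q & odd r ~= a (x j (r div 2))}"
   unfolding gR_def Q_def by (rule card_split)
  also have "{r. r < 2 ^ q & (Pf r & r ~= vw j)} = {r. r < 2 ^ q & Pf r} - {vw j}" by auto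
  also have "card ... = nval q Pf - 1" unfolding nval_def using Pv[of j] j vcode_less by (subst card_Diff_singleton) (auto simp: vw_def)
  also have "card {r. r < 2 * q & odd r ~= a (x j (r div 2))} = q" by (rule card_odd)
  finally show "card {r. r < R & Q j r} = nval q Pf - 1 + q" .
 qed
 finally have cS: "card S = M * (nval q Pf - 1 + q)" by simp
 have "card S + M = M * (nval q Pf + q)"
 proof (cases "M = 0")
  case False
  then have "vw 0 \<in> {v. v < 2 ^ q & Pf v}" using Pv[of 0] vcode_less by (auto simp: vw_def)
  then have "0 < nval q Pf" unfolding nval_def by (subst card_gt_0_iff) auto
  then have "nval q Pf - 1 + q + 1 = nval q Pf + q" by simp
  then show ?thesis unfolding cS by (metis add_mult_distrib2 mult.right_neutral)
 qed (simp add: cS)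
 moreover have "S \<subseteq> {..<n}" by (auto simp: S_def)
 ultimately show ?thesis using cov by blast
qed

text \<open>The independent set \<open>I\<close> left by the cover has at most one value vertex for
  each occurrence and at most one view for each constraint. A view all of whose variables have a
  value in \<open>I\<close> is the view under \<open>a\<close>, so its constraint is satisfied; any
  other view is paid for by an occurrence without a value vertex.\<close>

lemma cover_bound:
 assumes S: "S \<subseteq> {u. u < n & val u}" and cov: "ALL u<n. ALL v<n. conf u v --> u \<in> S | v \<in> S"
 shows "EX a. M * (nval q Pf + q) + unsat q M x (%j. Pf) a <= card S + M"
proof -
 define I where "I = {u. u < n & val u} - S"
 have ind: "~ conf u v" if "u \<in> I" "v \<in> I" for u v using that cov by (auto simp: I_def)
 define IA where "IA = {u \<in> I. isA q u}"
 define IB where "IB = {u \<in> I. ~ isA q u}"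
 \<comment> \<open>Conflicts make the values in \<open>IB\<close> consistent, so this reads them
   off, with False where there is none.\<close>
 define a where "a y <-> (EX u:IB. claims q x u y True)" for y
 define H where "H y <-> (EX u:IB. EX b. claims q x u y b)" for y
 have fin: "finite I" by (auto simp: I_def)
 have nocl: "~ (claims q x u y b & claims q x v y (~ b))" if "u \<in> IB" "v \<in> I" for u v y b
 proof
  assume cl: "claims q x u y b & claims q x v y (~ b)"
  then have "y < Suc (q * M)" using x_le that by (auto simp: claims_def IB_def less_Suc_eq_le)
  then have "conf u v" unfolding gconf_def using cl that by (cases b) (auto simp: IB_def I_def)
  then show False using ind that by (auto simp: IB_def)
 qed
 have a: "a y = b" if "u \<in> IB" "claims q x u y b" for u y b
  using that nocl[of _ u y True] unfolding a_def by (cases b) (auto simp: IB_def)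
 have dm: "u div R < M" "u mod R < R" if "u < n" for u using that R_pos by (auto simp: less_mult_imp_div_less)
 define occ where "occ = {(j, k). j < M & k < q}"
 have finocc: "finite occ" unfolding occ_def by (rule finite_subset[of _ "{..<M} \<times> {..<q}"]) auto
 have cocc: "card occ = M * q"
 proof -
  have "occ = {..<M} \<times> {..<q}" by (auto simp: occ_def)
  then show ?thesis by (simp add: card_cartesian_product)
 qed
 let ?O = "{(j, k) \<in> occ. H (x j k)}"
 let ?N = "{(j, k) \<in> occ. ~ H (x j k)}"
 let ?S = "{j. j < M & sat q x (%j. Pf) a j}"
 have B: "card IB <= card ?O"
 proof (rule card_inj_on_le[of "%u. (u div R, bpos q u)"])
  show "inj_on (%u. (u div R, bpos q u)) IB"
  proof (rule inj_onI)
   fix u v assume uv: "u \<in> IB" "v \<in> IB" "(u div R, bpos q u) = (v div R, bpos q v)"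
   have cu: "claims q x u (x (u div R) (bpos q u)) (bbit q u)" "claims q x v (x (v div R) (bpos q v)) (bbit q v)"
    using uv by (auto simp: claims_def IB_def)
   then have "bbit q u = bbit q v" using a[OF uv(1) cu(1)] a[OF uv(2) cu(2)] uv(3) by simp
   moreover have ge: "2 ^ q <= u mod R" "2 ^ q <= v mod R" using uv by (auto simp: IB_def isA_def)
   moreover have par: "odd X = odd Y ==> X mod 2 = Y mod 2" for X Y :: nat by presburger
   ultimately have "(u mod R - 2 ^ q) mod 2 = (v mod R - 2 ^ q) mod 2" unfolding bbit_def by blast
   moreover have "(u mod R - 2 ^ q) div 2 = (v mod R - 2 ^ q) div 2" using uv(3) unfolding bpos_def by blast
   ultimately have "u mod R - 2 ^ q = v mod R - 2 ^ q" by (metis div_mult_mod_eq)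
   then have "u mod R = v mod R" using ge by linarith
   then show "u = v" using uv(3) by (metis div_mult_mod_eq prod.inject)
  qed
  show "(%u. (u div R, bpos q u)) ` IB \<subseteq> ?O"
  proof
   fix z assume "z \<in> (%u. (u div R, bpos q u)) ` IB"
   then obtain u where u: "u \<in> IB" "z = (u div R, bpos q u)" by blast
   then have "claims q x u (x (u div R) (bpos q u)) (bbit q u)" by (auto simp: claims_def IB_def)
   then have "H (x (u div R) (bpos q u))" unfolding H_def using u(1) by blast
   moreover have "u < n" "2 ^ q <= u mod R" using u by (auto simp: IB_def I_def isA_def)
   then have "u mod R - 2 ^ q < q * 2" using dm(2)[of u] gR_def[of q] by linarith
   then have "bpos q u < q" unfolding bpos_def by (rule less_mult_imp_div_less)
   ultimately show "z \<in> ?O" using u dm(1)[OF \<open>u < n\<close>] by (simp add: occ_def)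
  qed
  show "finite ?O" by (rule finite_subset[OF _ finocc]) auto
 qed
 have A: "card IA <= card (?S \<union> fst ` ?N)"
 proof (rule card_inj_on_le[of "%u. u div R"])
  show "inj_on (%u. u div R) IA"
  proof (rule inj_onI)
   fix u v assume uv: "u \<in> IA" "v \<in> IA" "u div R = v div R"
   then have "~ conf u v" using ind by (auto simp: IA_def)
   then have "u mod R = v mod R" using uv by (auto simp: gconf_def IA_def I_def)
   then show "u = v" using uv(3) by (metis div_mult_mod_eq)
  qed
  show "(%u. u div R) ` IA \<subseteq> ?S \<union> fst ` ?N"
  proof
   fix j assume "j \<in> (%u. u div R) ` IA"
   then obtain u where u: "u \<in> IA" "j = u div R" by blast
   have un: "u < n" "val u" "isA q u" "u \<in> I" using u by (auto simp: IA_def I_def)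
   have j: "j < M" using dm(1)[OF un(1)] u by simp
   show "j \<in> ?S \<union> fst ` ?N"
   proof (cases "ALL k<q. H (x j k)")
    case True
    have "a (x j k) = vbit (u mod R) k" if k: "k < q" for k
    proof -
     obtain v b where v: "v \<in> IB" "claims q x v (x j k) b" using True k unfolding H_def by blast
     have "claims q x u (x j k) (vbit (u mod R) k)" using un(3) k u by (auto simp: claims_def)
     then have "b = vbit (u mod R) k" using nocl[OF v(1) un(4), of "x j k" b] v(2) by (cases b; cases "vbit (u mod R) k") auto
     then show ?thesis using a[OF v] by simp
    qed
    then have "vcode q (%k. a (x j k)) = vcode q (vbit (u mod R))" by (rule vcode_cong)
    also have "... = u mod R" by (rule vcode_vbit) (use un(3) in "simp add: isA_def")
    finally have "sat q x (%j. Pf) a j" using un(2,3) by (simp add: sat_def gvalid_def)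
    then show ?thesis using j by blast
   next
    case False
    then obtain k where "k < q" "~ H (x j k)" by blast
    then have "(j, k) \<in> ?N" using j by (simp add: occ_def)
    then have "fst (j, k) \<in> fst ` ?N" by (rule imageI)
    then show ?thesis by simp
   qed
  qed
  show "finite (?S \<union> fst ` ?N)" using finocc by (auto intro!: finite_imageI intro: finite_subset[OF _ finocc])
 qed
 have fo: "finite ?N" by (rule finite_subset[OF _ finocc]) auto
 note A
 also have "card (?S \<union> fst ` ?N) <=
  card ?S + card (fst ` ?N)" by (rule card_Un_le)
 also have "... <= card ?S + card ?N" using card_image_le[OF fo, of fst] by simp
 finally have A': "card IA <= card ?S + card ?N" .
 have o: "card ?O + card ?N = M * q"
 proof -
  have "?O \<union> ?N = occ" by auto
  moreover have "finite ?O" by (rule finite_subset[OF _ finocc]) auto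
  then have "card (?O \<union> ?N) = card ?O + card ?N" using fo by (intro card_Un_disjoint) auto
  ultimately show ?thesis using cocc by simp
 qed
 have us: "card ?S + unsat q M x (%j. Pf) a = M"
 proof -
  have "?S \<union> {j. j < M & ~ sat q x (%j. Pf) a j} = {..<M}" by auto
  moreover have "card (?S \<union> {j. j < M & ~ sat q x (%j. Pf) a j}) =
   card ?S + card {j. j < M & ~ sat q x (%j. Pf) a j}" by (rule card_Un_disjoint) auto
  ultimately show ?thesis by (simp add: unsat_def)
 qed
 have iab: "card I = card IA + card IB"
 proof -
  have "I = IA \<union> IB" by (auto simp: IA_def IB_def)
  moreover have "card (IA \<union> IB) = card IA + card IB" using fin by (intro card_Un_disjoint) (auto simp: IA_def IB_def)
  ultimately show ?thesis by simp
 qed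
 have "finite S" using S finite_subset by fastforce
 then have "card I = M * (nval q Pf + 2 * q) - card S" unfolding I_def using S by (simp add: card_Diff_subset card_val)
 then have "M * (nval q Pf + 2 * q) <= card I + card S" by linarith
 then have "M * nval q Pf + 2 * (M * q) <= card I + card S" by (simp add: algebra_simps)
 then have "M * nval q Pf + M * q + unsat q M x (%j. Pf) a <= card S + M" using iab A' B o us by linarith
 then show ?thesis by (intro exI[of _ a]) (simp add: algebra_simps)
qed

end

section \<open>The decision procedure obtained from an approximation scheme\<close>

lemma UB_isA: "U W G u ==> UB W G (%s. isA q (u s))" unfolding isA_def by (intro UB_less U_mod U_const)

lemma UB_bex_const: "(!!i. i < k ==> UB W G (P i)) ==> UB W G (%s. EX i<(k::nat). P i s)"
 by (rule UB_conv[OF UB_not[OF UB_ball_const[of k W G "%i s. ~ P i s"]]]) (auto intro: UB_not)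

lemma UB_claims: assumes u: "U W G u" and y: "U W G y"
 shows "UB W G (%s. claims q (cx q (W s)) (u s) (y s) b)"
proof -
 have m: "UB W G (%s. vbit (u s mod gR q) k)" for k by (rule UB_fin[where k = "gR q"]) (auto intro: U_mod u U_const simp: gR_def)
 have b: "UB W G (%s. bbit q (u s))" unfolding bbit_def
  by (rule UB_fin[where k = "gR q" and F = "%r. odd (r - 2 ^ q)"]) (auto intro: U_mod u U_const simp: gR_def)
 have p: "U W G (%s. bpos q (u s))" unfolding bpos_def by (intro U_div U_diff U_mod u U_const)
 show ?thesis unfolding claims_def by (intro UB_if UB_isA u UB_bex_const UB_conj UB_eq UB_iff U_cx U_div U_const y p m b UB_const)
qed

lemma UB_gvalid: "U W G u ==> UB W G (%s. gvalid q Pf (u s))" unfolding gvalid_def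
 by (intro UB_imp UB_isA UB_fin[of _ _ "%s. u s mod gR q" "gR q" Pf] U_mod U_const) (auto simp: gR_def)

lemma U_gcol: "U W G u ==> U W G (%s. gcol q (u s))" unfolding gcol_def by (intro U_if UB_isA U_add U_mod U_diff U_const)

lemma UB_gconf: assumes u: "U W G u" and v: "U W G v"
 shows "UB W G (%s. gconf q (cM q (W s)) (cx q (W s)) Pf (u s) (v s))"
proof -
 note w = U_weaken1[OF u] U_weaken1[OF v]
 have y: "U (%p. W (fst p)) (lift G) snd" by (rule U_var) (simp add: lift_def)
 show ?thesis unfolding gconf_def
  by (intro UB_conj UB_gvalid UB_if UB_isA UB_eq UB_not U_div U_mod U_const UB_bex UB_disj UB_claims w y u v U_Suc U_mult U_cM)
qed

definition gN :: "nat => nat => nat => nat" where "gN q C M = M * gR q + (2 ^ q + 2) * (C * M)"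

definition gE where
 "gE q C Pf w = fE (gN q C (cM q w)) (cM q w * gR q) (C * cM q w) (gvalid q Pf) (gcol q) (gconf q (cM q w) (cx q w) Pf)"

definition gword where
 "gword q C Pf w = encode (gN q C (cM q w)) (gE q C Pf w)"

lemma first_le: "first n P <= n"
proof -
 have "first n P <= (\<Sum>i<n. 1)" unfolding first_def by (rule sum_mono) auto
 then show ?thesis by simp
qed

lemma cgraph_word: "cgraph q (cM q w) (cx q w)" by unfold_locales (simp add: cx_def first_le)

lemma gE_iff: "{u, v} \<in> gE q C Pf w <-> u < gN q C (cM q w) & v < gN q C (cM q w) &
  fadj (cM q w * gR q) (C * cM q w) (gvalid q Pf) (gcol q) (gconf q (cM q w) (cx q w) Pf) u v"
proof -
 interpret cgraph q "cM q w" "cx q w" Pf by (rule cgraph_word)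
 show ?thesis unfolding gE_def gN_def by (rule E_iff)
qed

lemma UF_gword: "UF (gword q C Pf)"
proof -
 have N: "U W G (%s. gN q C (cM q (W s)))" for W G unfolding gN_def by (intro U_add U_mult U_const U_cM)
 have snd: "U fst [snd] snd" by (rule U_var) simp
 have f: "UB W G (%s. fadj (cM q (W s) * gR q) (C * cM q (W s)) (gvalid q Pf) (gcol q) (gconf q (cM q (W s)) (cx q (W s)) Pf) (u s) (v s))"
  if "U W G u" "U W G v" for W G u and v :: "'c => nat" unfolding fadj_def
  by (intro UB_conj UB_not UB_eq UB_if UB_less UB_imp UB_gconf UB_gvalid U_gcol U_div U_diff U_mult U_const U_cM that)
 have l: "length (gword q C Pf w) = gN q C (cM q w) * gN q C (cM q w)" for w by (simp add: gword_def length_encode)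
 have "U (%w. w) [] (%w. length (gword q C Pf w))" unfolding l by (intro U_mult N[of "%w. w"])
 moreover have "UB fst [snd] (%p. wbit (gword q C Pf (fst p)) (snd p))" unfolding gword_def wbit_encode gE_iff
  by (intro UB_conj UB_less f U_div U_mod snd U_mult N)
 ultimately show ?thesis by (simp add: UF_def)
qed

definition bits :: "bool list => nat" where "bits y = (\<Sum>i<length y. if wbit y i then 1 else 0)"

lemma bits_encode: "F \<subseteq> vertex_pairs {..<n} ==> bits (encode n F) = 2 * card F"
 unfolding bits_def sum_card length_encode by (rule card_bits_encode)

lemma UF_bits: "UF (%y. [bits y * a <= length y * b])"
proof -
 have w: "UB (%p. fst (fst p)) (lift [snd]) (%p. wbit (fst (fst p)) (snd p))"
  by (rule UB_wbit[where W = "%p. fst (fst p)"]) (rule U_var, simp add: lift_def)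
 have "UB fst [snd] (%p. snd p < 1 & bits (fst p) * a <= length (fst p) * b)" unfolding bits_def
  by (intro UB_conj UB_less UB_le U_mult U_const U_sum U_len U_if w) (rule U_var, simp)
 then have "UB fst [snd] (%p. wbit [bits (fst p) * a <= length (fst p) * b] (snd p))" by (rule UB_conv) (auto simp: wbit_def)
 moreover have "U (%w. w) [] (%y. length [bits y * a <= length y * b])" by (simp add: U_const)
 ultimately show ?thesis by (simp add: UF_def)
qed

text \<open>A common consequence of both guarantees. In the graphs to be built the number of edges
  is at most a constant times the square of the number of constraints, like the optimum, so the
  additive term is harmless.\<close>

lemma PTAS_additive:
 assumes "has_PTAS min_fill_in_ratio | has_PTAS chordal_completion_ratio" and e: "0 < \<epsilon>"
 shows "EX A. wf_tm A & poly_time_on A graph_codes & (ALL n E. simple_graph {..<n} E -->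
   (EX F. outputs A (encode n E) (encode n F) & fill_in {..<n} E F &
    real (card F) <= (1 + \<epsilon>) * real (min_fill_in {..<n} E) + \<epsilon> * real (card E)))"
proof -
 obtain A where A: "wf_tm A" "poly_time_on A graph_codes" "min_fill_in_ratio A (1 + \<epsilon>) | chordal_completion_ratio A (1 + \<epsilon>)"
  using assms unfolding has_PTAS_def by blast
 have "EX F. outputs A (encode n E) (encode n F) & fill_in {..<n} E F &
    real (card F) <= (1 + \<epsilon>) * real (min_fill_in {..<n} E) + \<epsilon> * real (card E)" if s: "simple_graph {..<n} E" for n E
  using A(3)
 proof
  assume "min_fill_in_ratio A (1 + \<epsilon>)"
  then obtain F where F: "outputs A (encode n E) (encode n F)" "fill_in {..<n} E F" "real (card F) <= (1 + \<epsilon>) * real (min_fill_in {..<n} E)"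
   using s unfolding min_fill_in_ratio_def by blast
  have "0 <= \<epsilon> * real (card E)" using e by simp
  then show ?thesis using F by (intro exI[of _ F]) simp
 next
  assume "chordal_completion_ratio A (1 + \<epsilon>)"
  then obtain F where F: "outputs A (encode n E) (encode n F)" "fill_in {..<n} E F" "real (card E + card F) <= (1 + \<epsilon>) * real (card E + min_fill_in {..<n} E)"
   using s unfolding chordal_completion_ratio_def by blast
  then show ?thesis by (intro exI[of _ F]) (simp add: algebra_simps)
 qed
 then show ?thesis using A by blast
qed

text \<open>If all constraints can be satisfied, the optimum is at most \<open>M^2 * al\<close>;
  with a gap every fill-in has at least \<open>M^2 * (al + 1)\<close> edges, because
  \<open>C\<close> is so large that the surplus of the cover times the block size exceeds the
  quadratic cost inside the conflict graph by \<open>M^2\<close>. The accuracy keeps the error at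
  most \<open>M^2 / 2\<close>, and \<open>D\<close> compares with \<open>al + 1/2\<close>.\<close>

theorem gap_decision:
 assumes ptas: "has_PTAS min_fill_in_ratio | has_PTAS chordal_completion_ratio" and kap: "0 < \<kappa>" and q: "1 <= q"
 shows "EX G A P D. UF G & wf_tm A & UF (%y. [D y]) & (ALL w. halts_within A (G w) (poly P (length (G w))) &
   (EX y. outputs A (G w) y & (1 <= cM q w --> (ALL j<cM q w. ALL v<2 ^ q. cP q w j v = Pf v) -->
    ((EX a. cunsat q w a = 0) --> D y) & ((ALL a. \<kappa> * real (cM q w) <= real (cunsat q w a)) --> ~ D y))))"
proof -
 define s where "s = nval q Pf"
 obtain C :: nat where C: "(real (gR q * gR q) + 1) / \<kappa> <= real C" using real_arch_simple by blast
 have C': "real (gR q * gR q) + 1 <= real C * \<kappa>" using C kap by (simp add: field_simps)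
 define al where "al = C * (s + q - 1) + gR q * gR q"
 define D0 where "D0 = gR q + (2 ^ q + 2) * C"
 define \<epsilon> :: real where "\<epsilon> = 1 / (2 * (real al + real (D0 * D0) + 1))"
 have e: "0 < \<epsilon>" by (simp add: \<epsilon>_def add_nonneg_pos)
 have e2: "\<epsilon> * (real al + real (D0 * D0)) <= 1 / 2" unfolding \<epsilon>_def by (simp add: divide_simps add_nonneg_pos)
 obtain A where A: "wf_tm A" "poly_time_on A graph_codes" "!!n E. simple_graph {..<n} E ==>
   (EX F. outputs A (encode n E) (encode n F) & fill_in {..<n} E F &
    real (card F) <= (1 + \<epsilon>) * real (min_fill_in {..<n} E) + \<epsilon> * real (card E))" using PTAS_additive[OF ptas e] by blast
 obtain P where P: "!!x. x \<in> graph_codes ==> halts_within A x (poly P (length x))" using A(2) unfolding poly_time_on_def by blast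
 \<comment> \<open>The decision sees only the output: its length is \<open>(M * D0)^2\<close>, which
   stands in for \<open>M^2\<close>, and its true bits count every edge of the fill-in
   twice.\<close>
 let ?D = "%y. bits y * (D0 * D0) <= length y * (2 * al + 1)"
 have main: "halts_within A (gword q C Pf w) (poly P (length (gword q C Pf w))) &
   (EX y. outputs A (gword q C Pf w) y & (1 <= cM q w --> (ALL j<cM q w. ALL v<2 ^ q. cP q w j v = Pf v) -->
    ((EX a. cunsat q w a = 0) --> ?D y) & ((ALL a. \<kappa> * real (cM q w) <= real (cunsat q w a)) --> ~ ?D y)))" for w
 proof -
  let ?M = "cM q w" and ?V = "gN q C (cM q w)" and ?E = "gE q C Pf w"
  interpret cgraph q ?M "cx q w" Pf by (rule cgraph_word)
  have V: "?V = ?M * gR q + (2 ^ q + 2) * (C * ?M)" by (simp add: gN_def)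
  have VD: "?V = ?M * D0" by (simp add: gN_def D0_def algebra_simps)
  have E: "?E = fE (?M * gR q + (2 ^ q + 2) * (C * ?M)) (?M * gR q) (C * ?M) (gvalid q Pf) (gcol q) (gconf q ?M (cx q w) Pf)"
   by (simp add: gE_def gN_def)
  have sg: "simple_graph {..<?V} ?E" unfolding V E by (rule simple)
  then have "gword q C Pf w \<in> graph_codes" unfolding graph_codes_def gword_def by blast
  then have h: "halts_within A (gword q C Pf w) (poly P (length (gword q C Pf w)))" by (rule P)
  obtain F where F: "outputs A (encode ?V ?E) (encode ?V F)" "fill_in {..<?V} ?E F"
    "real (card F) <= (1 + \<epsilon>) * real (min_fill_in {..<?V} ?E) + \<epsilon> * real (card ?E)" using A(3)[OF sg] by blast
  have Fp: "F \<subseteq> vertex_pairs {..<?V}" using F(2) by (auto simp: fill_in_def)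
  let ?y = "encode ?V F"
  have D0: "0 < D0 * D0" by (simp add: D0_def gR_def)
  have VV: "?V * ?V * (2 * al + 1) = ?M * ?M * (2 * al + 1) * (D0 * D0)" unfolding VD by (simp only: mult_ac)
  have D: "?D ?y <-> 2 * card F <= ?M * ?M * (2 * al + 1)" unfolding bits_encode[OF Fp] length_encode VV mult_le_cancel2 using D0 by blast
  have "((EX a. cunsat q w a = 0) --> ?D ?y) & ((ALL a. \<kappa> * real ?M <= real (cunsat q w a)) --> ~ ?D ?y)"
   if M: "1 <= ?M" and Pw: "ALL j<?M. ALL v<2 ^ q. cP q w j v = Pf v"
  proof (intro conjI impI)
   have sat: "sat q (cx q w) (cP q w) a j <-> sat q (cx q w) (%j. Pf) a j" if "j < ?M" for a j
    using Pw that vcode_less by (simp add: sat_def)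
   have un: "cunsat q w a = unsat q ?M (cx q w) (%j. Pf) a" for a
    unfolding cunsat_def unsat_def by (rule arg_cong[of _ _ card]) (auto simp: sat)
   {
    assume "EX a. cunsat q w a = 0"
    then obtain a where a: "!!j. j < ?M ==> sat q (cx q w) (%j. Pf) a j" unfolding un unsat_0 by blast
    obtain S where S: "S \<subseteq> {..<?M * gR q}" "ALL u<?M * gR q. ALL v<?M * gR q. gconf q ?M (cx q w) Pf u v --> u \<in> S | v \<in> S"
     "card S + ?M = ?M * (s + q)" using cover_sat[OF a] unfolding s_def by blast
    have "?M * (s + q) = ?M * (s + q - 1) + ?M" using q by (metis Suc_diff_1 add.commute add_gr_0 less_le_trans mult_Suc_right zero_less_one)
    then have cS: "card S = ?M * (s + q - 1)" using S(3) by simp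
    have "min_fill_in {..<?V} ?E <= card S * (C * ?M) + (?M * gR q) * (?M * gR q)"
     unfolding V E by (rule upper[OF S(1)]) (use S(2) in blast)
    also have "... = ?M * ?M * al" unfolding cS al_def by (simp add: algebra_simps)
    finally have phi: "real (min_fill_in {..<?V} ?E) <= real (?M * ?M) * real al" by (metis of_nat_le_iff of_nat_mult)
    have "2 * card ?E = bits (encode ?V ?E)" using sg by (intro bits_encode[symmetric]) (simp add: simple_graph_def)
    also have "... <= length (encode ?V ?E)" unfolding bits_def sum_card by (rule card_mono[of "{..<length (encode ?V ?E)}", simplified]) auto
    also have "... = ?M * ?M * (D0 * D0)" unfolding length_encode VD by simp
    finally have "card ?E <= ?M * ?M * (D0 * D0)" by linarith
    then have cE: "real (card ?E) <= real (?M * ?M) * real (D0 * D0)" by (metis of_nat_le_iff of_nat_mult)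
    have "real (card F) <= (1 + \<epsilon>) * (real (?M * ?M) * real al) + \<epsilon> * (real (?M * ?M) * real (D0 * D0))"
     using F(3) mult_left_mono[OF phi, of "1 + \<epsilon>"] mult_left_mono[OF cE, of \<epsilon>] e by linarith
    also have "... = real (?M * ?M) * (real al + \<epsilon> * (real al + real (D0 * D0)))" by (simp add: algebra_simps)
    also have "... <= real (?M * ?M) * (real al + 1 / 2)" using e2 by (intro mult_left_mono) auto
    finally have "2 * real (card F) <= real (?M * ?M) * (2 * real al + 1)" by (simp add: algebra_simps)
    then have "real (2 * card F) <= real (?M * ?M * (2 * al + 1))" by (simp add: algebra_simps)
    then show "?D ?y" unfolding D of_nat_le_iff .
   }
   {
    assume gp: "ALL a. \<kappa> * real ?M <= real (cunsat q w a)"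
    obtain S where S: "S \<subseteq> {u. u < ?M * gR q & gvalid q Pf u}" "ALL u<?M * gR q. ALL v<?M * gR q. gconf q ?M (cx q w) Pf u v --> u \<in> S | v \<in> S"
     "card S * (C * ?M) <= card F" using lower[of "C * ?M" F] F(2) unfolding V E by blast
    obtain a where a: "?M * (s + q) + unsat q ?M (cx q w) (%j. Pf) a <= card S + ?M" using cover_bound[OF S(1,2)] unfolding s_def by blast
    have "?M * (s + q) = ?M * (s + q - 1) + ?M" using q by (metis Suc_diff_1 add.commute add_gr_0 less_le_trans mult_Suc_right zero_less_one)
    then have "?M * (s + q - 1) + cunsat q w a <= card S" using a unfolding un by linarith
    then have "real ?M * real (s + q - 1) + real (cunsat q w a) <= real (card S)" by (metis of_nat_le_iff of_nat_mult of_nat_add)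
    then have cS: "real ?M * (real (s + q - 1) + \<kappa>) <= real (card S)" using gp[rule_format, of a] by (simp add: algebra_simps)
    have "real (?M * ?M) * (real al + 1) <= real (?M * ?M) * (real C * (real (s + q - 1) + \<kappa>))"
    proof (rule mult_left_mono)
     have "real al + 1 = real C * real (s + q - 1) + (real (gR q * gR q) + 1)" unfolding al_def by simp
     then show "real al + 1 <= real C * (real (s + q - 1) + \<kappa>)" using C' by (simp add: algebra_simps)
    qed simp
    also have "... = real ?M * (real (s + q - 1) + \<kappa>) * (real C * real ?M)" by simp
    also have "... <= real (card S) * (real C * real ?M)" using cS by (intro mult_right_mono) auto
    also have "... = real (card S * (C * ?M))" by simp
    also have "... <= real (card F)" using S(3) by (simp only: of_nat_le_iff)
    finally have "real (?M * ?M * (al + 1)) <= real (card F)" by (simp add: algebra_simps)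
    then have f: "?M * ?M * (al + 1) <= card F" unfolding of_nat_le_iff .
    have "?M * ?M * (2 * al + 1) < ?M * ?M * (2 * (al + 1))" using M by (intro mult_strict_left_mono) auto
    also have "... <= 2 * card F" using f by simp
    finally show "~ ?D ?y" unfolding D by simp
   }
  qed
  then show ?thesis using h F(1) unfolding gword_def by blast
 qed
 show ?thesis
  by (rule exI[of _ "gword q C Pf"], rule exI[of _ A], rule exI[of _ P], rule exI[of _ ?D], intro conjI UF_gword A(1) UF_bits allI)
   (rule conjunct1[OF main], rule conjunct2[OF main])
qed

section \<open>The computation tableau\<close>

lemma nth_double: "i < 2 * length x ==> concat (map (%b. [b, b]) x) ! i = x ! (i div 2)"
proof (induction x arbitrary: i)
 case (Cons b x)
 consider "i = 0" | "i = 1" | j where "i = Suc (Suc j)" by (metis One_nat_def not0_implies_Suc)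
 then show ?case
 proof cases
  case 3
  then show ?thesis using Cons by simp
 qed auto
qed simp

lemma length_double: "length (concat (map (%b. [b, b]) x)) = 2 * length x" by (induction x) auto

lemma length_pair_code: "length (pair_code x u) = 2 * length x + 2 + length u" by (simp add: pair_code_def length_double)

lemma nth_pair_code:
 "pair_code x u ! i = (if i < 2 * length x then x ! (i div 2) else if i = 2 * length x then False
   else if i = 2 * length x + 1 then True else u ! (i - (2 * length x + 2)))"
proof -
 have 2: "i - 2 * length x = Suc (Suc (i - (2 * length x + 2)))" if "2 * length x + 2 <= i" using that by simp
 have "~ i < 2 * length x ==> i = 2 * length x | i = 2 * length x + 1 | 2 * length x + 2 <= i" by linarith
 then show ?thesis using 2 by (auto simp: pair_code_def nth_append length_double nth_double)
qed

definition dl :: "turing_machine => nat => nat list => nat \<times> (nat \<times> head_move) list" where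
 "dl V q rs = (if q = 1 then (1, map (%s. (s, Stay)) rs) else delta V q rs)"

lemma step_dl: "step V (q, ts) = (fst (dl V q (map read ts)), map2 act (snd (dl V q (map read ts))) ts)"
proof (cases "q = 1")
 case True
 have "act (read x, Stay) x = x" for x by (cases x) simp
 then have "map2 act (map (%s. (s, Stay)) (map read ts)) ts = ts" by (intro nth_equalityI) auto
 then show ?thesis using True by (simp add: dl_def)
qed (simp add: dl_def case_prod_unfold)

text \<open>Index \<open>i\<close> of the window stands for tape position
  \<open>i - (T + 1)\<close>. With \<open>2 * T + 3\<close> cells the window has one border cell on
  either side that no head reaches within \<open>T\<close> steps.\<close>

definition enc :: "nat => tape => nat => nat" where
 "enc T X i = 2 * fst X (int i - int (Suc T)) + (if snd X = int i - int (Suc T) then 1 else 0)"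

lemma enc: "odd (enc T X i) <-> snd X = int i - int (Suc T)" "enc T X i div 2 = fst X (int i - int (Suc T))" by (auto simp: enc_def)

text \<open>\<open>v2\<close> and \<open>v3\<close> belong to the left and right neighbour; a head
  that moves right arrives from the left one.\<close>

definition newc :: "nat \<times> head_move => nat => nat => nat => nat" where
 "newc am v1 v2 v3 = 2 * (if odd v1 then fst am else v1 div 2) +
   (if (case snd am of Move_Right => odd v2 | Move_Left => odd v3 | Stay => odd v1) then 1 else 0)"

lemma enc_act: assumes "0 < i" shows "enc T (act am X) i = newc am (enc T X i) (enc T X (i - 1)) (enc T X (i + 1))"
proof -
 obtain a m where am: "am = (a, m)" by fastforce
 obtain f h where X: "X = (f, h)" by fastforce
 have "int (i - 1) = int i - 1" using assms by simp
 then show ?thesis unfolding newc_def enc unfolding am X by (cases m) (auto simp: enc_def)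
qed

text \<open>Border cells are copied, which is right because no head gets there; so the rule never
  refers to a neighbour outside the window.\<close>

definition newv where
 "newv V T s v1 v2 v3 v4 rs = (if s = 0 then fst (dl V v4 rs)
   else if (s - Suc (tapes V)) mod (2 * T + 3) = 0 | (s - Suc (tapes V)) mod (2 * T + 3) = 2 * T + 2 then v1
   else newc (snd (dl V v4 rs) ! ((s - Suc (tapes V)) div (2 * T + 3))) v1 v2 v3)"

text \<open>The numbers follow \<open>pair_code\<close>: the doubled bits of \<open>x\<close>, the
  separator as symbols 1 and 2, and certificate cells in which a blank can only be followed by
  blanks. The other tapes are blank, and every head starts at position 0, that is at index
  \<open>Suc T\<close>.\<close>

definition initc :: "turing_machine => nat => nat => bool list => nat => nat => nat => bool" where
 "initc V T l x s v1 v2 <-> (if s = 0 then v1 = 0 else tapes V < s -->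
  (let i = (s - Suc (tapes V)) mod (2 * T + 3); e = i - Suc T; n = length x in
   (odd v1 <-> i = Suc T) &
   (if tapes V + (2 * T + 3) < s | i < Suc T then v1 div 2 = 0
   else if e < 2 * n then v1 div 2 = (if wbit x (e div 2) then 2 else 1)
   else if e = 2 * n then v1 div 2 = 1 else if e = 2 * n + 1 then v1 div 2 = 2
   else if e < 2 * n + 2 + l then v1 div 2 <= 2 & (v1 div 2 ~= 0 --> v2 div 2 ~= 0) else v1 div 2 = 0)))"

definition clZ :: "turing_machine => nat => nat" where "clZ V T = Suc (tapes V) + tapes V * (2 * T + 3)"

text \<open>The constraint for site \<open>s\<close> at time \<open>t\<close>, where \<open>j = t * clZ V T + s\<close>. Site 0 is the state, the sites up to
 the number of tapes hold the symbols under the heads, and the others are the cells; the value of a cell is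
 twice its content, plus one at the head. At time 0 the cells reserved for the certificate, of number \<open>l\<close>,
 hold arbitrary bits up to some cell and blanks afterwards.\<close>

definition clPhi where
 "clPhi V T l x j v0 v1 v2 v3 v4 rs <-> (let s = j mod clZ V T; t = j div clZ V T in
   (s = 0 | tapes V < s --> v0 = newv V T s v1 v2 v3 v4 rs) &
   (tapes V < s & odd v1 --> rs ! ((s - Suc (tapes V)) div (2 * T + 3)) = v1 div 2) &
   (t = 0 --> initc V T l x s v1 v2) &
   (Suc t = T & s = Suc (tapes V) + Suc T --> v0 div 2 = 2))"

text \<open>A constraint of bounded arity cannot search for the heads. Therefore the symbols under
  them are carried in sites of their own near the start of each row, and the cells that show a head
  enforce that these symbols are right.\<close>

definition clsat where
 "clsat V T l x val j <-> (let b = j div clZ V T * clZ V T in clPhi V T l x j (val (j + clZ V T)) (val j) (val (j - 1)) (val (j + 1))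
   (val b) (map (%p. val (b + Suc p)) [0..<tapes V]))"

locale tableau =
 fixes V :: turing_machine and T l :: nat and x :: "bool list"
 assumes M: "wf_tm V" and T: "2 * length x + 2 + l <= T"
begin

abbreviation "k == tapes V"
abbreviation "W == 2 * T + 3"
abbreviation "Z == clZ V T"

abbreviation "cell p i == Suc k + (p * W + i)"
abbreviation "hds f == map (%p. f (Suc p)) [0..<k]"

abbreviation "ctape s == (s - Suc k) div W"
abbreviation "cpos s == (s - Suc k) mod W"
abbreviation "rt z t == snd (run V z t)"

lemma k: "0 < k" using M by (simp add: wf_tm_def)

definition tvl :: "bool list => nat => nat => nat" where
 "tvl z t s = (if s = 0 then fst (run V z t) else if s <= k then read (rt z t ! (s - 1))
   else enc T (rt z t ! (ctape s)) (cpos s))"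

lemma cell_less: "p < k ==> i < W ==> cell p i < Z" using pair_less[of p k i W] by (simp add: clZ_def)

lemma cell_ex: assumes "k < s" "s < Z" obtains p i where "s = cell p i" "p < k" "i < W"
proof -
 have "s - Suc k < k * W" using assms by (simp add: clZ_def)
 then have "ctape s < k" by (rule less_mult_imp_div_less)
 moreover have "s = Suc k + (ctape s * W + cpos s)" unfolding div_mult_mod_eq using assms by simp
 moreover have "cpos s < W" by simp
 ultimately show thesis using that by blast
qed

lemma cell_simps: "i < W ==> (cell p i - Suc k) div W = p" "i < W ==> (cell p i - Suc k) mod W = i"
 unfolding add_diff_cancel_left' by (rule div_pair, assumption)+

lemma tvl_cell: "i < W ==> tvl z t (cell p i) = enc T (rt z t ! p) i" unfolding tvl_def cell_simps by simp

lemma tvl_read: "p < k ==> tvl z t (Suc p) = read (rt z t ! p)" by (simp add: tvl_def)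

lemma run_len: "length (rt z t) = k" using run_inv[OF M, of z t] by (simp add: tinv_def)

lemma tvl_reads: "hds (tvl z t) = map read (rt z t)" by (rule nth_equalityI) (simp_all add: run_len tvl_read)

lemma run_Suc: defines "d == %z t. dl V (fst (run V z t)) (map read (rt z t))"
 shows "fst (run V z (Suc t)) = fst (d z t)" "p < k ==> rt z (Suc t) ! p = act (snd (d z t) ! p) (rt z t ! p)"
proof -
 have s: "run V z (Suc t) = (fst (d z t), map2 act (snd (d z t)) (rt z t))"
  using step_dl[of V "fst (run V z t)" "rt z t"] by (simp add: run_def d_def)
 then show "fst (run V z (Suc t)) = fst (d z t)" by simp
 assume p: "p < k"
 have "length (rt z (Suc t)) = min (length (snd (d z t))) (length (rt z t))" unfolding s by simp
 then have "p < length (snd (d z t))" using p run_len[of z t] run_len[of z "Suc t"] by simp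
 then show "rt z (Suc t) ! p = act (snd (d z t) ! p) (rt z t ! p)" unfolding s using p run_len[of z t] by simp
qed

lemma run_heads: "p < k ==> \<bar>snd (rt z t ! p)\<bar> <= int t"
proof (induction t)
 case 0
 then show ?case by (auto simp: run_def initial_config_def input_tape_def blank_tape_def nth_Cons split: nat.splits)
next
 case (Suc t)
 have m: "\<bar>head_shift m\<bar> <= 1" for m by (cases m) auto
 have "snd (act am X) = snd X + head_shift (snd am)" for am X by (cases am; cases X) simp
 moreover have "\<bar>snd X + head_shift h\<bar> <= \<bar>snd X\<bar> + \<bar>head_shift h\<bar>" for X :: tape and h by (rule abs_triangle_ineq)
 ultimately have "\<bar>snd (act am X)\<bar> <= \<bar>snd X\<bar> + 1" for am X using m[of "snd am"] by (metis add_left_mono order_trans)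
 then have A: "\<bar>snd (act am X)\<bar> <= \<bar>snd X\<bar> + 1" for am X .
 have "\<bar>snd (act am (rt z t ! p))\<bar> <= int (Suc t)" for am using A[of am "rt z t ! p"] Suc.IH[OF Suc.prems] by linarith
 then show ?case unfolding run_Suc(2)[OF Suc.prems] .
qed

lemma tvl_step:
 assumes t: "t < T" and s: "s = 0 | k < s" "s < Z"
 shows "tvl z (Suc t) s = newv V T s (tvl z t s) (tvl z t (s - 1)) (tvl z t (s + 1)) (tvl z t 0) (hds (tvl z t))"
proof (cases "s = 0")
 case True
 then show ?thesis unfolding tvl_reads by (simp add: tvl_def newv_def run_Suc)
next
 case False
 then obtain p i where si: "s = cell p i" "p < k" "i < W" using s cell_ex by blast
 have q: "tvl z t 0 = fst (run V z t)" by (simp add: tvl_def)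
 let ?X = "rt z t ! p" and ?a = "snd (dl V (fst (run V z t)) (map read (rt z t))) ! p"
 have X': "rt z (Suc t) ! p = act ?a ?X" by (rule run_Suc(2)[OF si(2)])
 show ?thesis
 proof (cases "i = 0 | i = 2 * T + 2")
  case True
  have h: "\<bar>snd ?X\<bar> <= int t" "\<bar>snd (act ?a ?X)\<bar> <= int (Suc t)" using run_heads[OF si(2)] unfolding X'[symmetric] by blast+
  then have "snd ?X ~= int i - int (Suc T)" "snd (act ?a ?X) ~= int i - int (Suc T)" using True t by auto
  moreover obtain a m where am: "?a = (a, m)" by fastforce
  moreover obtain f h where fh: "?X = (f, h)" by fastforce
  ultimately have "enc T (act ?a ?X) i = enc T ?X i" by (auto simp: enc_def)
  then show ?thesis using True unfolding si(1) tvl_cell[OF si(3)] newv_def cell_simps[OF si(3)] X' by simp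
 next
  case i: False
  have e: "s - 1 = cell p (i - 1)" "s + 1 = cell p (i + 1)" "i - 1 < W" "i + 1 < W" using i si by auto
  have n: "tvl z t (s - 1) = enc T ?X (i - 1)" "tvl z t (s + 1) = enc T ?X (i + 1)"
   unfolding e(1,2) by (rule tvl_cell[OF e(3)], rule tvl_cell[OF e(4)])
  show ?thesis unfolding n unfolding tvl_reads q si(1) tvl_cell[OF si(3)] newv_def cell_simps[OF si(3)] X'
   using i enc_act[of i T ?a ?X] by simp
 qed
qed

lemma tvl_tie: assumes s: "k < s" "s < Z" and o: "odd (tvl z t s)"
 shows "tvl z t (Suc (ctape s)) = tvl z t s div 2"
proof -
 obtain p i where si: "s = cell p i" "p < k" "i < W" using s cell_ex by blast
 obtain f h where fh: "rt z t ! p = (f, h)" by fastforce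
 show ?thesis using o unfolding si(1) cell_simps[OF si(3)] tvl_cell[OF si(3)] tvl_read[OF si(2)] enc fh by simp
qed

text \<open>Guarantees that every tape has a cell tying the read symbol to its true value; a head
  outside the window would leave that symbol free.\<close>

lemma head_cell: assumes "p < k" "t <= T"
 shows "EX i<W. odd (tvl z t (cell p i))"
proof -
 let ?h = "snd (rt z t ! p)"
 have h: "\<bar>?h\<bar> <= int T" using run_heads[OF assms(1), of z t] assms(2) by linarith
 then have i: "nat (?h + int (Suc T)) < W" "int (nat (?h + int (Suc T))) = ?h + int (Suc T)" by auto
 then have "odd (tvl z t (Suc k + (p * W + nat (?h + int (Suc T)))))" unfolding tvl_cell[OF i(1)] enc by simp
 then show ?thesis using i(1) by blast
qed

lemma tvl_init: assumes s: "s < Z" and u: "length u <= l"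
 shows "initc V T l x s (tvl (pair_code x u) 0 s) (tvl (pair_code x u) 0 (s - 1))"
proof (cases "k < s")
 case False
 then show ?thesis by (simp add: initc_def tvl_def run_def initial_config_def)
next
 case True
 then obtain p i where si: "s = cell p i" "p < k" "i < W" using s cell_ex by blast
 let ?z = "pair_code x u"
 have X: "rt ?z 0 ! p = (if p = 0 then input_tape ?z else blank_tape)"
  using si(2) by (auto simp: run_def initial_config_def nth_Cons split: nat.splits)
 have o: "odd (tvl ?z 0 s) <-> i = Suc T" unfolding si(1) tvl_cell[OF si(3)] enc X by (auto simp: input_tape_def blank_tape_def)
 have c: "tvl ?z 0 s div 2 = (if p = 0 then fst (input_tape ?z) (int i - int (Suc T)) else 0)"
  unfolding si(1) tvl_cell[OF si(3)] enc X by (auto simp: blank_tape_def)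
 have c0: "fst (input_tape ?z) (int i - int (Suc T)) = (if Suc T <= i & i - Suc T < length ?z then bit_symbol (?z ! (i - Suc T)) else 0)"
 proof (cases "Suc T <= i")
  case True
  then have "int i - int (Suc T) = int (i - Suc T)" by (simp only: of_nat_diff)
  then show ?thesis using True fst_input_tape(1)[of "i - Suc T" ?z] fst_input_tape(2)[of ?z "i - Suc T"] by (cases "i - Suc T < length ?z") simp_all
 next
  case False
  then have "int i - int (Suc T) < 0" by simp
  then show ?thesis using False by (simp add: input_tape_def)
 qed
 have t0: "k + W < s <-> p ~= 0" using si by (cases p) auto
 have prev: "tvl ?z 0 (s - 1) div 2 ~= 0" if "p = 0" "Suc T < i" "i - Suc T < length ?z"
 proof -
  have s1: "s - 1 = cell p (i - 1)" "i - 1 < W" using that si by auto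
  have e: "int (i - 1) - int (Suc T) = int (i - 1 - Suc T)" using that by simp
  have len: "i - 1 - Suc T < length ?z" using that by simp
  show ?thesis unfolding s1(1) tvl_cell[OF s1(2)] enc X unfolding that(1)
   by (simp only: if_True refl e fst_input_tape(1)[OF len]) (simp add: bit_symbol_def)
 qed
 have wx: "wbit x e = x ! e" if "e < length x" for e using that by (simp add: wbit_def)
 let ?e = "i - Suc T" and ?n = "length x"
 have "if p ~= 0 | i < Suc T then tvl ?z 0 s div 2 = 0
   else if ?e < 2 * ?n then tvl ?z 0 s div 2 = (if wbit x (?e div 2) then 2 else 1)
   else if ?e = 2 * ?n then tvl ?z 0 s div 2 = 1 else if ?e = 2 * ?n + 1 then tvl ?z 0 s div 2 = 2
   else if ?e < 2 * ?n + 2 + l then tvl ?z 0 s div 2 <= 2 & (tvl ?z 0 s div 2 ~= 0 --> tvl ?z 0 (s - 1) div 2 ~= 0) else tvl ?z 0 s div 2 = 0"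
 proof (cases "p ~= 0 | i < Suc T")
  case True
  then show ?thesis unfolding c c0 by auto
 next
  case False
  then have p: "p = 0" "Suc T <= i" by auto
  have v: "tvl ?z 0 s div 2 = (if ?e < 2 * ?n + 2 + length u then bit_symbol (?z ! ?e) else 0)"
   unfolding c c0 using p by (simp add: length_pair_code)
  consider "?e < 2 * ?n" | "?e = 2 * ?n" | "?e = 2 * ?n + 1" | "2 * ?n + 2 <= ?e" "?e < 2 * ?n + 2 + length u" | "2 * ?n + 2 + length u <= ?e"
   by linarith
  then show ?thesis
  proof cases
   case 1
   then have "?e div 2 < ?n" by auto
   then show ?thesis using 1 False unfolding v by (simp add: nth_pair_code wx bit_symbol_def)
  next
   case 4
   then have "tvl ?z 0 (s - 1) div 2 ~= 0" using prev p by (simp add: length_pair_code)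
   then show ?thesis using 4 False u unfolding v by (simp add: bit_symbol_def)
  qed (use False in "auto simp: v nth_pair_code bit_symbol_def")
 qed
 then show ?thesis using o True unfolding initc_def Let_def t0 unfolding si(1) cell_simps[OF si(3)] by simp
qed

definition acc :: "bool list => bool" where "acc z <-> fst (rt z T ! 0) 0 = 2"

lemma acc_tvl: "acc z <-> tvl z T (Suc k + Suc T) div 2 = 2" using tvl_cell[of "Suc T" z T 0] enc(2)[of T _ "Suc T"] by (simp add: acc_def)

lemma complete:
 assumes u: "length u <= l" and a: "acc (pair_code x u)" and j: "j < T * Z"
 shows "clsat V T l x (%y. tvl (pair_code x u) (y div Z) (y mod Z)) j"
proof -
 let ?z = "pair_code x u"
 define t s where "t = j div Z" and "s = j mod Z"
 have Z: "0 < Z" by (simp add: clZ_def)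
 have js: "j = t * Z + s" "s < Z" using Z by (simp_all only: t_def s_def div_mult_mod_eq mod_less_divisor)
 have t: "t < T" using j unfolding t_def by (rule less_mult_imp_div_less)
 have d: "(t * Z + r) div Z = t" "(t * Z + r) mod Z = r" if "r < Z" for r using div_pair[OF that] by auto
 have ds: "(j + Z) div Z = Suc t" "(j + Z) mod Z = s" using js Z d[OF js(2)] by auto
 have b: "(j div Z * Z) div Z = t" "(j div Z * Z) mod Z = 0" using Z by (simp_all add: t_def)
 have rs: "map (%p. tvl ?z ((j div Z * Z + Suc p) div Z) ((j div Z * Z + Suc p) mod Z)) [0..<k] = hds (tvl ?z t)"
 proof (rule map_cong[OF refl])
  fix p assume "p \<in> set [0..<k]"
  then have "Suc p < Z" by (simp add: clZ_def)
  note sl = d(1)[OF this] d(2)[OF this]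
  show "tvl ?z ((j div Z * Z + Suc p) div Z) ((j div Z * Z + Suc p) mod Z) = tvl ?z t (Suc p)" unfolding t_def[symmetric] sl ..
 qed
 have m1: "tvl ?z ((j - 1) div Z) ((j - 1) mod Z) = tvl ?z t (s - 1)" if "0 < s"
 proof -
  have "j - 1 = t * Z + (s - 1)" "s - 1 < Z" using js that by auto
  then show ?thesis using d by simp
 qed
 have p1: "tvl ?z ((j + 1) div Z) ((j + 1) mod Z) = tvl ?z t (s + 1)" if "s + 1 < Z" using d[OF that] js(1) by (simp add: add.assoc)
 \<comment> \<open>For the state and at border cells, \<open>j - 1\<close> or \<open>j + 1\<close>
   may belong to another tape or row; there \<open>newv\<close> does not look at them.\<close>
 have new: "tvl ?z (Suc t) s = newv V T s (tvl ?z t s) (tvl ?z ((j - 1) div Z) ((j - 1) mod Z)) (tvl ?z ((j + 1) div Z) ((j + 1) mod Z)) (tvl ?z t 0) (hds (tvl ?z t))"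
  if s: "s = 0 | k < s"
 proof (cases "s = 0 | cpos s = 0 | cpos s = 2 * T + 2")
  case True
  then show ?thesis unfolding tvl_step[OF t s js(2)] newv_def by auto
 next
  case False
  then obtain p i where si: "s = cell p i" "p < k" "i < W" using s js(2) cell_ex by blast
  then have "i ~= 2 * T + 2" using False cell_simps by auto
  then have sp: "s + 1 < Z" using cell_less[OF si(2), of "i + 1"] si by simp
  have s0: "0 < s" using False by simp
  show ?thesis unfolding m1[OF s0] p1[OF sp] by (rule tvl_step[OF t s js(2)])
 qed
 have tie: "hds (tvl ?z t) ! (ctape s) = tvl ?z t s div 2" if s: "k < s" "odd (tvl ?z t s)"
 proof -
  obtain p i where si: "s = cell p i" "p < k" "i < W" using s js(2) cell_ex by blast
  then have "ctape s < k" using cell_simps by simp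
  then show ?thesis using tvl_tie[OF s(1) js(2) s(2)] by simp
 qed
 have init: "initc V T l x s (tvl ?z t s) (tvl ?z ((j - 1) div Z) ((j - 1) mod Z))" if "t = 0"
 proof (cases "s = 0")
  case True
  then show ?thesis using that by (simp add: initc_def tvl_def run_def initial_config_def)
 next
  case False
  then show ?thesis using tvl_init[OF js(2) u] m1 that by simp
 qed
 have fin: "tvl ?z (Suc t) s div 2 = 2" if "Suc t = T" "s = Suc k + Suc T" using a that unfolding acc_tvl by simp
 show ?thesis unfolding clsat_def clPhi_def Let_def rs ds b unfolding s_def[symmetric] t_def[symmetric]
  by (intro conjI impI new tie init fin) blast+
qed

text \<open>Row 0 is forced in the state and in all cells once the contents of the certificate cells
  are given.\<close>

lemma initc_unique:
 assumes "initc V T l x s v1 v2" "initc V T l x s v1' v2'" "s = 0 | k < s"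
  and r: "s <= k + W ==> Suc T + (2 * length x + 2) <= cpos s ==> cpos s < Suc T + (2 * length x + 2 + l) ==> v1 div 2 = v1' div 2"
 shows "v1 = v1'"
proof (cases "s = 0")
 case True
 then show ?thesis using assms(1,2) by (simp add: initc_def)
next
 case False
 then have s: "k < s" using assms(3) by simp
 let ?i = "cpos s"
 have "v1 div 2 = v1' div 2"
 proof (cases "k + W < s | ?i < Suc T")
  case True
  then show ?thesis using assms(1,2) s unfolding initc_def Let_def by simp
 next
  case f: False
  consider "?i - Suc T < 2 * length x" | "?i - Suc T = 2 * length x" | "?i - Suc T = 2 * length x + 1"
   | "2 * length x + 2 <= ?i - Suc T" "?i - Suc T < 2 * length x + 2 + l" | "2 * length x + 2 + l <= ?i - Suc T" by linarith
  then show ?thesis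
  proof cases
   case 4
   then show ?thesis using f by (intro r) linarith+
  qed (use assms(1,2) s f False in "auto simp: initc_def Let_def")
 qed
 moreover have "odd v1 <-> odd v1'" using assms(1,2) s False unfolding initc_def Let_def by simp
 then have "v1 mod 2 = v1' mod 2" by presburger
 ultimately show ?thesis by (metis div_mult_mod_eq)
qed

text \<open>The certificate is read off row 0 up to the first blank, which makes row 0 the initial
  configuration. By induction each row determines the next: the head cells force the symbols read,
  these fix the transition, and the transition fixes the state and all cells.\<close>

lemma sound:
 assumes sat: "!!j. j < T * Z ==> clsat V T l x val j"
 shows "EX u. length u <= l & acc (pair_code x u)"
proof -
 have Z: "0 < Z" by (simp add: clZ_def)
 have Tp: "0 < T" using T by simp
 define vv where "vv t s = val (t * Z + s)" for t s
 have Phi: "clPhi V T l x (t * Z + s) (vv (Suc t) s) (vv t s) (val (t * Z + s - 1)) (vv t (s + 1)) (vv t 0) (hds (vv t))"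
  if t: "t < T" and s: "s < Z" for t s
 proof -
  have j: "(t * Z + s) div Z * Z = t * Z" unfolding div_pair(1)[OF s] ..
  have a: "t * Z + s + Z = Suc t * Z + s" "t * Z + s + 1 = t * Z + (s + 1)" "t * Z = t * Z + 0" by simp_all
  have "clsat V T l x val (t * Z + s)" by (rule sat[OF pair_less[OF t s]])
  then show ?thesis unfolding clsat_def Let_def j a(1,2) vv_def by simp
 qed
 note P = Phi[unfolded clPhi_def Let_def]
 have new: "vv (Suc t) s = newv V T s (vv t s) (val (t * Z + s - 1)) (vv t (s + 1)) (vv t 0) (hds (vv t))"
  if "t < T" "s < Z" "s = 0 | k < s" for t s using P[OF that(1,2)] that(3) unfolding div_pair[OF that(2)] by blast
 have tie: "hds (vv t) ! (ctape s) = vv t s div 2" if "t < T" "s < Z" "k < s" "odd (vv t s)" for t s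
  using P[OF that(1,2)] that(3,4) unfolding div_pair[OF that(2)] by blast
 have init: "initc V T l x s (vv 0 s) (vv 0 (s - 1))" if "s < Z" for s
 proof -
  have "initc V T l x s (vv 0 s) (val (0 * Z + s - 1))" using P[OF Tp that] unfolding div_pair[OF that] by blast
  then show ?thesis by (simp add: vv_def)
 qed
 have fin: "vv T (Suc k + Suc T) div 2 = 2"
 proof -
  have s: "Suc k + Suc T < Z" using cell_less[of 0 "Suc T"] k by simp
  have "Suc t = T ==> t < T ==> vv (Suc t) (Suc k + Suc T) div 2 = 2" for t using P[OF _ s, of t] unfolding div_pair[OF s] by blast
  then show ?thesis using Tp by (cases T) simp_all
 qed
 define n where "n = length x"
 define ps where "ps i = Suc k + (0 * W + (Suc T + (2 * n + 2 + i)))" for i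
 define c where "c i = vv 0 (ps i) div 2" for i
 have psW: "Suc T + (2 * n + 2 + i) < W" if "i < l" for i using T that by (simp add: n_def)
 have psZ: "ps i < Z" if "i < l" for i unfolding ps_def by (rule cell_less[OF k psW[OF that]])
 have ci: "c i <= 2" "c i ~= 0 ==> vv 0 (ps i - 1) div 2 ~= 0" if i: "i < l" for i
 proof -
  have m: "(ps i - Suc k) mod W = Suc T + (2 * n + 2 + i)" unfolding ps_def by (rule cell_simps(2)[OF psW[OF i]])
  have s: "ps i ~= 0" "k < ps i" "~ k + W < ps i" using psW[OF i] by (auto simp: ps_def)
  show "c i <= 2" "c i ~= 0 ==> vv 0 (ps i - 1) div 2 ~= 0"
   using init[OF psZ[OF i]] s i unfolding initc_def Let_def m by (auto simp: n_def c_def)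
 qed
 have cmono: "c i ~= 0" if "Suc i < l" "c (Suc i) ~= 0" for i
 proof -
  have "ps (Suc i) - 1 = ps i" by (simp add: ps_def)
  then show ?thesis using ci(2)[OF that] by (simp add: c_def)
 qed
 define m where "m = (LEAST i. i = l | c i = 0)"
 have m: "m = l | c m = 0" unfolding m_def by (rule LeastI[of "%i. i = l | c i = 0" l]) simp
 have ml: "m <= l" unfolding m_def by (rule Least_le) simp
 have mlt: "c i ~= 0" if "i < m" for i using not_less_Least[of i "%i. i = l | c i = 0"] that unfolding m_def by blast
 have mge: "i < l --> c i = 0" if "m <= i" for i using that
 proof (induction rule: dec_induct)
  case base
  then show ?case using m by auto
 next
  case (step i)
  then show ?case using cmono[of i] by auto
 qed
 define u where "u = map (%i. c i = 2) [0..<m]"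
 have u: "length u <= l" using ml by (simp add: u_def)
 let ?z = "pair_code x u"
 have base: "vv 0 s = tvl ?z 0 s" if s: "s < Z" "s = 0 | k < s" for s
 proof (rule initc_unique[OF init[OF s(1)] tvl_init[OF s(1) u] s(2)])
  assume a: "s <= k + W" "Suc T + (2 * length x + 2) <= cpos s" "cpos s < Suc T + (2 * length x + 2 + l)"
  define i where "i = cpos s - (Suc T + (2 * length x + 2))"
  have i: "cpos s = Suc T + (2 * n + 2 + i)" "i < l" using a by (auto simp: i_def n_def)
  have "s ~= 0" using a(2) by (intro notI) simp
  then have ks: "k < s" using s by simp
  then have "s - Suc k < W" using a(1) by simp
  then have sp: "s = ps i" using i(1) ks by (simp add: ps_def)
  have X: "rt ?z 0 ! 0 = input_tape ?z" by (simp add: run_def initial_config_def)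
  have e: "int (Suc T + (2 * n + 2 + i)) - int (Suc T) = int (2 * n + 2 + i)" by simp
  have t: "tvl ?z 0 (ps i) div 2 = fst (input_tape ?z) (int (2 * n + 2 + i))" unfolding ps_def tvl_cell[OF psW[OF i(2)]] enc X e ..
  have "c i = fst (input_tape ?z) (int (2 * n + 2 + i))"
  proof (cases "i < m")
   case True
   then have l: "2 * n + 2 + i < length ?z" by (simp add: length_pair_code u_def n_def)
   have "?z ! (2 * n + 2 + i) = (c i = 2)" using True by (simp add: nth_pair_code n_def u_def)
   then show ?thesis unfolding fst_input_tape(1)[OF l] using mlt[OF True] ci(1)[OF i(2)] by (auto simp: bit_symbol_def)
  next
   case False
   then have "length ?z <= 2 * n + 2 + i" by (simp add: length_pair_code u_def n_def)
   from fst_input_tape(2)[OF this] show ?thesis using mge[of i] False i(2) by simp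
  qed
  then show "vv 0 s div 2 = tvl ?z 0 s div 2" unfolding sp t c_def .
 qed
 have inv: "ALL s<Z. s = 0 | k < s --> vv t s = tvl ?z t s" if "t <= T" for t using that
 proof (induction t)
  case (Suc t)
  then have t: "t < T" and IH: "!!s. s < Z ==> s = 0 | k < s ==> vv t s = tvl ?z t s" by auto
  have rd: "vv t (Suc p) = tvl ?z t (Suc p)" if p: "p < k" for p
  proof -
   obtain i where i: "i < W" "odd (tvl ?z t (cell p i))" using head_cell[OF p, of t ?z] t by auto
   let ?s = "cell p i"
   have s: "?s < Z" "k < ?s" using cell_less[OF p i(1)] by auto
   have v: "vv t ?s = tvl ?z t ?s" by (rule IH) (use s in auto)
   have "hds (vv t) ! ((?s - Suc k) div W) = vv t ?s div 2" by (rule tie[OF t s], unfold v, rule i(2))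
   moreover have "tvl ?z t (Suc ((?s - Suc k) div W)) = tvl ?z t ?s div 2" by (rule tvl_tie[OF s(2,1) i(2)])
   ultimately show ?thesis unfolding cell_simps(1)[OF i(1)] v using p by simp
  qed
  have rs: "hds (vv t) = hds (tvl ?z t)" by (rule map_cong[OF refl]) (simp add: rd)
  show ?case
  proof (intro allI impI)
   fix s assume s: "s < Z" "s = 0 | k < s"
   have v0: "vv t 0 = tvl ?z t 0" by (rule IH) (use Z in auto)
   have vs: "vv t s = tvl ?z t s" by (rule IH[OF s])
   have "vv (Suc t) s = newv V T s (tvl ?z t s) (val (t * Z + s - 1)) (vv t (s + 1)) (tvl ?z t 0) (hds (tvl ?z t))"
    using new[OF t s] unfolding rs v0 vs .
   also have "... = newv V T s (tvl ?z t s) (tvl ?z t (s - 1)) (tvl ?z t (s + 1)) (tvl ?z t 0) (hds (tvl ?z t))"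
   proof (cases "s = 0 | cpos s = 0 | cpos s = 2 * T + 2")
    case True
    then show ?thesis unfolding newv_def by auto
   next
    case False
    then obtain p i where si: "s = cell p i" "p < k" "i < W" using s cell_ex by blast
    then have i: "i ~= 0" "i ~= 2 * T + 2" using False cell_simps(2)[OF si(3), of p] by auto
    then have p: "s + 1 < Z" using cell_less[OF si(2), of "i + 1"] si by simp
    have m: "k < s - 1" "s - 1 < Z" "0 < s" using si s i by auto
    have "t * Z + s - 1 = t * Z + (s - 1)" using m(3) by simp
    then have "val (t * Z + s - 1) = vv t (s - 1)" by (simp add: vv_def)
    moreover have "vv t (s - 1) = tvl ?z t (s - 1)" by (rule IH[OF m(2)]) (use m in simp)
    moreover have "vv t (s + 1) = tvl ?z t (s + 1)" by (rule IH[OF p]) (use m in simp)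
    ultimately show ?thesis by simp
   qed
   also have "... = tvl ?z (Suc t) s" by (rule tvl_step[OF t s(2,1), symmetric])
   finally show "vv (Suc t) s = tvl ?z (Suc t) s" .
  qed
 qed (use base in auto)
 have "Suc k + Suc T < Z" using cell_less[of 0 "Suc T"] k by simp
 then have "vv T (Suc k + Suc T) = tvl ?z T (Suc k + Suc T)" using inv[OF le_refl] by auto
 then have "acc ?z" using fin unfolding acc_tvl by simp
 then show ?thesis using u by blast
qed

end

section \<open>From the tableau to a constraint problem over bits\<close>

definition slot :: "nat => nat => nat => nat" where "slot b l v = v div 2 ^ (l * b) mod 2 ^ b"

text \<open>Field 4 is the state and field \<open>5 + p\<close> the symbol read on tape
  \<open>p\<close>, both from the start of the row of \<open>j\<close>; together with the successor,
  the site and its neighbours this makes \<open>tapes V + 5\<close> fields.\<close>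

definition csrc :: "turing_machine => nat => nat => nat => nat" where
 "csrc V T j l = (if l = 0 then j + clZ V T else if l = 1 then j else if l = 2 then j - 1 else if l = 3 then j + 1
   else j div clZ V T * clZ V T + (l - 4))"

definition clX where
 "clX V b T j i = (let l = i div b; r = i mod b in if l < tapes V + 5 then
   csrc V T j l * b + r else 0)"

definition clP where
 "clP V b T l x j v = clPhi V T l x j (slot b 0 v) (slot b 1 v) (slot b 2 v) (slot b 3 v) (slot b 4 v)
   (map (%p. slot b (5 + p) v) [0..<tapes V])"

lemma slot_vcode: assumes "l * b + b <= q" shows "slot b l (vcode q f) = vcode b (%r. f (l * b + r))"
proof -
 have v: "vbit (slot b l v) r = vbit v (l * b + r)" if r: "r < b" for v r
 proof -
  have e: "(2::nat) ^ b = 2 ^ r * 2 ^ (b - r)" using r by (simp flip: power_add)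
  have "v div 2 ^ (l * b) mod 2 ^ b div 2 ^ r = (v div 2 ^ (l * b) div 2 ^ r) mod 2 ^ (b - r)" unfolding e by (simp add: mod_mult2_eq)
  moreover have "odd (y mod 2 ^ (b - r)) = odd y" for y :: nat using r by (simp add: dvd_mod_iff)
  ultimately show ?thesis unfolding vbit_def slot_def by (simp add: div_mult2_eq power_add)
 qed
 have "slot b l (vcode q f) < 2 ^ b" by (simp add: slot_def)
 then have "slot b l (vcode q f) = vcode b (vbit (slot b l (vcode q f)))" by (rule vcode_vbit[symmetric])
 also have "... = vcode b (%r. f (l * b + r))" by (rule vcode_cong) (use assms in "simp add: v vbit_vcode")
 finally show ?thesis .
qed

lemma sat_clX:
 assumes q: "(tapes V + 5) * b <= q"
 shows "sat q (clX V b T) (clP V b T l x) a j <-> clsat V T l x (%s. vcode b (%r. a (s * b + r))) j"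
proof -
 have s: "slot b l (vcode q (%k. a (clX V b T j k))) = vcode b (%r. a (csrc V T j l * b + r))" if l: "l < tapes V + 5" for l
 proof -
  have "l * b + b <= (tapes V + 5) * b" using mult_le_mono1[of "Suc l" "tapes V + 5" b] l by simp
  then have "l * b + b <= q" using q by linarith
  from slot_vcode[OF this] have "slot b l (vcode q (%k. a (clX V b T j k))) = vcode b (%r. a (clX V b T j (l * b + r)))" .
  also have "... = vcode b (%r. a (csrc V T j l * b + r))"
  proof (rule vcode_cong)
   fix r assume "r < b"
   then show "a (clX V b T j (l * b + r)) = a (csrc V T j l * b + r)"
    using l unfolding clX_def Let_def div_pair[OF \<open>r < b\<close>] by simp
  qed
  finally show ?thesis .
 qed
 have m: "map (%p. slot b (5 + p) (vcode q (%k. a (clX V b T j k)))) [0..<tapes V] =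
  map (%p. vcode b (%r. a ((j div clZ V T * clZ V T + Suc p) * b + r))) [0..<tapes V]"
  by (rule map_cong[OF refl]) (subst s, auto simp: csrc_def)
 show ?thesis unfolding sat_def clP_def clsat_def Let_def m by (subst s, simp)+ (simp add: csrc_def)
qed

lemma U_poly: "U W G f ==> U W G (%s. poly p (f s))" for p :: "nat poly"
proof (induction p)
 case (pCons a p)
 then show ?case by (simp add: U_add U_mult U_const)
qed (simp add: U_const)

lemma clZ_bound: "s < clZ V T ==> 0 < tapes V ==> (s - Suc (tapes V)) div (2 * T + 3) < tapes V"
proof -
 assume "s < clZ V T" "0 < tapes V"
 moreover have "s < a + c ==> 0 < c ==> s - a < c" for a c :: nat by simp
 ultimately have "s - Suc (tapes V) < tapes V * (2 * T + 3)" unfolding clZ_def by simp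
 then show ?thesis by (rule less_mult_imp_div_less)
qed

text \<open>The values read are constants here, since a view takes only \<open>2 ^ q\<close> values
  and the reduction splits over all of them.\<close>

lemma UB_clPhi:
 assumes T: "U W G T" and l: "U W G l" and j: "U W G j" and k: "0 < tapes V"
 shows "UB W G (%s. clPhi V (T s) (l s) (W s) (j s) v0 v1 v2 v3 v4 rs)"
proof -
 let ?Z = "%s. clZ V (T s)"
 have Z: "U W G ?Z" unfolding clZ_def by (intro U_add U_mult U_const U_Suc T)
 have s: "U W G (%s. j s mod ?Z s)" by (intro U_mod j Z)
 have c: "U W G (%s. (j s mod ?Z s - Suc (tapes V)) div (2 * T s + 3))"
  and i: "U W G (%s. (j s mod ?Z s - Suc (tapes V)) mod (2 * T s + 3))" by (intro U_div U_mod U_diff U_add U_mult U_const T j Z)+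
 have ck: "(j s mod ?Z s - Suc (tapes V)) div (2 * T s + 3) < tapes V" for s by (rule clZ_bound[OF _ k]) (simp add: clZ_def)
 note fin = U_fin[OF c ck]
 have n: "UB W G (%s. v0 = newv V (T s) (j s mod ?Z s) v1 v2 v3 v4 rs)" unfolding newv_def
  by (intro UB_eq U_const U_if s UB_disj i U_add U_mult T fin[where F = "%p. newc (snd (dl V v4 rs) ! p) v1 v2 v3"])
 have t: "UB W G (%s. rs ! ((j s mod ?Z s - Suc (tapes V)) div (2 * T s + 3)) = v1 div 2)"
  by (intro UB_eq U_const fin[where F = "%p. rs ! p"])
 have ini: "UB W G (%s. initc V (T s) (l s) (W s) (j s mod ?Z s) v1 v2)" unfolding initc_def Let_def
  by (intro UB_if UB_eq U_const s UB_imp UB_less UB_conj UB_iff UB_const i U_Suc T UB_disj U_add U_mult U_diff U_len U_div U_if UB_wbit l)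
 show ?thesis unfolding clPhi_def Let_def
  by (rule n t ini | rule UB_conj UB_imp UB_disj | rule UB_eq U_const s UB_less UB_const U_div j Z U_Suc T U_add)+
qed

lemma decides_acc:
 assumes V: "wf_tm V" "decides V R" and h: "halts_within V z T"
 shows "fst (snd (run V z T) ! 0) 0 = 2 <-> z \<in> R"
proof -
 obtain t where t: "halts_within V z t" "fst (snd (run V z t) ! 0) 0 = bit_symbol (z \<in> R)"
  using V(2) unfolding decides_def outputs_def Let_def hd_run[OF V(1)] by fastforce
 have "run V z t = run V z T" using run_halted[of V z t T] run_halted[of V z T t] t(1) h unfolding halts_within_def by (cases "t <= T") auto
 then show ?thesis using t(2) by (auto simp: bit_symbol_def)
qed

theorem cook_levin:
 assumes "L \<in> class_NP"
 shows "EX q>=10. EX F. UF F & (ALL w. length (F w) = csz q (cM q (F w)) & 1 <= cM q (F w) & (w \<in> L <-> (EX a. cunsat q (F w) a = 0)))"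
proof -
 obtain R p where R: "R \<in> class_P" and L: "L = {x. EX u. length u <= poly p (length x) & pair_code x u \<in> R}"
  using assms by (auto simp: class_NP_def)
 obtain V where V: "wf_tm V" "decides V R" "poly_time_on V UNIV" using R by (auto simp: class_P_def)
 obtain P where P: "!!z. halts_within V z (poly P (length z))" using V(3) by (auto simp: poly_time_on_def)
 obtain g where g: "!!n. poly P n <= (n + 2) ^ g" using poly_pb[of P] by (auto simp: pb_def)
 define l where "l n = poly p n" for n
 \<comment> \<open>The exponent \<open>Suc g\<close> instead of \<open>g\<close> makes
   \<open>T\<close> dominate the length of the paired input as well as the running time.\<close>
 define T where "T n = (2 * n + l n + 4) ^ Suc g" for n
 \<comment> \<open>A generous width: states, symbols and encoded cells are all below
   \<open>b\<close>, hence below \<open>2 ^ b\<close>.\<close>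
 define b where "b = states V + 2 * symbols V"
 \<comment> \<open>The summand 10 provides the arity that amplification requires.\<close>
 define q where "q = (tapes V + 5) * b + 10"
 have k: "0 < tapes V" using V(1) by (simp add: wf_tm_def)
 have b0: "0 < b" using V(1) by (auto simp: b_def wf_tm_def)
 have Tge: "2 * n + 2 + l n <= T n" for n
 proof -
  have "(2 * n + l n + 4) ^ 1 <= T n" unfolding T_def by (rule power_increasing) auto
  then show ?thesis by simp
 qed
 have tab: "tableau V (T (length x)) (l (length x)) x" for x using V(1) Tge by unfold_locales
 have halt: "halts_within V (pair_code x u) (T (length x))" if u: "length u <= l (length x)" for x u
 proof -
  have "poly P (length (pair_code x u)) <= (length (pair_code x u) + 2) ^ g" by (rule g)
  also have "... <= (2 * length x + l (length x) + 4) ^ g" using u by (intro power_mono) (auto simp: length_pair_code)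
  also have "... <= T (length x)" unfolding T_def by (rule power_increasing) auto
  finally show ?thesis using P[of "pair_code x u"] run_halted unfolding halts_within_def by metis
 qed
 have acc: "tableau.acc V (T (length x)) (pair_code x u) <-> pair_code x u \<in> R" if "length u <= l (length x)" for x u
  unfolding tableau.acc_def[OF tab] by (rule decides_acc[OF V(1,2) halt[OF that]])
 let ?M = "%x. T (length x) * clZ V (T (length x))"
 let ?X = "%x. clX V b (T (length x))"
 let ?P = "%x. clP V b (T (length x)) (l (length x)) x"
 let ?F = "%x. cword q (?M x) (?X x) (?P x)"
 have q: "(tapes V + 5) * b <= q" by (simp add: q_def)
 have M1: "1 <= ?M x" for x
 proof -
  have "0 < T (length x)" using Tge[of "length x"] by linarith
  then show ?thesis by (simp add: clZ_def)
 qed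
 \<comment> \<open>The sites referred to lie below twice the number of constraints, and
   \<open>2 * b <= q\<close> leaves room for their bits.\<close>
 have Xless: "clX V b T' j i < q * (T' * clZ V T')" if j: "j < T' * clZ V T'" for T' j i
 proof -
  let ?Z = "clZ V T'"
  have r: "i mod b < b" using b0 by simp
  have "0 < T'" using j by (cases T') auto
  then have ZT: "?Z <= T' * ?Z" by simp
  have Z5: "tapes V < ?Z" by (simp add: clZ_def)
  have jz: "j div ?Z * ?Z <= j" by simp
  have gen: "j < B ==> z <= B ==> k < z ==> d <= j ==> m < k + 5 ==>
   (if m = 0 then j + z else if m = 1 then j else if m = 2 then j - 1 else if m = 3 then j + 1 else d + (m - 4)) < 2 * B"
   for B z k d m :: nat by auto
  define s where "s = csrc V T' j (i div b)"
  have "s < 2 * (T' * ?Z)" if "i div b < tapes V + 5" unfolding s_def csrc_def by (rule gen[OF j ZT Z5 jz that])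
  then have 1: "i div b < tapes V + 5 ==> s * b + i mod b < 2 * (T' * ?Z) * b" using pair_less[OF _ r] by blast
  have 2: "2 * (T' * ?Z) * b <= q * (T' * ?Z)"
  proof -
   have "2 * b <= q" unfolding q_def by (simp add: algebra_simps)
   then show ?thesis using mult_le_mono1[of "2 * b" q "T' * ?Z"] by (simp only: mult_ac)
  qed
  have 3: "0 < q * (T' * ?Z)" using j by (auto simp: q_def intro: gr0I)
  show ?thesis unfolding clX_def Let_def s_def[symmetric] using less_le_trans[OF 1 2] 3 by (simp only: split: if_split) blast
 qed
 have Tl: "U W G (%s. l (length (W s)))" "U W G (%s. T (length (W s)))" for W and G :: "('a => nat) list"
  unfolding T_def l_def by (intro U_pow U_add U_mult U_const U_poly U_len)+
 have "UF ?F"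
 proof (rule UF_cword)
  show "U (%w. w) [] ?M" unfolding clZ_def T_def l_def by (intro U_pow U_add U_mult U_const U_poly U_len[of "%w. w"] U_Suc)
 next
  fix j i :: "bool list \<times> nat => nat" assume a: "U fst [snd] j" "U fst [snd] i"
  show "U fst [snd] (%p. ?X (fst p) (j p) (i p))" unfolding clX_def csrc_def Let_def clZ_def T_def l_def
   by (intro U_if UB_less U_div U_const a U_add U_mult UB_eq U_mod U_Suc U_pow U_poly U_len U_diff)
 next
  fix j v :: "bool list \<times> nat => nat" assume a: "U fst [snd] j" "U fst [snd] v" "!!p. v p < 2 ^ q"
  show "UB fst [snd] (%p. ?P (fst p) (j p) (v p))" unfolding clP_def T_def l_def
   by (rule UB_cases'[OF a(2,3)]) (intro UB_clPhi U_pow U_add U_mult U_const U_poly U_len a k)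
 qed
 moreover have "length (?F w) = csz q (cM q (?F w)) & 1 <= cM q (?F w) & (w \<in> L <-> (EX a. cunsat q (?F w) a = 0))" for w
 proof -
  let ?T = "T (length w)" and ?l = "l (length w)"
  interpret tableau V ?T ?l w by (rule tab)
  have un: "cunsat q (?F w) a = unsat q (?M w) (?X w) (?P w) a" for a by (rule cunsat_cword) (rule Xless)
  have s: "(EX a. cunsat q (?F w) a = 0) <-> (EX a. ALL j<?M w. clsat V ?T ?l w (%s. vcode b (%r. a (s * b + r))) j)"
   unfolding un unsat_0 sat_clX[OF q] ..
  have "w \<in> L <-> (EX u. length u <= ?l & acc (pair_code w u))" unfolding L l_def[symmetric] using acc by auto
  also have "... <-> (EX a. ALL j<?M w. clsat V ?T ?l w (%s. vcode b (%r. a (s * b + r))) j)"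
  proof
   assume "EX u. length u <= ?l & acc (pair_code w u)"
   then obtain u where u: "length u <= ?l" "acc (pair_code w u)" by blast
   define val where "val y = tvl (pair_code w u) (y div Z) (y mod Z)" for y
   have lt: "val y < 2 ^ b" for y
   proof -
    obtain qq ts where qt: "run V (pair_code w u) (y div Z) = (qq, ts)" by fastforce
    have i: "length ts = k" "qq < states V" "!!i j. i < k ==> fst (ts ! i) j < symbols V"
     using run_inv[OF V(1), of "pair_code w u" "y div Z"] unfolding qt by (auto simp: tinv_def)
    have rd: "read (ts ! i) < symbols V" if "i < k" for i using i(3)[OF that] by (cases "ts ! i") (metis fst_conv read.simps)
    have "val y < b"
    proof -
     have "(y mod Z - Suc k) div W < k" by (rule clZ_bound) (use k in "simp_all add: clZ_def")
     then have e: "enc ?T (ts ! ((y mod Z - Suc k) div W)) j < 2 * symbols V" for j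
      using i(3)[of "(y mod Z - Suc k) div W" "int j - int (Suc ?T)"] by (auto simp: enc_def)
     have r: "y mod Z ~= 0 ==> y mod Z <= k ==> read (ts ! (y mod Z - 1)) < symbols V" by (rule rd) linarith
     have gen: "(P ==> A < S) ==> (~ P ==> Q ==> B < S') ==> C < 2 * S' ==> (if P then A else if Q then B else C) < S + 2 * S'"
      for P Q and A B C S S' :: nat by auto
     show ?thesis unfolding val_def tvl_def qt b_def fst_conv snd_conv by (rule gen[OF i(2) r e])
    qed
    then show ?thesis using less_exp[of b] by linarith
   qed
   define a where "a y = vbit (val (y div b)) (y mod b)" for y
   have "vcode b (%r. a (s * b + r)) = val s" for s
   proof -
    have "vcode b (%r. a (s * b + r)) = vcode b (vbit (val s))" by (rule vcode_cong) (simp add: a_def div_pair)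
    then show ?thesis using vcode_vbit[OF lt] by simp
   qed
   then show "EX a. ALL j<?M w. clsat V ?T ?l w (%s. vcode b (%r. a (s * b + r))) j"
    using complete[OF u] unfolding val_def by (intro exI[of _ a]) (simp add: val_def[abs_def])
  next
   assume "EX a. ALL j<?M w. clsat V ?T ?l w (%s. vcode b (%r. a (s * b + r))) j"
   then show "EX u. length u <= ?l & acc (pair_code w u)" using sound by blast
  qed
  finally show ?thesis using M1 unfolding s by (simp add: length_cword)
 qed
 ultimately show ?thesis by (intro exI[of _ q] conjI exI[of _ ?F] allI) (auto simp: q_def)
qed

section \<open>P = NP\<close>

text \<open>The power \<open>2 ^ i\<close>, truncated as soon as it reaches \<open>M\<close>, so that it stays polynomially bounded.\<close>

definition cpow :: "nat => nat => nat" where "cpow M i = rec_nat 1 (%i r. if r < M then 2 * r else r) i"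

lemma cpow: "cpow M i = 2 ^ i | M <= cpow M i & M <= 2 ^ i" by (induction i) (auto simp: cpow_def)

lemma cpow_le: "cpow M i <= 2 * M + 1" by (induction i) (auto simp: cpow_def)

lemma cpow_iff: "M <= cpow M i <-> M <= 2 ^ i" using cpow[of M i] by auto

lemma U_cpow: assumes M: "U W G M" and i: "U W G i" shows "U W G (%s. cpow (M s) (i s))"
proof -
 have B: "pb (sz W G) (%s. 2 * M s + 1)" by (intro pb_intros U_pb[OF M])
 have r: "U (%p. W (fst p)) (lift2 G) (%p. snd (snd p))" by (rule U_var) (simp add: lift2_def)
 have "U W G (%s. rec_nat 1 ((%s i r. if r < M s then 2 * r else r) s) (i s))"
 proof (rule U_rec'[OF i U_const B])
  show "U (%p. W (fst p)) (lift2 G) (%p. if snd (snd p) < M (fst p) then 2 * snd (snd p) else snd (snd p))"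
   by (intro U_if UB_less U_mult U_const r U_weaken2[OF M])
  show "rec_nat 1 (%i r. if r < M s then 2 * r else r) j <= 2 * M s + 1" for s j using cpow_le[of "M s" j] by (simp add: cpow_def)
 qed
 then show ?thesis by (simp add: cpow_def)
qed

definition lg :: "nat => nat" where "lg M = first (Suc M) (%i. M <= cpow M i)"

lemma lg: "M <= 2 ^ lg M" "1 <= M ==> 2 ^ lg M <= 2 * M"
proof -
 let ?P = "%i. M <= 2 ^ i"
 have ex: "?P M" using less_exp[of M] by simp
 have l: "lg M = (LEAST i. ?P i)" unfolding lg_def
 proof (rule first_eq)
  have "(LEAST i. ?P i) <= M" using ex by (rule Least_le)
  then show "(LEAST i. ?P i) < Suc M" by simp
  show "M <= cpow M (LEAST i. ?P i)" unfolding cpow_iff using ex by (rule LeastI[of ?P])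
  show "~ M <= cpow M j" if "j < (LEAST i. ?P i)" for j unfolding cpow_iff using that by (rule not_less_Least)
 qed
 show "M <= 2 ^ lg M" unfolding l using ex by (rule LeastI[of ?P])
 show "2 ^ lg M <= 2 * M" if "1 <= M"
 proof (cases "lg M")
  case (Suc i)
  then have "~ ?P i" using not_less_Least[of i ?P] unfolding l by simp
  then show ?thesis unfolding Suc by simp
 qed (use that in simp)
qed

lemma U_lg: assumes M: "U W G M" shows "U W G (%s. lg (M s))"
proof -
 have i: "U (%p. W (fst p)) (lift G) snd" by (rule U_var) (simp add: lift_def)
 show ?thesis unfolding lg_def by (intro U_first U_Suc M UB_le U_weaken1[OF M] U_cpow i)
qed

text \<open>Only the length is prescribed: it bounds \<open>cM q w\<close> by the length of the
  word, and amplification works for any contents of the tables.\<close>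

definition csps :: "nat => bool list set" where
 "csps q = {w. length w = csz q (cM q w) & 1 <= cM q w}"

definition amplified :: "nat => real => bool list => bool list => bool" where
 "amplified q \<kappa> w w' <-> 1 <= cM q w' & (ALL j<cM q w'. ALL v<2 ^ q. cP q w' j v = sP v) &
   ((EX a. cunsat q w a = 0) --> (EX a. cunsat q w' a = 0)) &
   ((ALL a. cunsat q w a ~= 0) --> (ALL a. \<kappa> * real (cM q w') <= real (cunsat q w' a)))"

text \<open>One violated constraint out of \<open>M\<close> is a gap of \<open>1 / M\<close>, and
  \<open>lg M + 1\<close> doublings lift it to the saturation \<open>kap q\<close>. The size gets
  multiplied by \<open>K ^ N\<close>, which is polynomial because
  \<open>2 ^ N <= 4 * M\<close>.\<close>

theorem amplify:
 assumes q: "10 <= q"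
 shows "EX H \<kappa>. 0 < \<kappa> & WP (csps q) H & (ALL w:csps q. amplified q \<kappa> w (H w))"
proof -
 obtain F K where F: "UF F" "0 < K" "!!w. cM q (F w) = K * cM q w" "!!w. length (F w) = csz q (cM q (F w))"
  "!!w j v. j < cM q (F w) ==> v < 2 ^ q ==> cP q (F w) j v = sP v"
  "!!w a. 1 <= cM q w ==> cunsat q w a = 0 ==> EX b. cunsat q (F w) b = 0"
  "!!w \<epsilon> a. 1 <= cM q w ==> 0 <= \<epsilon> ==> (!!a. \<epsilon> * real (cM q w) <= real (cunsat q w a)) ==>
    min (2 * \<epsilon>) (kap q) * real (cM q (F w)) <= real (cunsat q (F w) a)"
  using gap_doubling[OF q] by (elim exE conjE) (rule that, blast+)
 define X where "X = csps q"
 note X_def = X_def csps_def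
 define N where "N w = Suc (lg (cM q w))" for w
 let ?H = "%w. (F ^^ N w) w"
 have it: "cM q ((F ^^ i) w) = K ^ i * cM q w" for i w by (induction i) (simp_all add: F(3))
 have it1: "1 <= cM q ((F ^^ i) w)" if "w \<in> X" for i w unfolding it using that F(2) by (simp add: X_def Suc_le_eq)
 have KN: "K ^ N w <= (4 * cM q w) ^ K" if "w \<in> X" for w
 proof -
  have "K ^ N w <= (2 ^ K) ^ N w" using less_exp[of K] by (intro power_mono) auto
  also have "... = (2 ^ N w) ^ K" by (simp add: mult.commute flip: power_mult)
  also have "... <= (4 * cM q w) ^ K" using lg(2)[of "cM q w"] that by (intro power_mono) (auto simp: N_def X_def)
  finally show ?thesis .
 qed
 have Mlen: "cM q w <= length w" if "w \<in> X" for w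
 proof -
  have "cM q w * 1 <= cM q w * 2 ^ q" by (intro mult_le_mono) auto
  moreover have "length w = csz q (cM q w)" using that by (simp add: X_def)
  ultimately show ?thesis unfolding csz_def by linarith
 qed
 have cmono: "csz q m <= csz q m'" if "m <= m'" for m m' using csz_less[of m m' q] that by (cases "m = m'") auto
 let ?B = "%w :: bool list. csz q ((4 * length w) ^ K * length w)"
 have WP: "WP X ?H"
 proof (rule WP_iter[OF WP_UF[OF F(1)]])
  show "F w \<in> X" if "w \<in> X" for w using F(4) it1[OF that, of 1] by (simp add: X_def)
  show "U (%w. w) [] N" unfolding N_def[abs_def] by (intro U_Suc U_lg U_cM)
  show "pb length ?B" unfolding csz_def by (intro pb_add pb_mult pb_const pb_size pb_power)
  show "length ((F ^^ i) w) <= ?B w" if w: "w \<in> X" and i: "i <= N w" for w i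
  proof -
   have "length ((F ^^ i) w) = csz q (cM q ((F ^^ i) w))" by (cases i) (use w F(4) in "auto simp: X_def")
   also have "... <= ?B w" unfolding it
   proof (rule cmono, rule mult_le_mono[OF _ Mlen[OF w]])
    have "K ^ i <= K ^ N w" using F(2) i by (intro power_increasing) auto
    also have "... <= (4 * cM q w) ^ K" by (rule KN[OF w])
    also have "... <= (4 * length w) ^ K" using Mlen[OF w] by (intro power_mono) auto
    finally show "K ^ i <= (4 * length w) ^ K" .
   qed
   finally show ?thesis .
  qed
 qed
 define \<kappa> where "\<kappa> = min 1 (kap q)"
 have kp: "0 < \<kappa>" using kap_pos by (simp add: \<kappa>_def)
 have main: "amplified q \<kappa> w (?H w)" if w: "w \<in> X" for w unfolding amplified_def
 proof (intro conjI impI)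
  show "1 <= cM q (?H w)" by (rule it1[OF w])
  have "?H w = F ((F ^^ lg (cM q w)) w)" by (simp add: N_def)
  then show "ALL j<cM q (?H w). ALL v<2 ^ q. cP q (?H w) j v = sP v" using F(5) by simp
  have c: "EX a. cunsat q ((F ^^ i) w) a = 0" if "EX a. cunsat q w a = 0" for i using that F(6)[OF it1[OF w]] by (induction i) auto
  show "EX a. cunsat q (?H w) a = 0" if "EX a. cunsat q w a = 0" by (rule c[OF that])
  assume u: "ALL a. cunsat q w a ~= 0"
  let ?M = "real (cM q w)"
  have M: "0 < ?M" using w by (simp add: X_def)
  have s: "min (2 ^ i / ?M) (kap q) * real (cM q ((F ^^ i) w)) <= real (cunsat q ((F ^^ i) w) a)" for i a
  proof (induction i arbitrary: a)
   case 0
   have "min (1 / ?M) (kap q) * ?M <= 1 / ?M * ?M" using M by (intro mult_right_mono) auto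
   also have "... = 1" using M by simp
   also have "... <= real (cunsat q w a)" using u[rule_format, of a] by simp
   finally show ?case by simp
  next
   case (Suc i)
   have "min (2 ^ Suc i / ?M) (kap q) <= min (2 * min (2 ^ i / ?M) (kap q)) (kap q)" using kap_pos[of q] by (auto simp: min_def)
   then have "min (2 ^ Suc i / ?M) (kap q) * real (cM q (F ((F ^^ i) w))) <= min (2 * min (2 ^ i / ?M) (kap q)) (kap q) * real (cM q (F ((F ^^ i) w)))"
    by (intro mult_right_mono) auto
   also have "... <= real (cunsat q (F ((F ^^ i) w)) a)" by (rule F(7)[OF it1[OF w] _ Suc]) (use kap_pos[of q] M in "auto simp: min_def")
   finally show ?case by simp
  qed
  have "?M <= 2 ^ lg (cM q w)" using lg(1)[of "cM q w"] by (metis of_nat_le_iff of_nat_numeral of_nat_power)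
  also have "... <= 2 ^ N w" by (simp add: N_def)
  finally have "1 <= 2 ^ N w / ?M" using M by (simp add: field_simps)
  then have "\<kappa> <= min (2 ^ N w / ?M) (kap q)" unfolding \<kappa>_def by auto
  then have k: "\<kappa> * real (cM q (?H w)) <= min (2 ^ N w / ?M) (kap q) * real (cM q (?H w))" by (intro mult_right_mono) auto
  show "ALL a. \<kappa> * real (cM q (?H w)) <= real (cunsat q (?H w) a)" using order_trans[OF k s[of "N w"]] by blast
 qed
 show ?thesis by (rule exI[of _ ?H], rule exI[of _ \<kappa>], intro conjI kp WP[unfolded X_def(1)] ballI, rule main[unfolded X_def(1)])
qed

lemma NP_subset_P:
 assumes ptas: "has_PTAS min_fill_in_ratio | has_PTAS chordal_completion_ratio" and L: "L \<in> class_NP"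
 shows "L \<in> class_P"
proof -
 obtain q C where q: "10 <= q" and C: "UF C" "!!w. length (C w) = csz q (cM q (C w))" "!!w. 1 <= cM q (C w)"
   "!!w. w \<in> L <-> (EX a. cunsat q (C w) a = 0)" using cook_levin[OF L] by blast
 obtain H \<kappa> where H: "0 < \<kappa>" "WP (csps q) H" "!!w. w \<in> csps q ==> amplified q \<kappa> w (H w)"
  using amplify[OF q] by (elim exE conjE) (rule that, auto)
 have "1 <= q" using q by simp
 obtain G A P D where G: "UF G" "wf_tm A" "UF (%y. [D y])" "!!w. halts_within A (G w) (poly P (length (G w)))"
   "!!w. EX y. outputs A (G w) y & (1 <= cM q w --> (ALL j<cM q w. ALL v<2 ^ q. cP q w j v = sP v) -->
    ((EX a. cunsat q w a = 0) --> D y) & ((ALL a. \<kappa> * real (cM q w) <= real (cunsat q w a)) --> ~ D y))"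
  using gap_decision[OF ptas H(1) \<open>1 <= q\<close>, of sP] by (elim exE conjE) (rule that, auto)
 obtain R where R: "!!w. outputs A (G w) (R w) & (1 <= cM q w --> (ALL j<cM q w. ALL v<2 ^ q. cP q w j v = sP v) -->
    ((EX a. cunsat q w a = 0) --> D (R w)) & ((ALL a. \<kappa> * real (cM q w) <= real (cunsat q w a)) --> ~ D (R w)))" using G(5) by metis
 have CX: "C w \<in> csps q" for w using C(2,3) by (simp add: csps_def)
 show ?thesis
 proof (rule pipeline)
  show "WP UNIV (%w. G (H (C w)))" by (rule WP_comp[OF WP_comp[OF WP_UF[OF C(1)] H(2) CX] WP_UF[OF G(1), of UNIV]]) simp
  show "wf_tm A" by (rule G(2))
  show "halts_within A (G (H (C x))) (poly P (length (G (H (C x)))))" for x by (rule G(4))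
  show "outputs A (G (H (C x))) (R (H (C x)))" for x using R by blast
  show "WP UNIV (%y. [D y])" by (rule WP_UF[OF G(3)])
  show "[D (R (H (C x)))] = [x \<in> L]" for x
  proof -
   note h = H(3)[OF CX, of x, unfolded amplified_def]
   note r = R[of "H (C x)", THEN conjunct2, THEN mp, OF h[THEN conjunct1], THEN mp, OF h[THEN conjunct2, THEN conjunct1]]
   show ?thesis using r h[THEN conjunct2, THEN conjunct2] unfolding C(4) by (cases "EX a. cunsat q (C x) a = 0") simp_all
  qed
 qed
qed

definition dec_pair :: "bool list => bool list" where
 "dec_pair z = map (%i. wbit z (2 * i)) [0..<(length z - 2) div 2]"

lemma dec_pair: "dec_pair (pair_code x []) = x"
proof (rule nth_equalityI)
 show l: "length (dec_pair (pair_code x [])) = length x" by (simp add: dec_pair_def length_pair_code)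
 fix i assume "i < length (dec_pair (pair_code x []))"
 then have "i < length x" unfolding l .
 then show "dec_pair (pair_code x []) ! i = x ! i" by (simp add: dec_pair_def length_pair_code wbit_def nth_pair_code)
qed

lemma wbit_map: "wbit (map f [0..<n]) i <-> i < n & f i" by (auto simp: wbit_def)

lemma UF_dec_pair: "UF dec_pair"
proof -
 have "U (%w. w) [] (%w. length (dec_pair w))"
  unfolding dec_pair_def length_map length_upt by (intro U_diff U_div U_const U_len[of "%w. w"])
 moreover have "UB fst [snd] (%p. wbit (dec_pair (fst p)) (snd p))"
 proof -
  have snd: "U fst [snd] snd" by (rule U_var) simp
  have "UB fst [snd] (%p. snd p < (length (fst p) - 2) div 2 & wbit (fst p) (2 * snd p))"
   by (intro UB_conj UB_less snd U_div U_diff U_const U_len UB_wbit U_mult)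
  then show ?thesis by (rule UB_conv) (simp only: dec_pair_def wbit_map)
 qed
 ultimately show ?thesis by (simp add: UF_def)
qed

lemma P_subset_NP: assumes "L \<in> class_P" shows "L \<in> class_NP"
proof -
 obtain M P where M: "wf_tm M" "decides M L" and P: "!!x. halts_within M x (poly P (length x))"
  using assms by (auto simp: class_P_def poly_time_on_def)
 have id: "UF (%y. y)"
 proof -
  have "U (%w. w) [] (%w :: bool list. length w)" by (rule U_len)
  moreover have "UB fst [snd] (%p. wbit (fst p) (snd p))" by (rule UB_wbit) (rule U_var, simp)
  ultimately show ?thesis by (simp add: UF_def)
 qed
 have R: "{z. dec_pair z \<in> L} \<in> class_P"
  by (rule pipeline[OF WP_UF[OF UF_dec_pair] M(1) P, of "%z. [dec_pair z \<in> L]", OF _ WP_UF[OF id]])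
   (use M(2) in "auto simp: decides_def")
 have "L = {x. EX u. length u <= poly 0 (length x) & pair_code x u \<in> {z. dec_pair z \<in> L}}" by (auto simp: dec_pair)
 then show ?thesis unfolding class_NP_def using R by blast
qed

theorem theorem1p1:
  assumes "has_PTAS min_fill_in_ratio \<or> has_PTAS chordal_completion_ratio"
  shows "class_P = class_NP"
  using NP_subset_P[OF assms] P_subset_NP by blast

end
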